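(* Under the identification $\mathcal{B}=\mathcal{B}_0\rtimes_\beta G$, the $G$-equivariant category $Z_{\mathcal{C}_0}(\mathcal{C})^G$ of the relative center $Z_{\mathcal{C}_0}(\mathcal{C})$ can be identified with the Drinfeld center $Z(\mathcal{C})$ (both being viewed as tensor categories of endomorphisms of $\mathcal{B}$).
   Context: $\mathcal{M}$ is a type III factor with a faithful normal state; $\mathrm{End}(\mathcal{M})$ (resp. $\mathrm{End}_0(\mathcal{M})$) is the set of endomorphisms (resp. of finite index endomorphisms); $(\rho,\sigma)=\{T\mid T\rho(x)=\sigma(x)T\ \forall x\}$; $\rho\sim\sigma$ means $\rho=\mathrm{Ad}\,u\circ\sigma$ for a unitary $u$. For $\rho\in\mathrm{End}_0(\mathcal{M})$ with conjugate $\bar\rho$ a solution of the conjugate equation $R_\rho\in(\mathrm{id},\bar\rho\rho)$, $\bar R_\rho\in(\mathrm{id},\rho\bar\rho)$, $R_\rho^*R_\rho=\bar R_\rho^*\bar R_\rho=d(\rho)$, $R_\rho^*\bar\rho(\bar R_\rho)=\bar R_\rho^*\rho(R_\rho)=1$ is fixed. $\mathcal{C}\subset\mathrm{End}_0(\mathcal{M})$ is a rigid C$^*$-tensor category (full, closed under unitary equivalence, composition, conjugates, finite direct sums and subobjects, containing $\mathrm{id}$) with at most countable $\mathrm{Irr}(\mathcal{C})$. $G$ is a discrete group with neutral element $0$ and $\mathcal{C}$ is $G$-graded with components $\mathcal{C}_g\ne0$: every irreducible lies in exactly one $\mathcal{C}_g$, $\mathcal{C}_g\mathcal{C}_h\subset\mathcal{C}_{gh}$,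 $\overline{\mathcal{C}_g}=\mathcal{C}_{g^{-1}}$. $j:\mathcal{M}\to\mathcal{M}^{\mathrm{op}}$, $j(x)=x^*$, $\pi^{\mathrm{op}}=j\pi j^{-1}$, $\mathcal{A}=\mathcal{M}\otimes\mathcal{M}^{\mathrm{op}}$. The Longo-Rehren inclusion $\mathcal{A}\subset\mathcal{B}$ of $\mathcal{C}$: $\mathcal{B}$ is the von Neumann algebra generated by $\mathcal{A}$ and $\lambda_\pi$ ($\pi\in\mathcal{C}$) with $\lambda_\pi a=(\pi\otimes\pi^{\mathrm{op}})(a)\lambda_\pi$, $\lambda_\pi\lambda_\rho=\lambda_{\pi\rho}$, $\lambda_\pi^*=(R_\pi\otimes j(R_\pi))^*\lambda_{\bar\pi}$, $(T\otimes1)\lambda_\pi=(1\otimes j(T^* ))\lambda_\rho$ for $T\in(\pi,\rho)$, together with a faithful normal conditional expectation $E:\mathcal{B}\to\mathcal{A}$, $E(a\lambda_\pi)=\delta_{\mathrm{id},\pi}a$ for $\pi\in\mathrm{Irr}(\mathcal{C})$. $\mathcal{B}_g$ is the $\sigma$-weak closure of $\{\sum_{\pi\in\mathrm{Irr}(\mathcal{C}_g)}a_\pi\lambda_\pi\}$ (finite sums); $\mathcal{B}_0$ is the Longo-Rehren algebra of $\mathcal{C}_0$. Fixed are unitaries $u_g\in\mathcal{B}_g$ with $u_gu_h=u_{gh}$ and the action $\beta_g=\mathrm{Ad}\,u_g|_{\mathcal{B}_0}$ of $G$ on $\mathcal{B}_0$; $\mathcal{B}$ is identified with $\mathcal{B}_0\rtimes_\beta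 G$ with implementing unitaries $u_g$. Let $\mathcal{D}\in\{\mathcal{C}_0,\mathcal{C}\}$, with Longo-Rehren algebra $\mathcal{B}_{\mathcal{D}}$ ($\mathcal{B}_0$ resp. $\mathcal{B}$). A half braiding over $\mathcal{D}$ for $\sigma\in\mathcal{C}$ (countable direct sums of objects are allowed for $\sigma$) is a family of unitaries $\{\mathcal{E}_\sigma(\pi)\}_{\pi\in\mathcal{D}}$ with $\mathcal{E}_\sigma(\pi)\in(\sigma\pi,\pi\sigma)$, $\mathcal{E}_\sigma(\pi\rho)=\pi(\mathcal{E}_\sigma(\rho))\mathcal{E}_\sigma(\pi)$, $\mathcal{E}_\sigma(\rho)\sigma(T)=T\mathcal{E}_\sigma(\pi)$ for $T\in(\pi,\rho)$. Its $\eta$-extension $\eta(\sigma,\mathcal{E}_\sigma)\in\mathrm{End}(\mathcal{B}_{\mathcal{D}})$ is $a\mapsto(\sigma\otimes\mathrm{id})(a)$ for $a\in\mathcal{A}$, $\lambda_\pi\mapsto(\mathcal{E}_\sigma(\pi)^*\otimes1)\lambda_\pi$ for $\pi\in\mathcal{D}$. $Z_{\mathcal{C}_0}(\mathcal{C})\subset\mathrm{End}(\mathcal{B}_0)$ (resp. $Z(\mathcal{C})\subset\mathrm{End}(\mathcal{B})$) is the set of endomorphisms equivalent to $\eta$-extensions of half braidings over $\mathcal{C}_0$ (resp. over $\mathcal{C}$); morphisms are intertwiners. $\theta\in Z_{\mathcal{C}_0}(\mathcal{C})$ is $G$-equivariant if there are unitaries $c^\theta_g\in\mathcal{B}_0$,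 $g\in G$, with $\beta_g\theta\beta_g^{-1}=\mathrm{Ad}\,c_g^\theta\circ\theta$ and $\beta_g(c_h^\theta)c_g^\theta=c_{gh}^\theta$; then $\theta$ extends to $\hat\eta(\theta,c^\theta)\in\mathrm{End}(\mathcal{B}_0\rtimes_\beta G)$ by $u_g\mapsto c_g^{\theta*}u_g$. $Z_{\mathcal{C}_0}(\mathcal{C})^G$ is the set of endomorphisms $\mu$ of $\mathcal{B}_0\rtimes_\beta G$ with $\mu\sim\hat\eta(\theta,c^\theta)$ for some $G$-equivariant $(\theta,c^\theta)$. *)

theory Defs
  imports "HOL-Analysis.Analysis" "HOL-Library.FuncSet"
begin

section \<open>Complex Hilbert spaces and bounded operators\<close>

text \<open>The inner product is conjugate linear in its first argument.\<close>

class chilbert_space = banach +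
  fixes scaleC :: "complex \<Rightarrow> 'a \<Rightarrow> 'a" (infixr "*\<^sub>C" 75)
    and cinner :: "'a \<Rightarrow> 'a \<Rightarrow> complex"
  assumes scaleC_add_right: "a *\<^sub>C (x + y) = a *\<^sub>C x + a *\<^sub>C y"
    and scaleC_add_left: "(a + b) *\<^sub>C x = a *\<^sub>C x + b *\<^sub>C x"
    and scaleC_scaleC: "a *\<^sub>C b *\<^sub>C x = (a * b) *\<^sub>C x"
    and scaleR_scaleC: "scaleR r x = complex_of_real r *\<^sub>C x"
    and cinner_commute: "cinner x y = cnj (cinner y x)"
    and cinner_add_right: "cinner x (y + z) = cinner x y + cinner x z"
    and cinner_scaleC_right: "cinner x (a *\<^sub>C y) = a * cinner x y"
    and norm_eq_sqrt_cinner: "norm x = sqrt (Re (cinner x x))"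

text \<open>The complex conjugate Hilbert space: same vectors, \<open>c *\<^sub>C Conj x = Conj (cnj c *\<^sub>C x)\<close>.\<close>

datatype 'a conj_space = Conj (unConj: 'a)

instantiation conj_space :: (real_normed_vector) real_normed_vector
begin
definition zero_conj_space :: "'a conj_space" where "0 = Conj 0"
definition plus_conj_space :: "'a conj_space \<Rightarrow> 'a conj_space \<Rightarrow> 'a conj_space"
  where "x + y = Conj (unConj x + unConj y)"
definition minus_conj_space :: "'a conj_space \<Rightarrow> 'a conj_space \<Rightarrow> 'a conj_space"
  where "x - y = Conj (unConj x - unConj y)"
definition uminus_conj_space :: "'a conj_space \<Rightarrow> 'a conj_space"
  where "- x = Conj (- unConj x)"
definition scaleR_conj_space :: "real \<Rightarrow> 'a conj_space \<Rightarrow> 'a conj_space"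
  where "scaleR r x = Conj (scaleR r (unConj x))"
definition norm_conj_space :: "'a conj_space \<Rightarrow> real" where "norm x = norm (unConj x)"
definition sgn_conj_space :: "'a conj_space \<Rightarrow> 'a conj_space"
  where "sgn (x :: 'a conj_space) = scaleR (inverse (norm x)) x"
definition dist_conj_space :: "'a conj_space \<Rightarrow> 'a conj_space \<Rightarrow> real"
  where "dist (x :: 'a conj_space) y = norm (x - y)"
definition uniformity_conj_space :: "('a conj_space \<times> 'a conj_space) filter"
  where "uniformity_conj_space = (INF e\<in>{0<..}. principal {(x, y). dist x y < e})"
definition open_conj_space :: "'a conj_space set \<Rightarrow> bool"
  where "open_conj_space U = (\<forall>x\<in>U. eventually (\<lambda>(x', y). x' = x \<longrightarrow> y \<in> U) uniformity)"
instance
  by standard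
    (auto simp: zero_conj_space_def plus_conj_space_def minus_conj_space_def
      uminus_conj_space_def scaleR_conj_space_def norm_conj_space_def sgn_conj_space_def
      dist_conj_space_def uniformity_conj_space_def open_conj_space_def
      algebra_simps norm_triangle_ineq conj_space.expand)
end

lemma dist_Conj: "dist (x :: 'a::real_normed_vector conj_space) y = dist (unConj x) (unConj y)"
  by (simp add: dist_conj_space_def norm_conj_space_def minus_conj_space_def dist_norm)

instantiation conj_space :: (chilbert_space) chilbert_space
begin
definition scaleC_conj_space :: "complex \<Rightarrow> 'a conj_space \<Rightarrow> 'a conj_space"
  where "c *\<^sub>C x = Conj (cnj c *\<^sub>C unConj x)"
definition cinner_conj_space :: "'a conj_space \<Rightarrow> 'a conj_space \<Rightarrow> complex"
  where "cinner x y = cinner (unConj y) (unConj x)"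
instance
proof
  fix X :: "nat \<Rightarrow> 'a conj_space"
  assume "Cauchy X"
  then have "Cauchy (\<lambda>n. unConj (X n))"
    by (simp add: Cauchy_def dist_Conj)
  then obtain l where "(\<lambda>n. unConj (X n)) \<longlonglongrightarrow> l"
    using Cauchy_convergent convergent_def by blast
  then have "X \<longlonglongrightarrow> Conj l"
    by (simp add: tendsto_iff dist_Conj)
  then show "convergent X"
    by (auto simp: convergent_def)
next
  fix x y z :: "'a conj_space" and a :: complex
  have add_left: "cinner (u + v) w = cinner u w + cinner v w" for u v w :: 'a
    by (metis cinner_add_right cinner_commute complex_cnj_add)
  show "cinner x (y + z) = cinner x y + cinner x z"
    by (simp add: cinner_conj_space_def plus_conj_space_def add_left)
  have scale_left: "cinner (a *\<^sub>C u) w = cnj a * cinner u w" for a and u w :: 'a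
    by (metis cinner_scaleC_right cinner_commute complex_cnj_mult)
  show "cinner x (a *\<^sub>C y) = a * cinner x y"
    by (simp add: cinner_conj_space_def scaleC_conj_space_def scale_left)
  show "cinner x y = cnj (cinner y x)"
    unfolding cinner_conj_space_def by (rule cinner_commute)
qed (simp_all add: scaleC_conj_space_def plus_conj_space_def scaleR_conj_space_def
      norm_conj_space_def cinner_conj_space_def norm_eq_sqrt_cinner
      scaleC_add_right scaleC_add_left scaleC_scaleC scaleR_scaleC)
end

text \<open>Operators live in the Banach space of real-linear bounded maps; \<open>bops\<close> cuts out the
  complex-linear ones.\<close>

type_synonym 'a bop = "'a \<Rightarrow>\<^sub>L 'a"
type_synonym 'a endo = "'a bop \<Rightarrow> 'a bop"

definition bops :: "'a::chilbert_space bop set" where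
  "bops = {T. \<forall>c x. blinfun_apply T (c *\<^sub>C x) = c *\<^sub>C blinfun_apply T x}"

abbreviation mul :: "'a::chilbert_space bop \<Rightarrow> 'a bop \<Rightarrow> 'a bop" (infixl "\<odot>" 70) where
  "S \<odot> T \<equiv> S o\<^sub>L T"

abbreviation one :: "'a::chilbert_space bop" ("\<I>") where
  "\<I> \<equiv> id_blinfun"

definition scale_op :: "complex \<Rightarrow> 'a::chilbert_space bop \<Rightarrow> 'a bop" where
  "scale_op c T = Blinfun (\<lambda>x. c *\<^sub>C blinfun_apply T x)"

definition adj :: "'a::chilbert_space bop \<Rightarrow> 'a bop" where
  "adj T = (THE S. S \<in> bops \<and>
     (\<forall>x y. cinner (blinfun_apply S x) y = cinner x (blinfun_apply T y)))"

definition pos_op :: "'a::chilbert_space bop \<Rightarrow> bool" where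
  "pos_op T \<longleftrightarrow> T \<in> bops \<and> (\<forall>x. cinner x (blinfun_apply T x) \<in> \<real>\<^sub>\<ge>\<^sub>0)"

definition sigma_weak :: "'a::chilbert_space bop topology" where
  "sigma_weak = topology_generated_by
     {{T. (\<Sum>n. cinner (\<xi> n) (blinfun_apply T (\<eta> n))) \<in> U} | (\<xi> :: nat \<Rightarrow> 'a) \<eta> U.
        summable (\<lambda>n. (norm (\<xi> n))\<^sup>2) \<and> summable (\<lambda>n. (norm (\<eta> n))\<^sup>2) \<and> open U}"

section \<open>Von Neumann algebras\<close>

definition commutant :: "'a::chilbert_space bop set \<Rightarrow> 'a bop set" where
  "commutant S = {T \<in> bops. \<forall>x\<in>S. T \<odot> x = x \<odot> T}"

definition von_neumann_algebra :: "'a::chilbert_space bop set \<Rightarrow> bool" where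
  "von_neumann_algebra M \<longleftrightarrow> M \<subseteq> bops \<and> (\<forall>x\<in>M. adj x \<in> M) \<and> commutant (commutant M) = M"

definition vN_generated :: "'a::chilbert_space bop set \<Rightarrow> 'a bop set" where
  "vN_generated S = commutant (commutant (S \<union> adj ` S))"

definition factor :: "'a::chilbert_space bop set \<Rightarrow> bool" where
  "factor M \<longleftrightarrow> von_neumann_algebra M \<and> M \<inter> commutant M = range (\<lambda>c. scale_op c \<I>)"

definition proj_in :: "'a::chilbert_space bop set \<Rightarrow> 'a bop \<Rightarrow> bool" where
  "proj_in M p \<longleftrightarrow> p \<in> M \<and> adj p = p \<and> p \<odot> p = p"

definition finite_proj :: "'a::chilbert_space bop set \<Rightarrow> 'a bop \<Rightarrow> bool" where
  "finite_proj M p \<longleftrightarrow> proj_in M p \<and>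
     (\<forall>v\<in>M. adj v \<odot> v = p \<and> p \<odot> (v \<odot> adj v) = v \<odot> adj v \<longrightarrow> v \<odot> adj v = p)"

definition type_III_factor :: "'a::chilbert_space bop set \<Rightarrow> bool" where
  "type_III_factor M \<longleftrightarrow> factor M \<and> (\<forall>p. finite_proj M p \<longrightarrow> p = 0)"

definition faithful_normal_state :: "'a::chilbert_space bop set \<Rightarrow> ('a bop \<Rightarrow> complex) \<Rightarrow> bool" where
  "faithful_normal_state M \<phi> \<longleftrightarrow>
     (\<forall>x\<in>M. \<forall>y\<in>M. \<phi> (x + y) = \<phi> x + \<phi> y) \<and> (\<forall>c. \<forall>x\<in>M. \<phi> (scale_op c x) = c * \<phi> x) \<and>
     (\<forall>x\<in>M. \<phi> (adj x \<odot> x) \<in> \<real>\<^sub>\<ge>\<^sub>0) \<and> (\<forall>x\<in>M. \<phi> (adj x \<odot> x) = 0 \<longrightarrow> x = 0) \<and>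
     \<phi> \<I> = 1 \<and> continuous_map (subtopology sigma_weak M) euclidean \<phi>"

definition unitary_in :: "'a::chilbert_space bop set \<Rightarrow> 'a bop \<Rightarrow> bool" where
  "unitary_in M w \<longleftrightarrow> w \<in> M \<and> adj w \<odot> w = \<I> \<and> w \<odot> adj w = \<I>"

definition normal_homs :: "'a::chilbert_space bop set \<Rightarrow> 'b::chilbert_space bop set \<Rightarrow>
    ('a bop \<Rightarrow> 'b bop) set" where
  "normal_homs M N = {\<rho> \<in> M \<rightarrow>\<^sub>E N.
     (\<forall>x\<in>M. \<forall>y\<in>M. \<rho> (x + y) = \<rho> x + \<rho> y \<and> \<rho> (x \<odot> y) = \<rho> x \<odot> \<rho> y) \<and>
     (\<forall>c. \<forall>x\<in>M. \<rho> (scale_op c x) = scale_op c (\<rho> x)) \<and>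
     (\<forall>x\<in>M. \<rho> (adj x) = adj (\<rho> x)) \<and> \<rho> \<I> = \<I> \<and>
     continuous_map (subtopology sigma_weak M) (subtopology sigma_weak N) \<rho>}"

text \<open>Endomorphisms are extensional functions (\<open>undefined\<close> off the algebra), so that equality of
  endomorphisms is equality on the algebra.  Composition is \<open>compose M\<close>.\<close>

definition End :: "'a::chilbert_space bop set \<Rightarrow> 'a endo set" where
  "End M = normal_homs M M"

definition idend :: "'a::chilbert_space bop set \<Rightarrow> 'a endo" where
  "idend M = restrict (\<lambda>x. x) M"

definition intertwiners :: "'a::chilbert_space bop set \<Rightarrow> 'a endo \<Rightarrow> 'a endo \<Rightarrow> 'a bop set" where
  "intertwiners M \<rho> \<sigma> = {T \<in> M. \<forall>x\<in>M. T \<odot> \<rho> x = \<sigma> x \<odot> T}"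

definition uequiv :: "'a::chilbert_space bop set \<Rightarrow> 'a endo \<Rightarrow> 'a endo \<Rightarrow> bool" where
  "uequiv M \<rho> \<sigma> \<longleftrightarrow> (\<exists>w. unitary_in M w \<and> (\<forall>x\<in>M. \<rho> x = w \<odot> \<sigma> x \<odot> adj w))"

definition irreducible_endo :: "'a::chilbert_space bop set \<Rightarrow> 'a endo \<Rightarrow> bool" where
  "irreducible_endo M \<rho> \<longleftrightarrow> intertwiners M \<rho> \<rho> = range (\<lambda>c. scale_op c \<I>)"

text \<open>\<open>\<sigma>\<close> is the direct sum of \<open>\<sigma>s i\<close>, \<open>i \<in> I\<close> (finite or countably infinite): the isometries
  \<open>V i \<in> (\<sigma>s i, \<sigma>)\<close> have orthogonal ranges summing strongly to \<open>1\<close>, i.e.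
  \<open>\<sigma>(x) = \<Sum>\<^sub>i V\<^sub>i \<sigma>\<^sub>i(x) V\<^sub>i*\<close>.\<close>

definition direct_sum_endo :: "'a::chilbert_space bop set \<Rightarrow> nat set \<Rightarrow> (nat \<Rightarrow> 'a endo) \<Rightarrow>
    'a endo \<Rightarrow> bool" where
  "direct_sum_endo M I \<sigma>s \<sigma> \<longleftrightarrow> \<sigma> \<in> End M \<and>
     (\<exists>V. (\<forall>i\<in>I. V i \<in> intertwiners M (\<sigma>s i) \<sigma>) \<and>
          (\<forall>i\<in>I. \<forall>k\<in>I. adj (V i) \<odot> V k = (if i = k then \<I> else 0)) \<and>
          (\<forall>x. ((\<lambda>i. blinfun_apply (V i \<odot> adj (V i)) x) has_sum x) I))"

definition countable_sums :: "'a::chilbert_space bop set \<Rightarrow> 'a endo set \<Rightarrow> 'a endo set" where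
  "countable_sums M C = {\<sigma>. \<exists>I \<sigma>s. (\<forall>i\<in>I. \<sigma>s i \<in> C) \<and> direct_sum_endo M I \<sigma>s \<sigma>}"

section \<open>Finite index and conjugates\<close>

definition cond_exp :: "'a::chilbert_space bop set \<Rightarrow> 'a bop set \<Rightarrow> 'a endo \<Rightarrow> bool" where
  "cond_exp M N \<E> \<longleftrightarrow> N \<subseteq> M \<and> \<E> \<in> M \<rightarrow> N \<and> (\<forall>b\<in>N. \<E> b = b) \<and>
     (\<forall>x\<in>M. \<forall>y\<in>M. \<E> (x + y) = \<E> x + \<E> y) \<and>
     (\<forall>x\<in>M. \<forall>a\<in>N. \<forall>b\<in>N. \<E> (a \<odot> x \<odot> b) = a \<odot> \<E> x \<odot> b) \<and>
     (\<forall>x\<in>M. pos_op (\<E> (adj x \<odot> x)))"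

definition fn_cond_exp :: "'a::chilbert_space bop set \<Rightarrow> 'a bop set \<Rightarrow> 'a endo \<Rightarrow> bool" where
  "fn_cond_exp M N \<E> \<longleftrightarrow> cond_exp M N \<E> \<and>
     (\<forall>x\<in>M. \<E> (adj x \<odot> x) = 0 \<longrightarrow> x = 0) \<and>
     continuous_map (subtopology sigma_weak M) (subtopology sigma_weak N) \<E>"

text \<open>The index of a conditional expectation is the inverse of the best Pimsner-Popa constant,
  i.e. the least \<open>c\<close> with \<open>x*x \<le> c \<E>(x*x)\<close>; for infinite factors this is Kosaki's index.
  The dimension \<open>d(\<rho>)\<close> is the square root of the minimal index of \<open>\<rho>(M) \<subseteq> M\<close>.\<close>

definition index_bounds :: "'a::chilbert_space bop set \<Rightarrow> 'a bop set \<Rightarrow> real set" where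
  "index_bounds M N = {c. \<exists>\<E>. fn_cond_exp M N \<E> \<and>
     (\<forall>x\<in>M. pos_op (scaleR c (\<E> (adj x \<odot> x)) - adj x \<odot> x))}"

definition End0 :: "'a::chilbert_space bop set \<Rightarrow> 'a endo set" where
  "End0 M = {\<rho> \<in> End M. index_bounds M (\<rho> ` M) \<noteq> {}}"

definition sdim :: "'a::chilbert_space bop set \<Rightarrow> 'a endo \<Rightarrow> real" where
  "sdim M \<rho> = sqrt (Inf (index_bounds M (\<rho> ` M)))"

definition conjugate_solutions :: "'a::chilbert_space bop set \<Rightarrow> ('a endo \<Rightarrow> 'a endo) \<Rightarrow>
    ('a endo \<Rightarrow> 'a bop) \<Rightarrow> ('a endo \<Rightarrow> 'a bop) \<Rightarrow> bool" where
  "conjugate_solutions M bar R R' \<longleftrightarrow> (\<forall>\<rho>\<in>End0 M. bar \<rho> \<in> End0 M \<and>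
     R \<rho> \<in> intertwiners M (idend M) (compose M (bar \<rho>) \<rho>) \<and>
     R' \<rho> \<in> intertwiners M (idend M) (compose M \<rho> (bar \<rho>)) \<and>
     adj (R \<rho>) \<odot> R \<rho> = scaleR (sdim M \<rho>) \<I> \<and> adj (R' \<rho>) \<odot> R' \<rho> = scaleR (sdim M \<rho>) \<I> \<and>
     adj (R \<rho>) \<odot> bar \<rho> (R' \<rho>) = \<I> \<and> adj (R' \<rho>) \<odot> \<rho> (R \<rho>) = \<I>)"

section \<open>Rigid C*-tensor categories of endomorphisms\<close>

text \<open>Full subcategories are given by their objects.\<close>

definition closed_subcategory :: "'a::chilbert_space bop set \<Rightarrow> 'a endo set \<Rightarrow> bool" where
  "closed_subcategory M C \<longleftrightarrow>
     (\<forall>\<rho>\<in>C. \<forall>\<sigma>\<in>End M. uequiv M \<sigma> \<rho> \<longrightarrow> \<sigma> \<in> C) \<and>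
     (\<forall>\<rho>\<in>C. \<forall>\<sigma>\<in>End M. (\<exists>V\<in>intertwiners M \<sigma> \<rho>. adj V \<odot> V = \<I>) \<longrightarrow> \<sigma> \<in> C) \<and>
     (\<forall>I \<sigma>s \<sigma>. finite I \<and> (\<forall>i\<in>I. \<sigma>s i \<in> C) \<and> direct_sum_endo M I \<sigma>s \<sigma> \<longrightarrow> \<sigma> \<in> C)"

definition rigid_category :: "'a::chilbert_space bop set \<Rightarrow> ('a endo \<Rightarrow> 'a endo) \<Rightarrow>
    'a endo set \<Rightarrow> bool" where
  "rigid_category M bar C \<longleftrightarrow> C \<subseteq> End0 M \<and> closed_subcategory M C \<and> idend M \<in> C \<and>
     (\<forall>\<rho>\<in>C. \<forall>\<sigma>\<in>C. compose M \<rho> \<sigma> \<in> C) \<and> (\<forall>\<rho>\<in>C. bar \<rho> \<in> C)"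

text \<open>\<open>Irr\<close> is a system of representatives of the irreducibles; the class of the identity is
  represented by the identity itself.\<close>

definition irr_system :: "'a::chilbert_space bop set \<Rightarrow> 'a endo set \<Rightarrow> 'a endo set \<Rightarrow> bool" where
  "irr_system M C Irr \<longleftrightarrow> Irr \<subseteq> {\<pi> \<in> C. irreducible_endo M \<pi>} \<and> idend M \<in> Irr \<and>
     (\<forall>\<pi>\<in>C. irreducible_endo M \<pi> \<longrightarrow> (\<exists>!\<kappa>. \<kappa> \<in> Irr \<and> uequiv M \<pi> \<kappa>))"

text \<open>The (possibly non-abelian) group is written additively, its neutral element being \<open>0\<close>.\<close>

definition graded :: "'a::chilbert_space bop set \<Rightarrow> ('a endo \<Rightarrow> 'a endo) \<Rightarrow> 'a endo set \<Rightarrow>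
    ('g::group_add \<Rightarrow> 'a endo set) \<Rightarrow> bool" where
  "graded M bar C Cg \<longleftrightarrow>
     (\<forall>g. Cg g \<subseteq> C \<and> Cg g \<noteq> {} \<and> closed_subcategory M (Cg g)) \<and>
     (\<forall>\<pi>\<in>C. irreducible_endo M \<pi> \<longrightarrow> (\<exists>!g. \<pi> \<in> Cg g)) \<and>
     (\<forall>g h. \<forall>\<rho>\<in>Cg g. \<forall>\<sigma>\<in>Cg h. compose M \<rho> \<sigma> \<in> Cg (g + h)) \<and>
     (\<forall>g. {\<sigma> \<in> End M. \<exists>\<rho>\<in>Cg g. uequiv M \<sigma> (bar \<rho>)} = Cg (- g))"

section \<open>Opposite algebras and tensor products\<close>

text \<open>\<open>M\<^sup>o\<^sup>p\<close> acts on the conjugate Hilbert space: \<open>opp\<close> is the linear antimultiplicative map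
  \<open>opp x (Conj \<xi>) = Conj (x* \<xi>)\<close> identifying \<open>x\<close> as an element of \<open>M\<^sup>o\<^sup>p\<close>, and \<open>j(x) = x*\<close>.\<close>

definition opp :: "'a::chilbert_space bop \<Rightarrow> 'a conj_space bop" where
  "opp x = Blinfun (\<lambda>\<xi>. Conj (blinfun_apply (adj x) (unConj \<xi>)))"

definition Mop :: "'a::chilbert_space bop set \<Rightarrow> 'a conj_space bop set" where
  "Mop M = opp ` M"

definition jmap :: "'a::chilbert_space bop \<Rightarrow> 'a conj_space bop" where
  "jmap x = opp (adj x)"

definition op_endo :: "'a::chilbert_space bop set \<Rightarrow> 'a endo \<Rightarrow> 'a conj_space endo" where
  "op_endo M \<pi> = (\<lambda>y\<in>Mop M. jmap (\<pi> (inv_into M jmap y)))"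

definition hilbert_tensor :: "('a::chilbert_space \<Rightarrow> 'b::chilbert_space \<Rightarrow> 'c::chilbert_space) \<Rightarrow> bool"
  where "hilbert_tensor t \<longleftrightarrow>
     (\<forall>x x' y. t (x + x') y = t x y + t x' y) \<and> (\<forall>x y y'. t x (y + y') = t x y + t x y') \<and>
     (\<forall>c x y. t (c *\<^sub>C x) y = c *\<^sub>C t x y \<and> t x (c *\<^sub>C y) = c *\<^sub>C t x y) \<and>
     (\<forall>x y x' y'. cinner (t x y) (t x' y') = cinner x x' * cinner y y') \<and>
     closure (span {t x y | x y. True}) = UNIV"

definition op_tensor :: "('a::chilbert_space \<Rightarrow> 'b::chilbert_space \<Rightarrow> 'c::chilbert_space) \<Rightarrow>
    'a bop \<Rightarrow> 'b bop \<Rightarrow> 'c bop" where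
  "op_tensor t x y = (THE T. T \<in> bops \<and>
     (\<forall>\<xi> \<eta>. blinfun_apply T (t \<xi> \<eta>) = t (blinfun_apply x \<xi>) (blinfun_apply y \<eta>)))"

definition vN_tensor :: "('a::chilbert_space \<Rightarrow> 'b::chilbert_space \<Rightarrow> 'c::chilbert_space) \<Rightarrow>
    'a bop set \<Rightarrow> 'b bop set \<Rightarrow> 'c bop set" where
  "vN_tensor t M N = vN_generated {op_tensor t x y | x y. x \<in> M \<and> y \<in> N}"

text \<open>\<open>\<Theta> = \<rho> \<otimes> \<sigma>\<close>; as \<open>\<Theta>\<close> is normal, it is determined by its values on elementary tensors.\<close>

definition is_tensor_endo :: "('a::chilbert_space \<Rightarrow> 'b::chilbert_space \<Rightarrow> 'c::chilbert_space) \<Rightarrow>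
    'a bop set \<Rightarrow> 'b bop set \<Rightarrow> 'a endo \<Rightarrow> 'b endo \<Rightarrow> 'c endo \<Rightarrow> bool" where
  "is_tensor_endo t M N \<rho> \<sigma> \<Theta> \<longleftrightarrow> \<Theta> \<in> End (vN_tensor t M N) \<and>
     (\<forall>x\<in>M. \<forall>y\<in>N. \<Theta> (op_tensor t x y) = op_tensor t (\<rho> x) (\<sigma> y))"

section \<open>The Longo-Rehren inclusion\<close>

text \<open>\<open>lr_emb\<close> embeds \<open>\<A> = M \<otimes> M\<^sup>o\<^sup>p\<close>, acting on the Hilbert space tensor product of \<open>'h\<close> and its
  conjugate, into \<open>\<B>\<close>, acting on \<open>'l\<close>.\<close>

record (overloaded) ('h, 'k, 'l) lr_data =
  lr_tensor :: "'h::chilbert_space \<Rightarrow> 'h conj_space \<Rightarrow> 'k::chilbert_space"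
  lr_emb :: "'k bop \<Rightarrow> 'l::chilbert_space bop"
  lr_lam :: "'h endo \<Rightarrow> 'l bop"
  lr_alg :: "'l bop set"
  lr_exp :: "'l endo"

definition lrA :: "('h::chilbert_space, 'k::chilbert_space, 'l::chilbert_space) lr_data \<Rightarrow>
    'h bop set \<Rightarrow> 'k bop set" where
  "lrA L M = vN_tensor (lr_tensor L) M (Mop M)"

definition elem :: "('h::chilbert_space, 'k::chilbert_space, 'l::chilbert_space) lr_data \<Rightarrow>
    'h bop \<Rightarrow> 'h conj_space bop \<Rightarrow> 'l bop" where
  "elem L x y = lr_emb L (op_tensor (lr_tensor L) x y)"

definition longo_rehren :: "'h::chilbert_space bop set \<Rightarrow> 'h endo set \<Rightarrow> 'h endo set \<Rightarrow>
    ('h endo \<Rightarrow> 'h endo) \<Rightarrow> ('h endo \<Rightarrow> 'h bop) \<Rightarrow>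
    ('h, 'k::chilbert_space, 'l::chilbert_space) lr_data \<Rightarrow> bool" where
  "longo_rehren M C Irr bar R L \<longleftrightarrow>
     hilbert_tensor (lr_tensor L) \<and>
     lr_emb L \<in> normal_homs (lrA L M) (lr_alg L) \<and> inj_on (lr_emb L) (lrA L M) \<and>
     lr_lam L ` C \<subseteq> bops \<and>
     lr_alg L = vN_generated (lr_emb L ` lrA L M \<union> lr_lam L ` C) \<and>
     (\<forall>\<pi>\<in>C. \<exists>\<Theta>. is_tensor_endo (lr_tensor L) M (Mop M) \<pi> (op_endo M \<pi>) \<Theta> \<and>
        (\<forall>a\<in>lrA L M. lr_lam L \<pi> \<odot> lr_emb L a = lr_emb L (\<Theta> a) \<odot> lr_lam L \<pi>)) \<and>
     (\<forall>\<pi>\<in>C. \<forall>\<rho>\<in>C. lr_lam L \<pi> \<odot> lr_lam L \<rho> = lr_lam L (compose M \<pi> \<rho>)) \<and>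
     (\<forall>\<pi>\<in>C. adj (lr_lam L \<pi>) = adj (elem L (R \<pi>) (jmap (R \<pi>))) \<odot> lr_lam L (bar \<pi>)) \<and>
     (\<forall>\<pi>\<in>C. \<forall>\<rho>\<in>C. \<forall>T\<in>intertwiners M \<pi> \<rho>.
        elem L T \<I> \<odot> lr_lam L \<pi> = elem L \<I> (jmap (adj T)) \<odot> lr_lam L \<rho>) \<and>
     fn_cond_exp (lr_alg L) (lr_emb L ` lrA L M) (lr_exp L) \<and>
     (\<forall>\<pi>\<in>Irr. \<forall>a\<in>lrA L M. lr_exp L (lr_emb L a \<odot> lr_lam L \<pi>) =
        (if \<pi> = idend M then lr_emb L a else 0))"

text \<open>\<open>\<B>\<^sub>g\<close> for \<open>D = \<C>\<^sub>g\<close>; for \<open>D = \<C>\<^sub>0\<close> this is the Longo-Rehren algebra \<open>\<B>\<^sub>0\<close> of \<open>\<C>\<^sub>0\<close>.\<close>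

definition lr_component :: "'h::chilbert_space bop set \<Rightarrow> 'h endo set \<Rightarrow>
    ('h, 'k::chilbert_space, 'l::chilbert_space) lr_data \<Rightarrow> 'h endo set \<Rightarrow> 'l bop set" where
  "lr_component M Irr L D = sigma_weak closure_of
     {\<Sum>\<pi>\<in>F. lr_emb L (a \<pi>) \<odot> lr_lam L \<pi> | F a.
        finite F \<and> F \<subseteq> Irr \<inter> D \<and> (\<forall>\<pi>\<in>F. a \<pi> \<in> lrA L M)}"

section \<open>Half braidings, relative center and Drinfeld center\<close>

definition half_braiding :: "'a::chilbert_space bop set \<Rightarrow> 'a endo set \<Rightarrow> 'a endo \<Rightarrow>
    ('a endo \<Rightarrow> 'a bop) \<Rightarrow> bool" where
  "half_braiding M D \<sigma> \<E> \<longleftrightarrow>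
     (\<forall>\<pi>\<in>D. unitary_in M (\<E> \<pi>) \<and> \<E> \<pi> \<in> intertwiners M (compose M \<sigma> \<pi>) (compose M \<pi> \<sigma>)) \<and>
     (\<forall>\<pi>\<in>D. \<forall>\<rho>\<in>D. \<E> (compose M \<pi> \<rho>) = \<pi> (\<E> \<rho>) \<odot> \<E> \<pi>) \<and>
     (\<forall>\<pi>\<in>D. \<forall>\<rho>\<in>D. \<forall>T\<in>intertwiners M \<pi> \<rho>. \<E> \<rho> \<odot> \<sigma> T = T \<odot> \<E> \<pi>)"

text \<open>\<open>\<eta> \<in> End BD\<close> is the \<open>\<eta>\<close>-extension of \<open>(\<sigma>, \<E>)\<close>, a half braiding over \<open>D\<close> whose Longo-Rehren
  algebra is \<open>BD\<close>.  The two conditions determine \<open>\<eta>\<close>, since it is normal and \<open>BD\<close> is generated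
  by \<open>\<A>\<close> and the \<open>\<lambda>\<^sub>\<pi>\<close>, \<open>\<pi> \<in> D\<close>.\<close>

definition is_eta_extension :: "'h::chilbert_space bop set \<Rightarrow>
    ('h, 'k::chilbert_space, 'l::chilbert_space) lr_data \<Rightarrow> 'h endo set \<Rightarrow> 'l bop set \<Rightarrow>
    'h endo \<Rightarrow> ('h endo \<Rightarrow> 'h bop) \<Rightarrow> 'l endo \<Rightarrow> bool" where
  "is_eta_extension M L D BD \<sigma> \<E> \<eta> \<longleftrightarrow> \<eta> \<in> End BD \<and>
     (\<exists>\<Theta>. is_tensor_endo (lr_tensor L) M (Mop M) \<sigma> (idend (Mop M)) \<Theta> \<and>
        (\<forall>a\<in>lrA L M. \<eta> (lr_emb L a) = lr_emb L (\<Theta> a))) \<and>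
     (\<forall>\<pi>\<in>D. \<eta> (lr_lam L \<pi>) = elem L (adj (\<E> \<pi>)) \<I> \<odot> lr_lam L \<pi>)"

text \<open>\<open>relative_center M C L \<C>\<^sub>0 \<B>\<^sub>0\<close> is \<open>Z\<^bsub>\<C>\<^sub>0\<^esub>(\<C>)\<close>, and \<open>relative_center M C L C \<B>\<close> is the
  Drinfeld center \<open>Z(\<C>)\<close>.\<close>

definition relative_center :: "'h::chilbert_space bop set \<Rightarrow> 'h endo set \<Rightarrow>
    ('h, 'k::chilbert_space, 'l::chilbert_space) lr_data \<Rightarrow> 'h endo set \<Rightarrow> 'l bop set \<Rightarrow>
    'l endo set" where
  "relative_center M C L D BD = {\<theta> \<in> End BD. \<exists>\<sigma>\<in>countable_sums M C. \<exists>\<E> \<eta>.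
     half_braiding M D \<sigma> \<E> \<and> is_eta_extension M L D BD \<sigma> \<E> \<eta> \<and> uequiv BD \<theta> \<eta>}"

abbreviation drinfeld_center :: "'h::chilbert_space bop set \<Rightarrow> 'h endo set \<Rightarrow>
    ('h, 'k::chilbert_space, 'l::chilbert_space) lr_data \<Rightarrow> 'l endo set" where
  "drinfeld_center M C L \<equiv> relative_center M C L C (lr_alg L)"

section \<open>Crossed products and equivariantization\<close>

text \<open>A model of \<open>\<ell>\<^sup>2(G) \<otimes> 'l\<close>, with \<open>\<delta> g \<xi> = \<delta>\<^sub>g \<otimes> \<xi>\<close>.\<close>

definition ell2_sum :: "('g \<Rightarrow> 'l::chilbert_space \<Rightarrow> 'm::chilbert_space) \<Rightarrow> bool" where
  "ell2_sum \<delta> \<longleftrightarrow> (\<forall>g x y. \<delta> g (x + y) = \<delta> g x + \<delta> g y) \<and>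
     (\<forall>g c x. \<delta> g (c *\<^sub>C x) = c *\<^sub>C \<delta> g x) \<and>
     (\<forall>g h x y. cinner (\<delta> g x) (\<delta> h y) = (if g = h then cinner x y else 0)) \<and>
     closure (span {\<delta> g x | g x. True}) = UNIV"

definition cp_pi :: "('g::group_add \<Rightarrow> 'l::chilbert_space \<Rightarrow> 'm::chilbert_space) \<Rightarrow>
    ('g \<Rightarrow> 'l endo) \<Rightarrow> 'l bop \<Rightarrow> 'm bop" where
  "cp_pi \<delta> \<beta> b = (THE T. T \<in> bops \<and>
     (\<forall>h \<xi>. blinfun_apply T (\<delta> h \<xi>) = \<delta> h (blinfun_apply (\<beta> (- h) b) \<xi>)))"

definition cp_unitary :: "('g::group_add \<Rightarrow> 'l::chilbert_space \<Rightarrow> 'm::chilbert_space) \<Rightarrow>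
    'g \<Rightarrow> 'm bop" where
  "cp_unitary \<delta> g = (THE T. T \<in> bops \<and> (\<forall>h \<xi>. blinfun_apply T (\<delta> h \<xi>) = \<delta> (g + h) \<xi>))"

definition crossed_product :: "('g::group_add \<Rightarrow> 'l::chilbert_space \<Rightarrow> 'm::chilbert_space) \<Rightarrow>
    'l bop set \<Rightarrow> ('g \<Rightarrow> 'l endo) \<Rightarrow> 'm bop set" where
  "crossed_product \<delta> N \<beta> = vN_generated (cp_pi \<delta> \<beta> ` N \<union> range (cp_unitary \<delta>))"

definition Ad_action :: "('g \<Rightarrow> 'l::chilbert_space bop) \<Rightarrow> 'l bop set \<Rightarrow> 'g \<Rightarrow> 'l endo" where
  "Ad_action u N g = (\<lambda>b\<in>N. u g \<odot> b \<odot> adj (u g))"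

definition equivariant :: "'l::chilbert_space bop set \<Rightarrow> ('g::group_add \<Rightarrow> 'l endo) \<Rightarrow> 'l endo \<Rightarrow>
    ('g \<Rightarrow> 'l bop) \<Rightarrow> bool" where
  "equivariant N \<beta> \<theta> c \<longleftrightarrow> (\<forall>g. unitary_in N (c g)) \<and>
     (\<forall>g. \<forall>b\<in>N. \<beta> g (\<theta> (\<beta> (- g) b)) = c g \<odot> \<theta> b \<odot> adj (c g)) \<and>
     (\<forall>g h. \<beta> g (c h) \<odot> c g = c (g + h))"

text \<open>\<open>\<mu>\<close> is the extension of \<open>\<theta>\<close> to the crossed product given by \<open>u\<^sub>g \<mapsto> c\<^sub>g* u\<^sub>g\<close>.\<close>

definition is_hat_eta :: "('g::group_add \<Rightarrow> 'l::chilbert_space \<Rightarrow> 'm::chilbert_space) \<Rightarrow>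
    'l bop set \<Rightarrow> ('g \<Rightarrow> 'l endo) \<Rightarrow> 'l endo \<Rightarrow> ('g \<Rightarrow> 'l bop) \<Rightarrow> 'm endo \<Rightarrow> bool" where
  "is_hat_eta \<delta> N \<beta> \<theta> c \<mu> \<longleftrightarrow> \<mu> \<in> End (crossed_product \<delta> N \<beta>) \<and>
     (\<forall>b\<in>N. \<mu> (cp_pi \<delta> \<beta> b) = cp_pi \<delta> \<beta> (\<theta> b)) \<and>
     (\<forall>g. \<mu> (cp_unitary \<delta> g) = cp_pi \<delta> \<beta> (adj (c g)) \<odot> cp_unitary \<delta> g)"

definition equivariantization :: "('g::group_add \<Rightarrow> 'l::chilbert_space \<Rightarrow> 'm::chilbert_space) \<Rightarrow>
    'l bop set \<Rightarrow> ('g \<Rightarrow> 'l endo) \<Rightarrow> 'l endo set \<Rightarrow> 'm endo set" where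
  "equivariantization \<delta> N \<beta> Z = {\<mu> \<in> End (crossed_product \<delta> N \<beta>). \<exists>\<theta>\<in>Z. \<exists>c \<nu>.
     equivariant N \<beta> \<theta> c \<and> is_hat_eta \<delta> N \<beta> \<theta> c \<nu> \<and> uequiv (crossed_product \<delta> N \<beta>) \<mu> \<nu>}"

text \<open>\<open>\<Phi>\<close> identifies \<open>N \<rtimes>\<^sub>\<beta> G\<close> with \<open>B\<close>, with implementing unitaries \<open>u\<close>.\<close>

definition crossed_identification :: "('g::group_add \<Rightarrow> 'l::chilbert_space \<Rightarrow> 'm::chilbert_space) \<Rightarrow>
    'l bop set \<Rightarrow> ('g \<Rightarrow> 'l endo) \<Rightarrow> 'l bop set \<Rightarrow> ('g \<Rightarrow> 'l bop) \<Rightarrow> ('m bop \<Rightarrow> 'l bop) \<Rightarrow> bool" where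
  "crossed_identification \<delta> N \<beta> B u \<Phi> \<longleftrightarrow>
     \<Phi> \<in> normal_homs (crossed_product \<delta> N \<beta>) B \<and> bij_betw \<Phi> (crossed_product \<delta> N \<beta>) B \<and>
     (\<forall>b\<in>N. \<Phi> (cp_pi \<delta> \<beta> b) = b) \<and> (\<forall>g. \<Phi> (cp_unitary \<delta> g) = u g)"

section \<open>Tensor categories of endomorphisms\<close>

text \<open>Full subcategories of \<open>End M\<close>, with composition of endomorphisms as tensor product; on
  \<open>S : \<rho> \<rightarrow> \<rho>'\<close> and \<open>T : \<sigma> \<rightarrow> \<sigma>'\<close> the tensor product is \<open>S \<rho>(T)\<close>.\<close>

definition tensor_category :: "'a::chilbert_space bop set \<Rightarrow> 'a endo set \<Rightarrow> bool" where
  "tensor_category M Z \<longleftrightarrow> Z \<subseteq> End M \<and> idend M \<in> Z \<and> (\<forall>\<rho>\<in>Z. \<forall>\<sigma>\<in>Z. compose M \<rho> \<sigma> \<in> Z)"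

text \<open>The strict tensor *-functor \<open>\<mu> \<mapsto> \<Phi> \<mu> \<Phi>\<^sup>-\<^sup>1\<close>, \<open>T \<mapsto> \<Phi>(T)\<close> induced by an isomorphism of algebras.\<close>

definition transport :: "'a::chilbert_space bop set \<Rightarrow> 'b::chilbert_space bop set \<Rightarrow>
    ('a bop \<Rightarrow> 'b bop) \<Rightarrow> 'a endo \<Rightarrow> 'b endo" where
  "transport M N \<Phi> \<mu> = (\<lambda>y\<in>N. \<Phi> (\<mu> (inv_into M \<Phi> y)))"

definition tensor_category_iso :: "'a::chilbert_space bop set \<Rightarrow> 'a endo set \<Rightarrow>
    'b::chilbert_space bop set \<Rightarrow> 'b endo set \<Rightarrow> ('a endo \<Rightarrow> 'b endo) \<Rightarrow> ('a bop \<Rightarrow> 'b bop) \<Rightarrow> bool" where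
  "tensor_category_iso M Z N Z' F \<Phi> \<longleftrightarrow>
     tensor_category M Z \<and> tensor_category N Z' \<and>
     bij_betw F Z Z' \<and> F (idend M) = idend N \<and>
     (\<forall>\<rho>\<in>Z. \<forall>\<sigma>\<in>Z. F (compose M \<rho> \<sigma>) = compose N (F \<rho>) (F \<sigma>)) \<and>
     (\<forall>\<rho>\<in>Z. \<forall>\<sigma>\<in>Z. bij_betw \<Phi> (intertwiners M \<rho> \<sigma>) (intertwiners N (F \<rho>) (F \<sigma>)) \<and>
        (\<forall>S\<in>intertwiners M \<rho> \<sigma>. \<forall>T\<in>intertwiners M \<rho> \<sigma>. \<Phi> (S + T) = \<Phi> S + \<Phi> T) \<and>
        (\<forall>c. \<forall>T\<in>intertwiners M \<rho> \<sigma>. \<Phi> (scale_op c T) = scale_op c (\<Phi> T)) \<and>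
        (\<forall>T\<in>intertwiners M \<rho> \<sigma>. \<Phi> (adj T) = adj (\<Phi> T))) \<and>
     \<Phi> \<I> = \<I> \<and>
     (\<forall>\<rho>\<in>Z. \<forall>\<sigma>\<in>Z. \<forall>\<tau>\<in>Z. \<forall>T\<in>intertwiners M \<rho> \<sigma>. \<forall>S\<in>intertwiners M \<sigma> \<tau>.
        \<Phi> (S \<odot> T) = \<Phi> S \<odot> \<Phi> T) \<and>
     (\<forall>\<rho>\<in>Z. \<forall>\<rho>'\<in>Z. \<forall>\<sigma>\<in>Z. \<forall>\<sigma>'\<in>Z. \<forall>S\<in>intertwiners M \<rho> \<rho>'. \<forall>T\<in>intertwiners M \<sigma> \<sigma>'.
        \<Phi> (S \<odot> \<rho> T) = \<Phi> S \<odot> F \<rho> (\<Phi> T))"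

end

theory Submission
  imports Defs
begin

text \<open>The key point is that an endomorphism \<open>\<eta>\<close> of \<open>\<B>\<close> restricting to \<open>\<sigma> \<otimes> id\<close> on \<open>\<A>\<close> is
  automatically an \<open>\<eta>\<close>-extension of a half braiding over all of \<open>\<C>\<close>.  Indeed, elements of \<open>\<B>\<close>
  commuting with \<open>1 \<otimes> M\<^sup>o\<^sup>p\<close> lie in \<open>M \<otimes> 1\<close>; by Frobenius reciprocity this gives
  \<open>\<eta>(\<lambda>\<^sub>\<pi>) = (T\<^sub>\<pi> \<otimes> 1) \<lambda>\<^sub>\<pi>\<close>, and the relations among the \<open>\<lambda>\<^sub>\<pi>\<close> turn \<open>T\<^sub>\<pi>*\<close> into a half braiding.

  If \<open>\<nu>\<close> is the extension to the crossed product of an equivariant \<open>\<theta> = Ad w \<circ> \<eta>\<^sub>0\<close>, then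
  \<open>Ad w* \<circ> \<nu>\<close> restricts to \<open>\<sigma> \<otimes> id\<close> on \<open>\<A>\<close>, so \<open>\<nu>\<close> belongs to the Drinfeld center.  Conversely,
  since every \<open>\<lambda>\<^sub>\<pi>\<close> is an \<open>\<A>\<close>-combination of irreducible ones, an \<open>\<eta>\<close>-extension over \<open>\<C>\<close> preserves
  all \<open>\<B>\<^sub>g\<close>; hence it restricts to \<open>\<B>\<^sub>0\<close>, and \<open>c\<^sub>g = u\<^sub>g \<eta>(u\<^sub>g)*\<close> is a cocycle in \<open>\<B>\<^sub>0\<close> making
  the restriction equivariant.  Transport along \<open>\<Phi>\<close> stays within normal endomorphisms because the
  inverse of a normal isomorphism of von Neumann algebras is normal.\<close>

section \<open>Hilbert space preliminaries\<close>

text \<open>The definition of \<open>\<B>\<close> supplies relations and a conditional expectation,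
  but no expansion of its elements. Three facts replace one: the finite sums of
  \<open>emb a \<odot> lam \<pi>\<close> form a *-algebra that is sigma-weakly dense by the
  bicommutant theorem; faithfulness of \<open>\<E>A\<close> lets Fourier coefficients detect zero;
  and the conjugate equations recover \<open>T\<close> from
  \<open>tens T \<I> \<odot> lam \<pi>\<close>. Half braidings must be unitary, and the conjugate
  equations are used once more to invert \<open>T\<close>.

  Type III and the faithful state serve to cut objects into summands: a projection in
  \<open>(\<pi>, \<pi>)\<close> has to be \<open>V \<odot> adj V\<close> for an isometry
  \<open>V\<close> in \<open>M\<close> before it defines an endomorphism of \<open>M\<close>.
  Finding \<open>V\<close> takes comparison of projections, hence polar decompositions and square
  roots.

  Normality is sigma-weak continuity, generated by vector functionals of amplified operators
  \<open>amp T\<close> on square-summable sequences. Statements about normal maps are therefore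
  proved through the seminorms \<open>norm (amp x \<eta>)\<close>, among them the normality of
  inverses and the preservation of infinite sums of isometries.\<close>

lemma scaleC_zero_left [simp]: "0 *\<^sub>C (x::'a::chilbert_space) = 0"
  using scaleC_add_left[of 0 0 x] by simp

lemma scaleC_zero_right [simp]: "c *\<^sub>C (0::'a::chilbert_space) = 0"
  using scaleC_add_right[of c 0 "0::'a"] by simp

lemma scaleC_one [simp]: "1 *\<^sub>C (x::'a::chilbert_space) = x"
  using scaleR_scaleC[of 1 x] by simp

lemma scaleC_minus_left [simp]: "(- c) *\<^sub>C (x::'a::chilbert_space) = - (c *\<^sub>C x)"
  using scaleC_add_left[of c "-c" x] by (simp add: add_eq_0_iff)

lemma scaleC_minus_right [simp]: "c *\<^sub>C (- x::'a::chilbert_space) = - (c *\<^sub>C x)"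
  using scaleC_add_right[of c x "-x"] by (simp add: add_eq_0_iff)

lemma scaleC_diff_right: "c *\<^sub>C (x - y::'a::chilbert_space) = c *\<^sub>C x - c *\<^sub>C y"
  using scaleC_add_right[of c x "-y"] by simp

lemma cinner_add_left: "cinner (x + y) (z::'a::chilbert_space) = cinner x z + cinner y z"
  by (metis cinner_add_right cinner_commute complex_cnj_add)

lemma cinner_scaleC_left: "cinner (c *\<^sub>C x) (z::'a::chilbert_space) = cnj c * cinner x z"
  by (metis cinner_scaleC_right cinner_commute complex_cnj_mult)

lemma cinner_zero_left [simp]: "cinner (0::'a::chilbert_space) x = 0"
  using cinner_scaleC_left[of 0 0 x] by simp

lemma cinner_zero_right [simp]: "cinner x (0::'a::chilbert_space) = 0"
  using cinner_scaleC_right[of x 0 0] by simp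

lemma cinner_minus_right [simp]: "cinner x (- y::'a::chilbert_space) = - cinner x y"
  using cinner_scaleC_right[of x "-1" y] by simp

lemma cinner_minus_left [simp]: "cinner (- x::'a::chilbert_space) y = - cinner x y"
  using cinner_scaleC_left[of "-1" x y] by simp

lemma cinner_diff_right: "cinner x (y - z::'a::chilbert_space) = cinner x y - cinner x z"
  using cinner_add_right[of x y "-z"] by simp

lemma cinner_diff_left: "cinner (x - y) (z::'a::chilbert_space) = cinner x z - cinner y z"
  using cinner_add_left[of x "-y" z] by simp

lemma cinner_scaleR_right: "cinner x (r *\<^sub>R (y::'a::chilbert_space)) = of_real r * cinner x y"
  by (simp add: scaleR_scaleC cinner_scaleC_right)

lemma cinner_scaleR_left: "cinner (r *\<^sub>R (x::'a::chilbert_space)) y = of_real r * cinner x y"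
  by (simp add: scaleR_scaleC cinner_scaleC_left)

lemma cinner_sum_right: "cinner x (\<Sum>i\<in>F. f i :: 'a::chilbert_space) = (\<Sum>i\<in>F. cinner x (f i))"
  by (induction F rule: infinite_finite_induct) (auto simp: cinner_add_right)

lemma cinner_sum_left: "cinner (\<Sum>i\<in>F. f i :: 'a::chilbert_space) x = (\<Sum>i\<in>F. cinner (f i) x)"
  by (induction F rule: infinite_finite_induct) (auto simp: cinner_add_left)

lemmas cinner_simps = cinner_add_left cinner_add_right cinner_diff_left cinner_diff_right
  cinner_scaleC_left cinner_scaleC_right cinner_scaleR_left cinner_scaleR_right

lemma cinner_self: "cinner x x = of_real ((norm (x::'a::chilbert_space))\<^sup>2)"
proof -
  have "sqrt (Re (cinner x x)) \<ge> 0"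
    using norm_eq_sqrt_cinner[of x] by (metis norm_ge_zero)
  then have "Re (cinner x x) \<ge> 0" by simp
  then have "Re (cinner x x) = (norm x)\<^sup>2"
    by (simp add: norm_eq_sqrt_cinner)
  moreover have "Im (cinner x x) = 0"
    using arg_cong[OF cinner_commute[of x x], of Im] by simp
  ultimately show ?thesis by (simp add: complex_eq_iff)
qed

lemma Re_cinner_self: "Re (cinner x x) = (norm (x::'a::chilbert_space))\<^sup>2"
  by (metis cinner_self Re_complex_of_real)

lemma norm_scaleC [simp]: "norm (c *\<^sub>C (x::'a::chilbert_space)) = cmod c * norm x"
proof -
  have "cinner (c *\<^sub>C x) (c *\<^sub>C x) = of_real ((cmod c)\<^sup>2) * cinner x x"
    unfolding complex_norm_square by (simp add: cinner_scaleC_left cinner_scaleC_right)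
  then have "(norm (c *\<^sub>C x))\<^sup>2 = (cmod c)\<^sup>2 * (norm x)\<^sup>2"
    by (metis Re_cinner_self Re_complex_of_real cinner_self of_real_mult)
  then have "(norm (c *\<^sub>C x))\<^sup>2 = (cmod c * norm x)\<^sup>2" by (simp add: power_mult_distrib)
  then show ?thesis by simp
qed

lemma norm_add_sq:
  "(norm (x + y :: 'a::chilbert_space))\<^sup>2 = (norm x)\<^sup>2 + 2 * Re (cinner x y) + (norm y)\<^sup>2"
proof -
  have "(norm (x + y))\<^sup>2 = Re (cinner (x+y) (x+y))" by (simp add: Re_cinner_self)
  also have "\<dots> = (norm x)\<^sup>2 + (Re (cinner x y) + Re (cinner y x)) + (norm y)\<^sup>2"
    by (simp add: cinner_add_left cinner_add_right Re_cinner_self)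
  also have "Re (cinner y x) = Re (cinner x y)"
    by (metis cinner_commute complex_cnj(1) cnj.simps(1))
  finally show ?thesis by simp
qed

lemma norm_diff_sq:
  "(norm (x - y :: 'a::chilbert_space))\<^sup>2 = (norm x)\<^sup>2 - 2 * Re (cinner x y) + (norm y)\<^sup>2"
  using norm_add_sq[of x "-y"] by simp

lemma cinner_cauchy_schwarz: "cmod (cinner x (y::'a::chilbert_space)) \<le> norm x * norm y"
proof (cases "x = 0")
  case False
  define c where "c = cinner x y / of_real ((norm x)\<^sup>2)"
  have n: "norm x \<noteq> 0" using False by simp
  have "cinner x (y - c *\<^sub>C x) = 0"
    using n by (simp add: cinner_simps cinner_self c_def)
  then have "(norm (c *\<^sub>C x + (y - c *\<^sub>C x)))\<^sup>2 = (norm (c *\<^sub>C x))\<^sup>2 + (norm (y - c *\<^sub>C x))\<^sup>2"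
    unfolding norm_add_sq by (simp add: cinner_scaleC_left)
  then have "(cmod c * norm x)\<^sup>2 \<le> (norm y)\<^sup>2" by simp
  then have "cmod c * norm x \<le> norm y" by simp
  moreover have "cmod c * norm x = cmod (cinner x y) / norm x"
    using n by (simp add: c_def norm_divide power2_eq_square norm_mult)
  ultimately show ?thesis using n by (simp add: divide_le_eq mult.commute)
qed simp

lemma bounded_bilinear_cinner: "bounded_bilinear (cinner :: 'a::chilbert_space \<Rightarrow> 'a \<Rightarrow> complex)"
proof
  show "\<exists>K. \<forall>a b. cmod (cinner (a::'a) b) \<le> norm a * norm b * K"
    by (rule exI[of _ 1]) (simp add: cinner_cauchy_schwarz)
qed (auto simp: cinner_simps scaleR_conv_of_real)

lemmas tendsto_cinner [tendsto_intros] = bounded_bilinear.tendsto[OF bounded_bilinear_cinner]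

lemma bounded_linear_scaleC: "bounded_linear (\<lambda>x::'a::chilbert_space. c *\<^sub>C x)"
proof (rule bounded_linear_intro[of _ "cmod c"])
  show "c *\<^sub>C (r *\<^sub>R x) = r *\<^sub>R c *\<^sub>C x" for r and x :: 'a
    by (simp add: scaleR_scaleC scaleC_scaleC mult.commute)
qed (auto simp: scaleC_add_right mult.commute)

lemmas tendsto_scaleC [tendsto_intros] = bounded_linear.tendsto[OF bounded_linear_scaleC]

lemma cinner_ext: "(\<And>x. cinner x y = cinner x z) \<Longrightarrow> y = (z::'a::chilbert_space)"
proof -
  assume "\<And>x. cinner x y = cinner x z"
  then have "cinner (y - z) (y - z) = 0" by (simp add: cinner_diff_right)
  then show "y = z" by (simp add: cinner_self)
qed

lemma cinner_ext_left: "(\<And>x. cinner y x = cinner z x) \<Longrightarrow> y = (z::'a::chilbert_space)"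
  by (rule cinner_ext) (metis cinner_commute)

section \<open>Closed complex subspaces, projections and extension by continuity\<close>

definition csub :: "'a::chilbert_space set \<Rightarrow> bool" where
  "csub K \<longleftrightarrow> 0 \<in> K \<and> (\<forall>x\<in>K. \<forall>y\<in>K. x + y \<in> K) \<and> (\<forall>c. \<forall>x\<in>K. c *\<^sub>C x \<in> K)"

lemma csub_diff: "csub K \<Longrightarrow> x \<in> K \<Longrightarrow> y \<in> K \<Longrightarrow> x - y \<in> K"
  unfolding csub_def by (metis diff_conv_add_uminus scaleC_minus_left scaleC_one)

lemma csub_scaleR: "csub K \<Longrightarrow> x \<in> K \<Longrightarrow> r *\<^sub>R x \<in> K"
  by (simp add: csub_def scaleR_scaleC)

lemma csub_closure: assumes "csub K" shows "csub (closure K)"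
  unfolding csub_def
proof (intro conjI ballI allI)
  show "0 \<in> closure K" using assms closure_subset unfolding csub_def by blast
  fix x y assume "x \<in> closure K" "y \<in> closure K"
  then obtain f g where f: "\<And>n::nat. f n \<in> K" "f \<longlonglongrightarrow> x" and g: "\<And>n::nat. g n \<in> K" "g \<longlonglongrightarrow> y"
    unfolding closure_sequential by blast
  have "(\<lambda>n. f n + g n) \<longlonglongrightarrow> x + y" using f(2) g(2) by (rule tendsto_add)
  then show "x + y \<in> closure K"
    unfolding closure_sequential using f(1) g(1) assms unfolding csub_def
    by (intro exI[of _ "\<lambda>n. f n + g n"]) auto
  fix c
  have "(\<lambda>n. c *\<^sub>C f n) \<longlonglongrightarrow> c *\<^sub>C x" using f(2) by (rule tendsto_scaleC)
  then show "c *\<^sub>C x \<in> closure K"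
    unfolding closure_sequential using f(1) assms unfolding csub_def
    by (intro exI[of _ "\<lambda>n. c *\<^sub>C f n"]) auto
qed

lemma parallelogram:
  "(norm (x - y :: 'a::chilbert_space))\<^sup>2 + (norm (x + y))\<^sup>2 = 2 * (norm x)\<^sup>2 + 2 * (norm y)\<^sup>2"
  by (simp add: norm_add_sq norm_diff_sq)

text \<open>A minimizing sequence for the distance is Cauchy by the parallelogram law, and its limit
  is the foot of the perpendicular.\<close>

lemma projection_exists:
  fixes K :: "'a::chilbert_space set"
  assumes K: "csub K" and cl: "closed K"
  shows "\<exists>p\<in>K. \<forall>k\<in>K. cinner k (x - p) = 0"
proof -
  have ne: "K \<noteq> {}" using K by (auto simp: csub_def)
  define d where "d = infdist x K"
  have d0: "d \<ge> 0" by (simp add: d_def infdist_nonneg)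
  have dle: "d \<le> norm (x - k)" if "k \<in> K" for k
    using infdist_le[OF that, of x] by (simp add: d_def dist_norm)
  have "\<exists>k\<in>K. norm (x - k) < d + 1 / real (Suc n)" for n
  proof (rule ccontr)
    assume "\<not> ?thesis"
    then have "\<And>k. k \<in> K \<Longrightarrow> d + 1 / real (Suc n) \<le> dist x k" by (auto simp: dist_norm)
    then have "d + 1 / real (Suc n) \<le> infdist x K"
      using ne by (simp add: infdist_def cINF_greatest)
    then show False by (simp add: d_def)
  qed
  then obtain k where k: "\<And>n. k n \<in> K" "\<And>n. norm (x - k n) < d + 1 / real (Suc n)" by metis
  have lim: "(\<lambda>n. 1 / real (Suc n)) \<longlonglongrightarrow> 0" by (rule lim_1_over_n[THEN LIMSEQ_Suc])
  have est: "(norm (k m - k n))\<^sup>2 \<le> 2 * (d + 1 / real (Suc m))\<^sup>2 + 2 * (d + 1 / real (Suc n))\<^sup>2 - 4 * d\<^sup>2"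
    for m n
  proof -
    \<comment> \<open>The midpoint stays in \<open>K\<close>, so its distance from \<open>x\<close>
      is at least \<open>d\<close>; the parallelogram law then bounds the gap between the two
      points.\<close>
    have h: "(1/2) *\<^sub>R (k m + k n) \<in> K"
      using K k(1) by (intro csub_scaleR) (auto simp: csub_def)
    have "(x - k n) + (x - k m) = 2 *\<^sub>R (x - (1/2) *\<^sub>R (k m + k n))"
      by (simp add: algebra_simps scaleR_2)
    then have "norm ((x - k n) + (x - k m)) \<ge> 2 * d" using dle[OF h] by simp
    then have "(norm ((x - k n) + (x - k m)))\<^sup>2 \<ge> (2 * d)\<^sup>2" using d0 by (intro power_mono) auto
    moreover have "(norm ((x - k n) - (x - k m)))\<^sup>2 + (norm ((x - k n) + (x - k m)))\<^sup>2
        = 2 * (norm (x - k n))\<^sup>2 + 2 * (norm (x - k m))\<^sup>2"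
      by (rule parallelogram)
    moreover have "(x - k n) - (x - k m) = k m - k n" by simp
    moreover have "(norm (x - k j))\<^sup>2 \<le> (d + 1 / real (Suc j))\<^sup>2" for j
      using k(2)[of j] by (intro power_mono) auto
    moreover have "(2 * d)\<^sup>2 = 4 * d\<^sup>2" by (simp add: power_mult_distrib)
    moreover note \<open>\<And>j. (norm (x - k j))\<^sup>2 \<le> (d + 1 / real (Suc j))\<^sup>2\<close>[of m]
    ultimately show ?thesis by (smt (verit))
  qed
  have "Cauchy k"
  proof (rule metric_CauchyI)
    fix e :: real assume e: "e > 0"
    have "(\<lambda>n. (d + 1 / real (Suc n))\<^sup>2 - d\<^sup>2) \<longlonglongrightarrow> (d + 0)\<^sup>2 - d\<^sup>2"
      by (intro tendsto_intros lim)
    then have "\<forall>\<^sub>F n in sequentially. (d + 1 / real (Suc n))\<^sup>2 - d\<^sup>2 < e\<^sup>2 / 4"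
      using e by (intro order_tendstoD(2)[where y=0]) auto
    then obtain N where N: "\<And>n. n \<ge> N \<Longrightarrow> (d + 1 / real (Suc n))\<^sup>2 - d\<^sup>2 < e\<^sup>2 / 4"
      by (auto simp: eventually_sequentially)
    show "\<exists>N. \<forall>m\<ge>N. \<forall>n\<ge>N. dist (k m) (k n) < e"
    proof (intro exI allI impI)
      fix m n assume "N \<le> m" "N \<le> n"
      then have "(norm (k m - k n))\<^sup>2 < e\<^sup>2" using est[of m n] N[of m] N[of n] by linarith
      then show "dist (k m) (k n) < e" using e by (simp add: dist_norm power2_less_imp_less)
    qed
  qed
  then obtain p where p: "k \<longlonglongrightarrow> p" using Cauchy_convergent convergent_def by blast
  have pK: "p \<in> K" using cl k(1) p closed_sequentially by blast
  have "norm (x - p) \<le> d + 0"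
  proof (rule LIMSEQ_le)
    show "(\<lambda>n. norm (x - k n)) \<longlonglongrightarrow> norm (x - p)" by (intro tendsto_intros p)
    show "(\<lambda>n. d + 1 / real (Suc n)) \<longlonglongrightarrow> d + 0" by (intro tendsto_intros lim)
  qed (use k(2) less_imp_le in blast)
  then have pd: "norm (x - p) \<le> d" by simp
  have "cinner y (x - p) = 0" if y: "y \<in> K" for y
  proof (cases "y = 0")
    case False
    \<comment> \<open>\<open>c\<close> is the coefficient of \<open>x - p\<close> along
      \<open>y\<close>: moving the foot by that multiple of \<open>y\<close> would shorten the
      distance unless \<open>c\<close> vanishes.\<close>
    define c where "c = cinner y (x - p) / of_real ((norm y)\<^sup>2)"
    have n: "norm y \<noteq> 0" using False by simp
    have "cinner y ((x - p) - c *\<^sub>C y) = 0"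
      using n by (simp add: cinner_simps cinner_self c_def)
    then have "(norm (c *\<^sub>C y + ((x - p) - c *\<^sub>C y)))\<^sup>2 = (norm (c *\<^sub>C y))\<^sup>2 + (norm ((x - p) - c *\<^sub>C y))\<^sup>2"
      unfolding norm_add_sq by (simp add: cinner_scaleC_left)
    moreover have "p + c *\<^sub>C y \<in> K" using K pK y by (simp add: csub_def)
    then have "norm (x - p) \<le> norm ((x - p) - c *\<^sub>C y)"
      using dle[of "p + c *\<^sub>C y"] pd by (simp add: algebra_simps)
    then have "(norm (x - p))\<^sup>2 \<le> (norm ((x - p) - c *\<^sub>C y))\<^sup>2" by simp
    ultimately have "(norm (c *\<^sub>C y))\<^sup>2 \<le> 0" by simp
    then have "c = 0" using n by simp
    then show ?thesis using n by (simp add: c_def)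
  qed simp
  with pK show ?thesis by blast
qed

definition proj :: "'a::chilbert_space set \<Rightarrow> 'a bop" where
  "proj K = Blinfun (\<lambda>x. SOME p. p \<in> K \<and> (\<forall>k\<in>K. cinner k (x - p) = 0))"

text \<open>Linearity of the chosen foot comes from its uniqueness, boundedness from
  Pythagoras.\<close>

lemma proj:
  fixes K :: "'a::chilbert_space set"
  assumes K: "csub K" and cl: "closed K"
  shows proj_mem: "proj K x \<in> K"
    and proj_orth: "k \<in> K \<Longrightarrow> cinner k (x - proj K x) = 0"
    and proj_unique: "p \<in> K \<Longrightarrow> (\<And>k. k \<in> K \<Longrightarrow> cinner k (x - p) = 0) \<Longrightarrow> (proj K) x = p"
    and proj_bops: "proj K \<in> bops"
proof -
  define P where "P x = (SOME p. p \<in> K \<and> (\<forall>k\<in>K. cinner k (x - p) = 0))" for x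
  have P: "P x \<in> K \<and> (\<forall>k\<in>K. cinner k (x - P x) = 0)" for x
    unfolding P_def by (rule someI_ex) (use projection_exists[OF K cl] in blast)
  have uniq: "P x = p" if "p \<in> K" "\<And>k. k \<in> K \<Longrightarrow> cinner k (x - p) = 0" for x p
  proof -
    have d: "P x - p \<in> K" using P that(1) K csub_diff by blast
    have "cinner (P x - p) (x - P x) = 0" using d P by blast
    moreover have "cinner (P x - p) (x - p) = 0" using d that(2) by blast
    ultimately have "cinner (P x - p) ((x - p) - (x - P x)) = 0"
      unfolding cinner_diff_right[of "P x - p" "x - p" "x - P x"] by simp
    moreover have "(x - p) - (x - P x) = P x - p" by simp
    ultimately show ?thesis by (simp add: cinner_self)
  qed
  have add: "P (x + y) = P x + P y" for x y
  proof (rule uniq)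
    show "P x + P y \<in> K" using P[of x] P[of y] K by (auto simp: csub_def)
    fix k assume "k \<in> K"
    then have "cinner k ((x - P x) + (y - P y)) = 0"
      unfolding cinner_add_right using P[of x] P[of y] by simp
    then show "cinner k (x + y - (P x + P y)) = 0" by (simp add: algebra_simps)
  qed
  have sc: "P (c *\<^sub>C x) = c *\<^sub>C P x" for c x
  proof (rule uniq)
    show "c *\<^sub>C P x \<in> K" using P[of x] K by (auto simp: csub_def)
    fix k assume "k \<in> K"
    then have "cinner k (c *\<^sub>C (x - P x)) = 0"
      unfolding cinner_scaleC_right using P[of x] by simp
    then show "cinner k (c *\<^sub>C x - c *\<^sub>C P x) = 0" by (simp add: scaleC_diff_right)
  qed
  have nm: "norm (P x) \<le> norm x" for x
  proof -
    have "cinner (P x) (x - P x) = 0" using P by blast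
    then have "(norm (P x + (x - P x)))\<^sup>2 = (norm (P x))\<^sup>2 + (norm (x - P x))\<^sup>2"
      unfolding norm_add_sq by simp
    then have "(norm (P x))\<^sup>2 \<le> (norm x)\<^sup>2" by simp
    then show ?thesis by simp
  qed
  have bl: "bounded_linear P"
    by (rule bounded_linear_intro[of _ 1]) (auto simp: add sc nm scaleR_scaleC)
  have app: "proj K x = P x" for x
    unfolding proj_def P_def[symmetric] by (simp add: bl bounded_linear_Blinfun_apply)
  show "proj K x \<in> K" "k \<in> K \<Longrightarrow> cinner k (x - proj K x) = 0"
    "p \<in> K \<Longrightarrow> (\<And>k. k \<in> K \<Longrightarrow> cinner k (x - p) = 0) \<Longrightarrow> (proj K) x = p"
    using P uniq by (auto simp: app)
  show "proj K \<in> bops" by (simp add: bops_def app sc)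
qed

definition perp_to :: "('i \<Rightarrow> 'a::chilbert_space) \<Rightarrow> 'a \<Rightarrow> bool" where
  "perp_to e x \<longleftrightarrow> (\<forall>i. cinner (e i) x = 0)"

text \<open>\<open>span\<close> is the real span. The hypothesis, stability of the family under
  complex multiples up to reindexing, makes it a complex subspace; it recurs as \<open>sc\<close> in
  the constructions below.\<close>

lemma csub_span:
  fixes e :: "'i \<Rightarrow> 'a::chilbert_space"
  assumes sc: "\<And>c i. \<exists>j. e j = c *\<^sub>C e i"
  shows "csub (span (range e))"
  unfolding csub_def
proof (intro conjI ballI allI)
  fix c x assume "x \<in> span (range e)"
  then show "c *\<^sub>C x \<in> span (range e)"
  proof (induction rule: span_induct_alt)
    case base
    then show ?case by (simp add: span_zero)
  next
    case (step r a x)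
    from step(1) obtain i where "a = e i" by blast
    then have "c *\<^sub>C a \<in> span (range e)" using sc[of c i] by (metis rangeI span_base)
    moreover have "c *\<^sub>C (r *\<^sub>R a + x) = r *\<^sub>R (c *\<^sub>C a) + c *\<^sub>C x"
      by (simp add: scaleR_scaleC scaleC_scaleC scaleC_add_right mult.commute)
    ultimately show ?case using step by (simp add: span_add span_scale)
  qed
qed (auto simp: span_zero span_add)

lemma cinner_zero_closure_span:
  assumes "perp_to e x" "y \<in> closure (span (range e))"
  shows "cinner y (x::'a::chilbert_space) = 0"
proof -
  have s: "cinner y x = 0" if "y \<in> span (range e)" for y
    using that
  proof (induction rule: span_induct_alt)
    case (step c a y)
    then show ?case using assms(1) by (auto simp: cinner_simps perp_to_def)
  qed simp
  obtain f where "\<And>n::nat. f n \<in> span (range e)" "f \<longlonglongrightarrow> y"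
    using assms(2) unfolding closure_sequential by blast
  then have "(\<lambda>n. cinner (f n) x) \<longlonglongrightarrow> cinner y x" "\<And>n. cinner (f n) x = 0"
    by (auto intro!: tendsto_intros s)
  then show ?thesis by (simp add: LIMSEQ_const_iff)
qed

lemma blinfun_eq_closure_span:
  fixes A B :: "'a::chilbert_space \<Rightarrow>\<^sub>L 'b::real_normed_vector"
  assumes "\<And>i. A (e i) = B (e i)" and "x \<in> closure (span (range e))"
  shows "A x = B x"
proof -
  have s: "A y = B y" if "y \<in> span (range e)" for y
    using that
  proof (induction rule: span_induct_alt)
    case (step c a y)
    then show ?case using assms(1) by (auto simp: blinfun.bilinear_simps)
  qed simp
  obtain f where f: "\<And>n::nat. f n \<in> span (range e)" "f \<longlonglongrightarrow> x"
    using assms(2) unfolding closure_sequential by blast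
  then have "(\<lambda>n. A (f n)) \<longlonglongrightarrow> A x" "(\<lambda>n. B (f n)) \<longlonglongrightarrow> B x"
    by (auto intro!: tendsto_intros)
  moreover have "(\<lambda>n. A (f n)) = (\<lambda>n. B (f n))" using f(1) s by simp
  ultimately show ?thesis using LIMSEQ_unique by metis
qed

text \<open>Splits a vector into its projection to the closed span and a remainder orthogonal to the
  family. It is the uniqueness counterpart of \<open>bounded_extension\<close>, which prescribes
  values on a family and zero on the complement.\<close>

lemma blinfun_eq_onI:
  fixes A B :: "'a::chilbert_space \<Rightarrow>\<^sub>L 'b::real_normed_vector"
  assumes sc: "\<And>c i. \<exists>j. e j = c *\<^sub>C e i"
    and "\<And>i. A (e i) = B (e i)" and "\<And>x. perp_to e x \<Longrightarrow> A x = B x"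
  shows "A = B"
proof (rule blinfun_eqI)
  fix x
  let ?K = "closure (span (range e))"
  have K: "csub ?K" "closed ?K" by (auto intro: csub_closure csub_span sc)
  let ?p = "(proj ?K) x"
  have "A ?p = B ?p" by (rule blinfun_eq_closure_span[OF assms(2) proj_mem[OF K]])
  moreover have "A (x - ?p) = B (x - ?p)"
    by (rule assms(3))
       (auto simp: perp_to_def intro!: proj_orth[OF K] closure_subset[THEN subsetD] span_base)
  ultimately show "A x = B x" by (simp add: blinfun.diff_right)
qed

lemma blinfun_eq_dense:
  fixes A B :: "'a::chilbert_space \<Rightarrow>\<^sub>L 'b::real_normed_vector"
  assumes "closure (span (range e)) = UNIV" "\<And>i. A (e i) = B (e i)"
  shows "A = B"
  by (rule blinfun_eqI) (use assms blinfun_eq_closure_span in blast)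

text \<open>The bound does double duty. Applied to a difference of two coefficient functions it
  shows that the value on a finite combination is independent of the chosen representation, and it
  gives the uniform continuity needed to pass to the closure.\<close>

lemma bounded_extension:
  fixes e :: "'i \<Rightarrow> 'a::chilbert_space" and f :: "'i \<Rightarrow> 'b::banach"
  assumes bound: "\<And>F c. finite F \<Longrightarrow> norm (\<Sum>i\<in>F. c i *\<^sub>R f i) \<le> K * norm (\<Sum>i\<in>F. c i *\<^sub>R e i)"
    and sc: "\<And>c i. \<exists>j. e j = c *\<^sub>C e i" and K0: "K \<ge> 0"
  obtains T :: "'a \<Rightarrow>\<^sub>L 'b" where "\<And>i. T (e i) = f i" "\<And>x. perp_to e x \<Longrightarrow> T x = 0"
    "\<And>x. norm (T x) \<le> K * norm x"
proof -
  define S where "S = span (range e)"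
  define supp where "supp c = {i. c i \<noteq> (0::real)}" for c :: "'i \<Rightarrow> real"
  define le where "le c = (\<Sum>i\<in>supp c. c i *\<^sub>R e i)" for c
  define lf where "lf c = (\<Sum>i\<in>supp c. c i *\<^sub>R f i)" for c
  have le: "le c = (\<Sum>i\<in>F. c i *\<^sub>R e i)" if "finite F" "supp c \<subseteq> F" for c F
    unfolding le_def by (rule sum.mono_neutral_left[OF that]) (auto simp: supp_def)
  have lf: "lf c = (\<Sum>i\<in>F. c i *\<^sub>R f i)" if "finite F" "supp c \<subseteq> F" for c F
    unfolding lf_def by (rule sum.mono_neutral_left[OF that]) (auto simp: supp_def)
  have comb: "finite (supp (\<lambda>i. a * c i + c' i)) \<and>
      le (\<lambda>i. a * c i + c' i) = a *\<^sub>R le c + le c' \<and> lf (\<lambda>i. a * c i + c' i) = a *\<^sub>R lf c + lf c'"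
    if "finite (supp c)" "finite (supp c')" for a c c'
  proof -
    let ?F = "supp c \<union> supp c'"
    have F: "finite ?F" "supp c \<subseteq> ?F" "supp c' \<subseteq> ?F" "supp (\<lambda>i. a * c i + c' i) \<subseteq> ?F"
      using that by (auto simp: supp_def)
    show ?thesis
      unfolding le[OF F(1,2)] le[OF F(1,3)] le[OF F(1,4)] lf[OF F(1,2)] lf[OF F(1,3)] lf[OF F(1,4)]
      using finite_subset[OF F(4,1)]
      by (simp add: scaleR_add_left sum.distrib scaleR_sum_right)
  qed
  have rep: "\<exists>c. finite (supp c) \<and> le c = x" if "x \<in> S" for x
    using that unfolding S_def
  proof (induction rule: span_induct_alt)
    case base
    have "supp (\<lambda>_. 0) = {}" by (auto simp: supp_def)
    then show ?case by (intro exI[of _ "\<lambda>_. 0"]) (auto simp: le_def)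
  next
    case (step a y x)
    then obtain i c where i: "y = e i" and c: "finite (supp c)" "le c = x" by blast
    let ?d = "\<lambda>j. if j = i then 1 else (0::real)"
    have s: "supp ?d = {i}" by (auto simp: supp_def)
    then have "le ?d = e i" by (simp add: le_def)
    then show ?case using comb[of ?d c a] c s i by (intro exI[of _ "\<lambda>i. a * ?d i + c i"]) simp
  qed
  define ch where "ch x = (SOME c. finite (supp c) \<and> le c = x)" for x
  have ch: "finite (supp (ch x)) \<and> le (ch x) = x" if "x \<in> S" for x
    unfolding ch_def using someI_ex[OF rep[OF that]] .
  define g where "g x = lf (ch x)" for x
  have bd: "norm (lf c) \<le> K * norm (le c)" if "finite (supp c)" for c
    unfolding lf_def le_def by (rule bound[OF that])
  have gl: "g (le c) = lf c" if c: "finite (supp c)" for c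
  proof -
    have "le c \<in> S" unfolding S_def le_def by (intro span_sum span_scale span_base) auto
    note h = ch[OF this]
    have "norm (lf (\<lambda>i. (-1) * c i + ch (le c) i)) \<le> K * norm (le (\<lambda>i. (-1) * c i + ch (le c) i))"
      by (rule bd) (use comb c h in blast)
    then show ?thesis using comb[OF c conjunct1[OF h], of "-1"] h by (simp add: g_def)
  qed
  have gadd: "g (a *\<^sub>R x + y) = a *\<^sub>R g x + g y" if "x \<in> S" "y \<in> S" for a x y
  proof -
    note c = ch[OF that(1)] ch[OF that(2)]
    note k = comb[OF conjunct1[OF c(1)] conjunct1[OF c(2)], of a]
    from gl[OF conjunct1[OF k]] show ?thesis unfolding g_def[of x] g_def[of y] using k c by simp
  qed
  have gb: "norm (g x) \<le> K * norm x" if "x \<in> S" for x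
    using ch[OF that] bd[of "ch x"] by (simp add: g_def)
  have ge: "g (e i) = f i" for i
  proof -
    let ?d = "\<lambda>j. if j = i then 1 else (0::real)"
    have s: "supp ?d = {i}" by (auto simp: supp_def)
    then have "le ?d = e i" "lf ?d = f i" by (auto simp: le_def lf_def)
    then show ?thesis using gl[of ?d] s by simp
  qed
  have gdiff: "g x - g y = g (x - y)" if "x \<in> S" "y \<in> S" for x y
    using gadd[OF that(2,1), of "-1"] by simp
  have "uniformly_continuous_on S g"
    unfolding uniformly_continuous_on_def
  proof (intro allI impI)
    fix \<epsilon> :: real assume \<epsilon>: "\<epsilon> > 0"
    show "\<exists>d>0. \<forall>x\<in>S. \<forall>x'\<in>S. dist x' x < d \<longrightarrow> dist (g x') (g x) < \<epsilon>"
    proof (intro exI[of _ "\<epsilon> / (K + 1)"] conjI ballI impI)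
      show "\<epsilon> / (K + 1) > 0" using \<epsilon> K0 by simp
      fix x x' assume x: "x \<in> S" "x' \<in> S" and d: "dist x' x < \<epsilon> / (K + 1)"
      have "x' - x \<in> S" using x unfolding S_def by (rule span_diff[rotated])
      then have "norm (g x' - g x) \<le> K * norm (x' - x)" using gdiff x gb by metis
      also have "\<dots> \<le> (K + 1) * norm (x' - x)" by (simp add: mult_right_mono)
      also have "\<dots> < \<epsilon>" using d K0 by (simp add: dist_norm pos_less_divide_eq mult.commute)
      finally show "dist (g x') (g x) < \<epsilon>" by (simp add: dist_norm)
    qed
  qed
  then obtain h where h: "uniformly_continuous_on (closure S) h" "\<And>x. x \<in> S \<Longrightarrow> g x = h x"
    using uniformly_continuous_on_extension_on_closure by metis
  have hc: "(\<lambda>n. h (s n)) \<longlonglongrightarrow> h x" if "s \<longlonglongrightarrow> x" "\<And>n::nat. s n \<in> S" "x \<in> closure S" for s x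
    using uniformly_continuous_imp_continuous[OF h(1)] that closure_subset[of S]
    unfolding continuous_on_sequentially by (auto simp: comp_def)
  have hl: "h (a *\<^sub>R x + y) = a *\<^sub>R h x + h y" if xy: "x \<in> closure S" "y \<in> closure S" for a x y
  proof -
    obtain s t where s: "\<And>n::nat. s n \<in> S" "s \<longlonglongrightarrow> x" and t: "\<And>n::nat. t n \<in> S" "t \<longlonglongrightarrow> y"
      using xy unfolding closure_sequential by blast
    have st: "a *\<^sub>R s n + t n \<in> S" for n
      using s(1) t(1) unfolding S_def by (intro span_add span_scale)
    have l: "(\<lambda>n. a *\<^sub>R s n + t n) \<longlonglongrightarrow> a *\<^sub>R x + y" by (intro tendsto_intros s t)
    then have "a *\<^sub>R x + y \<in> closure S"
      unfolding closure_sequential using st by (intro exI[of _ "\<lambda>n. a *\<^sub>R s n + t n"]) simp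
    from hc[OF l st this] have "(\<lambda>n. h (a *\<^sub>R s n + t n)) \<longlonglongrightarrow> h (a *\<^sub>R x + y)" .
    moreover have "(\<lambda>n. a *\<^sub>R h (s n) + h (t n)) \<longlonglongrightarrow> a *\<^sub>R h x + h y"
      by (intro tendsto_intros hc s t xy)
    moreover have "h (a *\<^sub>R s n + t n) = a *\<^sub>R h (s n) + h (t n)" for n
      using gadd[OF s(1) t(1)] h(2) s(1) t(1) st by metis
    ultimately show ?thesis using LIMSEQ_unique by simp
  qed
  have hb: "norm (h x) \<le> K * norm x" if x: "x \<in> closure S" for x
  proof -
    obtain s where s: "\<And>n::nat. s n \<in> S" "s \<longlonglongrightarrow> x" using x unfolding closure_sequential by blast
    have "(\<lambda>n. norm (h (s n))) \<longlonglongrightarrow> norm (h x)" by (intro tendsto_intros hc s x)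
    moreover have "(\<lambda>n. K * norm (s n)) \<longlonglongrightarrow> K * norm x" by (intro tendsto_intros s)
    moreover have "norm (h (s n)) \<le> K * norm (s n)" for n using gb[OF s(1)] h(2)[OF s(1)] by metis
    ultimately show ?thesis using LIMSEQ_le by blast
  qed
  have cs: "csub (closure S)" "closed (closure S)" unfolding S_def by (auto intro: csub_closure csub_span sc)
  let ?P = "\<lambda>x. (proj (closure S)) x"
  have h0: "h 0 = 0" using hb[of 0] cs by (simp add: csub_def)
  have hs: "h (a *\<^sub>R x) = a *\<^sub>R h x" if "x \<in> closure S" for a x
    using hl[OF that, of 0 a] cs h0 by (simp add: csub_def)
  have ha: "h (x + y) = h x + h y" if "x \<in> closure S" "y \<in> closure S" for x y
    using hl[OF that, of 1] by simp
  have nP: "norm (?P x) \<le> norm x" for x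
  proof -
    have "(norm (?P x + (x - ?P x)))\<^sup>2 = (norm (?P x))\<^sup>2 + (norm (x - ?P x))\<^sup>2"
      unfolding norm_add_sq using proj_orth[OF cs proj_mem[OF cs]] by simp
    then have "(norm (?P x))\<^sup>2 \<le> (norm x)\<^sup>2" by simp
    then show ?thesis by simp
  qed
  have nb: "norm (h (?P x)) \<le> K * norm x" for x
    using hb[OF proj_mem[OF cs, of x]] mult_left_mono[OF nP K0] by (rule order_trans)
  have bl: "bounded_linear (\<lambda>x. h (?P x))"
    by (rule bounded_linear_intro[of _ K])
       (auto simp: blinfun.bilinear_simps ha hs proj_mem[OF cs] nb mult.commute)
  show thesis
  proof
    let ?T = "Blinfun (\<lambda>x. h (?P x))"
    note [simp] = bounded_linear_Blinfun_apply[OF bl]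
    fix i
    have "e i \<in> S" by (simp add: S_def span_base)
    moreover from this have "e i \<in> closure S" using closure_subset by blast
    then have "?P (e i) = e i" by (intro proj_unique[OF cs]) auto
    ultimately show "?T (e i) = f i" by (simp add: h(2)[symmetric] ge)
  next
    let ?T = "Blinfun (\<lambda>x. h (?P x))"
    note [simp] = bounded_linear_Blinfun_apply[OF bl]
    show "norm (?T x) \<le> K * norm x" for x by (simp add: nb)
    fix x assume "perp_to e x"
    then have "?P x = 0" using cs
      by (intro proj_unique[OF cs]) (auto simp: csub_def S_def cinner_zero_closure_span)
    then show "?T x = 0" by (simp add: h0)
  qed
qed

text \<open>The real-linear extension is automatically complex linear, since
  \<open>T (c *\<^sub>C x)\<close> and \<open>c *\<^sub>C T x\<close> agree on the family and both
  vanish on its complement.\<close>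

lemma bounded_cextension:
  fixes e :: "'i \<Rightarrow> 'a::chilbert_space" and f :: "'i \<Rightarrow> 'b::chilbert_space"
  assumes bound: "\<And>F c. finite F \<Longrightarrow> norm (\<Sum>i\<in>F. c i *\<^sub>R f i) \<le> K * norm (\<Sum>i\<in>F. c i *\<^sub>R e i)"
    and sc: "\<And>c i. \<exists>j. e j = c *\<^sub>C e i \<and> f j = c *\<^sub>C f i" and K0: "K \<ge> 0"
  obtains T :: "'a \<Rightarrow>\<^sub>L 'b" where "\<And>i. T (e i) = f i" "\<And>x. perp_to e x \<Longrightarrow> T x = 0"
    "\<And>x. norm (T x) \<le> K * norm x" "\<And>c x. T (c *\<^sub>C x) = c *\<^sub>C T x"
proof -
  have sc': "\<exists>j. e j = c *\<^sub>C e i" for c i using sc by blast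
  obtain T :: "'a \<Rightarrow>\<^sub>L 'b" where T: "\<And>i. T (e i) = f i" "\<And>x. perp_to e x \<Longrightarrow> T x = 0"
    "\<And>x. norm (T x) \<le> K * norm x"
    using bounded_extension[OF bound sc' K0] by blast
  have "T (c *\<^sub>C x) = c *\<^sub>C T x" for c x
  proof -
    have bl: "bounded_linear (\<lambda>x. T (c *\<^sub>C x))" "bounded_linear (\<lambda>x. c *\<^sub>C T x)"
      using bounded_linear_compose[OF blinfun.bounded_linear_right bounded_linear_scaleC]
        bounded_linear_compose[OF bounded_linear_scaleC blinfun.bounded_linear_right] by auto
    have "Blinfun (\<lambda>x. T (c *\<^sub>C x)) = Blinfun (\<lambda>x. c *\<^sub>C T x)"
    proof (rule blinfun_eq_onI[OF sc'])
      show "Blinfun (\<lambda>x. T (c *\<^sub>C x)) (e i) = Blinfun (\<lambda>x. c *\<^sub>C T x) (e i)" for i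
        using sc[of c i] T(1) by (auto simp: bounded_linear_Blinfun_apply bl) metis
      fix x assume x: "perp_to e x"
      then have "perp_to e (c *\<^sub>C x)" by (simp add: perp_to_def cinner_scaleC_right)
      then show "Blinfun (\<lambda>x. T (c *\<^sub>C x)) x = Blinfun (\<lambda>x. c *\<^sub>C T x) x"
        using x by (simp add: bounded_linear_Blinfun_apply bl T)
    qed
    then show ?thesis by (metis bl bounded_linear_Blinfun_apply)
  qed
  with T that show thesis by blast
qed

section \<open>Riesz representation, adjoints and the calculus of bounded operators\<close>

lemma riesz:
  fixes f :: "'a::chilbert_space \<Rightarrow>\<^sub>L complex"
  assumes lin: "\<And>c x. f (c *\<^sub>C x) = c * f x"
  obtains z where "\<And>x. f x = cinner z x"
proof (cases "\<forall>x. f x = 0")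
  case True
  then show ?thesis using that[of 0] by simp
next
  case False
  then obtain x0 where x0: "f x0 \<noteq> 0" by blast
  define K where "K = {x. f x = 0}"
  have K: "csub K" by (auto simp: K_def csub_def blinfun.bilinear_simps lin)
  have cl: "closed K"
    unfolding K_def by (intro closed_Collect_eq continuous_intros)
  define y where "y = x0 - proj K x0"
  have fy: "f y \<noteq> 0" using proj_mem[OF K cl, of x0] x0 by (simp add: y_def blinfun.diff_right K_def)
  have y0: "norm y \<noteq> 0" using fy by auto
  have orth: "cinner y k = 0" if "k \<in> K" for k
    using proj_orth[OF K cl that, of x0] cinner_commute[of y k] by (simp add: y_def)
  show thesis
  proof (rule that[of "cnj (f y / of_real ((norm y)\<^sup>2)) *\<^sub>C y"])
    fix x
    have "x - (f x / f y) *\<^sub>C y \<in> K" using fy by (simp add: K_def blinfun.diff_right lin)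
    then have "cinner y (x - (f x / f y) *\<^sub>C y) = 0" by (rule orth)
    then have "cinner y x = (f x / f y) * of_real ((norm y)\<^sup>2)"
      by (simp add: cinner_simps cinner_self)
    then show "f x = cinner (cnj (f y / of_real ((norm y)\<^sup>2)) *\<^sub>C y) x"
      using y0 fy by (simp add: cinner_scaleC_left)
  qed
qed

lemma adjoint_exists:
  fixes T :: "'a::chilbert_space \<Rightarrow>\<^sub>L 'b::chilbert_space"
  assumes lin: "\<And>c x. T (c *\<^sub>C x) = c *\<^sub>C T x"
  obtains S :: "'b \<Rightarrow>\<^sub>L 'a" where "\<And>x y. cinner (S x) y = cinner x (T y)" "\<And>c x. S (c *\<^sub>C x) = c *\<^sub>C S x"
proof -
  have "\<exists>z. \<forall>y. cinner z y = cinner x (T y)" for x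
  proof -
    have bl: "bounded_linear (\<lambda>y. cinner x (T y))"
      by (rule bounded_linear_compose[OF bounded_bilinear.bounded_linear_right[OF bounded_bilinear_cinner]
            blinfun.bounded_linear_right])
    obtain z where "\<And>y. (Blinfun (\<lambda>y. cinner x (T y))) y = cinner z y"
      by (rule riesz[of "Blinfun (\<lambda>y. cinner x (T y))"])
         (auto simp: bounded_linear_Blinfun_apply bl lin cinner_scaleC_right)
    then show ?thesis by (auto simp: bounded_linear_Blinfun_apply bl)
  qed
  then obtain g where g: "\<And>x y. cinner (g x) y = cinner x (T y)" by metis
  have add: "g (x + y) = g x + g y" for x y by (rule cinner_ext_left) (simp add: g cinner_add_left)
  have sc: "g (c *\<^sub>C x) = c *\<^sub>C g x" for c x by (rule cinner_ext_left) (simp add: g cinner_scaleC_left)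
  have nb: "norm (g x) \<le> norm x * norm T" for x
  proof -
    have "of_real ((norm (g x))\<^sup>2) = cinner x (T (g x))" by (simp only: g cinner_self[symmetric])
    then have "(norm (g x))\<^sup>2 = cmod (cinner x (T (g x)))" by (metis norm_of_real abs_of_nonneg zero_le_power2)
    also have "\<dots> \<le> norm x * norm (T (g x))" by (rule cinner_cauchy_schwarz)
    also have "\<dots> \<le> norm x * (norm T * norm (g x))" by (simp add: mult_left_mono norm_blinfun)
    finally show ?thesis by (cases "norm (g x) = 0") (auto simp: power2_eq_square mult.assoc[symmetric])
  qed
  have bl: "bounded_linear g"
    by (rule bounded_linear_intro[of _ "norm T"]) (auto simp: add sc scaleR_scaleC nb)
  show thesis
    by (rule that[of "Blinfun g"]) (auto simp: bounded_linear_Blinfun_apply bl g sc)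
qed

lemma bops_app: "T \<in> bops \<Longrightarrow> T (c *\<^sub>C x) = c *\<^sub>C T x"
  by (simp add: bops_def)

lemma bopsI: "(\<And>c x. blinfun_apply T (c *\<^sub>C x) = c *\<^sub>C blinfun_apply T x) \<Longrightarrow> T \<in> bops"
  by (simp add: bops_def)

lemma adj_unique:
  assumes "S \<in> bops" "\<And>x y. cinner (blinfun_apply S x) y = cinner x (blinfun_apply T y)"
  shows "adj T = S"
  unfolding adj_def
proof (rule the_equality)
  fix S' assume "S' \<in> bops \<and> (\<forall>x y. cinner (S' x) y = cinner x (T y))"
  then show "S' = S" by (intro blinfun_eqI cinner_ext_left) (simp add: assms)
qed (use assms in auto)

lemma adj:
  assumes "T \<in> bops"
  shows adj_bops [simp]: "adj T \<in> bops"
    and cinner_adj: "cinner (blinfun_apply (adj T) x) y = cinner x (blinfun_apply T y)"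
    and cinner_adj': "cinner x (blinfun_apply (adj T) y) = cinner (blinfun_apply T x) y"
proof -
  obtain S where S: "\<And>x y. cinner (blinfun_apply S x) y = cinner x (blinfun_apply T y)"
      "\<And>c x. blinfun_apply S (c *\<^sub>C x) = c *\<^sub>C blinfun_apply S x"
    using adjoint_exists[of T] assms bops_app by metis
  then have "S \<in> bops" by (simp add: bops_def)
  then have "adj T = S" using S(1) by (rule adj_unique)
  then show "adj T \<in> bops" "cinner (blinfun_apply (adj T) x) y = cinner x (blinfun_apply T y)"
      "cinner x (blinfun_apply (adj T) y) = cinner (blinfun_apply T x) y"
    using S \<open>S \<in> bops\<close> by auto (metis cinner_commute)
qed

lemma bops_id [simp]: "\<I> \<in> bops" and bops_0 [simp]: "0 \<in> bops"
  and bops_comp [simp]: "S \<in> bops \<Longrightarrow> T \<in> bops \<Longrightarrow> S \<odot> T \<in> bops"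
  and bops_add [simp]: "S \<in> bops \<Longrightarrow> T \<in> bops \<Longrightarrow> S + T \<in> bops"
  and bops_diff [simp]: "S \<in> bops \<Longrightarrow> T \<in> bops \<Longrightarrow> S - T \<in> bops"
  and bops_scaleR [simp]: "S \<in> bops \<Longrightarrow> r *\<^sub>R S \<in> bops"
  by (auto simp: bops_def blinfun.bilinear_simps scaleC_add_right scaleC_diff_right scaleR_scaleC
      scaleC_scaleC mult.commute)

lemma scale_op_apply [simp]: "scale_op c T x = c *\<^sub>C T x"
  unfolding scale_op_def
  by (rule fun_cong[OF bounded_linear_Blinfun_apply])
     (rule bounded_linear_compose[OF bounded_linear_scaleC blinfun.bounded_linear_right])

lemma scale_op_bops [simp]: "T \<in> bops \<Longrightarrow> scale_op c T \<in> bops"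
  by (auto simp: bops_def scaleC_scaleC mult.commute)

lemma adj_adj [simp]: "T \<in> bops \<Longrightarrow> adj (adj T) = T"
  by (rule adj_unique) (auto simp: cinner_adj')

lemma adj_comp: "S \<in> bops \<Longrightarrow> T \<in> bops \<Longrightarrow> adj (S \<odot> T) = adj T \<odot> adj S"
  by (rule adj_unique) (auto simp: cinner_adj)

lemma adj_id [simp]: "adj \<I> = \<I>"
  by (rule adj_unique) auto

lemma adj_0 [simp]: "adj 0 = 0"
  by (rule adj_unique) auto

lemma adj_add: "S \<in> bops \<Longrightarrow> T \<in> bops \<Longrightarrow> adj (S + T) = adj S + adj T"
  by (rule adj_unique) (auto simp: cinner_adj cinner_simps blinfun.bilinear_simps)

lemma adj_diff: "S \<in> bops \<Longrightarrow> T \<in> bops \<Longrightarrow> adj (S - T) = adj S - adj T"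
  by (rule adj_unique) (auto simp: cinner_adj cinner_simps blinfun.bilinear_simps)

lemma adj_scale_op: "T \<in> bops \<Longrightarrow> adj (scale_op c T) = scale_op (cnj c) (adj T)"
  by (rule adj_unique) (auto simp: cinner_adj cinner_simps)

lemma adj_scaleR: "T \<in> bops \<Longrightarrow> adj (r *\<^sub>R T) = r *\<^sub>R adj T"
  by (rule adj_unique) (auto simp: cinner_adj cinner_simps blinfun.bilinear_simps)

lemma adj_sum: "(\<And>i. i \<in> F \<Longrightarrow> f i \<in> bops) \<Longrightarrow> adj (\<Sum>i\<in>F. f i) = (\<Sum>i\<in>F. adj (f i)) \<and> (\<Sum>i\<in>F. f i) \<in> bops"
  by (induction F rule: infinite_finite_induct) (auto simp: adj_add)

lemma comp_simps:
  fixes A B C :: "'a::chilbert_space bop"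
  shows comp_assoc: "A \<odot> B \<odot> C = A \<odot> (B \<odot> C)"
    and comp_id_left [simp]: "\<I> \<odot> A = A" and comp_id_right [simp]: "A \<odot> \<I> = A"
    and comp_zero_right [simp]: "A \<odot> 0 = 0"
    and comp_add_left: "(A + B) \<odot> C = A \<odot> C + B \<odot> C"
    and comp_add_right: "A \<odot> (B + C) = A \<odot> B + A \<odot> C"
    and comp_diff_left: "(A - B) \<odot> C = A \<odot> C - B \<odot> C"
    and comp_diff_right: "A \<odot> (B - C) = A \<odot> B - A \<odot> C"
    and comp_scaleR_left: "(r *\<^sub>R A) \<odot> B = r *\<^sub>R (A \<odot> B)"
    and comp_scaleR_right: "A \<odot> (r *\<^sub>R B) = r *\<^sub>R (A \<odot> B)"
    and comp_scale_op_left: "scale_op c A \<odot> B = scale_op c (A \<odot> B)"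
    and comp_scale_op_right: "A \<in> bops \<Longrightarrow> A \<odot> scale_op c B = scale_op c (A \<odot> B)"
  by (auto intro!: blinfun_eqI simp: blinfun.bilinear_simps bops_app)

lemma comp_sum_left: "(\<Sum>i\<in>F. f i) \<odot> (B::'a::chilbert_space bop) = (\<Sum>i\<in>F. f i \<odot> B)"
  by (induction F rule: infinite_finite_induct) (auto simp: comp_add_left)

lemma comp_sum_right: "(B::'a::chilbert_space bop) \<odot> (\<Sum>i\<in>F. f i) = (\<Sum>i\<in>F. B \<odot> f i)"
  by (induction F rule: infinite_finite_induct) (auto simp: comp_add_right)

lemma scale_op_scale_op [simp]: "scale_op a (scale_op b T) = scale_op (a * b) T"
  by (rule blinfun_eqI) (simp add: scaleC_scaleC)

lemma scaleR_scale_op: "r *\<^sub>R T = scale_op (of_real r) T"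
  by (rule blinfun_eqI) (simp add: blinfun.bilinear_simps scaleR_scaleC)

lemma scale_op_1 [simp]: "scale_op 1 T = T" and scale_op_0 [simp]: "scale_op 0 T = 0"
  and scale_op_zero [simp]: "scale_op c 0 = 0"
  and scale_op_m1: "scale_op (-1) T = - T"
  and scale_op_add: "scale_op c (S + T) = scale_op c S + scale_op c T"
  and scale_op_add_left: "scale_op (c + d) T = scale_op c T + scale_op d T"
  and scale_op_diff: "scale_op c (S - T) = scale_op c S - scale_op c T"
  by (auto intro!: blinfun_eqI simp: blinfun.bilinear_simps scaleC_add_right scaleC_add_left scaleC_diff_right)

lemma norm_adj: assumes "T \<in> bops" shows "norm (adj T) = norm T"
proof -
  have "norm (adj S) \<le> norm S" if S: "S \<in> bops" for S :: "'a bop"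
  proof (rule norm_blinfun_bound)
    fix x
    have "of_real ((norm (adj S x))\<^sup>2) = cinner x (S (adj S x))"
      by (simp only: cinner_adj[OF S] cinner_self[symmetric])
    then have "(norm (adj S x))\<^sup>2 = cmod (cinner x (S (adj S x)))"
      by (metis norm_of_real abs_of_nonneg zero_le_power2)
    also have "\<dots> \<le> norm x * norm (S (adj S x))" by (rule cinner_cauchy_schwarz)
    also have "\<dots> \<le> norm x * (norm S * norm (adj S x))" by (simp add: mult_left_mono norm_blinfun)
    finally show "norm (adj S x) \<le> norm S * norm x"
      by (cases "norm (adj S x) = 0") (auto simp: power2_eq_square mult.assoc[symmetric] mult.commute)
  qed simp
  from this[OF assms] this[OF adj_bops[OF assms]] assms show ?thesis by simp
qed

lemma norm_sq_adj_comp: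
  "T \<in> bops \<Longrightarrow> cinner x ((adj T \<odot> T) x) = of_real ((norm (T x))\<^sup>2)"
  by (simp add: cinner_adj' cinner_self)

lemma norm_sq_scalar:
  assumes "T \<in> bops" "adj T \<odot> T = r *\<^sub>R \<I>" shows "(norm (T x))\<^sup>2 = r * (norm x)\<^sup>2"
proof -
  have "complex_of_real ((norm (T x))\<^sup>2) = of_real (r * (norm x)\<^sup>2)"
    using norm_sq_adj_comp[OF assms(1), of x] unfolding assms(2)
    by (simp add: blinfun.scaleR_left cinner_scaleR_right cinner_self)
  then show ?thesis by (simp only: of_real_eq_iff)
qed

lemma adj_comp_zero: "T \<in> bops \<Longrightarrow> adj T \<odot> T = 0 \<Longrightarrow> T = 0"
  by (rule blinfun_eqI) (use norm_sq_adj_comp[of T] in auto)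

section \<open>Quadratic forms, positive operators and square roots\<close>

lemma polarization:
  assumes T: "T \<in> bops"
  defines "q \<equiv> \<lambda>z. cinner z (T z)"
  shows "4 * cinner y (T x) =
    q (x + y) - q (x - y) + \<i> * (q (x + \<i> *\<^sub>C y) - q (x - \<i> *\<^sub>C y))"
  unfolding q_def by (simp add: blinfun.add_right blinfun.diff_right bops_app[OF T] cinner_add_left
      cinner_add_right cinner_diff_left cinner_diff_right cinner_scaleC_left cinner_scaleC_right algebra_simps)

lemma bops_zero_if_quadratic_zero:
  assumes "T \<in> bops" "\<And>x. cinner x (blinfun_apply T x) = 0"
  shows "T = 0"
proof (rule blinfun_eqI)
  fix x
  have "4 * cinner y (blinfun_apply T x) = 0" for y
    unfolding polarization[OF assms(1)] by (simp add: assms(2))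
  then show "blinfun_apply T x = blinfun_apply 0 x" by (intro cinner_ext) simp
qed

lemma selfadjoint_if_quadratic_real:
  assumes T: "T \<in> bops" and re: "\<And>x. cinner x (T x) \<in> \<real>"
  shows "adj T = T"
proof -
  have "cinner x ((adj T - T) x) = 0" for x
  proof -
    have "cinner x (adj T x) = cnj (cinner x (T x))"
      unfolding cinner_adj'[OF T] by (rule cinner_commute)
    also have "\<dots> = cinner x (T x)" using re by (simp add: Reals_cnj_iff)
    finally show ?thesis by (simp add: blinfun.diff_left cinner_diff_right)
  qed
  then have "adj T - T = 0" by (intro bops_zero_if_quadratic_zero) (simp_all add: T)
  then show ?thesis by simp
qed

lemma pos_op_bops: "pos_op T \<Longrightarrow> T \<in> bops"
  by (simp add: pos_op_def)

lemma pos_op_selfadjoint: "pos_op T \<Longrightarrow> adj T = T"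
  by (rule selfadjoint_if_quadratic_real) (auto simp: pos_op_def nonneg_Reals_subset_Reals[THEN subsetD])

lemma pos_op_Re: "pos_op T \<Longrightarrow> Re (cinner x (T x)) \<ge> 0"
  by (simp add: pos_op_def complex_nonneg_Reals_iff)

lemma selfadjoint_quadratic_real:
  assumes "T \<in> bops" "adj T = T"
  shows "Im (cinner x (T x)) = 0"
proof -
  have "cinner x (T x) = cnj (cinner x (T x))"
    by (metis assms cinner_adj cinner_commute)
  from arg_cong[OF this, of Im] show ?thesis by simp
qed

lemma pos_opI: "T \<in> bops \<Longrightarrow> adj T = T \<Longrightarrow> (\<And>x. Re (cinner x (T x)) \<ge> 0) \<Longrightarrow> pos_op T"
  unfolding pos_op_def by (simp add: complex_nonneg_Reals_iff selfadjoint_quadratic_real)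

lemma pos_op_adj_comp: "T \<in> bops \<Longrightarrow> pos_op (adj T \<odot> T)"
  by (rule pos_opI) (auto simp: adj_comp norm_sq_adj_comp simp del: blinfun_apply_blinfun_compose)

text \<open>Positivity at \<open>x - S x\<close>, combined with the upper bound at
  \<open>S x\<close>, gives \<open>(norm (S x))\<^sup>2 \<le> Re (cinner x (S x))\<close>; the upper
  bound at \<open>x\<close> finishes.\<close>

lemma norm_le_1_if_between:
  assumes S: "pos_op S" and le: "\<And>x. Re (cinner x (S x)) \<le> (norm x)\<^sup>2"
  shows "norm S \<le> 1"
proof (rule norm_blinfun_bound)
  fix x
  note b = pos_op_bops[OF S] and sa = pos_op_selfadjoint[OF S]
  let ?y = "S x"
  have sym: "Re (cinner ?y (S x)) = (norm ?y)\<^sup>2" by (simp add: Re_cinner_self)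
  have Q: "Re (cinner (x - t *\<^sub>R ?y) (S (x - t *\<^sub>R ?y))) =
      Re (cinner x ?y) - 2 * t * (norm ?y)\<^sup>2 + t\<^sup>2 * Re (cinner ?y (S ?y))" for t :: real
  proof -
    have "cinner x (S ?y) = cinner ?y ?y"
      using cinner_adj[OF b, of x ?y] sa by simp
    then show ?thesis
      by (simp add: blinfun.bilinear_simps cinner_simps Re_cinner_self power2_eq_square algebra_simps)
  qed
  have "0 \<le> Re (cinner x ?y) - 2 * t * (norm ?y)\<^sup>2 + t\<^sup>2 * (norm ?y)\<^sup>2" for t :: real
  proof -
    have "t\<^sup>2 * Re (cinner ?y (S ?y)) \<le> t\<^sup>2 * (norm ?y)\<^sup>2"
      by (intro mult_left_mono le) simp
    then show ?thesis using pos_op_Re[OF S, of "x - t *\<^sub>R ?y"] unfolding Q by linarith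
  qed
  from this[of 1] have "(norm ?y)\<^sup>2 \<le> Re (cinner x ?y)" by simp
  also have "\<dots> \<le> (norm x)\<^sup>2" by (rule le)
  finally show "norm ?y \<le> 1 * norm x" by simp
qed simp

text \<open>\<open>1 - Y\<close> is a square root of \<open>1 - S\<close>; the iteration \<open>Y \<mapsto> (S + Y\<^sup>2)/2\<close> from \<open>0\<close> is dominated in
  norm by its scalar counterpart with \<open>S = 1\<close>, which increases to \<open>1\<close>.\<close>

lemma op_sqrt_norm_le:
  assumes S: "S \<in> bops" "adj S = S" "norm S \<le> 1"
  obtains Y where "Y \<in> bops" "adj Y = Y" "norm Y \<le> 1" "2 *\<^sub>R Y = S + Y \<odot> Y"
    "\<And>T. T \<odot> S = S \<odot> T \<Longrightarrow> T \<odot> Y = Y \<odot> T"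
proof -
  define Y where "Y = rec_nat 0 (\<lambda>n Y. (1/2) *\<^sub>R (S + Y \<odot> Y))"
  define y where "y = rec_nat 0 (\<lambda>n y. (1/2) * (1 + y * y) :: real)"
  have Y0 [simp]: "Y 0 = 0" and YS [simp]: "\<And>n. Y (Suc n) = (1/2) *\<^sub>R (S + Y n \<odot> Y n)" by (auto simp: Y_def)
  have y0 [simp]: "y 0 = 0" and yS [simp]: "\<And>n. y (Suc n) = (1/2) * (1 + y n * y n)" by (auto simp: y_def)
  have comm: "T \<odot> Y n = Y n \<odot> T" if "T \<odot> S = S \<odot> T" for T n
  proof (induction n)
    case (Suc n)
    have "T \<odot> (Y n \<odot> Y n) = Y n \<odot> Y n \<odot> T" by (metis Suc comp_assoc)
    then show ?case using that
      by (simp add: comp_add_left comp_add_right comp_scaleR_left comp_scaleR_right)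
  qed simp
  have yb: "0 \<le> y n \<and> y n \<le> 1 \<and> y n \<le> y (Suc n)" for n
  proof -
    have "0 \<le> y n \<and> y n \<le> 1" for n
    proof (induction n)
      case (Suc n)
      then have "y n * y n \<le> 1" by (simp add: mult_le_one)
      then show ?case using Suc by simp
    qed simp
    moreover have "0 \<le> (1 - y n)\<^sup>2" by simp
    then have "y n \<le> y (Suc n)" by (simp add: power2_eq_square algebra_simps)
    ultimately show ?thesis by blast
  qed
  have bop: "Y n \<in> bops \<and> adj (Y n) = Y n" for n
    by (induction n) (auto simp: S adj_scaleR adj_add adj_comp)
  have nY: "norm (Y n) \<le> y n" for n
  proof (induction n)
    case (Suc n)
    have "norm (S + Y n \<odot> Y n) \<le> norm S + norm (Y n \<odot> Y n)" by (rule norm_triangle_ineq)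
    also have "norm (Y n \<odot> Y n) \<le> norm (Y n) * norm (Y n)" by (rule norm_blinfun_compose)
    also have "\<dots> \<le> y n * y n" by (intro mult_mono Suc) (auto simp: yb)
    finally show ?case using S(3) by simp
  qed simp
  have dY: "norm (Y (Suc n) - Y n) \<le> y (Suc n) - y n" for n
  proof (induction n)
    case 0
    then show ?case using S(3) by simp
  next
    case (Suc n)
    \<comment> \<open>Consecutive iterates commute, so the difference of their squares factors; this
      lets the increments of \<open>Y\<close> be dominated by those of \<open>y\<close>.\<close>
    have c: "Y n \<odot> Y (Suc n) = Y (Suc n) \<odot> Y n"
      using comm[OF comm[OF refl, symmetric], of n "Suc n"] by simp
    have "Y (Suc (Suc n)) - Y (Suc n) = (1/2) *\<^sub>R (Y (Suc n) \<odot> Y (Suc n) - Y n \<odot> Y n)"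
      unfolding YS[of "Suc n"] YS[of n] by (simp add: scaleR_diff_right[symmetric] del: scaleR_diff_right)
    also have "Y (Suc n) \<odot> Y (Suc n) - Y n \<odot> Y n = (Y (Suc n) - Y n) \<odot> (Y (Suc n) + Y n)"
      unfolding comp_diff_left comp_add_right c by simp
    finally have "norm (Y (Suc (Suc n)) - Y (Suc n)) \<le> (1/2) * (norm (Y (Suc n) - Y n) * norm (Y (Suc n) + Y n))"
      using norm_blinfun_compose[of "Y (Suc n) - Y n" "Y (Suc n) + Y n"] by simp
    also have "norm (Y (Suc n) + Y n) \<le> y (Suc n) + y n"
      using nY[of n] nY[of "Suc n"] norm_triangle_ineq[of "Y (Suc n)" "Y n"] by linarith
    then have "(1/2) * (norm (Y (Suc n) - Y n) * norm (Y (Suc n) + Y n)) \<le>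
        (1/2) * ((y (Suc n) - y n) * (y (Suc n) + y n))"
      using yb[of n] by (intro mult_left_mono mult_mono Suc) auto
    also have "\<dots> = y (Suc (Suc n)) - y (Suc n)" unfolding yS[of "Suc n"] yS[of n] by (simp add: algebra_simps)
    finally show ?case .
  qed
  have dY': "norm (Y (n + k) - Y n) \<le> y (n + k) - y n" for n k
  proof (induction k)
    case (Suc k)
    have "norm (Y (n + Suc k) - Y n) \<le> norm (Y (Suc (n + k)) - Y (n + k)) + norm (Y (n + k) - Y n)"
      using norm_triangle_ineq[of "Y (Suc (n + k)) - Y (n + k)" "Y (n + k) - Y n"] by simp
    then show ?case using dY[of "n + k"] Suc by simp
  qed simp
  have "incseq y" using yb by (intro incseq_SucI) blast
  have "convergent y"
  proof (rule Bseq_mono_convergent)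
    show "Bseq y" using yb by (intro BseqI'[of _ 1]) (simp add: abs_le_iff)
    show "\<forall>m n. m \<le> n \<longrightarrow> y m \<le> y n" using \<open>incseq y\<close> by (simp add: incseq_def)
  qed
  then have "Cauchy y" by (rule convergent_Cauchy)
  have "Cauchy Y"
  proof (rule metric_CauchyI)
    fix e :: real assume "e > 0"
    then obtain N where N: "\<And>m n. m \<ge> N \<Longrightarrow> n \<ge> N \<Longrightarrow> dist (y m) (y n) < e"
      using \<open>Cauchy y\<close> unfolding Cauchy_def by meson
    have *: "dist (Y m) (Y n) < e" if "n \<ge> N" "m \<ge> n" for m n
      using dY'[of n "m - n"] N[of m n] that by (simp add: dist_norm)
    show "\<exists>N. \<forall>m\<ge>N. \<forall>n\<ge>N. dist (Y m) (Y n) < e"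
      by (intro exI[of _ N] allI impI) (metis * dist_commute nle_le)
  qed
  then obtain Z where Z: "Y \<longlonglongrightarrow> Z" using Cauchy_convergent convergent_def by blast
  have Zp: "(\<lambda>n. (Y n) x) \<longlonglongrightarrow> Z x" for x
    by (intro tendsto_intros Z)
  show thesis
  proof
    show Zb: "Z \<in> bops"
    proof (rule bopsI)
      fix c x
      have "(\<lambda>n. c *\<^sub>C (Y n) x) \<longlonglongrightarrow> c *\<^sub>C Z x" by (intro tendsto_intros Zp)
      then show "Z (c *\<^sub>C x) = c *\<^sub>C Z x"
        using Zp[of "c *\<^sub>C x"] bop by (simp add: bops_app LIMSEQ_unique)
    qed
    show "adj Z = Z"
    proof (rule adj_unique[OF Zb])
      fix x v
      have "(\<lambda>n. cinner (Y n x) v) \<longlonglongrightarrow> cinner (Z x) v"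
        "(\<lambda>n. cinner x (Y n v)) \<longlonglongrightarrow> cinner x (Z v)"
        by (intro tendsto_intros Zp)+
      moreover have "cinner (Y n x) v = cinner x (Y n v)" for n
        using cinner_adj[of "Y n" x v] bop by metis
      ultimately show "cinner (Z x) v = cinner x (Z v)"
        using LIMSEQ_unique by simp
    qed
    show "norm Z \<le> 1"
    proof (rule LIMSEQ_le_const2[OF tendsto_norm[OF Z]])
      show "\<exists>N. \<forall>n\<ge>N. norm (Y n) \<le> 1" using nY yb order_trans by blast
    qed
    have "(\<lambda>n. (1/2) *\<^sub>R (S + Y n \<odot> Y n)) \<longlonglongrightarrow> (1/2) *\<^sub>R (S + Z \<odot> Z)"
      by (intro tendsto_intros bounded_bilinear.tendsto[OF bounded_bilinear_blinfun_compose] Z)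
    moreover have "(\<lambda>n. Y (Suc n)) \<longlonglongrightarrow> Z" using Z by (rule LIMSEQ_Suc)
    ultimately have "Z = (1/2) *\<^sub>R (S + Z \<odot> Z)" using LIMSEQ_unique by simp
    then have "2 *\<^sub>R Z = 2 *\<^sub>R ((1/2) *\<^sub>R (S + Z \<odot> Z))" by (rule arg_cong)
    then show "2 *\<^sub>R Z = S + Z \<odot> Z" by simp
    fix T :: "'a bop" assume T: "T \<odot> S = S \<odot> T"
    have "(\<lambda>n. T \<odot> Y n) \<longlonglongrightarrow> T \<odot> Z" "(\<lambda>n. Y n \<odot> T) \<longlonglongrightarrow> Z \<odot> T"
      by (intro bounded_bilinear.tendsto[OF bounded_bilinear_blinfun_compose] tendsto_const Z)+
    then show "T \<odot> Z = Z \<odot> T" using comm[OF T] LIMSEQ_unique by simp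
  qed
qed

text \<open>With \<open>S = \<I> - A / a\<close> and \<open>a = norm A\<close>, the fixed-point
  equation for \<open>Y\<close> says that the square of \<open>\<I> - Y\<close> is
  \<open>A / a\<close>; rescaling by \<open>sqrt a\<close> gives the root. Operators commuting with
  \<open>A\<close> commute with \<open>S\<close> and hence with \<open>Y\<close>.\<close>

lemma op_sqrt:
  assumes A: "pos_op (A :: 'a::chilbert_space bop)"
  obtains R where "pos_op R" "R \<odot> R = A" "\<And>T. T \<in> bops \<Longrightarrow> T \<odot> A = A \<odot> T \<Longrightarrow> T \<odot> R = R \<odot> T"
proof (cases "A = 0")
  case True
  show thesis by (rule that[of 0]) (auto simp: True intro: pos_opI)
next
  case False
  define a where "a = norm A"
  have a: "a > 0" using False by (simp add: a_def)
  note Ab = pos_op_bops[OF A] and As = pos_op_selfadjoint[OF A]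
  define S where "S = \<I> - (1 / a) *\<^sub>R A"
  have Sb: "S \<in> bops" and Ss: "adj S = S" by (auto simp: S_def Ab As adj_diff adj_scaleR)
  have q: "Re (cinner x (S x)) = (norm x)\<^sup>2 - Re (cinner x (A x)) / a" for x
    by (simp add: S_def blinfun.bilinear_simps cinner_simps Re_cinner_self)
  have up: "Re (cinner x (A x)) \<le> a * (norm x)\<^sup>2" for x
  proof -
    have "Re (cinner x (A x)) \<le> cmod (cinner x (A x))" by (rule complex_Re_le_cmod)
    also have "\<dots> \<le> norm x * norm (A x)" by (rule cinner_cauchy_schwarz)
    also have "\<dots> \<le> norm x * (a * norm x)" unfolding a_def by (intro mult_left_mono norm_blinfun) simp
    finally show ?thesis by (simp add: power2_eq_square mult_ac)
  qed
  have "pos_op S"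
    by (rule pos_opI[OF Sb Ss]) (use up a in \<open>simp add: q pos_divide_le_eq mult.commute\<close>)
  then have "norm S \<le> 1"
    by (rule norm_le_1_if_between) (use pos_op_Re[OF A] a in \<open>simp add: q\<close>)
  from op_sqrt_norm_le[OF Sb Ss this] obtain Y where Y: "Y \<in> bops" "adj Y = Y" "norm Y \<le> 1"
    "2 *\<^sub>R Y = S + Y \<odot> Y" "\<And>T. T \<odot> S = S \<odot> T \<Longrightarrow> T \<odot> Y = Y \<odot> T" by blast
  show thesis
  proof (rule that[of "sqrt a *\<^sub>R (\<I> - Y)"])
    show "pos_op (sqrt a *\<^sub>R (\<I> - Y))"
    proof (rule pos_opI)
      fix x
      have "Re (cinner x (Y x)) \<le> norm x * norm (Y x)"
        using complex_Re_le_cmod cinner_cauchy_schwarz order_trans by blast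
      also have "\<dots> \<le> norm x * (1 * norm x)"
        using norm_blinfun[of Y x] mult_right_mono[OF Y(3), of "norm x"] by (intro mult_left_mono) auto
      finally show "0 \<le> Re (cinner x ((sqrt a *\<^sub>R (\<I> - Y)) x))"
        using a by (simp add: blinfun.bilinear_simps cinner_simps Re_cinner_self power2_eq_square)
    qed (auto simp: Y adj_scaleR adj_diff)
    have "(\<I> - Y) \<odot> (\<I> - Y) = \<I> - 2 *\<^sub>R Y + Y \<odot> Y"
      by (simp add: comp_diff_left comp_diff_right scaleR_2)
    also have "\<dots> = (1/a) *\<^sub>R A" using Y(4) by (simp add: S_def)
    finally show "sqrt a *\<^sub>R (\<I> - Y) \<odot> sqrt a *\<^sub>R (\<I> - Y) = A"
      using a by (simp add: comp_scaleR_left comp_scaleR_right)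
    fix T :: "'a bop" assume "T \<in> bops" "T \<odot> A = A \<odot> T"
    then have "T \<odot> S = S \<odot> T"
      by (simp add: S_def comp_diff_left comp_diff_right comp_scaleR_left comp_scaleR_right)
    then have "T \<odot> Y = Y \<odot> T" by (rule Y(5))
    then show "T \<odot> sqrt a *\<^sub>R (\<I> - Y) = sqrt a *\<^sub>R (\<I> - Y) \<odot> T"
      by (simp add: comp_diff_left comp_diff_right comp_scaleR_left comp_scaleR_right)
  qed
qed

section \<open>Square-summable sequences and amplified operators\<close>

typedef (overloaded) 'a l2seq = "{f :: nat \<Rightarrow> 'a::real_normed_vector. summable (\<lambda>n. (norm (f n))\<^sup>2)}"
  morphisms coord l2mk
  by (rule exI[of _ "\<lambda>_. 0"]) simp

setup_lifting type_definition_l2seq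

lemma summable_coord: "summable (\<lambda>n. (norm (coord x n))\<^sup>2)"
  using coord[of x] by simp

lemma sq_add_le: "(norm (x + y :: 'a::real_normed_vector))\<^sup>2 \<le> 2 * (norm x)\<^sup>2 + 2 * (norm y)\<^sup>2"
proof -
  have "(norm (x + y))\<^sup>2 \<le> (norm x + norm y)\<^sup>2" by (intro power_mono norm_triangle_ineq) simp
  moreover have "0 \<le> (norm x - norm y)\<^sup>2" by simp
  ultimately show ?thesis by (simp add: power2_eq_square algebra_simps)
qed

lemma summable_sq_add:
  fixes f g :: "nat \<Rightarrow> 'a::real_normed_vector"
  assumes "summable (\<lambda>n. (norm (f n))\<^sup>2)" "summable (\<lambda>n. (norm (g n))\<^sup>2)"
  shows "summable (\<lambda>n. (norm (f n + g n))\<^sup>2)"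
  by (rule summable_comparison_test[of _ "\<lambda>n. 2 * (norm (f n))\<^sup>2 + 2 * (norm (g n))\<^sup>2"])
     (auto intro!: summable_add summable_mult assms sq_add_le)

lemma summable_sq_bounded:
  fixes f :: "nat \<Rightarrow> 'a::real_normed_vector" and g :: "nat \<Rightarrow> 'b::real_normed_vector"
  assumes "summable (\<lambda>n. (norm (f n))\<^sup>2)" "\<And>n. norm (g n) \<le> K * norm (f n)"
  shows "summable (\<lambda>n. (norm (g n))\<^sup>2)"
proof (rule summable_comparison_test[of _ "\<lambda>n. K\<^sup>2 * (norm (f n))\<^sup>2"])
  show "\<exists>N. \<forall>n\<ge>N. norm ((norm (g n))\<^sup>2) \<le> K\<^sup>2 * (norm (f n))\<^sup>2"
    using power_mono[OF assms(2), of _ 2] by (auto simp: power_mult_distrib)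
qed (intro summable_mult assms)

instantiation l2seq :: (real_normed_vector) real_normed_vector
begin
lift_definition zero_l2seq :: "'a l2seq" is "\<lambda>_. 0" by simp
lift_definition plus_l2seq :: "'a l2seq \<Rightarrow> 'a l2seq \<Rightarrow> 'a l2seq" is "\<lambda>f g n. f n + g n"
  by (rule summable_sq_add)
lift_definition uminus_l2seq :: "'a l2seq \<Rightarrow> 'a l2seq" is "\<lambda>f n. - f n" by simp
lift_definition minus_l2seq :: "'a l2seq \<Rightarrow> 'a l2seq \<Rightarrow> 'a l2seq" is "\<lambda>f g n. f n - g n"
  using summable_sq_add[of _ "\<lambda>n. - f n" for f] by fastforce
lift_definition scaleR_l2seq :: "real \<Rightarrow> 'a l2seq \<Rightarrow> 'a l2seq" is "\<lambda>r f n. r *\<^sub>R f n"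
  by (erule summable_sq_bounded, unfold norm_scaleR, rule order_refl)
definition norm_l2seq :: "'a l2seq \<Rightarrow> real" where "norm x = sqrt (\<Sum>n. (norm (coord x n))\<^sup>2)"
definition sgn_l2seq :: "'a l2seq \<Rightarrow> 'a l2seq"
  where "sgn (x :: 'a l2seq) = scaleR (inverse (norm x)) x"
definition dist_l2seq :: "'a l2seq \<Rightarrow> 'a l2seq \<Rightarrow> real"
  where "dist (x :: 'a l2seq) y = norm (x - y)"
definition uniformity_l2seq :: "('a l2seq \<times> 'a l2seq) filter"
  where "uniformity_l2seq = (INF e\<in>{0<..}. principal {(x, y). dist x y < e})"
definition open_l2seq :: "'a l2seq set \<Rightarrow> bool"
  where "open_l2seq U = (\<forall>x\<in>U. eventually (\<lambda>(x', y). x' = x \<longrightarrow> y \<in> U) uniformity)"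
instance
proof
  show "dist x y = norm (x - y)" for x y :: "'a l2seq" by (rule dist_l2seq_def)
  show "sgn x = inverse (norm x) *\<^sub>R x" for x :: "'a l2seq" by (rule sgn_l2seq_def)
  show "(uniformity :: ('a l2seq \<times> 'a l2seq) filter) = (INF e\<in>{0<..}. principal {(x, y). dist x y < e})"
    by (rule uniformity_l2seq_def)
  show "open U = (\<forall>x\<in>U. \<forall>\<^sub>F (x', y) in uniformity. x' = x \<longrightarrow> y \<in> U)" for U :: "'a l2seq set"
    by (rule open_l2seq_def)
  show "(norm x = 0) = (x = 0)" for x :: "'a l2seq"
  proof -
    have "(\<Sum>n. (norm (coord x n))\<^sup>2) = 0 \<longleftrightarrow> (\<forall>n. (norm (coord x n))\<^sup>2 = 0)"
      by (rule suminf_eq_zero_iff[OF summable_coord]) simp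
    then show ?thesis
      by (auto simp: norm_l2seq_def zero_l2seq.rep_eq simp flip: coord_inject)
  qed
  show "norm (a *\<^sub>R x) = \<bar>a\<bar> * norm x" for a and x :: "'a l2seq"
    by (simp add: norm_l2seq_def scaleR_l2seq.rep_eq power_mult_distrib suminf_mult[OF summable_coord]
        real_sqrt_mult)
  show "norm (x + y) \<le> norm x + norm y" for x y :: "'a l2seq"
  proof -
    have "(\<Sum>n. (norm (coord (x + y) n))\<^sup>2) \<le> (norm x + norm y)\<^sup>2"
    proof (rule suminf_le_const[OF summable_coord])
      fix N
      have le: "L2_set (\<lambda>n. norm (coord z n)) {..<N} \<le> norm z" for z :: "'a l2seq"
        unfolding L2_set_def norm_l2seq_def
        by (intro real_sqrt_le_mono sum_le_suminf summable_coord) auto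
      have "L2_set (\<lambda>n. norm (coord (x + y) n)) {..<N} \<le> L2_set (\<lambda>n. norm (coord x n) + norm (coord y n)) {..<N}"
        by (rule L2_set_mono) (auto simp: plus_l2seq.rep_eq norm_triangle_ineq)
      also have "\<dots> \<le> norm x + norm y"
        using L2_set_triangle_ineq[of "\<lambda>n. norm (coord x n)" "\<lambda>n. norm (coord y n)" "{..<N}"] le[of x] le[of y]
        by linarith
      finally have "(L2_set (\<lambda>n. norm (coord (x + y) n)) {..<N})\<^sup>2 \<le> (norm x + norm y)\<^sup>2"
        by (intro power_mono) (auto simp: L2_set_nonneg)
      then show "(\<Sum>n<N. (norm (coord (x + y) n))\<^sup>2) \<le> (norm x + norm y)\<^sup>2"
        by (simp add: L2_set_def sum_nonneg)
    qed
    moreover have "0 \<le> norm z" for z :: "'a l2seq"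
      unfolding norm_l2seq_def by (simp add: suminf_nonneg summable_coord)
    ultimately show ?thesis unfolding norm_l2seq_def[of "x + y"]
      by (intro real_le_lsqrt) (auto simp: suminf_nonneg summable_coord)
  qed
qed (transfer; simp add: algebra_simps fun_eq_iff)+
end

lemmas coord_simps [simp] = zero_l2seq.rep_eq plus_l2seq.rep_eq uminus_l2seq.rep_eq
  minus_l2seq.rep_eq scaleR_l2seq.rep_eq

lemma l2seq_eqI: "(\<And>n. coord x n = coord y n) \<Longrightarrow> x = y"
  by (metis coord_inject ext)

lemma norm_l2seq_sq: "(norm (x::'a::real_normed_vector l2seq))\<^sup>2 = (\<Sum>n. (norm (coord x n))\<^sup>2)"
  by (simp add: norm_l2seq_def suminf_nonneg summable_coord)

lemma norm_coord_le: "norm (coord x n) \<le> norm (x::'a::real_normed_vector l2seq)"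
proof -
  have "(\<Sum>i\<in>{n}. (norm (coord x i))\<^sup>2) \<le> (norm x)\<^sup>2"
    unfolding norm_l2seq_sq by (rule sum_le_suminf[OF summable_coord]) auto
  then show ?thesis by simp
qed

lemma coord_l2mk: "summable (\<lambda>n. (norm (f n))\<^sup>2) \<Longrightarrow> coord (l2mk f) = f"
  by (simp add: l2mk_inverse)

lemma summable_cinner:
  fixes f g :: "nat \<Rightarrow> 'a::chilbert_space"
  assumes "summable (\<lambda>n. (norm (f n))\<^sup>2)" "summable (\<lambda>n. (norm (g n))\<^sup>2)"
  shows "summable (\<lambda>n. cinner (f n) (g n))"
proof (rule summable_comparison_test[of _ "\<lambda>n. (norm (f n))\<^sup>2 + (norm (g n))\<^sup>2"])
  have "norm (cinner (f n) (g n)) \<le> (norm (f n))\<^sup>2 + (norm (g n))\<^sup>2" for n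
  proof -
    have "norm (cinner (f n) (g n)) \<le> norm (f n) * norm (g n)" by (rule cinner_cauchy_schwarz)
    moreover have "0 \<le> (norm (f n) - norm (g n))\<^sup>2" by simp
    moreover have "0 \<le> norm (f n) * norm (g n)" by simp
    ultimately show ?thesis unfolding power2_diff by linarith
  qed
  then show "\<exists>N. \<forall>n\<ge>N. norm (cinner (f n) (g n)) \<le> (norm (f n))\<^sup>2 + (norm (g n))\<^sup>2" by blast
qed (intro summable_add assms)

instantiation l2seq :: (chilbert_space) chilbert_space
begin
lift_definition scaleC_l2seq :: "complex \<Rightarrow> 'a l2seq \<Rightarrow> 'a l2seq" is "\<lambda>c f n. c *\<^sub>C f n"
  by (erule summable_sq_bounded, unfold norm_scaleC, rule order_refl)
definition cinner_l2seq :: "'a l2seq \<Rightarrow> 'a l2seq \<Rightarrow> complex"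
  where "cinner x y = (\<Sum>n. cinner (coord x n) (coord y n))"
instance
proof
  note sc = summable_cinner[OF summable_coord summable_coord]
  fix x y z :: "'a l2seq" and a b :: complex and r :: real
  show "a *\<^sub>C (x + y) = a *\<^sub>C x + a *\<^sub>C y" "(a + b) *\<^sub>C x = a *\<^sub>C x + b *\<^sub>C x"
    "a *\<^sub>C b *\<^sub>C x = (a * b) *\<^sub>C x" "r *\<^sub>R x = complex_of_real r *\<^sub>C x"
    by (auto intro!: l2seq_eqI simp: scaleC_l2seq.rep_eq scaleC_add_right scaleC_add_left scaleC_scaleC scaleR_scaleC)
  show "cinner x y = cnj (cinner y x)"
  proof -
    have "(\<lambda>n. cnj (cinner (coord y n) (coord x n))) sums cnj (cinner y x)"
      unfolding cinner_l2seq_def sums_cnj by (rule summable_sums[OF sc])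
    moreover have "(\<lambda>n. cnj (cinner (coord y n) (coord x n))) = (\<lambda>n. cinner (coord x n) (coord y n))"
      by (rule ext) (rule cinner_commute[symmetric])
    ultimately show ?thesis unfolding cinner_l2seq_def[of x y] using sums_unique by metis
  qed
  show "cinner x (y + z) = cinner x y + cinner x z"
    by (simp add: cinner_l2seq_def cinner_add_right suminf_add[OF sc sc])
  show "cinner x (a *\<^sub>C y) = a * cinner x y"
    by (simp add: cinner_l2seq_def scaleC_l2seq.rep_eq cinner_scaleC_right suminf_mult[OF sc])
  show "norm x = sqrt (Re (cinner x x))"
  proof -
    have "cinner x x = of_real (\<Sum>n. (norm (coord x n))\<^sup>2)"
      unfolding cinner_l2seq_def cinner_self by (rule suminf_of_real[symmetric]) (rule summable_coord)
    then show ?thesis by (simp add: norm_l2seq_def)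
  qed
next
  fix X :: "nat \<Rightarrow> 'a l2seq"
  assume X: "Cauchy X"
  have "Cauchy (\<lambda>k. coord (X k) n)" for n
  proof (rule metric_CauchyI)
    fix e :: real assume "e > 0"
    then obtain N where N: "\<And>k m. k \<ge> N \<Longrightarrow> m \<ge> N \<Longrightarrow> dist (X k) (X m) < e"
      using X unfolding Cauchy_def by meson
    show "\<exists>M. \<forall>m\<ge>M. \<forall>k\<ge>M. dist (coord (X m) n) (coord (X k) n) < e"
    proof (intro exI[of _ N] allI impI)
      fix m k assume "N \<le> m" "N \<le> k"
      then show "dist (coord (X m) n) (coord (X k) n) < e"
        using N[of m k] norm_coord_le[of "X m - X k" n] by (simp add: dist_norm)
    qed
  qed
  then have "\<forall>n. \<exists>l. (\<lambda>k. coord (X k) n) \<longlonglongrightarrow> l" using Cauchy_convergent convergent_def by blast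
  then obtain l where l: "\<And>n. (\<lambda>k. coord (X k) n) \<longlonglongrightarrow> l n" by metis
  \<comment> \<open>Finite partial sums of the distance to the coordinatewise limit inherit the
    Cauchy bound by letting \<open>m\<close> tend to infinity; only afterwards is the bound carried
    to the full series.\<close>
  have part: "(\<Sum>n<N. (norm (coord (X k) n - l n))\<^sup>2) \<le> e\<^sup>2"
    if "\<And>m. m \<ge> k \<Longrightarrow> norm (X k - X m) \<le> e" for k e N
  proof (rule LIMSEQ_le_const2)
    show "(\<lambda>m. \<Sum>n<N. (norm (coord (X k) n - coord (X m) n))\<^sup>2) \<longlonglongrightarrow> (\<Sum>n<N. (norm (coord (X k) n - l n))\<^sup>2)"
      by (intro tendsto_intros l)
    show "\<exists>M. \<forall>m\<ge>M. (\<Sum>n<N. (norm (coord (X k) n - coord (X m) n))\<^sup>2) \<le> e\<^sup>2"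
    proof (intro exI[of _ k] allI impI)
      fix m assume "k \<le> m"
      have "(\<Sum>n<N. (norm (coord (X k - X m) n))\<^sup>2) \<le> (norm (X k - X m))\<^sup>2"
        unfolding norm_l2seq_sq by (rule sum_le_suminf[OF summable_coord]) auto
      also have "\<dots> \<le> e\<^sup>2" using that[OF \<open>k \<le> m\<close>] by (intro power_mono) auto
      finally show "(\<Sum>n<N. (norm (coord (X k) n - coord (X m) n))\<^sup>2) \<le> e\<^sup>2" by simp
    qed
  qed
  have sd: "summable (\<lambda>n. (norm (coord (X k) n - l n))\<^sup>2)"
    if "\<And>m. m \<ge> k \<Longrightarrow> norm (X k - X m) \<le> e" for k e
  proof (rule bounded_imp_summable[of _ "e\<^sup>2"])
    show "(\<Sum>n\<le>N. (norm (coord (X k) n - l n))\<^sup>2) \<le> e\<^sup>2" for N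
      using part[OF that, of "Suc N"] by (simp add: lessThan_Suc_atMost)
  qed simp
  obtain K where K: "\<And>m. m \<ge> K \<Longrightarrow> norm (X K - X m) \<le> 1"
    using X[unfolded Cauchy_def, rule_format, of 1] by (force simp: dist_norm)
  have sl: "summable (\<lambda>n. (norm (l n))\<^sup>2)"
    using summable_sq_add[OF summable_coord[of "X K"], of "\<lambda>n. - (coord (X K) n - l n)"] sd[OF K]
    by (simp add: norm_minus_commute)
  have "X \<longlonglongrightarrow> l2mk l"
  proof (rule metric_LIMSEQ_I)
    fix e :: real assume e: "e > 0"
    then obtain N where N: "\<And>k m. k \<ge> N \<Longrightarrow> m \<ge> N \<Longrightarrow> dist (X k) (X m) < e / 2"
      using X[unfolded Cauchy_def, rule_format, of "e/2"] by auto
    show "\<exists>no. \<forall>n\<ge>no. dist (X n) (l2mk l) < e"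
    proof (intro exI[of _ N] allI impI)
      fix k assume k: "k \<ge> N"
      have h: "norm (X k - X m) \<le> e / 2" if "m \<ge> k" for m
        using N[of k m] k that by (simp add: dist_norm)
      have "(norm (X k - l2mk l))\<^sup>2 \<le> (e/2)\<^sup>2"
        unfolding norm_l2seq_sq by (rule suminf_le_const[OF summable_coord])
          (simp add: coord_l2mk[OF sl], rule part[OF h])
      then have "norm (X k - l2mk l) \<le> e/2" by (rule power2_le_imp_le) (use e in simp)
      then show "dist (X k) (l2mk l) < e" using e by (simp add: dist_norm)
    qed
  qed
  then show "convergent X" by (auto simp: convergent_def)
qed
end

lemma coord_scaleC [simp]: "coord (c *\<^sub>C x) n = c *\<^sub>C coord x n"
  by (simp add: scaleC_l2seq.rep_eq)

lemma cinner_l2seq_sums: "(\<lambda>n. cinner (coord x n) (coord y n)) sums cinner x (y::'a::chilbert_space l2seq)"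
  unfolding cinner_l2seq_def by (rule summable_sums[OF summable_cinner[OF summable_coord summable_coord]])

text \<open>This is \<open>1 \<otimes> T\<close> on the tensor product of the scalar square-summable
  sequences with the given space. Vector functionals of \<open>amp T\<close> are exactly the
  generating functionals of \<open>sigma_weak\<close>.\<close>

definition amp :: "'a::chilbert_space bop \<Rightarrow> 'a l2seq bop" where
  "amp T = Blinfun (\<lambda>x. l2mk (\<lambda>n. T (coord x n)))"

lemma coord_amp [simp]: "coord (amp T x) n = T (coord x n)"
proof -
  have s: "summable (\<lambda>n. (norm (T (coord x n)))\<^sup>2)" for x
    by (rule summable_sq_bounded[OF summable_coord norm_blinfun])
  define g where "g x = l2mk (\<lambda>n. T (coord x n))" for x
  have c: "coord (g x) n = T (coord x n)" for x n
    by (simp add: g_def coord_l2mk[OF s])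
  have "bounded_linear g"
  proof (rule bounded_linear_intro[of _ "norm T"])
    show "norm (g x) \<le> norm x * norm T" for x
    proof -
      have "(norm (g x))\<^sup>2 \<le> (\<Sum>n. (norm T)\<^sup>2 * (norm (coord x n))\<^sup>2)"
        unfolding norm_l2seq_sq c
      proof (rule suminf_le[OF _ s summable_mult[OF summable_coord]])
        show "(norm (T (coord x n)))\<^sup>2 \<le> (norm T)\<^sup>2 * (norm (coord x n))\<^sup>2" for n
          using power_mono[OF norm_blinfun[of T "coord x n"] norm_ge_zero, of 2] by (simp add: power_mult_distrib)
      qed
      also have "\<dots> = (norm x * norm T)\<^sup>2"
        unfolding suminf_mult[OF summable_coord] norm_l2seq_sq[symmetric] power_mult_distrib
        by (rule mult.commute)
      finally show ?thesis by (rule power2_le_imp_le) simp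
    qed
  qed (auto intro!: l2seq_eqI simp: c blinfun.bilinear_simps)
  then show ?thesis unfolding amp_def g_def[symmetric] by (simp add: bounded_linear_Blinfun_apply c)
qed

lemma amp_comp: "amp (S \<odot> T) = amp S \<odot> amp T" and amp_id [simp]: "amp \<I> = \<I>"
  and amp_add: "amp (S + T) = amp S + amp T" and amp_diff: "amp (S - T) = amp S - amp T"
  and amp_scale_op: "amp (scale_op c T) = scale_op c (amp T)"
  and amp_0 [simp]: "amp 0 = 0"
  by (auto intro!: blinfun_eqI l2seq_eqI simp: blinfun.bilinear_simps)

lemma amp_bops [simp]: "T \<in> bops \<Longrightarrow> amp T \<in> bops"
  by (rule bopsI) (auto intro!: l2seq_eqI simp: bops_app)

lemma amp_adj: "T \<in> bops \<Longrightarrow> amp (adj T) = adj (amp T)"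
  by (rule adj_unique[symmetric]) (auto simp: cinner_l2seq_def cinner_adj)

definition l2coord :: "nat \<Rightarrow> 'a::chilbert_space l2seq \<Rightarrow>\<^sub>L 'a" where
  "l2coord n = Blinfun (\<lambda>x. coord x n)"

lemma l2coord [simp]: "l2coord n x = coord x n"
  unfolding l2coord_def
  by (rule fun_cong[OF bounded_linear_Blinfun_apply])
     (rule bounded_linear_intro[of _ 1], auto simp: norm_coord_le)

definition l2emb :: "nat \<Rightarrow> 'a::chilbert_space \<Rightarrow>\<^sub>L 'a l2seq" where
  "l2emb n = Blinfun (\<lambda>x. l2mk (\<lambda>k. if k = n then x else 0))"

lemma suminf_delta: "(\<Sum>k. if k = n then f k else 0) = (f n :: 'b::{comm_monoid_add,t2_space})"
  using sums_unique[OF sums_single[of n f]] by simp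

lemma coord_l2emb [simp]: "coord (l2emb n x) k = (if k = n then x else 0)"
proof -
  have e: "(\<lambda>k. (norm (if k = n then x else 0))\<^sup>2) = (\<lambda>k. if k = n then (norm x)\<^sup>2 else 0)" for x :: 'a
    by auto
  have s: "summable (\<lambda>k. (norm (if k = n then x else 0))\<^sup>2)" for x :: 'a
    unfolding e using sums_single[of n "\<lambda>_. (norm x)\<^sup>2"] sums_summable by blast
  note c = coord_l2mk[OF s]
  have "bounded_linear (\<lambda>x::'a. l2mk (\<lambda>k. if k = n then x else 0))"
  proof (rule bounded_linear_intro[of _ 1])
    fix x :: 'a
    have "(norm (l2mk (\<lambda>k. if k = n then x else 0)))\<^sup>2 = (norm x)\<^sup>2"
      unfolding norm_l2seq_sq c e by (rule suminf_delta)
    then show "norm (l2mk (\<lambda>k. if k = n then x else 0)) \<le> norm x * 1" by simp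
  qed (auto intro!: l2seq_eqI simp: c)
  then show ?thesis unfolding l2emb_def by (simp add: bounded_linear_Blinfun_apply c)
qed

lemma cinner_l2emb: "cinner (l2emb n x) y = cinner x (coord y n)"
proof -
  have "cinner (l2emb n x) y = (\<Sum>k. if k = n then cinner x (coord y k) else 0)"
    unfolding cinner_l2seq_def by (intro suminf_cong) auto
  then show ?thesis by (simp add: suminf_delta)
qed

lemma norm_l2emb [simp]: "norm (l2emb n x) = norm (x::'a::chilbert_space)"
proof -
  have "(norm (l2emb n x))\<^sup>2 = (norm x)\<^sup>2"
    using cinner_l2emb[of n x "l2emb n x"] by (simp add: cinner_self flip: of_real_power)
  then show ?thesis by simp
qed

lemma l2emb_scaleC: "l2emb n (c *\<^sub>C x) = c *\<^sub>C (l2emb n) x"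
  by (rule l2seq_eqI) simp

lemma amp_l2emb: "amp T (l2emb n x) = l2emb n (T x)"
  by (rule l2seq_eqI) (simp add: blinfun.bilinear_simps)

lemma l2seq_blinfun_eqI:
  fixes A B :: "'a::chilbert_space l2seq \<Rightarrow>\<^sub>L 'b::real_normed_vector"
  assumes "\<And>n x. A (l2emb n x) = B (l2emb n x)"
  shows "A = B"
proof (rule blinfun_eq_onI[of "\<lambda>(n, x). (l2emb n) x"])
  show "\<exists>j. (case j of (n, x) \<Rightarrow> (l2emb n) x) = c *\<^sub>C (case i of (n, x) \<Rightarrow> (l2emb n) x)"
    for c and i :: "nat \<times> 'a"
    by (cases i, simp) (metis l2emb_scaleC)
  fix y :: "'a l2seq" assume "perp_to (\<lambda>(n, x). (l2emb n) x) y"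
  then have h: "cinner x (coord y n) = 0" for n x by (auto simp: perp_to_def cinner_l2emb)
  have "coord y n = 0" for n using h[of "coord y n" n] by (simp add: cinner_self)
  then have "y = 0" by (intro l2seq_eqI) simp
  then show "A y = B y" by simp
qed (use assms in auto)

section \<open>The sigma-weak topology\<close>

text \<open>Concatenates countably many sequences along the pairing of indices, so that a
  square-summable family of vectors of the amplified space becomes a single vector of that same
  space.\<close>

definition l2join :: "(nat \<Rightarrow> 'a::chilbert_space l2seq) \<Rightarrow> 'a l2seq" where
  "l2join \<zeta> = l2mk (\<lambda>m. coord (\<zeta> (fst (prod_decode m))) (snd (prod_decode m)))"

lemma l2join_summable_on:
  assumes "summable (\<lambda>k. (norm (\<zeta> k))\<^sup>2)"
  shows "(\<lambda>(k, n). (norm (coord (\<zeta> k) n))\<^sup>2) summable_on (UNIV \<times> UNIV)"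
proof (rule summable_on_SigmaI[where g = "\<lambda>k. (norm (\<zeta> k))\<^sup>2"])
  fix k
  have "(\<lambda>n. (norm (coord (\<zeta> k) n))\<^sup>2) sums (norm (\<zeta> k))\<^sup>2"
    unfolding norm_l2seq_sq by (rule summable_sums[OF summable_coord])
  then show "((\<lambda>n. case (k, n) of (k, n) \<Rightarrow> (norm (coord (\<zeta> k) n))\<^sup>2) has_sum (norm (\<zeta> k))\<^sup>2) UNIV"
    by (simp add: sums_nonneg_imp_has_sum)
next
  show "(\<lambda>k. (norm (\<zeta> k))\<^sup>2) summable_on UNIV"
    using assms by (rule summable_nonneg_imp_summable_on) simp
qed auto

lemma coord_l2join:
  assumes "summable (\<lambda>k. (norm (\<zeta> k))\<^sup>2)"
  shows "coord (l2join \<zeta>) m = coord (\<zeta> (fst (prod_decode m))) (snd (prod_decode m))"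
proof -
  have "(\<lambda>m. case prod_decode m of (k, n) \<Rightarrow> (norm (coord (\<zeta> k) n))\<^sup>2) summable_on UNIV"
    using l2join_summable_on[OF assms] summable_on_reindex_bij_betw[OF bij_prod_decode,
        of "\<lambda>(k, n). (norm (coord (\<zeta> k) n))\<^sup>2"] by simp
  then have "summable (\<lambda>m. (norm (coord (\<zeta> (fst (prod_decode m))) (snd (prod_decode m))))\<^sup>2)"
    using summable_on_imp_summable by (force simp: case_prod_beta)
  then show ?thesis unfolding l2join_def by (simp add: coord_l2mk)
qed

text \<open>Both sides are the sum of one double family, which is absolutely summable since a
  product is at most the sum of the two squares: once summed row by row, once along
  \<open>prod_decode\<close>.\<close>

lemma cinner_l2join:
  assumes s: "summable (\<lambda>k. (norm (\<zeta> k))\<^sup>2)" and s': "summable (\<lambda>k. (norm (\<zeta>' k))\<^sup>2)"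
  shows "(\<lambda>k. cinner (\<zeta> k) (\<zeta>' k)) sums cinner (l2join \<zeta>) (l2join \<zeta>')"
proof -
  define f where "f = (\<lambda>(k, n). cinner (coord (\<zeta> k) n) (coord (\<zeta>' k) n))"
  have cs: "norm (f p) \<le> norm ((case p of (k, n) \<Rightarrow> (norm (coord (\<zeta> k) n))\<^sup>2) + (case p of (k, n) \<Rightarrow> (norm (coord (\<zeta>' k) n))\<^sup>2))" for p
  proof -
    obtain k n where p: "p = (k, n)" by (cases p)
    let ?a = "norm (coord (\<zeta> k) n)" and ?b = "norm (coord (\<zeta>' k) n)"
    have "norm (f p) \<le> ?a * ?b" unfolding p f_def by (simp add: cinner_cauchy_schwarz)
    moreover have "0 \<le> (?a - ?b)\<^sup>2" "0 \<le> ?a * ?b" by simp_all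
    ultimately have "norm (f p) \<le> ?a\<^sup>2 + ?b\<^sup>2" unfolding power2_diff by linarith
    then show ?thesis by (simp add: p)
  qed
  have "(\<lambda>p. norm (f p)) summable_on UNIV \<times> UNIV"
  proof (rule Infinite_Sum.abs_summable_on_comparison_test[OF _ cs])
    have "(\<lambda>p. (case p of (k, n) \<Rightarrow> (norm (coord (\<zeta> k) n))\<^sup>2) + (case p of (k, n) \<Rightarrow> (norm (coord (\<zeta>' k) n))\<^sup>2))
        summable_on UNIV \<times> UNIV"
      by (intro summable_on_add l2join_summable_on s s')
    then show "(\<lambda>p. norm ((case p of (k, n) \<Rightarrow> (norm (coord (\<zeta> k) n))\<^sup>2) + (case p of (k, n) \<Rightarrow> (norm (coord (\<zeta>' k) n))\<^sup>2)))
        summable_on UNIV \<times> UNIV"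
      by (rule summable_on_cong[THEN iffD1, rotated]) (auto split: prod.split)
  qed
  then have fs: "f summable_on UNIV \<times> UNIV" by (rule Infinite_Sum.abs_summable_summable)
  then obtain S where S: "(f has_sum S) (UNIV \<times> UNIV)" by (auto simp: summable_on_def)
  have "((\<lambda>k. cinner (\<zeta> k) (\<zeta>' k)) has_sum S) UNIV"
  proof (rule has_sum_SigmaD[OF S])
    fix k
    have "(\<lambda>(k, n). f (k, n)) summable_on UNIV \<times> UNIV" using fs by simp
    then have "(\<lambda>n. f (k, n)) summable_on UNIV" by (rule summable_on_SigmaD1) simp
    then obtain c where c: "((\<lambda>n. f (k, n)) has_sum c) UNIV" by (auto simp: summable_on_def)
    then have "(\<lambda>n. f (k, n)) sums c" by (rule has_sum_imp_sums)
    moreover have "(\<lambda>n. f (k, n)) sums cinner (\<zeta> k) (\<zeta>' k)"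
      unfolding f_def using cinner_l2seq_sums by simp
    ultimately have "c = cinner (\<zeta> k) (\<zeta>' k)" by (rule sums_unique2)
    with c show "((\<lambda>n. f (k, n)) has_sum cinner (\<zeta> k) (\<zeta>' k)) UNIV" by simp
  qed
  then have 1: "(\<lambda>k. cinner (\<zeta> k) (\<zeta>' k)) sums S" by (rule has_sum_imp_sums)
  have "((\<lambda>m. f (prod_decode m)) has_sum S) UNIV"
    using S has_sum_reindex_bij_betw[OF bij_prod_decode, of f S] by simp
  then have "(\<lambda>m. f (prod_decode m)) sums S" by (rule has_sum_imp_sums)
  moreover have "(\<lambda>m. f (prod_decode m)) sums cinner (l2join \<zeta>) (l2join \<zeta>')"
    unfolding f_def using cinner_l2seq_sums[of "l2join \<zeta>" "l2join \<zeta>'"]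
    by (simp add: coord_l2join s s' case_prod_beta)
  ultimately have "S = cinner (l2join \<zeta>) (l2join \<zeta>')" by (rule sums_unique2)
  with 1 show ?thesis by simp
qed

lemma amp_l2join:
  assumes s: "summable (\<lambda>k. (norm (\<zeta> k))\<^sup>2)"
  shows "amp T (l2join \<zeta>) = l2join (\<lambda>k. (amp T) (\<zeta> k))"
    and "summable (\<lambda>k. (norm (amp T (\<zeta> k)))\<^sup>2)"
proof -
  show s': "summable (\<lambda>k. (norm (amp T (\<zeta> k)))\<^sup>2)"
    by (rule summable_sq_bounded[OF s norm_blinfun])
  show "amp T (l2join \<zeta>) = l2join (\<lambda>k. (amp T) (\<zeta> k))"
    by (rule l2seq_eqI) (simp add: coord_l2join s s')
qed

lemma norm_amp_l2join:
  assumes s: "summable (\<lambda>k. (norm (\<zeta> k))\<^sup>2)"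
  shows "(\<lambda>k. (norm (amp T (\<zeta> k)))\<^sup>2) sums (norm (amp T (l2join \<zeta>)))\<^sup>2"
proof -
  have "(\<lambda>k. complex_of_real ((norm (amp T (\<zeta> k)))\<^sup>2)) sums
      of_real ((norm (amp T (l2join \<zeta>)))\<^sup>2)"
    using cinner_l2join[OF amp_l2join(2)[OF s] amp_l2join(2)[OF s], of T T]
    unfolding amp_l2join(1)[OF s] cinner_self .
  then show ?thesis by (simp only: sums_of_real_iff)
qed

text \<open>Joins two vectors into one, so that the seminorms \<open>norm (amp T \<eta>)\<close> are
  directed: smallness at one vector controls two.\<close>

lemma l2_pair_exists:
  fixes \<eta>1 \<eta>2 :: "'a::chilbert_space l2seq"
  obtains \<eta> where "\<And>T :: 'a bop. (norm (amp T \<eta>))\<^sup>2 =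
    (norm (amp T \<eta>1))\<^sup>2 + (norm (amp T \<eta>2))\<^sup>2"
proof -
  define \<zeta> where "\<zeta> k = (if k = 0 then \<eta>1 else if k = 1 then \<eta>2 else 0)" for k :: nat
  have f: "(\<lambda>k. (norm (amp T (\<zeta> k)))\<^sup>2) sums
      ((norm (amp T \<eta>1))\<^sup>2 + (norm (amp T \<eta>2))\<^sup>2)" for T :: "'a bop"
  proof -
    have "(\<lambda>k. (norm (amp T (\<zeta> k)))\<^sup>2) sums (\<Sum>k\<in>{0,1}. (norm (amp T (\<zeta> k)))\<^sup>2)"
      by (rule sums_finite) (auto simp: \<zeta>_def)
    then show ?thesis by (simp add: \<zeta>_def)
  qed
  have "summable (\<lambda>k. (norm (\<zeta> k))\<^sup>2)" using sums_summable[OF f[of \<I>]] by simp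
  from norm_amp_l2join[OF this] f show thesis
    by (intro that[of "l2join \<zeta>"]) (rule sums_unique2)
qed

text \<open>Replaces the series in the definition by a single inner product on the amplified space,
  so that continuity can be tested on vector functionals.\<close>

lemma sigma_weak_amp:
  "(sigma_weak :: 'a::chilbert_space bop topology) =
   topology_generated_by {{T. cinner \<xi> (blinfun_apply (amp T) \<eta>) \<in> U} | \<xi> \<eta> U. open U}"
proof -
  have 1: "{T :: 'a bop. (\<Sum>n. cinner (\<xi> n) (blinfun_apply T (\<eta> n))) \<in> U} =
      {T. cinner (l2mk \<xi>) (blinfun_apply (amp T) (l2mk \<eta>)) \<in> U}"
    if "summable (\<lambda>n. (norm (\<xi> n))\<^sup>2)" "summable (\<lambda>n. (norm (\<eta> n))\<^sup>2)" for \<xi> \<eta> U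
    using that by (simp add: cinner_l2seq_def coord_l2mk)
  have 2: "{T :: 'a bop. cinner \<xi> (blinfun_apply (amp T) \<eta>) \<in> U} =
      {T. (\<Sum>n. cinner (coord \<xi> n) (blinfun_apply T (coord \<eta> n))) \<in> U}" for \<xi> \<eta> U
    by (simp add: cinner_l2seq_def)
  have "{{T :: 'a bop. (\<Sum>n. cinner (\<xi> n) (blinfun_apply T (\<eta> n))) \<in> U} | \<xi> \<eta> U.
        summable (\<lambda>n. (norm (\<xi> n))\<^sup>2) \<and> summable (\<lambda>n. (norm (\<eta> n))\<^sup>2) \<and> open U} =
      {{T. cinner \<xi> (blinfun_apply (amp T) \<eta>) \<in> U} | \<xi> \<eta> U. open U}" (is "?A = ?B")
  proof (intro equalityI subsetI)
    fix X assume "X \<in> ?A"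
    then show "X \<in> ?B" using 1 by blast
  next
    fix X assume "X \<in> ?B"
    then show "X \<in> ?A" using 2 summable_coord by blast
  qed
  then show ?thesis unfolding sigma_weak_def by simp
qed

lemma topspace_sigma_weak [simp]: "topspace sigma_weak = UNIV"
  unfolding sigma_weak_amp topology_generated_by_topspace by (auto intro!: exI[of _ UNIV])

lemma continuous_map_vector_functional:
  "continuous_map sigma_weak euclidean (\<lambda>T. cinner \<xi> (amp T \<eta>))"
  unfolding continuous_map_def
  by (auto simp: Pi_iff) (auto simp: sigma_weak_amp intro!: topology_generated_by_Basis)

lemma continuous_map_into_sigma_weak:
  fixes f :: "'x \<Rightarrow> 'a::chilbert_space bop"
  assumes "\<And>\<xi> \<eta>. continuous_map X euclidean (\<lambda>x. cinner \<xi> (amp (f x) \<eta>))"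
  shows "continuous_map X sigma_weak f"
  unfolding sigma_weak_amp
proof (rule continuous_on_generated_topo)
  fix U assume "U \<in> {{T :: 'a bop. cinner \<xi> (amp T \<eta>) \<in> U} | \<xi> \<eta> U. open U}"
  then obtain \<xi> \<eta> V where U: "U = {T. cinner \<xi> (amp T \<eta>) \<in> V}" "open V" by blast
  have "openin X {x \<in> topspace X. cinner \<xi> (amp (f x) \<eta>) \<in> V}"
    using assms[of \<xi> \<eta>] U(2) by (auto simp: continuous_map_def)
  moreover have "f -` U \<inter> topspace X = {x \<in> topspace X. cinner \<xi> (amp (f x) \<eta>) \<in> V}"
    by (auto simp: U)
  ultimately show "openin X (f -` U \<inter> topspace X)" by simp
qed (auto intro!: exI[of _ UNIV])

text \<open>The sets supplied are sigma-strong neighbourhoods: approximation in one seminorm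
  \<open>norm (amp T \<eta>)\<close> already implies sigma-weak approximation. Finite intersections
  are absorbed by \<open>l2_pair_exists\<close>.\<close>

lemma sigma_weak_nbhd:
  fixes x :: "'a::chilbert_space bop"
  assumes "openin sigma_weak U" "x \<in> U"
  obtains \<eta> e where "e > 0" "\<And>y :: 'a bop. norm (amp (y - x) \<eta>) < e \<Longrightarrow> y \<in> U"
proof -
  have "generate_topology_on {{T :: 'a bop. cinner \<xi> (amp T \<eta>) \<in> U} | \<xi> \<eta> U. open U} U"
    using assms(1) unfolding sigma_weak_amp by (rule openin_topology_generated_by)
  then have "x \<in> U \<Longrightarrow> \<exists>\<eta> e. e > 0 \<and> (\<forall>y :: 'a bop. norm (amp (y - x) \<eta>) < e \<longrightarrow> y \<in> U)"
  proof (induction rule: generate_topology_on.induct)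
    case (Int a b)
    then obtain \<eta>1 e1 \<eta>2 e2 where
      1: "e1 > 0" "\<And>y :: 'a bop. norm (amp (y - x) \<eta>1) < e1 \<Longrightarrow> y \<in> a" and
      2: "e2 > 0" "\<And>y :: 'a bop. norm (amp (y - x) \<eta>2) < e2 \<Longrightarrow> y \<in> b"
      by (metis IntD1 IntD2)
    obtain \<eta> where \<eta>: "\<And>T :: 'a bop. (norm (amp T \<eta>))\<^sup>2 =
      (norm (amp T \<eta>1))\<^sup>2 + (norm (amp T \<eta>2))\<^sup>2" using l2_pair_exists by blast
    have "norm (amp T \<eta>1) \<le> norm (amp T \<eta>)"
      "norm (amp T \<eta>2) \<le> norm (amp T \<eta>)" for T :: "'a bop"
      by (rule power2_le_imp_le; simp add: \<eta>)+
    then have "y \<in> a \<inter> b" if "norm (amp (y - x) \<eta>) < min e1 e2" for y :: "'a bop"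
      using 1(2)[of y] 2(2)[of y] that by (meson IntI min_less_iff_conj order_le_less_trans)
    then show ?case using 1(1) 2(1) by (intro exI[of _ \<eta>] exI[of _ "min e1 e2"]) auto
  next
    case (UN K)
    then show ?case by (meson UnionE UnionI)
  next
    case (Basis s)
    then obtain \<xi> \<eta> V where s: "s = {T. cinner \<xi> (amp T \<eta>) \<in> V}" "open V" by blast
    then obtain e where e: "e > 0" "\<And>z. dist z (cinner \<xi> (amp x \<eta>)) < e \<Longrightarrow> z \<in> V"
      using Basis by (auto simp: open_dist)
    show ?case
    proof (intro exI[of _ \<eta>] exI[of _ "e / (norm \<xi> + 1)"] conjI allI impI)
      show "e / (norm \<xi> + 1) > 0" using e(1) by (simp add: add_nonneg_pos)
      fix y :: "'a bop" assume y: "norm (amp (y - x) \<eta>) < e / (norm \<xi> + 1)"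
      have p: "norm \<xi> + 1 > 0" by (simp add: add_nonneg_pos)
      have "dist (cinner \<xi> (amp y \<eta>)) (cinner \<xi> (amp x \<eta>)) =
          norm (cinner \<xi> (amp (y - x) \<eta>))"
        by (simp add: dist_norm amp_diff blinfun.diff_left cinner_diff_right)
      also have "\<dots> \<le> norm \<xi> * norm (amp (y - x) \<eta>)" by (rule cinner_cauchy_schwarz)
      also have "\<dots> \<le> (norm \<xi> + 1) * norm (amp (y - x) \<eta>)" by (intro mult_right_mono) auto
      also have "\<dots> < e" using y p by (simp add: pos_less_divide_eq mult.commute)
      finally show "y \<in> s" using e(2) by (simp add: s)
    qed
  qed simp
  then show thesis using assms(2) that by blast
qed

lemma in_sigma_weak_closureI:
  fixes y :: "'a::chilbert_space bop"
  assumes "\<And>\<eta> e. e > 0 \<Longrightarrow> \<exists>d\<in>D. norm (amp (d - y) \<eta>) < e"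
  shows "y \<in> sigma_weak closure_of D"
  unfolding in_closure_of
proof (intro conjI allI impI)
  fix U :: "'a bop set" assume "y \<in> U \<and> openin sigma_weak U"
  then obtain \<eta> e where "e > 0" "\<And>d :: 'a bop. norm (amp (d - y) \<eta>) < e \<Longrightarrow> d \<in> U"
    using sigma_weak_nbhd by metis
  with assms[of e \<eta>] show "\<exists>d. d \<in> D \<and> d \<in> U" by blast
qed simp

lemma sigma_weak_sep:
  "x = y" if "\<And>\<xi> \<eta>. cinner \<xi> (amp x \<eta>) = cinner \<xi> (amp y \<eta>)"
proof (rule blinfun_eqI)
  fix v
  have "amp x (l2emb 0 v) = amp y (l2emb 0 v)" by (rule cinner_ext) (rule that)
  then show "x v = y v" by (metis amp_l2emb coord_l2emb)
qed

lemma Hausdorff_sigma_weak: "Hausdorff_space (sigma_weak :: 'a::chilbert_space bop topology)"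
  unfolding Hausdorff_space_def
proof (intro allI impI)
  fix x y :: "'a bop" assume "x \<in> topspace sigma_weak \<and> y \<in> topspace sigma_weak \<and> x \<noteq> y"
  then obtain \<xi> \<eta> where "cinner \<xi> (amp x \<eta>) \<noteq> cinner \<xi> (amp y \<eta>)"
    using sigma_weak_sep by blast
  then obtain U V where UV: "open U" "open V" "cinner \<xi> (amp x \<eta>) \<in> U"
     "cinner \<xi> (amp y \<eta>) \<in> V" "U \<inter> V = {}" using hausdorff by metis
  let ?f = "\<lambda>T. cinner \<xi> (amp T \<eta>)"
  have "openin sigma_weak {T. ?f T \<in> W}" if "open W" for W
    using continuous_map_vector_functional[of \<xi> \<eta>] that by (auto simp: continuous_map_def)
  then show "\<exists>U V. openin sigma_weak U \<and> openin sigma_weak V \<and> x \<in> U \<and> y \<in> V \<and> disjnt U V"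
    using UV by (intro exI[of _ "{T. ?f T \<in> U}"] exI[of _ "{T. ?f T \<in> V}"]) (auto simp: disjnt_def)
qed

lemma continuous_map_left_mult: "a \<in> bops \<Longrightarrow> continuous_map sigma_weak sigma_weak (\<lambda>T. a \<odot> T)"
proof (rule continuous_map_into_sigma_weak)
  fix \<xi> \<eta> assume a: "a \<in> bops"
  have "(\<lambda>T. cinner \<xi> (amp (a \<odot> T) \<eta>)) = (\<lambda>T. cinner (amp (adj a) \<xi>) (amp T \<eta>))"
    using a by (simp add: amp_comp amp_adj cinner_adj fun_eq_iff)
  then show "continuous_map sigma_weak euclidean (\<lambda>T. cinner \<xi> (amp (a \<odot> T) \<eta>))"
    using continuous_map_vector_functional by simp
qed

lemma continuous_map_right_mult: "continuous_map sigma_weak sigma_weak (\<lambda>T. T \<odot> a)"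
  by (rule continuous_map_into_sigma_weak) (simp add: amp_comp continuous_map_vector_functional)

lemma continuous_map_translation: "continuous_map sigma_weak sigma_weak (\<lambda>T. a + T)"
  by (rule continuous_map_into_sigma_weak)
     (simp add: amp_add blinfun.add_left cinner_add_right continuous_map_add continuous_map_vector_functional)

lemma continuous_map_complex_mult_left:
  assumes "continuous_map X euclidean f"
  shows "continuous_map X euclidean (\<lambda>x. (c::complex) * f x)"
  using continuous_map_compose[OF assms, of euclidean "\<lambda>z. c * z"]
  by (simp add: comp_def continuous_on_mult_left)

text \<open>The restriction to \<open>bops\<close> is essential: \<open>adj\<close> is a definite
  description, and the equation defining it can be solved only for complex-linear operators.\<close>

lemma continuous_map_adj: "continuous_map (subtopology sigma_weak bops) sigma_weak adj"
proof (rule continuous_map_into_sigma_weak)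
  fix \<xi> \<eta> :: "'a l2seq"
  have c: "continuous_map (subtopology sigma_weak bops) euclidean (\<lambda>T. cnj (cinner \<eta> (amp T \<xi>)))"
    using continuous_map_compose[OF continuous_map_from_subtopology[OF continuous_map_vector_functional[of \<eta> \<xi>]],
        of euclidean cnj] by (simp add: comp_def continuous_on_cnj)
  show "continuous_map (subtopology sigma_weak bops) euclidean (\<lambda>T. cinner \<xi> (amp (adj T) \<eta>))"
  proof (rule continuous_map_eq[OF c])
    fix T :: "'a bop" assume "T \<in> topspace (subtopology sigma_weak bops)"
    then have T: "T \<in> bops" by simp
    show "cnj (cinner \<eta> (amp T \<xi>)) = cinner \<xi> (amp (adj T) \<eta>)"
      using T by (simp add: amp_adj cinner_adj' flip: cinner_commute)
  qed
qed

text \<open>Complex linearity is a family of equations between vector functionals of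
  \<open>amp T\<close>, each of which is a sigma-weakly closed condition.\<close>

lemma closedin_bops: "closedin sigma_weak (bops :: 'a::chilbert_space bop set)"
proof -
  have "bops = (\<Inter>(\<xi>,\<eta>,c)\<in>UNIV. {T :: 'a bop. cinner \<xi> (amp T (c *\<^sub>C \<eta>)) = c * cinner \<xi> (amp T \<eta>)})"
    (is "_ = ?R")
  proof (intro equalityI subsetI)
    fix T :: "'a bop" assume "T \<in> bops"
    then show "T \<in> ?R" by (auto simp: bops_app cinner_scaleC_right)
  next
    fix T :: "'a bop" assume T: "T \<in> ?R"
    show "T \<in> bops"
    proof (rule bopsI)
      fix c x
      have "amp T (c *\<^sub>C l2emb 0 x) = c *\<^sub>C (amp T) (l2emb 0 x)"
        by (rule cinner_ext) (use T in \<open>simp add: cinner_scaleC_right\<close>)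
      then show "T (c *\<^sub>C x) = c *\<^sub>C T x"
        by (metis amp_l2emb coord_l2emb coord_scaleC l2emb_scaleC)
    qed
  qed
  moreover have "closedin sigma_weak {T :: 'a bop. cinner \<xi> (amp T (c *\<^sub>C \<eta>)) = c * cinner \<xi> (amp T \<eta>)}" for \<xi> \<eta> c
  proof -
    have "closedin sigma_weak {T \<in> topspace sigma_weak. cinner \<xi> (amp T (c *\<^sub>C \<eta>)) = c * cinner \<xi> (amp T \<eta>)}"
      by (rule closedin_continuous_maps_eq[of euclidean])
         (auto intro!: continuous_map_vector_functional continuous_map_complex_mult_left)
    then show ?thesis by simp
  qed
  then have "closedin sigma_weak (\<Inter>(\<xi>,\<eta>,c)\<in>UNIV. {T :: 'a bop. cinner \<xi> (amp T (c *\<^sub>C \<eta>)) = c * cinner \<xi> (amp T \<eta>)})"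
    by (intro closedin_Inter) (auto simp: split_def)
  ultimately show ?thesis by simp
qed

lemma closedin_commutant:
  assumes "S \<subseteq> bops"
  shows "closedin sigma_weak (commutant S)"
proof -
  have "commutant S = bops \<inter> (\<Inter>x\<in>S. {T. T \<odot> x = x \<odot> T})" by (auto simp: commutant_def)
  moreover have "closedin sigma_weak {T. T \<odot> x = x \<odot> T}" if "x \<in> S" for x
  proof -
    have "closedin sigma_weak {T \<in> topspace sigma_weak. T \<odot> x = x \<odot> T}"
      by (rule closedin_continuous_maps_eq[of sigma_weak])
         (use assms that in \<open>auto intro!: continuous_map_left_mult continuous_map_right_mult Hausdorff_sigma_weak\<close>)
    then show ?thesis by simp
  qed
  ultimately show ?thesis
    by (cases "S = {}") (auto intro!: closedin_Int closedin_bops closedin_Inter)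
qed

section \<open>Von Neumann algebras and normal homomorphisms\<close>

definition star_alg :: "'a::chilbert_space bop set \<Rightarrow> bool" where
  "star_alg D \<longleftrightarrow> D \<subseteq> bops \<and> \<I> \<in> D \<and> (\<forall>x\<in>D. \<forall>y\<in>D. x + y \<in> D \<and> x \<odot> y \<in> D) \<and>
     (\<forall>x\<in>D. adj x \<in> D) \<and> (\<forall>c. \<forall>x\<in>D. scale_op c x \<in> D)"

lemma star_algD:
  assumes "star_alg D"
  shows star_alg_bops: "x \<in> D \<Longrightarrow> x \<in> bops" and star_alg_one: "\<I> \<in> D"
    and star_alg_add: "x \<in> D \<Longrightarrow> y \<in> D \<Longrightarrow> x + y \<in> D"
    and star_alg_mult: "x \<in> D \<Longrightarrow> y \<in> D \<Longrightarrow> x \<odot> y \<in> D"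
    and star_alg_adj: "x \<in> D \<Longrightarrow> adj x \<in> D"
    and star_alg_scale: "x \<in> D \<Longrightarrow> scale_op c x \<in> D"
    and star_alg_zero: "0 \<in> D"
    and star_alg_minus: "x \<in> D \<Longrightarrow> - x \<in> D"
    and star_alg_diff: "x \<in> D \<Longrightarrow> y \<in> D \<Longrightarrow> x - y \<in> D"
    and star_alg_scaleR: "x \<in> D \<Longrightarrow> r *\<^sub>R x \<in> D"
proof -
  show z: "x \<in> D \<Longrightarrow> x \<in> bops" "\<I> \<in> D" "x \<in> D \<Longrightarrow> y \<in> D \<Longrightarrow> x + y \<in> D"
    "x \<in> D \<Longrightarrow> y \<in> D \<Longrightarrow> x \<odot> y \<in> D" "x \<in> D \<Longrightarrow> adj x \<in> D" "x \<in> D \<Longrightarrow> scale_op c x \<in> D" for x y c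
    using assms by (auto simp: star_alg_def)
  show "0 \<in> D" using z(6)[OF z(2), of 0] by simp
  show m: "x \<in> D \<Longrightarrow> - x \<in> D" for x using z(6)[of x "-1"] by (simp add: scale_op_m1)
  show "x \<in> D \<Longrightarrow> y \<in> D \<Longrightarrow> x - y \<in> D" using z(3)[of x "-y"] m by simp
  show "x \<in> D \<Longrightarrow> r *\<^sub>R x \<in> D" using z(6)[of x "of_real r"] by (simp add: scaleR_scale_op)
qed

lemmas star_alg_closed = star_alg_add star_alg_mult star_alg_scale star_alg_adj star_alg_one star_alg_diff

lemma star_alg_sum: "star_alg D \<Longrightarrow> (\<And>i. i \<in> F \<Longrightarrow> f i \<in> D) \<Longrightarrow> (\<Sum>i\<in>F. f i) \<in> D"
  by (induction F rule: infinite_finite_induct) (auto intro: star_alg_zero star_alg_add)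

lemma commutant_bops: "commutant S \<subseteq> bops"
  by (auto simp: commutant_def)

lemma commutantI: "T \<in> bops \<Longrightarrow> (\<And>x. x \<in> S \<Longrightarrow> T \<odot> x = x \<odot> T) \<Longrightarrow> T \<in> commutant S"
  by (simp add: commutant_def)

lemma commutantD: "T \<in> commutant S \<Longrightarrow> x \<in> S \<Longrightarrow> T \<odot> x = x \<odot> T"
  by (simp add: commutant_def)

lemma commutant_mono: "S \<subseteq> S' \<Longrightarrow> commutant S' \<subseteq> commutant S"
  by (auto simp: commutant_def)

lemma subset_double_commutant: "S \<subseteq> bops \<Longrightarrow> S \<subseteq> commutant (commutant S)"
  by (auto simp: commutant_def)

lemma triple_commutant: "S \<subseteq> bops \<Longrightarrow> commutant (commutant (commutant S)) = commutant S"
  using subset_double_commutant[of S] subset_double_commutant[OF commutant_bops, of S]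
    commutant_mono[of S "commutant (commutant S)"] by blast

lemma star_alg_commutant:
  assumes S: "S \<subseteq> bops" "\<And>x. x \<in> S \<Longrightarrow> adj x \<in> S"
  shows "star_alg (commutant S)"
  unfolding star_alg_def
proof (intro conjI ballI allI)
  fix x y c assume x: "x \<in> commutant S" and y: "y \<in> commutant S"
  note b = commutant_bops[THEN subsetD, OF x] commutant_bops[THEN subsetD, OF y]
  show "x + y \<in> commutant S" using x y by (simp add: commutant_def comp_add_left comp_add_right)
  show "x \<odot> y \<in> commutant S"
    by (rule commutantI) (use b commutantD[OF x] commutantD[OF y] in \<open>simp_all add: comp_assoc\<close>, simp flip: comp_assoc)
next
  fix x c assume x: "x \<in> commutant S"
  note b = commutant_bops[THEN subsetD, OF x]
  show "adj x \<in> commutant S"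
  proof (rule commutantI)
    fix s assume s: "s \<in> S"
    then have "adj (x \<odot> adj s) = adj (adj s \<odot> x)" using commutantD[OF x S(2)] by simp
    then show "adj x \<odot> s = s \<odot> adj x" using b s S(1) by (simp add: adj_comp subset_iff)
  qed (use b in simp)
  show "scale_op c x \<in> commutant S"
    by (rule commutantI) (use b S commutantD[OF x] in \<open>auto simp: comp_scale_op_left comp_scale_op_right\<close>)
qed (auto simp: commutant_def)

lemma von_neumann_algebra_commutant:
  assumes S: "S \<subseteq> bops" "\<And>x. x \<in> S \<Longrightarrow> adj x \<in> S"
  shows "von_neumann_algebra (commutant S)"
  unfolding von_neumann_algebra_def
  using triple_commutant[OF S(1)] commutant_bops star_alg_adj[OF star_alg_commutant[OF S]] by blast

lemma vN_bops: "von_neumann_algebra M \<Longrightarrow> M \<subseteq> bops"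
  by (simp add: von_neumann_algebra_def)

lemma vN_double: "von_neumann_algebra M \<Longrightarrow> commutant (commutant M) = M"
  by (simp add: von_neumann_algebra_def)

lemma vN_commutant_star_alg: "von_neumann_algebra M \<Longrightarrow> star_alg (commutant M)"
  by (rule star_alg_commutant) (auto simp: von_neumann_algebra_def)

lemma vN_star_alg: assumes "von_neumann_algebra M" shows "star_alg M"
proof -
  have "star_alg (commutant (commutant M))"
    using vN_commutant_star_alg[OF assms] by (intro star_alg_commutant) (auto simp: star_alg_def)
  then show ?thesis by (simp add: vN_double[OF assms])
qed

lemma vN_closedin: "von_neumann_algebra M \<Longrightarrow> closedin sigma_weak M"
  using closedin_commutant[OF commutant_bops, of M] by (simp add: vN_double)

lemma vN_memI: "von_neumann_algebra M \<Longrightarrow> x \<in> bops \<Longrightarrow> (\<And>T. T \<in> commutant M \<Longrightarrow> x \<odot> T = T \<odot> x) \<Longrightarrow> x \<in> M"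
  using vN_double[of M] commutantI[of x "commutant M"] by simp

lemma vN_generated:
  assumes "S \<subseteq> bops"
  shows vN_vN_generated: "von_neumann_algebra (vN_generated S)"
    and vN_generated_subset: "S \<subseteq> vN_generated S"
proof -
  have b: "S \<union> adj ` S \<subseteq> bops" using assms by (auto simp: subset_iff)
  have a: "adj x \<in> S \<union> adj ` S" if "x \<in> S \<union> adj ` S" for x using that assms by (auto simp: subset_iff)
  from star_alg_commutant[OF b a] have "star_alg (commutant (S \<union> adj ` S))" .
  then show "von_neumann_algebra (vN_generated S)" unfolding vN_generated_def
    by (intro von_neumann_algebra_commutant) (auto simp: star_alg_def)
  show "S \<subseteq> vN_generated S" using subset_double_commutant[OF b] by (auto simp: vN_generated_def)
qed

lemma vN_generated_minimal:
  assumes "von_neumann_algebra M" "S \<subseteq> M"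
  shows "vN_generated S \<subseteq> M"
proof -
  have "S \<union> adj ` S \<subseteq> M" using assms star_alg_adj[OF vN_star_alg] by auto
  then show ?thesis unfolding vN_generated_def
    using commutant_mono[OF commutant_mono] vN_double[OF assms(1)] by metis
qed

lemma vN_generated_commute:
  assumes "x \<in> bops" "S \<subseteq> bops" "\<And>s. s \<in> S \<Longrightarrow> x \<odot> s = s \<odot> x" "\<And>s. s \<in> S \<Longrightarrow> x \<odot> adj s = adj s \<odot> x"
    and "y \<in> vN_generated S"
  shows "x \<odot> y = y \<odot> x"
proof -
  have "x \<in> commutant (S \<union> adj ` S)" by (rule commutantI) (use assms in auto)
  then show ?thesis using assms(5) unfolding vN_generated_def by (metis commutantD)
qed

lemma proj_facts:
  assumes K: "csub K" "closed K"
  shows proj_id: "x \<in> K \<Longrightarrow> (proj K) x = x"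
    and proj_zero: "(\<And>k. k \<in> K \<Longrightarrow> cinner k x = 0) \<Longrightarrow> (proj K) x = 0"
    and proj_adj: "adj (proj K) = proj K"
    and proj_idem: "proj K \<odot> proj K = proj K"
proof -
  show id: "x \<in> K \<Longrightarrow> (proj K) x = x" for x by (rule proj_unique[OF K]) auto
  show "(\<And>k. k \<in> K \<Longrightarrow> cinner k x = 0) \<Longrightarrow> (proj K) x = 0"
    by (rule proj_unique[OF K]) (use K in \<open>auto simp: csub_def\<close>)
  show "adj (proj K) = proj K"
  proof (rule adj_unique[OF proj_bops[OF K]])
    fix x y
    let ?p = "(proj K)"
    have "cinner (?p x) (y - ?p y) = 0" by (rule proj_orth[OF K proj_mem[OF K]])
    moreover have "cinner (x - ?p x) (?p y) = 0"
      using proj_orth[OF K proj_mem[OF K], of y x] by (metis cinner_commute complex_cnj_zero)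
    ultimately show "cinner (?p x) y = cinner x (?p y)"
      by (simp add: cinner_diff_left cinner_diff_right)
  qed
  show "proj K \<odot> proj K = proj K" by (rule blinfun_eqI) (simp add: id proj_mem[OF K])
qed

lemma proj_commute:
  assumes K: "csub K" "closed K" and T: "T \<in> bops"
    and inv: "\<And>k. k \<in> K \<Longrightarrow> T k \<in> K" "\<And>k. k \<in> K \<Longrightarrow> (adj T) k \<in> K"
  shows "proj K \<odot> T = T \<odot> proj K"
proof (rule blinfun_eqI)
  fix x
  let ?p = "(proj K)"
  have "?p (T x) = T (?p x)"
  proof (rule proj_unique[OF K])
    show "T (?p x) \<in> K" by (rule inv(1)[OF proj_mem[OF K]])
    fix k assume "k \<in> K"
    then have "cinner (adj T k) (x - ?p x) = 0" by (intro proj_orth[OF K] inv)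
    then show "cinner k (T x - T (?p x)) = 0"
      by (simp add: cinner_adj[OF T] blinfun.diff_right)
  qed
  then show "(proj K \<odot> T) x = (T \<odot> proj K) x" by simp
qed

lemma closure_invariant:
  fixes T :: "'a::real_normed_vector \<Rightarrow>\<^sub>L 'a"
  assumes "\<And>x. x \<in> S \<Longrightarrow> T x \<in> S" "x \<in> closure S"
  shows "T x \<in> closure S"
proof -
  obtain s where s: "\<And>n::nat. s n \<in> S" "s \<longlonglongrightarrow> x" using assms(2) unfolding closure_sequential by blast
  have "(\<lambda>n. T (s n)) \<longlonglongrightarrow> T x" by (intro tendsto_intros s)
  then show ?thesis unfolding closure_sequential using assms(1) s(1)
    by (intro exI[of _ "\<lambda>n. T (s n)"]) auto
qed

lemma csub_orbit:
  assumes "star_alg D" shows "csub ((\<lambda>d. (amp d) \<eta>) ` D)"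
proof -
  have *: "(amp x) \<eta> + (amp y) \<eta> = (amp (x + y)) \<eta>"
    "c *\<^sub>C (amp x) \<eta> = (amp (scale_op c x)) \<eta>"
    "0 = (amp 0) \<eta>" for x y c
    by (simp_all add: amp_add amp_scale_op blinfun.add_left)
  show ?thesis unfolding csub_def
  proof (intro conjI ballI allI)
    show "0 \<in> (\<lambda>d. (amp d) \<eta>) ` D"
      by (rule image_eqI, rule *(3), rule star_alg_zero[OF assms])
    fix u c assume "u \<in> (\<lambda>d. (amp d) \<eta>) ` D"
    then obtain x where x: "x \<in> D" "u = (amp x) \<eta>" by blast
    show "c *\<^sub>C u \<in> (\<lambda>d. (amp d) \<eta>) ` D"
      unfolding x(2) by (rule image_eqI, rule *(2), rule star_alg_scale[OF assms x(1)])
    fix v assume "v \<in> (\<lambda>d. (amp d) \<eta>) ` D"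
    then obtain y where y: "y \<in> D" "v = (amp y) \<eta>" by blast
    show "u + v \<in> (\<lambda>d. (amp d) \<eta>) ` D"
      unfolding x(2) y(2) by (rule image_eqI, rule *(1), rule star_alg_add[OF assms x(1) y(1)])
  qed
qed

text \<open>Von Neumann's argument on the amplified space: the projection \<open>p\<close> onto the
  closed orbit of \<open>\<eta>\<close> commutes with every \<open>amp d\<close>, hence with
  \<open>amp y\<close>. Since \<open>\<eta>\<close> lies in its own orbit,
  \<open>amp y \<eta>\<close> lies in the closure. The approximation obtained is
  sigma-strong.\<close>

theorem bicommutant_density:
  fixes D :: "'a::chilbert_space bop set"
  assumes D: "star_alg D" and y: "y \<in> commutant (commutant D)"
  shows "y \<in> sigma_weak closure_of D"
proof (rule in_sigma_weak_closureI)
  fix \<eta> :: "'a l2seq" and e :: real assume e: "e > 0"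
  define S where "S = (\<lambda>d. (amp d) \<eta>) ` D"
  define p where "p = proj (closure S)"
  have K: "csub (closure S)" "closed (closure S)" unfolding S_def by (auto intro: csub_closure csub_orbit D)
  have inv: "amp d k \<in> closure S" if "d \<in> D" "k \<in> closure S" for d k
  proof (rule closure_invariant[OF _ that(2)])
    fix x assume "x \<in> S"
    then obtain b where b: "b \<in> D" "x = (amp b) \<eta>" by (auto simp: S_def)
    then have "amp d x = (amp (d \<odot> b)) \<eta>" by (simp add: amp_comp)
    then show "amp d x \<in> S" using star_alg_mult[OF D that(1) b(1)] by (auto simp: S_def)
  qed
  have pc: "p \<odot> amp d = amp d \<odot> p" if "d \<in> D" for d unfolding p_def
  proof (rule proj_commute[OF K])
    show "amp d \<in> bops" using star_alg_bops[OF D that] by simp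
    show "amp d k \<in> closure S" if "k \<in> closure S" for k by (rule inv[OF \<open>d \<in> D\<close> that])
    show "adj (amp d) k \<in> closure S" if "k \<in> closure S" for k
      using inv[OF star_alg_adj[OF D \<open>d \<in> D\<close>] that] star_alg_bops[OF D \<open>d \<in> D\<close>] by (simp add: amp_adj)
  qed
  have pc': "p (amp d x) = amp d (p x)" if "d \<in> D" for d x
    using arg_cong[OF pc[OF that], of "\<lambda>T. T x"] by simp
  have pb: "p \<in> bops" unfolding p_def by (rule proj_bops[OF K])
  \<comment> \<open>The matrix entries of \<open>p\<close>. They lie in the commutant of
    \<open>D\<close>, so \<open>y\<close> commutes with them one by one, which is how
    \<open>p\<close> is seen to commute with \<open>amp y\<close>.\<close>
  define E where "E m n = l2coord m o\<^sub>L p o\<^sub>L l2emb n" for m n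
  have Eapp: "E m n x = coord (p (l2emb n x)) m" for m n x
    by (simp add: E_def)
  have "E m n \<in> commutant D" for m n
  proof (rule commutantI)
    show "E m n \<in> bops" by (rule bopsI) (simp add: Eapp l2emb_scaleC bops_app[OF pb])
    fix d assume d: "d \<in> D"
    show "E m n \<odot> d = d \<odot> E m n"
      by (rule blinfun_eqI) (simp add: Eapp pc'[OF d] flip: amp_l2emb)
  qed
  then have yE: "y \<odot> E m n = E m n \<odot> y" for m n using y commutantD by blast
  have "p \<odot> amp y = amp y \<odot> p"
  proof (rule l2seq_blinfun_eqI)
    fix n x
    show "(p \<odot> amp y) (l2emb n x) = (amp y \<odot> p) (l2emb n x)"
    proof (rule l2seq_eqI)
      fix m
      show "coord ((p \<odot> amp y) (l2emb n x)) m =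
        coord ((amp y \<odot> p) (l2emb n x)) m"
        using arg_cong[OF yE[of m n], of "\<lambda>T. T x"] by (simp add: Eapp amp_l2emb)
    qed
  qed
  then have "p (amp y \<eta>) = amp y (p \<eta>)"
    by (metis blinfun_apply_blinfun_compose)
  moreover have "\<eta> \<in> S" unfolding S_def using star_alg_one[OF D] by (intro image_eqI[of _ _ \<I>]) auto
  then have "p \<eta> = \<eta>" unfolding p_def by (intro proj_id[OF K]) (use closure_subset in blast)
  ultimately have "(amp y) \<eta> \<in> closure S" using proj_mem[OF K] unfolding p_def by metis
  then obtain s where "s \<in> S" "dist s (amp y \<eta>) < e"
    using e unfolding closure_approachable by blast
  then show "\<exists>d\<in>D. norm (amp (d - y) \<eta>) < e"
    by (auto simp: S_def dist_norm amp_diff blinfun.diff_left)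
qed

section \<open>Normal homomorphisms and their composition\<close>

lemma normal_homsD:
  assumes "\<rho> \<in> normal_homs M N"
  shows normal_homs_mem: "x \<in> M \<Longrightarrow> \<rho> x \<in> N"
    and normal_homs_ext: "x \<notin> M \<Longrightarrow> \<rho> x = undefined"
    and normal_homs_add: "x \<in> M \<Longrightarrow> y \<in> M \<Longrightarrow> \<rho> (x + y) = \<rho> x + \<rho> y"
    and normal_homs_mult: "x \<in> M \<Longrightarrow> y \<in> M \<Longrightarrow> \<rho> (x \<odot> y) = \<rho> x \<odot> \<rho> y"
    and normal_homs_scale: "x \<in> M \<Longrightarrow> \<rho> (scale_op c x) = scale_op c (\<rho> x)"
    and normal_homs_adj: "x \<in> M \<Longrightarrow> \<rho> (adj x) = adj (\<rho> x)"
    and normal_homs_one: "\<rho> \<I> = \<I>"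
    and normal_homs_cont: "continuous_map (subtopology sigma_weak M) (subtopology sigma_weak N) \<rho>"
  using assms by (auto simp: normal_homs_def)

lemma normal_homs_more:
  assumes \<rho>: "\<rho> \<in> normal_homs M N" and M: "star_alg M"
  shows normal_homs_zero: "\<rho> 0 = 0"
    and normal_homs_diff: "x \<in> M \<Longrightarrow> y \<in> M \<Longrightarrow> \<rho> (x - y) = \<rho> x - \<rho> y"
    and normal_homs_scaleR: "x \<in> M \<Longrightarrow> \<rho> (r *\<^sub>R x) = r *\<^sub>R \<rho> x"
    and normal_homs_sum: "(\<And>i. i \<in> F \<Longrightarrow> f i \<in> M) \<Longrightarrow> \<rho> (\<Sum>i\<in>F. f i) = (\<Sum>i\<in>F. \<rho> (f i))"
proof -
  show z: "\<rho> 0 = 0" using normal_homs_scale[OF \<rho> star_alg_one[OF M], of 0] by simp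
  have m: "x \<in> M \<Longrightarrow> \<rho> (- x) = - \<rho> x" for x using normal_homs_scale[OF \<rho>, of x "-1"] by (simp add: scale_op_m1)
  show "x \<in> M \<Longrightarrow> y \<in> M \<Longrightarrow> \<rho> (x - y) = \<rho> x - \<rho> y"
    using normal_homs_add[OF \<rho>, of x "-y"] m star_alg_minus[OF M] by simp
  show "x \<in> M \<Longrightarrow> \<rho> (r *\<^sub>R x) = r *\<^sub>R \<rho> x" by (simp add: scaleR_scale_op normal_homs_scale[OF \<rho>])
  show "(\<And>i. i \<in> F \<Longrightarrow> f i \<in> M) \<Longrightarrow> \<rho> (\<Sum>i\<in>F. f i) = (\<Sum>i\<in>F. \<rho> (f i))"
    by (induction F rule: infinite_finite_induct)
       (auto simp: z normal_homs_add[OF \<rho>] star_alg_sum[OF M])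
qed

lemma normal_homsI:
  assumes "\<And>x. x \<in> M \<Longrightarrow> \<rho> x \<in> N" "\<And>x. x \<notin> M \<Longrightarrow> \<rho> x = undefined"
    "\<And>x y. x \<in> M \<Longrightarrow> y \<in> M \<Longrightarrow> \<rho> (x + y) = \<rho> x + \<rho> y" "\<And>x y. x \<in> M \<Longrightarrow> y \<in> M \<Longrightarrow> \<rho> (x \<odot> y) = \<rho> x \<odot> \<rho> y"
    "\<And>c x. x \<in> M \<Longrightarrow> \<rho> (scale_op c x) = scale_op c (\<rho> x)" "\<And>x. x \<in> M \<Longrightarrow> \<rho> (adj x) = adj (\<rho> x)"
    "\<rho> \<I> = \<I>" "continuous_map (subtopology sigma_weak M) sigma_weak \<rho>"
  shows "\<rho> \<in> normal_homs M N"
  using assms by (auto simp: normal_homs_def continuous_map_in_subtopology PiE_def extensional_def)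

lemma normal_homs_cont': "\<rho> \<in> normal_homs M N \<Longrightarrow> continuous_map (subtopology sigma_weak M) sigma_weak \<rho>"
  by (drule normal_homs_cont) (simp add: continuous_map_in_subtopology)

lemma normal_homs_compose:
  assumes \<rho>: "\<rho> \<in> normal_homs M N" and \<sigma>: "\<sigma> \<in> normal_homs N P" and M: "star_alg M"
  shows "(\<lambda>x\<in>M. \<sigma> (\<rho> x)) \<in> normal_homs M P"
proof (rule normal_homsI)
  have "continuous_map (subtopology sigma_weak M) sigma_weak (\<sigma> \<circ> \<rho>)"
    by (rule continuous_map_compose[OF normal_homs_cont[OF \<rho>] normal_homs_cont'[OF \<sigma>]])
  then show "continuous_map (subtopology sigma_weak M) sigma_weak (\<lambda>x\<in>M. \<sigma> (\<rho> x))"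
    by (rule continuous_map_eq) simp
qed (use M in \<open>auto simp: normal_homsD[OF \<rho>] normal_homsD[OF \<sigma>] star_algD\<close>)

lemma End_compose: "\<rho> \<in> End M \<Longrightarrow> \<sigma> \<in> End M \<Longrightarrow> star_alg M \<Longrightarrow> compose M \<rho> \<sigma> \<in> End M"
  unfolding End_def compose_def by (rule normal_homs_compose)

lemma idend_End: "star_alg M \<Longrightarrow> idend M \<in> End M"
  unfolding End_def idend_def
  by (rule normal_homsI) (auto simp: star_algD intro!: continuous_map_eq[OF continuous_map_from_subtopology[OF continuous_map_id]])

lemma End_eqI:
  assumes "\<rho> \<in> End M" "\<sigma> \<in> End M" "\<And>x. x \<in> M \<Longrightarrow> \<rho> x = \<sigma> x"
  shows "\<rho> = \<sigma>"
proof (rule ext)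
  fix x show "\<rho> x = \<sigma> x"
    using assms normal_homs_ext[of \<rho> M M x] normal_homs_ext[of \<sigma> M M x] by (cases "x \<in> M") (auto simp: End_def)
qed

section \<open>Inverses of normal isomorphisms\<close>

text \<open>A linear map on \<open>D\<close> dominated by \<open>norm (amp x \<xi>)\<close> factors
  through the orbit of \<open>\<xi>\<close>. This is how functionals and representations of
  \<open>D\<close> become operators on the amplified space.\<close>

lemma orbit_operator:
  fixes L :: "'a::chilbert_space bop \<Rightarrow> 'b::chilbert_space"
  assumes D: "star_alg D" and add: "\<And>x y. x \<in> D \<Longrightarrow> y \<in> D \<Longrightarrow> L (x + y) = L x + L y"
    and sc: "\<And>c x. x \<in> D \<Longrightarrow> L (scale_op c x) = c *\<^sub>C L x"
    and bd: "\<And>x. x \<in> D \<Longrightarrow> norm (L x) \<le> K * norm (amp x \<xi>)" and K: "K \<ge> 0"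
  obtains T :: "'a l2seq \<Rightarrow>\<^sub>L 'b" where "\<And>x. x \<in> D \<Longrightarrow> T (amp x \<xi>) = L x"
    "\<And>y. (\<And>x. x \<in> D \<Longrightarrow> cinner (amp x \<xi>) y = 0) \<Longrightarrow> T y = 0" "\<And>c y. T (c *\<^sub>C y) = c *\<^sub>C T y"
proof -
  \<comment> \<open>The extension lemma takes a family indexed by a whole type, so both families are
    set to zero off \<open>D\<close>.\<close>
  define e where "e x = (if x \<in> D then amp x \<xi> else 0)" for x
  define g where "g x = (if x \<in> D then L x else 0)" for x
  have asc: "amp (scale_op c z) \<xi> = c *\<^sub>C amp z \<xi>" for c z by (simp add: amp_scale_op)
  have lin: "(\<Sum>i\<in>F. c i *\<^sub>R g i) = L (\<Sum>i\<in>F \<inter> D. c i *\<^sub>R i) \<and> (\<Sum>i\<in>F. c i *\<^sub>R e i) = amp (\<Sum>i\<in>F \<inter> D. c i *\<^sub>R i) \<xi>"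
    if F: "finite F" for F c
    using F
  proof (induction F)
    case empty
    show ?case using sc[OF star_alg_one[OF D], of 0] by simp
  next
    case (insert i F)
    have m: "(\<Sum>i\<in>F \<inter> D. c i *\<^sub>R i) \<in> D" by (intro star_alg_sum[OF D] star_alg_scaleR[OF D]) auto
    show ?case
    proof (cases "i \<in> D")
      case True
      then show ?thesis using insert m star_alg_scaleR[OF D True, of "c i"]
        by (simp add: g_def e_def add amp_add blinfun.add_left) (simp add: scaleR_scale_op sc asc scaleR_scaleC)
    qed (use insert in \<open>auto simp: e_def g_def\<close>)
  qed
  obtain T :: "'a l2seq \<Rightarrow>\<^sub>L 'b" where T: "\<And>i. T (e i) = g i" "\<And>x. perp_to e x \<Longrightarrow> T x = 0"
    "\<And>c x. T (c *\<^sub>C x) = c *\<^sub>C T x"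
  proof (rule bounded_cextension[of g K e])
    fix F :: "'a bop set" and c assume F: "finite F"
    have "(\<Sum>i\<in>F \<inter> D. c i *\<^sub>R i) \<in> D" by (intro star_alg_sum[OF D] star_alg_scaleR[OF D]) auto
    then show "norm (\<Sum>i\<in>F. c i *\<^sub>R g i) \<le> K * norm (\<Sum>i\<in>F. c i *\<^sub>R e i)"
      using lin[OF F, of c] bd by simp
  next
    fix c and i :: "'a bop"
    show "\<exists>j. e j = c *\<^sub>C e i \<and> g j = c *\<^sub>C g i"
    proof (cases "i \<in> D")
      case True
      then show ?thesis using star_alg_scale[OF D]
        by (intro exI[of _ "scale_op c i"]) (simp add: e_def g_def asc sc)
    qed (auto intro!: exI[of _ i] simp: e_def g_def)
  qed (use K in auto)
  show thesis
  proof (rule that[OF _ _ T(3)])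
    show "T (amp x \<xi>) = L x" if "x \<in> D" for x using T(1)[of x] that by (simp add: e_def g_def)
    show "T y = 0" if y: "\<And>x. x \<in> D \<Longrightarrow> cinner (amp x \<xi>) y = 0" for y
      by (rule T(2)) (simp add: perp_to_def e_def y)
  qed
qed

text \<open>A Radon-Nikodym argument: if \<open>T\<close> is the operator with \<open>amp x \<xi> \<mapsto> h(x) v\<close>, then \<open>\<bar>T\<bar>\<close> commutes
  with all \<open>amp x\<close>, and \<open>\<zeta> = \<bar>T\<bar> \<xi>\<close>.\<close>

lemma dominated_vector:
  fixes h :: "'a::chilbert_space bop \<Rightarrow> 'b::chilbert_space bop"
  assumes D: "star_alg D" and hb: "\<And>x. x \<in> D \<Longrightarrow> h x \<in> bops"
    and add: "\<And>x y. x \<in> D \<Longrightarrow> y \<in> D \<Longrightarrow> h (x + y) = h x + h y" and mult: "\<And>x y. x \<in> D \<Longrightarrow> y \<in> D \<Longrightarrow> h (x \<odot> y) = h x \<odot> h y"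
    and sc: "\<And>c x. x \<in> D \<Longrightarrow> h (scale_op c x) = scale_op c (h x)" and adj: "\<And>x. x \<in> D \<Longrightarrow> h (adj x) = adj (h x)"
    and dom: "\<And>x. x \<in> D \<Longrightarrow> norm (h x v) \<le> norm (amp x \<xi>)"
  obtains \<zeta> where "\<And>x. x \<in> D \<Longrightarrow> norm (amp x \<zeta>) = norm (h x v)"
proof -
  note cl = star_alg_closed[OF D] and b = star_alg_bops[OF D]
  obtain T :: "'a l2seq \<Rightarrow>\<^sub>L 'b" where T: "\<And>x. x \<in> D \<Longrightarrow> T (amp x \<xi>) = h x v"
    "\<And>y. (\<And>x. x \<in> D \<Longrightarrow> cinner (amp x \<xi>) y = 0) \<Longrightarrow> T y = 0" "\<And>c y. T (c *\<^sub>C y) = c *\<^sub>C T y"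
    by (rule orbit_operator[OF D, of "\<lambda>x. h x v" 1 \<xi>]) (use dom in \<open>auto simp: add sc blinfun.add_left\<close>)
  obtain S :: "'b \<Rightarrow>\<^sub>L 'a l2seq" where S: "\<And>x y. cinner (S x) y = cinner x (T y)" "\<And>c x. S (c *\<^sub>C x) = c *\<^sub>C S x"
    using adjoint_exists[OF T(3)] by metis
  \<comment> \<open>\<open>T\<close> intertwines the two representations: this is checked on the
    orbit and on its complement, which \<open>amp d\<close> preserves because \<open>D\<close> is
    closed under adjoints.\<close>
  have Th: "T (amp d y) = h d (T y)" if d: "d \<in> D" for d y
  proof -
    define e where "e x = (if x \<in> D then amp x \<xi> else 0)" for x
    have "T o\<^sub>L amp d = h d o\<^sub>L T"
    proof (rule blinfun_eq_onI[of e])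
      show "\<exists>j. e j = c *\<^sub>C e i" for c i
        using cl by (cases "i \<in> D") (auto simp: e_def amp_scale_op intro: exI[of _ "scale_op c i"] exI[of _ i])
      have "T (amp d (amp x \<xi>)) = h d (h x v)" if "x \<in> D" for x
        using T(1)[of "d \<odot> x"] that d by (simp add: cl amp_comp mult)
      then show "(T o\<^sub>L amp d) (e i) = (h d o\<^sub>L T) (e i)" for i using T(1) by (simp add: e_def)
      fix y assume "perp_to e y"
      then have y: "cinner (amp x \<xi>) y = 0" if "x \<in> D" for x using that by (auto simp: perp_to_def e_def dest: spec[of _ x])
      have "cinner (amp x \<xi>) (amp d y) = 0" if "x \<in> D" for x
        using y[of "adj d \<odot> x"] that d b by (simp add: cl amp_comp amp_adj cinner_adj)
      then show "(T o\<^sub>L amp d) y = (h d o\<^sub>L T) y" using y T(2) by simp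
    qed
    then show ?thesis by (metis blinfun_apply_blinfun_compose)
  qed
  have Sh: "S (h d a) = amp d (S a)" if d: "d \<in> D" for d a
  proof (rule cinner_ext_left)
    fix y
    have "cinner (h d a) (T y) = cinner a (T (amp (adj d) y))"
      using d by (simp add: Th cl adj hb cinner_adj')
    moreover have "cinner (amp d (S a)) y = cinner (S a) (amp (adj d) y)" using d b by (simp add: amp_adj cinner_adj')
    ultimately show "cinner (S (h d a)) y = cinner (amp d (S a)) y" by (simp add: S(1))
  qed
  define A where "A = S o\<^sub>L T"
  have Ap: "cinner x (A x) = of_real ((norm (T x))\<^sup>2)" for x
    using cinner_commute[of x "A x"] by (simp add: A_def S(1) cinner_self)
  have Ab: "A \<in> bops" by (rule bopsI) (simp add: A_def T(3) S(2))
  have "pos_op A" unfolding pos_op_def Ap using Ab by (simp add: complex_nonneg_Reals_iff del: of_real_power)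
  then obtain Q where Q: "pos_op Q" "Q \<odot> Q = A" "\<And>X. X \<in> bops \<Longrightarrow> X \<odot> A = A \<odot> X \<Longrightarrow> X \<odot> Q = Q \<odot> X"
    using op_sqrt by blast
  show thesis
  proof (rule that[of "Q \<xi>"])
    fix x assume x: "x \<in> D"
    let ?w = "amp x \<xi>"
    have "amp x \<odot> A = A \<odot> amp x" by (rule blinfun_eqI) (simp add: A_def Th Sh x)
    then have "amp x \<odot> Q = Q \<odot> amp x" using Q(3) b[OF x] by simp
    then have "amp x (Q \<xi>) = Q ?w" by (metis blinfun_apply_blinfun_compose)
    moreover have "cinner (Q ?w) (Q ?w) = cinner ?w (A ?w)"
      unfolding Q(2)[symmetric] using cinner_adj[OF pos_op_bops[OF Q(1)], of ?w "Q ?w"] pos_op_selfadjoint[OF Q(1)] by simp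
    ultimately have "(norm (amp x (Q \<xi>)))\<^sup>2 = (norm (h x v))\<^sup>2"
      unfolding Ap T(1)[OF x] Re_cinner_self[symmetric] by simp
    then show "norm (amp x (Q \<xi>)) = norm (h x v)" by simp
  qed
qed

text \<open>By continuity \<open>f\<close> maps a neighbourhood of zero into the unit ball, and that
  neighbourhood contains a ball of one seminorm \<open>norm (amp x \<eta>)\<close>; homogeneity
  turns this into a linear bound.\<close>

lemma normal_functional_bound:
  fixes f :: "'a::chilbert_space bop \<Rightarrow> complex"
  assumes D: "star_alg D" and sc: "\<And>c x. x \<in> D \<Longrightarrow> f (scale_op c x) = c * f x"
    and cont: "continuous_map (subtopology sigma_weak D) euclidean f"
  obtains K \<eta> where "K \<ge> 0" "\<And>x. x \<in> D \<Longrightarrow> cmod (f x) \<le> K * norm (amp x \<eta>)"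
proof -
  have "openin (subtopology sigma_weak D) {x \<in> D. f x \<in> ball 0 1}"
    using cont by (simp add: continuous_map_def del: mem_ball_0 mem_ball)
  then obtain U where U: "openin sigma_weak U" "{x \<in> D. f x \<in> ball 0 1} = U \<inter> D"
    by (auto simp: openin_subtopology)
  have "f 0 = 0" using sc[OF star_alg_zero[OF D], of 0] by simp
  then have "0 \<in> {x \<in> D. f x \<in> ball 0 1}" using star_alg_zero[OF D] by simp
  then have "0 \<in> U" unfolding U(2) by blast
  then have "\<exists>\<eta> e. e > 0 \<and> (\<forall>y :: 'a bop. norm (amp (y - 0) \<eta>) < e \<longrightarrow> y \<in> U)"
    by (rule sigma_weak_nbhd[OF U(1)]) blast
  then obtain \<eta> e where e: "e > 0" "\<And>y :: 'a bop. norm (amp (y - 0) \<eta>) < e \<Longrightarrow> y \<in> U"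
    by blast
  have bd: "cmod (f x) \<le> (2 / e) * norm (amp x \<eta>)" if x: "x \<in> D" for x
  proof (rule ccontr)
    assume "\<not> ?thesis"
    then have gt: "(2 / e) * norm (amp x \<eta>) < cmod (f x)" by simp
    let ?r = "norm (amp x \<eta>)"
    have fx: "cmod (f x) > 0" using gt e(1) by (smt (verit) divide_nonneg_pos mult_nonneg_nonneg norm_ge_zero)
    define t where "t = 1 / cmod (f x)"
    have t: "t > 0" using fx by (simp add: t_def)
    have "scale_op (of_real t) x \<in> U"
    proof (rule e(2))
      have "norm (amp (scale_op (of_real t) x - 0) \<eta>) = t * ?r" using t by (simp add: amp_scale_op)
      also have "\<dots> < e"
      proof -
        have "2 * ?r < e * cmod (f x)" using gt e(1) by (simp add: field_simps)
        then have "?r < e * cmod (f x)" using norm_ge_zero[of "(amp x) \<eta>"] by linarith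
        then show ?thesis using fx by (simp add: t_def pos_divide_less_eq)
      qed
      finally show "norm (amp (scale_op (of_real t) x - 0) \<eta>) < e" .
    qed
    then have "scale_op (of_real t) x \<in> {x \<in> D. f x \<in> ball 0 1}" unfolding U(2) using star_alg_scale[OF D x] by blast
    then have "cmod (f (scale_op (of_real t) x)) < 1" by simp
    then show False using fx t by (simp add: sc[OF x] norm_mult) (simp add: t_def)
  qed
  then show thesis using that[of "2 / e" \<eta>] e(1) by auto
qed

text \<open>The functional \<open>f x = cinner v (\<rho> x v)\<close> is normal, hence of the form
  \<open>cinner \<chi>' (amp x \<eta>)\<close>. At \<open>adj x \<odot> x\<close> it equals
  \<open>(norm (\<rho> x v))\<^sup>2\<close>, and estimating the inner product by a single vector
  brings the data into the shape of \<open>dominated_vector\<close>.\<close>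

theorem normal_hom_vector:
  fixes \<rho> :: "'a::chilbert_space bop \<Rightarrow> 'b::chilbert_space bop"
  assumes D: "star_alg D" and \<rho>: "\<rho> \<in> normal_homs D N" and N: "N \<subseteq> bops"
  obtains \<zeta> where "\<And>x. x \<in> D \<Longrightarrow> norm (amp x \<zeta>) = norm (\<rho> x v)"
proof (cases "v = 0")
  case True
  then show thesis using that[of 0] by simp
next
  case False
  note b = star_alg_bops[OF D] and \<rho>D = normal_homsD[OF \<rho>] and cl = star_alg_closed[OF D]
  have \<rho>b: "\<rho> x \<in> bops" if "x \<in> D" for x using \<rho>D(1)[OF that] N by blast
  define f where "f x = cinner v (\<rho> x v)" for x
  have f: "f (x + y) = f x + f y" if "x \<in> D" "y \<in> D" for x y
    using that by (simp add: f_def \<rho>D blinfun.add_left cinner_add_right)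
  have fsc: "f (scale_op c x) = c * f x" if "x \<in> D" for x c
    using that by (simp add: f_def \<rho>D cinner_scaleC_right)
  have "continuous_map (subtopology sigma_weak D) euclidean
      ((\<lambda>T. cinner (l2emb 0 v) (amp T (l2emb 0 v))) \<circ> \<rho>)"
    by (rule continuous_map_compose[OF normal_homs_cont'[OF \<rho>] continuous_map_vector_functional])
  then have "continuous_map (subtopology sigma_weak D) euclidean f"
    by (rule continuous_map_eq) (simp add: f_def cinner_l2emb)
  then obtain K \<eta> where K: "K \<ge> 0" "\<And>x. x \<in> D \<Longrightarrow> cmod (f x) \<le> K * norm (amp x \<eta>)"
    using normal_functional_bound[OF D fsc] by metis
  \<comment> \<open>The values are multiples of the fixed vector \<open>v\<close> so that the
    adjoint of \<open>T\<close>, applied to \<open>v\<close>, yields the vector representing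
    \<open>f\<close>.\<close>
  obtain T :: "'a l2seq \<Rightarrow>\<^sub>L 'b" where T: "\<And>x. x \<in> D \<Longrightarrow> T (amp x \<eta>) = f x *\<^sub>C v" "\<And>c y. T (c *\<^sub>C y) = c *\<^sub>C T y"
  proof (rule orbit_operator[OF D, of "\<lambda>x. f x *\<^sub>C v" "K * norm v" \<eta>])
    show "norm (f x *\<^sub>C v) \<le> K * norm v * norm (amp x \<eta>)" if "x \<in> D" for x
      using mult_right_mono[OF K(2)[OF that] norm_ge_zero[of v]] by (simp add: mult_ac)
  qed (use K f fsc in \<open>auto simp: scaleC_add_left scaleC_scaleC\<close>)
  obtain S where S: "\<And>x y. cinner (blinfun_apply S x) y = cinner x (T y)" using adjoint_exists[OF T(2)] by metis
  define \<chi>' where "\<chi>' = (1 / (norm v)\<^sup>2) *\<^sub>R S v"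
  have f\<chi>: "f x = cinner \<chi>' (amp x \<eta>)" if "x \<in> D" for x
    using False that by (simp add: \<chi>'_def cinner_scaleR_left S T(1) cinner_scaleC_right cinner_self)
  have dom: "norm (\<rho> x v) \<le> norm (amp x ((1/2) *\<^sub>R (\<chi>' + \<eta>)))" if x: "x \<in> D" for x
  proof (rule power2_le_imp_le)
    let ?u = "amp x \<chi>'" and ?w = "amp x \<eta>"
    have "f (adj x \<odot> x) = of_real ((norm (\<rho> x v))\<^sup>2)"
      unfolding f_def using x norm_sq_adj_comp[OF \<rho>b[OF x]] by (simp add: \<rho>D cl)
    moreover have "f (adj x \<odot> x) = cinner ?u ?w" using f\<chi>[of "adj x \<odot> x"] x b by (simp add: cl amp_comp amp_adj cinner_adj')
    ultimately have "(norm (\<rho> x v))\<^sup>2 = Re (cinner ?u ?w)" by (metis Re_complex_of_real)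
    \<comment> \<open>Source of the dominating vector
      \<open>(1/2) *\<^sub>R (\<chi>' + \<eta>)\<close>: four times the real part of the inner
      product is at most the squared norm of the sum.\<close>
    moreover have "4 * Re (cinner ?u ?w) \<le> (norm (?u + ?w))\<^sup>2"
      using norm_add_sq[of ?u ?w] norm_diff_sq[of ?u ?w] zero_le_power2[of "norm (?u - ?w)"] by linarith
    ultimately show "(norm (\<rho> x v))\<^sup>2 \<le> (norm (amp x ((1/2) *\<^sub>R (\<chi>' + \<eta>))))\<^sup>2"
      by (simp add: blinfun.scaleR_right blinfun.add_right power_divide)
  qed simp
  show thesis
    by (rule dominated_vector[where h = \<rho> and v = v and D = D, OF D \<rho>b _ _ _ _ dom], simp_all add: \<rho>D) (rule that)
qed

text \<open>Iterates \<open>sq_add_le\<close>, each step doubling the weight of the remaining terms.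
  The gain is a bound by a sum of squares, the form in which dominating vectors can be collected by
  \<open>l2join\<close>.\<close>

lemma norm_sum_sq_le:
  fixes u :: "nat \<Rightarrow> 'a::real_normed_vector"
  shows "(norm (\<Sum>n<N. u n))\<^sup>2 \<le> (\<Sum>n<N. 2 ^ Suc n * (norm (u n))\<^sup>2)"
proof (induction N arbitrary: u)
  case (Suc N)
  have "(norm (\<Sum>n<Suc N. u n))\<^sup>2 = (norm (u 0 + (\<Sum>n<N. u (Suc n))))\<^sup>2"
    by (simp add: sum.lessThan_Suc_shift del: sum.lessThan_Suc)
  also have "\<dots> \<le> 2 * (norm (u 0))\<^sup>2 + 2 * (norm (\<Sum>n<N. u (Suc n)))\<^sup>2" by (rule sq_add_le)
  also have "\<dots> \<le> 2 * (norm (u 0))\<^sup>2 + 2 * (\<Sum>n<N. 2 ^ Suc n * (norm (u (Suc n)))\<^sup>2)"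
    using Suc[of "\<lambda>n. u (Suc n)"] by simp
  also have "\<dots> = (\<Sum>n<Suc N. 2 ^ Suc n * (norm (u n))\<^sup>2)"
    by (simp add: sum.lessThan_Suc_shift sum_distrib_left mult.assoc del: sum.lessThan_Suc)
  finally show ?case .
qed simp

text \<open>The vectors \<open>v\<close> whose state becomes normal after composition with the inverse form a closed
  subspace \<open>P\<close>.  If \<open>P\<close> were proper, the projection \<open>z\<close> onto its complement would be in \<open>A\<close> and
  nonzero, but pulling back a vector state that does not vanish on \<open>\<Phi> z\<close> produces vectors of \<open>P\<close> on
  which \<open>z\<close> does not vanish.\<close>

theorem normal_iso_inverse:
  fixes A :: "'a::chilbert_space bop set" and B :: "'b::chilbert_space bop set"
  assumes A: "von_neumann_algebra A" and B: "von_neumann_algebra B"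
    and \<Phi>: "\<Phi> \<in> normal_homs A B" and bij: "bij_betw \<Phi> A B"
  shows "(\<lambda>y\<in>B. inv_into A \<Phi> y) \<in> normal_homs B A"
proof -
  note sA = vN_star_alg[OF A] and sB = vN_star_alg[OF B]
  define \<Psi> where "\<Psi> = inv_into A \<Phi>"
  have \<Psi>A: "\<Psi> y \<in> A" and \<Phi>\<Psi>: "\<Phi> (\<Psi> y) = y" if "y \<in> B" for y
    using that bij unfolding \<Psi>_def bij_betw_def by (auto intro: inv_into_into f_inv_into_f)
  have \<Psi>\<Phi>: "\<Psi> (\<Phi> x) = x" if "x \<in> A" for x
    using that bij unfolding \<Psi>_def bij_betw_def by auto
  have inj: "x = x'" if "x \<in> A" "x' \<in> A" "\<Phi> x = \<Phi> x'" for x x' using that \<Psi>\<Phi> by metis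
  note cA = star_alg_closed[OF sA]
  note cB = star_alg_closed[OF sB]
  note \<Phi>D = normal_homsD[OF \<Phi>]
  have \<Psi>add: "\<Psi> (x + y) = \<Psi> x + \<Psi> y" if "x \<in> B" "y \<in> B" for x y
    using that by (intro inj) (auto simp: \<Psi>A \<Phi>\<Psi> \<Phi>D cA cB)
  have \<Psi>mult: "\<Psi> (x \<odot> y) = \<Psi> x \<odot> \<Psi> y" if "x \<in> B" "y \<in> B" for x y
    using that by (intro inj) (auto simp: \<Psi>A \<Phi>\<Psi> \<Phi>D cA cB)
  have \<Psi>scale: "\<Psi> (scale_op c x) = scale_op c (\<Psi> x)" if "x \<in> B" for c x
    using that by (intro inj) (auto simp: \<Psi>A \<Phi>\<Psi> \<Phi>D cA cB)
  have \<Psi>adj: "\<Psi> (adj x) = adj (\<Psi> x)" if "x \<in> B" for x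
    using that by (intro inj) (auto simp: \<Psi>A \<Phi>\<Psi> \<Phi>D cA cB)
  have \<Psi>one: "\<Psi> \<I> = \<I>"
    by (intro inj) (auto simp: \<Psi>A \<Phi>\<Psi> \<Phi>D cA cB)
  have \<Psi>b: "\<Psi> y \<in> bops" if "y \<in> B" for y using \<Psi>A[OF that] star_alg_bops[OF sA] by blast
  have bb: "y \<in> bops" if "y \<in> B" for y using that star_alg_bops[OF sB] by blast
  define P where "P = {v. \<exists>\<zeta>. \<forall>y\<in>B. norm (\<Psi> y v) \<le> norm (amp y \<zeta>)}"
  have PI: "v \<in> P" if "\<And>y. y \<in> B \<Longrightarrow> norm (\<Psi> y v) \<le> norm (amp y \<zeta>)" for v \<zeta>
    using that by (auto simp: P_def)
  have PD: "\<exists>\<zeta>. \<forall>y\<in>B. norm (\<Psi> y v) = norm (amp y \<zeta>)" if "v \<in> P" for v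
  proof -
    obtain \<zeta> where \<zeta>: "\<And>y. y \<in> B \<Longrightarrow> norm (\<Psi> y v) \<le> norm (amp y \<zeta>)"
      using \<open>v \<in> P\<close> by (auto simp: P_def)
    obtain \<theta> where "\<And>y. y \<in> B \<Longrightarrow> norm (amp y \<theta>) = norm (\<Psi> y v)"
      using dominated_vector[where h = \<Psi> and v = v and \<xi> = \<zeta>, OF sB \<Psi>b \<Psi>add \<Psi>mult \<Psi>scale \<Psi>adj \<zeta>] by blast
    then show ?thesis by metis
  qed
  have Padd: "v + w \<in> P" if v: "v \<in> P" and w: "w \<in> P" for v w
  proof -
    obtain \<zeta> \<zeta>' where z: "\<And>y. y \<in> B \<Longrightarrow> norm (\<Psi> y v) \<le> norm (amp y \<zeta>)"
      "\<And>y. y \<in> B \<Longrightarrow> norm (\<Psi> y w) \<le> norm (amp y \<zeta>')"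
      using v w by (auto simp: P_def)
    obtain \<eta> where \<eta>: "\<And>T :: 'b bop. (norm (amp T \<eta>))\<^sup>2 =
      (norm (amp T \<zeta>))\<^sup>2 + (norm (amp T \<zeta>'))\<^sup>2" using l2_pair_exists by blast
    show ?thesis
    proof (rule PI[of _ "sqrt 2 *\<^sub>R \<eta>"], rule power2_le_imp_le)
      fix y assume y: "y \<in> B"
      have "(norm (\<Psi> y (v + w)))\<^sup>2 \<le> 2 * (norm (\<Psi> y v))\<^sup>2 + 2 * (norm (\<Psi> y w))\<^sup>2"
        unfolding blinfun.add_right by (rule sq_add_le)
      also have "\<dots> \<le> 2 * (norm (amp y \<zeta>))\<^sup>2 + 2 * (norm (amp y \<zeta>'))\<^sup>2"
        using z[OF y] by (intro add_mono mult_left_mono power_mono) auto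
      also have "\<dots> = (norm (amp y (sqrt 2 *\<^sub>R \<eta>)))\<^sup>2"
        by (simp add: blinfun.scaleR_right power_mult_distrib \<eta>)
      finally show "(norm (\<Psi> y (v + w)))\<^sup>2 \<le> (norm (amp y (sqrt 2 *\<^sub>R \<eta>)))\<^sup>2" .
    qed simp
  qed
  have Psc: "c *\<^sub>C v \<in> P" if v: "v \<in> P" for c v
  proof -
    obtain \<zeta> where z: "\<And>y. y \<in> B \<Longrightarrow> norm (\<Psi> y v) \<le> norm (amp y \<zeta>)"
      using v by (auto simp: P_def)
    show ?thesis
      by (rule PI[of _ "c *\<^sub>C \<zeta>"]) (use z in \<open>simp add: bops_app \<Psi>b bb mult_left_mono\<close>)
  qed
  have P0: "0 \<in> P" by (rule PI[of _ 0]) simp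
  have csubP: "csub P" using Padd Psc P0 by (simp add: csub_def)
  have Pm: "v - w \<in> P" if "v \<in> P" "w \<in> P" for v w by (rule csub_diff[OF csubP that])
  have clP: "closed P"
    unfolding closure_subset_eq[symmetric]
  proof
    fix v assume v: "v \<in> closure P"
    \<comment> \<open>The rate one quarter is chosen to beat the weights \<open>2 ^ Suc n\<close> of
      \<open>norm_sum_sq_le\<close>: squared increments decay like powers of 1/16, so the weighted
      series of dominating vectors converges.\<close>
    have "\<exists>s\<in>P. dist s v < (1/4)^n" for n :: nat using v unfolding closure_approachable by simp
    then obtain s where s: "\<And>n. s n \<in> P" "\<And>n::nat. dist (s n) v < (1/4)^n" by metis
    define w where "w n = (case n of 0 \<Rightarrow> s 0 | Suc m \<Rightarrow> s (Suc m) - s m)" for n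
    have wP: "w n \<in> P" for n using s(1) Pm by (auto simp: w_def split: nat.split)
    have ws: "(\<Sum>n<Suc N. w n) = s N" for N by (induction N) (auto simp: w_def)
    have wn: "norm (w (Suc n)) \<le> 2 * (1/4)^n" for n
    proof -
      have "norm (w (Suc n)) = dist (s (Suc n)) (s n)" by (simp add: w_def dist_norm)
      also have "\<dots> \<le> dist (s (Suc n)) v + dist (s n) v" by (rule dist_triangle2)
      also have "\<dots> \<le> (1/4)^Suc n + (1/4)^n" using s(2)[of n] s(2)[of "Suc n"] by linarith
      also have "\<dots> \<le> 2 * (1/4)^n" by simp
      finally show ?thesis .
    qed
    obtain \<zeta> where \<zeta>n: "\<And>n y. y \<in> B \<Longrightarrow> norm (\<Psi> y (w n)) = norm (amp y (\<zeta> n))"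
      using PD[OF wP] by metis
    define \<theta> where "\<theta> n = sqrt (2 ^ Suc n) *\<^sub>R \<zeta> n" for n
    have th: "(norm (amp y (\<theta> n)))\<^sup>2 = 2 ^ Suc n * (norm (\<Psi> y (w n)))\<^sup>2" if "y \<in> B" for n y
      by (simp add: \<theta>_def blinfun.scaleR_right power_mult_distrib \<zeta>n[OF that])
    have "summable (\<lambda>n. (norm (\<theta> (Suc n)))\<^sup>2)"
    proof (rule summable_comparison_test[of _ "\<lambda>n. 16 * (1/2)^n"])
      have "(norm (\<theta> (Suc n)))\<^sup>2 \<le> 16 * (1/2)^n" for n
      proof -
        have "(norm (\<theta> (Suc n)))\<^sup>2 = 2 ^ Suc (Suc n) * (norm (w (Suc n)))\<^sup>2"
          using th[OF star_alg_one[OF sB], of "Suc n"] by (simp add: \<Psi>one)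
        also have "\<dots> \<le> 2 ^ Suc (Suc n) * (2 * (1/4)^n)\<^sup>2"
          by (intro mult_left_mono power_mono wn) auto
        also have "\<dots> = 16 * ((2 * (1/4 * (1/4))) ^ n)"
          by (simp only: power_mult_distrib power2_eq_square) (simp add: power_mult_distrib[symmetric])
        also have "\<dots> \<le> 16 * (1/2)^n" by (intro mult_left_mono power_mono) auto
        finally show ?thesis .
      qed
      then show "\<exists>N. \<forall>n\<ge>N. norm ((norm (\<theta> (Suc n)))\<^sup>2) \<le> 16 * (1/2)^n" by simp
    qed (intro summable_mult summable_geometric, simp)
    then have sth: "summable (\<lambda>n. (norm (\<theta> n))\<^sup>2)" by (subst (asm) summable_Suc_iff)
    show "v \<in> P"
    proof (rule PI[of _ "l2join \<theta>"], rule power2_le_imp_le)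
      fix y assume y: "y \<in> B"
      have sm: "(\<lambda>n. 2 ^ Suc n * (norm (\<Psi> y (w n)))\<^sup>2) sums (norm (amp y (l2join \<theta>)))\<^sup>2"
        using norm_amp_l2join[OF sth, of y] unfolding th[OF y] .
      have le: "(norm (\<Psi> y (s N)))\<^sup>2 \<le> (norm (amp y (l2join \<theta>)))\<^sup>2" for N
      proof -
        have "(norm (\<Psi> y (s N)))\<^sup>2 = (norm (\<Sum>n<Suc N. (\<Psi> y) (w n)))\<^sup>2"
          unfolding ws[symmetric] by (simp only: blinfun.sum_right)
        also have "\<dots> \<le> (\<Sum>n<Suc N. 2 ^ Suc n * (norm (\<Psi> y (w n)))\<^sup>2)" by (rule norm_sum_sq_le)
        also have "\<dots> \<le> (norm (amp y (l2join \<theta>)))\<^sup>2"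
          unfolding sums_unique[OF sm] by (rule sum_le_suminf[OF sums_summable[OF sm]]) auto
        finally show ?thesis .
      qed
      have "s \<longlonglongrightarrow> v"
      proof (rule metric_tendsto_imp_tendsto[of "\<lambda>n. (1/4::real)^n" 0])
        show "(\<lambda>n. (1/4::real)^n) \<longlonglongrightarrow> 0" by (rule LIMSEQ_power_zero) simp
        show "\<forall>\<^sub>F n in sequentially. dist (s n) v \<le> dist ((1/4::real)^n) 0"
          using s(2) by (intro always_eventually) (auto simp: less_imp_le)
      qed
      then have "(\<lambda>n. (norm (\<Psi> y (s n)))\<^sup>2) \<longlonglongrightarrow> (norm (\<Psi> y v))\<^sup>2"
        by (intro tendsto_intros)
      then show "(norm (\<Psi> y v))\<^sup>2 \<le> (norm (amp y (l2join \<theta>)))\<^sup>2"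
        by (rule LIMSEQ_le_const2) (use le in blast)
    qed simp
  qed
  \<comment> \<open>Invariance of \<open>P\<close> under the commutant of \<open>A\<close> is what
    puts the projection onto \<open>P\<close> into \<open>A\<close>.\<close>
  have PA': "a v \<in> P" if a: "a \<in> commutant A" and v: "v \<in> P" for a v
  proof -
    obtain \<zeta> where z: "\<And>y. y \<in> B \<Longrightarrow> norm (\<Psi> y v) \<le> norm (amp y \<zeta>)"
      using v by (auto simp: P_def)
    show ?thesis
    proof (rule PI[of _ "norm a *\<^sub>R \<zeta>"])
      fix y assume y: "y \<in> B"
      have "\<Psi> y (a v) = a (\<Psi> y v)"
        using commutantD[OF a \<Psi>A[OF y]] by (metis blinfun_apply_blinfun_compose)
      then have "norm (\<Psi> y (a v)) \<le> norm a * norm (\<Psi> y v)"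
        by (simp add: norm_blinfun)
      also have "\<dots> \<le> norm a * norm (amp y \<zeta>)" by (intro mult_left_mono z y) simp
      finally show "norm (\<Psi> y (a v)) \<le> norm (amp y (norm a *\<^sub>R \<zeta>))"
        by (simp add: blinfun.scaleR_right)
    qed
  qed
  have PAi: "a v \<in> P" if a: "a \<in> A" and v: "v \<in> P" for a v
  proof -
    obtain \<zeta> where z: "\<And>y. y \<in> B \<Longrightarrow> norm (\<Psi> y v) \<le> norm (amp y \<zeta>)"
      using v by (auto simp: P_def)
    show ?thesis
    proof (rule PI[of _ "(amp (\<Phi> a)) \<zeta>"])
      fix y assume y: "y \<in> B"
      have "\<Psi> y (a v) = \<Psi> (y \<odot> \<Phi> a) v"
        using y a by (simp add: \<Psi>mult \<Phi>D \<Psi>\<Phi>)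
      then show "norm (\<Psi> y (a v)) \<le> norm (amp y (amp (\<Phi> a) \<zeta>))"
        using z[of "y \<odot> \<Phi> a"] y a by (simp add: cB \<Phi>D amp_comp)
    qed
  qed
  define p where "p = proj P"
  note pf = csubP clP
  have pA: "p \<in> A"
  proof (rule vN_memI[OF A])
    show "p \<in> bops" unfolding p_def by (rule proj_bops[OF pf])
    fix T assume T: "T \<in> commutant A"
    show "p \<odot> T = T \<odot> p" unfolding p_def
      by (rule proj_commute[OF pf])
         (use T PA' star_alg_adj[OF vN_commutant_star_alg[OF A]] commutant_bops[of A] in auto)
  qed
  have "p = \<I>"
  proof (rule ccontr)
    assume "p \<noteq> \<I>"
    define z where "z = \<I> - p"
    have zA: "z \<in> A" unfolding z_def by (rule star_alg_diff[OF sA star_alg_one[OF sA] pA])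
    have "z \<noteq> 0" using \<open>p \<noteq> \<I>\<close> by (simp add: z_def)
    have "\<Phi> z \<noteq> 0"
    proof
      assume "\<Phi> z = 0"
      then have "\<Phi> z = \<Phi> 0" by (simp add: normal_homs_zero[OF \<Phi> sA])
      then show False using inj zA star_alg_zero[OF sA] \<open>z \<noteq> 0\<close> by blast
    qed
    then obtain u where u: "\<Phi> z u \<noteq> 0" using blinfun_eqI[of "\<Phi> z" 0] by auto
    obtain \<zeta> where \<zeta>: "\<And>x. x \<in> A \<Longrightarrow> norm (amp x \<zeta>) = norm (\<Phi> x u)"
      using normal_hom_vector[OF sA \<Phi> vN_bops[OF B]] by blast
    \<comment> \<open>Each coordinate of \<open>\<zeta>\<close> is dominated by the vector
      \<open>u\<close> itself, so it lies in \<open>P\<close> and is killed by \<open>z\<close>; yet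
      \<open>norm (amp z \<zeta>)\<close> equals the nonzero norm of
      \<open>\<Phi> z u\<close>.\<close>
    have "coord \<zeta> k \<in> P" for k
    proof (rule PI[of _ "(l2emb 0) u"])
      fix y assume y: "y \<in> B"
      have "norm (amp (\<Psi> y) \<zeta>) = norm (y u)" using \<zeta>[OF \<Psi>A[OF y]] \<Phi>\<Psi>[OF y] by simp
      then show "norm (\<Psi> y (coord \<zeta> k)) \<le> norm (amp y ((l2emb 0) u))"
        using norm_coord_le[of "(amp (\<Psi> y)) \<zeta>" k] by (simp add: amp_l2emb)
    qed
    then have "p (coord \<zeta> k) = coord \<zeta> k" for k unfolding p_def by (rule proj_id[OF pf])
    then have "(amp z) \<zeta> = 0" by (intro l2seq_eqI) (simp add: z_def blinfun.diff_left)
    then show False using \<zeta>[OF zA] u by simp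
  qed
  have Pall: "v \<in> P" for v using proj_mem[OF pf, of v] \<open>p = \<I>\<close> by (simp add: p_def)
  show ?thesis unfolding \<Psi>_def[symmetric]
  proof (rule normal_homsI)
    show "continuous_map (subtopology sigma_weak B) sigma_weak (\<lambda>y\<in>B. \<Psi> y)"
    proof (rule continuous_map_into_sigma_weak)
      fix \<xi> \<eta> :: "'a l2seq"
      have "\<forall>k. \<exists>z. \<forall>y\<in>B. norm (\<Psi> y (coord \<eta> k)) = norm (amp y z)" using PD[OF Pall] by blast
      then obtain h where h: "\<And>k y. y \<in> B \<Longrightarrow> norm (\<Psi> y (coord \<eta> k)) = norm (amp y (h k))" by metis
      have s: "summable (\<lambda>k. (norm (h k))\<^sup>2)"
        using summable_coord[of \<eta>] h[OF star_alg_one[OF sB]] by (simp add: \<Psi>one)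
      \<comment> \<open>The adjoint of \<open>T\<close> carries \<open>\<xi>\<close> to a vector
        \<open>\<zeta>\<close> for which the functional of \<open>\<Psi> y\<close> becomes a vector
        functional of \<open>y\<close>, whence continuity.\<close>
      obtain T :: "'b l2seq \<Rightarrow>\<^sub>L 'a l2seq" where T: "\<And>y. y \<in> B \<Longrightarrow> T (amp y (l2join h)) = amp (\<Psi> y) \<eta>"
        "\<And>c y. T (c *\<^sub>C y) = c *\<^sub>C T y"
      proof (rule orbit_operator[OF sB, of "\<lambda>y. amp (\<Psi> y) \<eta>" 1 "l2join h"])
        fix y assume y: "y \<in> B"
        have "(norm (amp (\<Psi> y) \<eta>))\<^sup>2 = (norm (amp y (l2join h)))\<^sup>2"
          using norm_amp_l2join[OF s, of y] by (simp add: norm_l2seq_sq[of "amp (\<Psi> y) \<eta>"] h[OF y] sums_iff)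
        then show "norm (amp (\<Psi> y) \<eta>) \<le> 1 * norm (amp y (l2join h))" by simp
      qed (auto simp: \<Psi>add \<Psi>scale amp_add amp_scale_op blinfun.add_left)
      obtain \<zeta> where "\<And>y. cinner \<zeta> y = cinner \<xi> (T y)" using adjoint_exists[OF T(2)] by metis
      then have "cinner \<xi> (amp (\<Psi> y) \<eta>) = cinner \<zeta> (amp y (l2join h))" if "y \<in> B" for y using T(1)[OF that] by simp
      then show "continuous_map (subtopology sigma_weak B) euclidean (\<lambda>y. cinner \<xi> (amp ((\<lambda>y\<in>B. \<Psi> y) y) \<eta>))"
        by (intro continuous_map_eq[OF continuous_map_from_subtopology[OF continuous_map_vector_functional[of \<zeta> "l2join h"]]]) auto
    qed
  qed (auto simp: \<Psi>A \<Psi>add \<Psi>mult \<Psi>scale \<Psi>adj \<Psi>one cB)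
qed

section \<open>Projections in type III factors\<close>

text \<open>The tool by which projections onto closed spans are placed in an algebra: operators of
  the commutant send spanning vectors into the span, and so do their adjoints.\<close>

lemma proj_span_commute:
  fixes e :: "'i \<Rightarrow> 'a::chilbert_space"
  assumes sc: "\<And>c i. \<exists>j. e j = c *\<^sub>C e i" and T: "T \<in> bops"
    and inv: "\<And>i. T (e i) \<in> span (range e)" "\<And>i. (adj T) (e i) \<in> span (range e)"
  shows "proj (closure (span (range e))) \<odot> T = T \<odot> proj (closure (span (range e)))"
proof -
  have K: "csub (closure (span (range e)))" "closed (closure (span (range e)))"
    by (auto intro: csub_closure csub_span sc)
  have sp: "S x \<in> span (range e)"
    if "\<And>i. S (e i) \<in> span (range e)" "x \<in> span (range e)" for S :: "'a bop" and x
    using that(2)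
  proof (induction rule: span_induct_alt)
    case (step c y x)
    then show ?case using that(1) by (auto simp: blinfun.add_right blinfun.scaleR_right intro!: span_add span_scale)
  qed (simp add: span_zero)
  show ?thesis
    by (rule proj_commute[OF K T]; rule closure_invariant; (rule sp)?) (use inv in auto)
qed

text \<open>Equal Gram matrices give equal norms of finite combinations, so the extension exists.
  The adjoint carries \<open>f i\<close> back to \<open>e i\<close> because the difference is
  orthogonal to the family \<open>e\<close>, and \<open>T\<close> vanishes on such vectors.\<close>

lemma isometric_extension:
  fixes e :: "'i \<Rightarrow> 'a::chilbert_space" and f :: "'i \<Rightarrow> 'a"
  assumes iso: "\<And>i j. cinner (f i) (f j) = cinner (e i) (e j)"
    and sc: "\<And>c i. \<exists>j. e j = c *\<^sub>C e i \<and> f j = c *\<^sub>C f i"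
  obtains T :: "'a bop" where "T \<in> bops" "\<And>i. T (e i) = f i"
    "\<And>x. perp_to e x \<Longrightarrow> T x = 0" "\<And>i. (adj T) (f i) = e i"
proof -
  have n: "norm (\<Sum>i\<in>F. c i *\<^sub>R f i) = norm (\<Sum>i\<in>F. c i *\<^sub>R e i)" for F c
  proof -
    have "cinner (\<Sum>i\<in>F. c i *\<^sub>R f i) (\<Sum>i\<in>F. c i *\<^sub>R f i) = cinner (\<Sum>i\<in>F. c i *\<^sub>R e i) (\<Sum>i\<in>F. c i *\<^sub>R e i)"
      by (simp add: cinner_sum_left cinner_sum_right cinner_scaleR_left cinner_scaleR_right iso)
    then have "(norm (\<Sum>i\<in>F. c i *\<^sub>R f i))\<^sup>2 = (norm (\<Sum>i\<in>F. c i *\<^sub>R e i))\<^sup>2" by (metis Re_cinner_self)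
    then show ?thesis by simp
  qed
  obtain T :: "'a bop" where T: "\<And>i. T (e i) = f i" "\<And>x. perp_to e x \<Longrightarrow> T x = 0"
    "\<And>c x. T (c *\<^sub>C x) = c *\<^sub>C T x"
    by (rule bounded_cextension[of f 1 e]) (use n sc in auto)
  have Tb: "T \<in> bops" using T(3) by (simp add: bops_def)
  show thesis
  proof (rule that[OF Tb T(1,2)])
    fix i
    define v where "v = adj T (f i) - e i"
    have "perp_to e v" unfolding perp_to_def
    proof
      fix j
      have "cinner (e j) (adj T (f i)) = cinner (f j) (f i)" by (simp add: cinner_adj'[OF Tb] T(1))
      then show "cinner (e j) v = 0" by (simp add: v_def cinner_diff_right iso)
    qed
    then have "T v = 0" "cinner v (e i) = 0"
      using T(2) unfolding perp_to_def by (auto, metis cinner_commute complex_cnj_zero)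
    then have "cinner v v = 0"
      by (subst (2) v_def) (simp add: cinner_diff_right cinner_adj'[OF Tb])
    then show "adj T (f i) = e i" by (simp add: cinner_self v_def)
  qed
qed

text \<open>The partial isometry of the polar decomposition, defined by
  \<open>h \<xi> \<mapsto> x \<xi>\<close> with \<open>h\<close> the absolute value of
  \<open>x\<close>. The last two conclusions say that its initial space and its range are no larger
  than the support and the closed range of \<open>x\<close>.\<close>

lemma partial_isometry_in_vN:
  fixes M :: "'a::chilbert_space bop set"
  assumes M: "von_neumann_algebra M" and x: "x \<in> M" "x \<noteq> 0"
  obtains w where "w \<in> M" "w \<noteq> 0" "w \<odot> (adj w \<odot> w) = w"
    "\<And>r. r \<in> bops \<Longrightarrow> adj r = r \<Longrightarrow> x \<odot> r = x \<Longrightarrow> w \<odot> r = w"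
    "\<And>q. q \<odot> x = 0 \<Longrightarrow> q \<odot> w = 0"
proof -
  note sM = vN_star_alg[OF M]
  have xb: "x \<in> bops" using x(1) star_alg_bops[OF sM] by blast
  obtain h where h: "pos_op h" "h \<odot> h = adj x \<odot> x" "\<And>T. T \<in> bops \<Longrightarrow> T \<odot> (adj x \<odot> x) = (adj x \<odot> x) \<odot> T \<Longrightarrow> T \<odot> h = h \<odot> T"
    using op_sqrt[OF pos_op_adj_comp[OF xb]] by blast
  have hb: "h \<in> bops" and hs: "adj h = h" using h(1) by (auto simp: pos_op_bops pos_op_selfadjoint)
  let ?e = "\<lambda>\<xi>. h \<xi>" and ?f = "\<lambda>\<xi>. x \<xi>"
  have iso: "cinner (?f \<xi>) (?f \<eta>) = cinner (?e \<xi>) (?e \<eta>)" for \<xi> \<eta>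
  proof -
    have "cinner (?e \<xi>) (?e \<eta>) = cinner \<xi> ((h \<odot> h) \<eta>)" using cinner_adj[OF hb, of \<xi>] hs by simp
    also have "\<dots> = cinner (?f \<xi>) (?f \<eta>)" unfolding h(2) by (simp add: cinner_adj'[OF xb])
    finally show ?thesis by simp
  qed
  have sc: "\<exists>j. ?e j = c *\<^sub>C ?e i \<and> ?f j = c *\<^sub>C ?f i" for c i
    by (intro exI[of _ "c *\<^sub>C i"]) (simp add: bops_app hb xb)
  obtain w where w: "w \<in> bops" "\<And>\<xi>. w (?e \<xi>) = ?f \<xi>" "\<And>v. perp_to ?e v \<Longrightarrow> w v = 0"
    "\<And>\<xi>. (adj w) (?f \<xi>) = ?e \<xi>"
    using isometric_extension[of ?f ?e, OF iso sc] by blast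
  have sce: "\<exists>j. ?e j = c *\<^sub>C ?e i" for c i using sc by blast
  note eqI = blinfun_eq_onI[OF sce]
  show thesis
  proof
    show "w \<in> M"
    proof (rule vN_memI[OF M w(1)])
      fix T assume T: "T \<in> commutant M"
      then have Tb: "T \<in> bops" using commutant_bops by blast
      have "T \<odot> (adj x \<odot> x) = (adj x \<odot> x) \<odot> T"
        by (rule commutantD[OF T]) (intro star_alg_mult[OF sM] star_alg_adj[OF sM] x)
      then have Th: "T \<odot> h = h \<odot> T" by (rule h(3)[OF Tb])
      have "adj T \<odot> h = h \<odot> adj T" using arg_cong[OF Th, of adj] Tb hb hs by (simp add: adj_comp)
      then have Th': "adj T (?e \<xi>) = ?e (adj T \<xi>)" for \<xi>
        by (metis blinfun_apply_blinfun_compose)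
      have Th1: "T (?e \<xi>) = ?e (T \<xi>)" for \<xi>
        using Th by (metis blinfun_apply_blinfun_compose)
      have Tx: "T (?f \<xi>) = ?f (T \<xi>)" for \<xi>
        using commutantD[OF T x(1)] by (metis blinfun_apply_blinfun_compose)
      show "w \<odot> T = T \<odot> w"
      proof (rule eqI)
        show "(w \<odot> T) (?e \<xi>) = (T \<odot> w) (?e \<xi>)" for \<xi> by (simp add: Th1 w(2) Tx)
        fix v assume v: "perp_to ?e v"
        then have "perp_to ?e (T v)"
          unfolding perp_to_def by (simp add: Th' flip: cinner_adj[OF Tb])
        then show "(w \<odot> T) v = (T \<odot> w) v" using v w(3) by simp
      qed
    qed
    show "w \<noteq> 0" using w(2) x(2) by (metis blinfun.zero_left blinfun_eqI)
    show "w \<odot> (adj w \<odot> w) = w" by (rule eqI) (auto simp: w)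
    show "w \<odot> r = w" if r: "r \<in> bops" "adj r = r" "x \<odot> r = x" for r
    proof -
      have "?e (r \<xi> - \<xi>) = 0" for \<xi>
      proof -
        have "?f (r \<xi> - \<xi>) = 0" using r(3) by (metis blinfun.diff_right blinfun_apply_blinfun_compose right_minus_eq)
        then show ?thesis using iso[of "r \<xi> - \<xi>" "r \<xi> - \<xi>"] by (simp add: cinner_self)
      qed
      then have "h \<odot> r = h" by (intro blinfun_eqI) (simp add: blinfun.diff_right)
      then have "adj (h \<odot> r) = adj h" by simp
      then have "r \<odot> h = h" unfolding adj_comp[OF hb r(1)] hs r(2) .
      then have rh: "r (?e \<xi>) = ?e \<xi>" for \<xi> by (metis blinfun_apply_blinfun_compose)
      show ?thesis
      proof (rule eqI)
        fix v assume v: "perp_to ?e v"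
        then have "perp_to ?e (r v)"
          unfolding perp_to_def using r(2) by (simp add: rh flip: cinner_adj[OF r(1)])
        then show "(w \<odot> r) v = w v" using v w(3) by simp
      qed (simp add: rh)
    qed
    show "q \<odot> w = 0" if "q \<odot> x = 0" for q
      by (rule eqI) (use arg_cong[OF that, of "\<lambda>T. T _"] in \<open>auto simp: w\<close>)
  qed
qed

text \<open>If every \<open>q \<odot> m \<odot> r\<close> vanished, the projection onto the closed
  span of all \<open>m (r \<xi>)\<close> would lie in \<open>M\<close> and in its commutant, hence
  be a scalar. It fixes a nonzero vector, so it is \<open>\<I>\<close>; but \<open>q\<close>
  vanishes on its range.\<close>

lemma factor_link:
  fixes M :: "'a::chilbert_space bop set"
  assumes M: "factor M" and q: "q \<in> M" "q \<noteq> 0" and r: "r \<in> M" "r \<noteq> 0"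
  shows "\<exists>m\<in>M. q \<odot> m \<odot> r \<noteq> 0"
proof (rule ccontr)
  assume "\<not> ?thesis"
  then have z: "q \<odot> m \<odot> r = 0" if "m \<in> M" for m using that by blast
  have vN: "von_neumann_algebra M" using M by (simp add: factor_def)
  note sM = vN_star_alg[OF vN]
  note bM = star_alg_bops[OF sM]
  define e where "e = (\<lambda>(m, \<xi>). if m \<in> M then blinfun_apply m (blinfun_apply r \<xi>) else 0)"
  have sc: "\<exists>j. e j = c *\<^sub>C e i" for c i
    by (rule exI[of _ "(fst i, c *\<^sub>C snd i)"]) (simp add: e_def bops_app bM r split_beta)
  define p where "p = proj (closure (span (range e)))"
  have K: "csub (closure (span (range e)))" "closed (closure (span (range e)))"
    by (auto intro: csub_closure csub_span sc)
  have pb: "p \<in> bops" unfolding p_def by (rule proj_bops[OF K])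
  have tM: "blinfun_apply T (e i) \<in> span (range e)" if T: "T \<in> M" for T i
  proof -
    obtain m \<xi> where i: "i = (m, \<xi>)" by (cases i)
    have "blinfun_apply T (e i) = e (if m \<in> M then T \<odot> m else m, \<xi>)"
      using star_alg_mult[OF sM T] by (simp add: i e_def)
    then show ?thesis by (simp add: span_base)
  qed
  have tM': "blinfun_apply T (e i) \<in> span (range e)" if T: "T \<in> commutant M" for T i
  proof -
    obtain m \<xi> where i: "i = (m, \<xi>)" by (cases i)
    have "m \<in> M \<Longrightarrow> T \<odot> (m \<odot> r) = (m \<odot> r) \<odot> T" using star_alg_mult[OF sM _ r(1)] commutantD[OF T] by blast
    then have "m \<in> M \<Longrightarrow> blinfun_apply T (blinfun_apply m (blinfun_apply r \<xi>)) = blinfun_apply m (blinfun_apply r (blinfun_apply T \<xi>))"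
      by (metis blinfun_apply_blinfun_compose)
    then have "blinfun_apply T (e i) = e (m, blinfun_apply T \<xi>)" by (simp add: i e_def)
    then show ?thesis by (simp add: span_base)
  qed
  have "p \<in> M"
  proof (rule vN_memI[OF vN pb])
    fix T assume T: "T \<in> commutant M"
    show "p \<odot> T = T \<odot> p" unfolding p_def
      by (rule proj_span_commute[OF sc])
         (use T tM' commutant_bops[of M] star_alg_adj[OF vN_commutant_star_alg[OF vN]] in auto)
  qed
  moreover have "p \<in> commutant M"
  proof (rule commutantI[OF pb])
    fix T assume T: "T \<in> M"
    show "p \<odot> T = T \<odot> p" unfolding p_def
      by (rule proj_span_commute[OF sc]) (use T tM bM star_alg_adj[OF sM] in auto)
  qed
  ultimately obtain c where c: "p = scale_op c \<I>" using M by (auto simp: factor_def)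
  have eK: "e i \<in> closure (span (range e))" for i by (rule subsetD[OF closure_subset]) (simp add: span_base)
  obtain \<xi> where \<xi>: "blinfun_apply r \<xi> \<noteq> 0" using r(2) blinfun_eqI[of r 0] by auto
  have "e (\<I>, \<xi>) = blinfun_apply r \<xi>" using star_alg_one[OF sM] by (simp add: e_def)
  then have "blinfun_apply p (blinfun_apply r \<xi>) = blinfun_apply r \<xi>" unfolding p_def using proj_id[OF K] eK by metis
  then have "(c - 1) *\<^sub>C blinfun_apply r \<xi> = 0" using scaleC_add_left[of c "-1" "blinfun_apply r \<xi>"] by (simp add: c)
  then have "norm ((c - 1) *\<^sub>C blinfun_apply r \<xi>) = 0" by simp
  then have "c = 1" using \<xi> by simp
  then have p1: "blinfun_apply p x = x" for x by (simp add: c)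
  have "q = 0"
  proof (rule blinfun_eqI)
    fix x
    have "x \<in> closure (span (range e))" using proj_mem[OF K, of x] p1[of x] by (simp add: p_def)
    moreover have "blinfun_apply q (e i) = blinfun_apply 0 (e i)" for i
    proof -
      obtain m \<xi> where i: "i = (m, \<xi>)" by (cases i)
      show ?thesis using arg_cong[OF z[of m], of "\<lambda>T. blinfun_apply T \<xi>"] by (auto simp: i e_def)
    qed
    ultimately show "blinfun_apply q x = blinfun_apply 0 x" by (rule blinfun_eq_closure_span[rotated])
  qed
  with q(2) show False by simp
qed

text \<open>The range projections of the \<open>w\<close> are mutually orthogonal, so their sum is a
  projection, whose mass under a state is at most one.\<close>

lemma state_bound_orthogonal:
  fixes M :: "'a::chilbert_space bop set"
  assumes M: "star_alg M" and \<phi>: "faithful_normal_state M \<phi>"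
    and F: "finite F" "F \<subseteq> M" and pi: "\<And>w. w \<in> F \<Longrightarrow> w \<odot> (adj w \<odot> w) = w"
    and orth: "\<And>w w'. w \<in> F \<Longrightarrow> w' \<in> F \<Longrightarrow> w \<noteq> w' \<Longrightarrow> adj w \<odot> w' = 0"
  shows "(\<Sum>w\<in>F. Re (\<phi> (w \<odot> adj w))) \<le> 1"
proof -
  have add: "\<phi> (x + y) = \<phi> x + \<phi> y" if "x \<in> M" "y \<in> M" for x y
    using \<phi> that by (auto simp: faithful_normal_state_def)
  have sc: "\<phi> (scale_op c x) = c * \<phi> x" if "x \<in> M" for c x
    using \<phi> that by (auto simp: faithful_normal_state_def)
  have Fb: "w \<in> bops" "w \<in> M" if "w \<in> F" for w using that F(2) star_alg_bops[OF M] by auto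
  have m: "w \<odot> adj w \<in> M" if "w \<in> F" for w using Fb[OF that] by (auto intro: star_alg_mult[OF M] star_alg_adj[OF M])
  define s where "s = (\<Sum>w\<in>F. w \<odot> adj w)"
  have sM: "s \<in> M" unfolding s_def by (rule star_alg_sum[OF M m])
  have sb: "s \<in> bops" by (rule star_alg_bops[OF M sM])
  have sadj: "adj s = s"
    using adj_sum[of F "\<lambda>w. w \<odot> adj w"] Fb(1) by (simp add: s_def adj_comp cong: sum.cong)
  have "s \<odot> s = s"
  proof -
    have "(w \<odot> adj w) \<odot> s = w \<odot> adj w" if w: "w \<in> F" for w
    proof -
      have "(w \<odot> adj w) \<odot> s = (\<Sum>w'\<in>F. if w' = w then w \<odot> adj w else 0)"
        unfolding s_def comp_sum_right
      proof (rule sum.cong[OF refl])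
        fix w' assume w': "w' \<in> F"
        have "(w \<odot> adj w) \<odot> (w' \<odot> adj w') = w \<odot> (adj w \<odot> w') \<odot> adj w'" by (simp add: comp_assoc)
        then show "(w \<odot> adj w) \<odot> (w' \<odot> adj w') = (if w' = w then w \<odot> adj w else 0)"
          using orth[OF w w'] pi[OF w] by auto
      qed
      then show ?thesis using w F(1) by simp
    qed
    then show ?thesis by (subst (1) s_def) (simp add: comp_sum_left, simp add: s_def)
  qed
  then have "adj (\<I> - s) \<odot> (\<I> - s) = \<I> - s" by (simp add: adj_diff sb sadj comp_diff_left comp_diff_right)
  moreover have "\<phi> (adj (\<I> - s) \<odot> (\<I> - s)) \<in> \<real>\<^sub>\<ge>\<^sub>0"
    using \<phi> star_alg_diff[OF M star_alg_one[OF M] sM] by (auto simp: faithful_normal_state_def)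
  ultimately have "Re (\<phi> (\<I> - s)) \<ge> 0" by (simp add: complex_nonneg_Reals_iff)
  moreover have "\<phi> ((\<I> - s) + s) = \<phi> (\<I> - s) + \<phi> s"
    by (rule add[OF star_alg_diff[OF M star_alg_one[OF M] sM] sM])
  then have "1 = \<phi> (\<I> - s) + \<phi> s" using \<phi> by (simp add: faithful_normal_state_def)
  moreover have "\<phi> (\<Sum>w\<in>G. w \<odot> adj w) = (\<Sum>w\<in>G. \<phi> (w \<odot> adj w))" if "G \<subseteq> F" for G
    using finite_subset[OF that F(1)] that
  proof (induction G)
    case empty
    then show ?case using sc[OF star_alg_zero[OF M], of 0] by simp
  next
    case (insert w G)
    then show ?case using add[OF m star_alg_sum[OF M, of G "\<lambda>w. w \<odot> adj w"]] m by (simp add: subset_iff)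
  qed
  then have "\<phi> s = (\<Sum>w\<in>F. \<phi> (w \<odot> adj w))" unfolding s_def by blast
  ultimately have "1 = Re (\<phi> (\<I> - s)) + (\<Sum>w\<in>F. Re (\<phi> (w \<odot> adj w)))"
    by (metis Re_sum one_complex.simps(1) plus_complex.simps(1))
  with \<open>Re (\<phi> (\<I> - s)) \<ge> 0\<close> show ?thesis by linarith
qed

text \<open>Faithfulness gives each range projection positive mass, while the total mass is bounded
  by one.\<close>

lemma orthogonal_partial_isometries_countable:
  fixes M :: "'a::chilbert_space bop set"
  assumes M: "star_alg M" and \<phi>: "faithful_normal_state M \<phi>"
    and X: "X \<subseteq> M" and pi: "\<And>w. w \<in> X \<Longrightarrow> w \<odot> (adj w \<odot> w) = w \<and> w \<noteq> 0"
    and orth: "\<And>w w'. w \<in> X \<Longrightarrow> w' \<in> X \<Longrightarrow> w \<noteq> w' \<Longrightarrow> adj w \<odot> w' = 0"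
    shows "countable X"
proof -
  have pos: "Re (\<phi> (w \<odot> adj w)) > 0" if "w \<in> X" for w
  proof -
    have b: "w \<in> bops" "w \<in> M" using that X star_alg_bops[OF M] by auto
    have a: "adj w \<in> M" using b star_alg_adj[OF M] by blast
    have "\<phi> (adj (adj w) \<odot> adj w) \<in> \<real>\<^sub>\<ge>\<^sub>0" "\<phi> (adj (adj w) \<odot> adj w) = 0 \<longrightarrow> adj w = 0"
      using \<phi> a by (auto simp: faithful_normal_state_def)
    moreover have "adj w \<noteq> 0" using pi[OF that] b(1) adj_adj[of w] by (metis adj_0)
    ultimately have "Im (\<phi> (w \<odot> adj w)) = 0" "Re (\<phi> (w \<odot> adj w)) \<ge> 0" "\<phi> (w \<odot> adj w) \<noteq> 0"
      using b(1) by (auto simp: complex_nonneg_Reals_iff)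
    then show ?thesis by (auto simp: complex_eq_iff)
  qed
  have "(\<lambda>w. Re (\<phi> (w \<odot> adj w))) summable_on X"
  proof (rule nonneg_bdd_above_summable_on)
    show "bdd_above (sum (\<lambda>w. Re (\<phi> (w \<odot> adj w))) ` {F. F \<subseteq> X \<and> finite F})"
    proof (rule bdd_aboveI[of _ 1])
      fix s assume "s \<in> sum (\<lambda>w. Re (\<phi> (w \<odot> adj w))) ` {F. F \<subseteq> X \<and> finite F}"
      then obtain F where F: "F \<subseteq> X" "finite F" "s = (\<Sum>w\<in>F. Re (\<phi> (w \<odot> adj w)))" by blast
      show "s \<le> 1" unfolding F(3)
        by (rule state_bound_orthogonal[OF M \<phi> F(2)]) (use F(1) X pi orth in blast)+
    qed
  qed (use pos in \<open>auto simp: less_imp_le\<close>)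
  then have "(\<lambda>w. norm (Re (\<phi> (w \<odot> adj w)))) summable_on X"
    by (rule summable_on_cong[THEN iffD1, rotated]) (use pos in \<open>simp add: less_imp_le\<close>)
  then have "countable {w \<in> X. Re (\<phi> (w \<odot> adj w)) \<noteq> 0}" by (rule abs_summable_countable)
  moreover have "{w \<in> X. Re (\<phi> (w \<odot> adj w)) \<noteq> 0} = X" using pos by force
  ultimately show ?thesis by simp
qed

text \<open>A \<open>v\<close> with initial projection \<open>p\<close> and range properly inside
  \<open>p\<close> acts as a shift. The gap \<open>r = p - v \<odot> adj v\<close> is wandering: its
  images under the powers of \<open>v\<close> are infinitely many orthogonal copies of
  \<open>r\<close> below \<open>p\<close>.\<close>

lemma infinite_projection_shift:
  fixes M :: "'a::chilbert_space bop set"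
  assumes sM: "star_alg M" and p: "proj_in M p" and nf: "\<not> finite_proj M p"
  obtains r F where "r \<in> M" "adj r = r" "r \<noteq> 0" "r \<odot> r = r" "\<And>n::nat. F n \<in> M" "\<And>n. p \<odot> F n = F n"
    "\<And>n m. adj (F n) \<odot> F m = (if n = m then r else 0)"
proof -
  note bM = star_alg_bops[OF sM]
  have pM: "p \<in> M" "adj p = p" "p \<odot> p = p" using p by (auto simp: proj_in_def)
  obtain v where v: "v \<in> M" "adj v \<odot> v = p" "p \<odot> (v \<odot> adj v) = v \<odot> adj v" "v \<odot> adj v \<noteq> p"
    using p nf by (auto simp: finite_proj_def)
  have vb: "v \<in> bops" and pb: "p \<in> bops" using v(1) pM(1) bM by auto
  have vp: "v \<odot> p = v"
  proof -
    have "adj (v - v \<odot> p) \<odot> (v - v \<odot> p) = (\<I> - p) \<odot> (adj v \<odot> v) \<odot> (\<I> - p)"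
      by (simp add: adj_diff adj_comp vb pb pM(2) comp_diff_left comp_diff_right comp_assoc)
    also have "\<dots> = 0" by (simp add: v(2) comp_diff_left comp_diff_right pM(3))
    finally have "v - v \<odot> p = 0" by (rule adj_comp_zero[rotated]) (simp add: vb pb)
    then show ?thesis by simp
  qed
  have pv: "p \<odot> v = v"
  proof -
    have "p \<odot> (v \<odot> (adj v \<odot> v)) = v \<odot> (adj v \<odot> v)" using arg_cong[OF v(3), of "\<lambda>T. T \<odot> v"] by (simp add: comp_assoc)
    then show ?thesis by (simp add: v(2) vp)
  qed
  define r where "r = p - v \<odot> adj v"
  have rM: "r \<in> M" unfolding r_def by (intro star_alg_diff[OF sM] star_alg_mult[OF sM] star_alg_adj[OF sM] pM v)
  have ra: "adj r = r" by (simp add: r_def adj_diff adj_comp vb pb pM)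
  have r0: "r \<noteq> 0" using v(4) by (simp add: r_def)
  have rv: "r \<odot> v = 0" by (simp add: r_def comp_diff_left comp_assoc v(2) vp pv)
  have pr: "p \<odot> r = r" by (simp add: r_def comp_diff_right pM(3) v(3))
  have rr: "r \<odot> r = r"
  proof -
    have "r \<odot> p = r" using arg_cong[OF pr, of adj] by (simp add: adj_comp pb bM[OF rM] ra pM(2))
    then show ?thesis using rv by (subst (2) r_def) (simp add: comp_diff_right flip: comp_assoc)
  qed
  define F where "F n = ((\<lambda>T. v \<odot> T) ^^ n) r" for n
  have F0: "F 0 = r" and FS: "F (Suc n) = v \<odot> F n" for n by (auto simp: F_def)
  have FM: "F n \<in> M" for n by (induction n) (auto simp: F0 FS rM v(1) star_alg_mult[OF sM])
  have pF: "p \<odot> F n = F n" for n by (induction n) (auto simp: F0 FS pr pv simp flip: comp_assoc)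
  have Fb: "F n \<in> bops" for n using FM bM by blast
  have z: "adj (F 0) \<odot> F (Suc m) = 0" for m by (simp add: F0 FS ra rv flip: comp_assoc)
  have "adj (F n) \<odot> F m = (if n = m then r else 0)" for n m
  proof (induction n arbitrary: m)
    case 0
    then show ?case by (cases m) (use z in \<open>auto simp: F0 ra rr\<close>)
  next
    case (Suc n)
    show ?case
    proof (cases m)
      case 0
      have "adj (adj (F 0) \<odot> F (Suc n)) = 0" unfolding z by simp
      then show ?thesis using 0 Fb by (simp add: adj_comp)
    next
      case (Suc k)
      have "adj (F (Suc n)) \<odot> F (Suc k) = adj (F n) \<odot> ((adj v \<odot> v) \<odot> F k)"
        by (simp add: FS adj_comp vb Fb comp_assoc)
      also have "\<dots> = adj (F n) \<odot> F k" by (simp add: v(2) pF)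
      finally show ?thesis using Suc.IH[of k] Suc by simp
    qed
  qed
  with rM ra r0 rr FM pF that show thesis by blast
qed

text \<open>The Cantor-Bernstein argument for projections. The isometry \<open>W\<close> embeds the
  whole space below \<open>p\<close>; \<open>E\<close> projects onto the closed span of the images
  of the range of \<open>q = \<I> - p\<close> under the powers of \<open>W\<close>, and
  \<open>V\<close> equals \<open>W\<close> there and the identity on the complement. By
  \<open>E = q + W \<odot> E \<odot> adj W\<close>, exactly \<open>q\<close> is removed from the
  range.\<close>

lemma schroeder_bernstein_projection:
  fixes M :: "'a::chilbert_space bop set"
  assumes vN: "von_neumann_algebra M" and p: "proj_in M p"
    and W: "W \<in> M" "adj W \<odot> W = \<I>" "p \<odot> W = W"
  obtains V where "V \<in> M" "adj V \<odot> V = \<I>" "V \<odot> adj V = p"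
proof -
  note sM = vN_star_alg[OF vN]
  note bM = star_alg_bops[OF sM]
  have pM: "p \<in> M" "adj p = p" "p \<odot> p = p" using p by (auto simp: proj_in_def)
  have pb: "p \<in> bops" and Wb: "W \<in> bops" using pM(1) W(1) bM by auto
  define q where "q = \<I> - p"
  have qM: "q \<in> M" unfolding q_def by (rule star_alg_diff[OF sM star_alg_one[OF sM] pM(1)])
  have qb: "q \<in> bops" using qM bM by blast
  have qq: "q \<odot> q = q" by (simp add: q_def comp_diff_left comp_diff_right pM)
  have qa: "adj q = q" by (simp add: q_def adj_diff pb pM)
  have qW: "q \<odot> W = 0" by (simp add: q_def comp_diff_left W(3))
  have Wq: "adj W \<odot> q = 0" using arg_cong[OF qW, of adj] by (simp add: adj_comp Wb qb qa)
  define G where "G n = ((\<lambda>T. W \<odot> T) ^^ n) q" for n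
  have G0: "G 0 = q" and GS: "G (Suc n) = W \<odot> G n" for n by (auto simp: G_def)
  have GM: "G n \<in> M" for n by (induction n) (auto simp: G0 GS qM W(1) star_alg_mult[OF sM])
  have Gb: "G n \<in> bops" for n using GM bM by blast
  define e where "e = (\<lambda>(n, \<xi>). (G n) \<xi>)"
  have sc: "\<exists>j. e j = c *\<^sub>C e i" for c i
    by (rule exI[of _ "(fst i, c *\<^sub>C snd i)"]) (simp add: e_def bops_app Gb split_beta)
  have K: "csub (closure (span (range e)))" "closed (closure (span (range e)))"
    by (auto intro: csub_closure csub_span sc)
  define E where "E = proj (closure (span (range e)))"
  have Eb: "E \<in> bops" and Ea: "adj E = E" and EE: "E \<odot> E = E"
    unfolding E_def by (auto simp: proj_bops[OF K] proj_adj[OF K] proj_idem[OF K])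
  have EM: "E \<in> M"
  proof (rule vN_memI[OF vN Eb])
    fix T assume T: "T \<in> commutant M"
    have *: "T (e i) \<in> span (range e)" if T: "T \<in> commutant M" for T and i :: "nat \<times> 'a"
    proof -
      have "T \<odot> G (fst i) = G (fst i) \<odot> T" by (rule commutantD[OF T GM])
      then have "T (e i) = e (fst i, T (snd i))"
        unfolding e_def split_beta by (metis blinfun_apply_blinfun_compose fst_conv snd_conv)
      then show ?thesis by (simp add: span_base)
    qed
    show "E \<odot> T = T \<odot> E" unfolding E_def
      by (rule proj_span_commute[OF sc])
         (use T * commutant_bops[of M] star_alg_adj[OF vN_commutant_star_alg[OF vN]] in auto)
  qed
  have eK: "e i \<in> closure (span (range e))" for i by (rule subsetD[OF closure_subset]) (simp add: span_base)
  have EG: "E (G n \<xi>) = (G n) \<xi>" for n \<xi>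
    using proj_id[OF K eK[of "(n, \<xi>)"]] by (simp add: E_def e_def)
  have app: "S \<odot> T = U \<Longrightarrow> S (T x) = U x" for S T U :: "'a bop" and x
    by auto
  have main: "E = q + W \<odot> E \<odot> adj W"
  proof (rule blinfun_eq_onI[OF sc])
    fix i :: "nat \<times> 'a"
    obtain n \<xi> where i: "i = (n, \<xi>)" by (cases i)
    show "E (e i) = (q + W \<odot> E \<odot> adj W) (e i)"
    proof (cases n)
      case 0
      then show ?thesis using EG[of 0 \<xi>]
        by (simp add: i e_def G0 blinfun.add_left app[OF qq] app[OF Wq])
    next
      case (Suc m)
      then show ?thesis using EG[of "Suc m" \<xi>]
        by (simp add: i e_def GS blinfun.add_left app[OF qW] app[OF W(2)] EG)
    qed
  next
    fix x assume x: "perp_to e x"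
    have z: "cinner k x = 0" if "k \<in> closure (span (range e))" for k by (rule cinner_zero_closure_span[OF x that])
    have "E x = 0" unfolding E_def by (rule proj_zero[OF K z])
    moreover have "q x = 0"
    proof -
      have "cinner (q x) x = 0" using x unfolding perp_to_def by (metis G0 case_prod_conv e_def)
      then have "cinner (q x) (q x) = 0"
        using cinner_adj[OF qb, of x] qa app[OF qq] by (metis cinner_adj' qb)
      then show ?thesis by (simp add: cinner_self)
    qed
    moreover have "E (adj W x) = 0" unfolding E_def
    proof (rule proj_zero[OF K])
      fix k assume k: "k \<in> closure (span (range e))"
      have "perp_to e (adj W x)" unfolding perp_to_def
      proof
        fix i :: "nat \<times> 'a"
        have "W (e i) = e (Suc (fst i), snd i)" by (simp add: e_def split_beta GS)
        then show "cinner (e i) (adj W x) = 0" using x by (simp add: cinner_adj'[OF Wb] perp_to_def)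
      qed
      then show "cinner k (adj W x) = 0" using k by (rule cinner_zero_closure_span)
    qed
    ultimately show "E x = (q + W \<odot> E \<odot> adj W) x" by (simp add: blinfun.add_left)
  qed
  have EWE: "E \<odot> (W \<odot> E) = W \<odot> E"
  proof -
    have "E \<odot> (W \<odot> E) = (q \<odot> W) \<odot> E + W \<odot> (E \<odot> ((adj W \<odot> W) \<odot> E))"
      by (subst main) (simp add: comp_add_left comp_assoc)
    then show ?thesis by (simp add: qW W(2) EE)
  qed
  have EWE': "E \<odot> (adj W \<odot> E) = E \<odot> adj W"
    using arg_cong[OF EWE, of adj] by (simp add: adj_comp Eb Wb Ea comp_assoc)
  define V where "V = W \<odot> E + (\<I> - E)"
  have Va: "adj V = E \<odot> adj W + (\<I> - E)" by (simp add: V_def adj_add adj_comp adj_diff Wb Eb Ea)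
  show thesis
  proof
    show "V \<in> M" unfolding V_def
      by (intro star_alg_add[OF sM] star_alg_mult[OF sM] star_alg_diff[OF sM] star_alg_one[OF sM] W EM)
    have "adj V \<odot> V = E \<odot> ((adj W \<odot> W) \<odot> E) + (E \<odot> adj W - E \<odot> (adj W \<odot> E)) + (W \<odot> E - E \<odot> (W \<odot> E)) + (\<I> - E)"
      unfolding Va unfolding V_def by (simp add: comp_add_left comp_add_right comp_diff_left comp_diff_right comp_assoc EE)
    then show "adj V \<odot> V = \<I>" by (simp add: W(2) EE EWE EWE')
    have "V \<odot> adj V = W \<odot> E \<odot> adj W + (\<I> - E)"
      unfolding Va unfolding V_def by (simp add: comp_add_left comp_add_right comp_diff_left comp_diff_right comp_assoc)
        (simp add: EE flip: comp_assoc)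
    also have "W \<odot> E \<odot> adj W = E - q" using main by (simp add: algebra_simps)
    finally show "V \<odot> adj V = p" by (simp add: q_def)
  qed
qed

text \<open>Zorn's lemma for families with orthogonal ranges and initial projections below
  \<open>r\<close>. Were the ranges not total, \<open>factor_link\<close> would connect the
  remaining projection with \<open>r\<close>, and the polar part of the connecting element could be
  added.\<close>

lemma maximal_partial_isometries_dense:
  fixes M :: "'a::chilbert_space bop set"
  assumes M: "factor M" and r: "r \<in> M" "r \<noteq> 0" "adj r = r" "r \<odot> r = r"
  obtains X where "X \<subseteq> M" "\<And>w. w \<in> X \<Longrightarrow> w \<odot> (adj w \<odot> w) = w \<and> w \<noteq> 0 \<and> w \<odot> r = w"
    "\<And>w w'. w \<in> X \<Longrightarrow> w' \<in> X \<Longrightarrow> w \<noteq> w' \<Longrightarrow> adj w \<odot> w' = 0"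
    "\<And>x. (\<And>w \<xi>. w \<in> X \<Longrightarrow> cinner (w \<xi>) x = 0) \<Longrightarrow> x = 0"
proof -
  have vN: "von_neumann_algebra M" using M by (simp add: factor_def)
  note sM = vN_star_alg[OF vN]
  note bM = star_alg_bops[OF sM]
  define good where "good w \<longleftrightarrow> w \<in> M \<and> w \<odot> (adj w \<odot> w) = w \<and> w \<noteq> 0 \<and> w \<odot> r = w" for w
  define \<A> where "\<A> = {X. (\<forall>w\<in>X. good w) \<and> (\<forall>w\<in>X. \<forall>w'\<in>X. w \<noteq> w' \<longrightarrow> adj w \<odot> w' = 0)}"
  have "\<Union>\<C> \<in> \<A>" if "subset.chain \<A> \<C>" for \<C>
  proof -
    have "adj w \<odot> w' = 0" if w: "w \<in> X" "X \<in> \<C>" "w' \<in> Y" "Y \<in> \<C>" "w \<noteq> w'" for w w' X Y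
    proof -
      have "X \<subseteq> Y \<or> Y \<subseteq> X" "X \<in> \<A>" "Y \<in> \<A>"
        using \<open>subset.chain \<A> \<C>\<close> w by (auto simp: subset_chain_def)
      then show ?thesis using w by (auto simp: \<A>_def)
    qed
    moreover have "good w" if "w \<in> X" "X \<in> \<C>" for w X
      using \<open>subset.chain \<A> \<C>\<close> that by (auto simp: subset_chain_def \<A>_def)
    ultimately show ?thesis by (auto simp: \<A>_def)
  qed
  then obtain X where X: "X \<in> \<A>" and maxX: "\<And>Y. Y \<in> \<A> \<Longrightarrow> X \<subseteq> Y \<Longrightarrow> Y = X"
    using subset_Zorn'[of \<A>] by blast
  have good: "good w" if "w \<in> X" for w using X that by (auto simp: \<A>_def)
  have wb: "w \<in> bops" if "w \<in> X" for w using good[OF that] bM by (auto simp: good_def)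
  define e where "e = (\<lambda>(w, \<xi>). if w \<in> X then w \<xi> else 0)"
  have sc: "\<exists>j. e j = c *\<^sub>C e i" for c i
    by (rule exI[of _ "(fst i, c *\<^sub>C snd i)"]) (simp add: e_def bops_app wb split_beta)
  have K: "csub (closure (span (range e)))" "closed (closure (span (range e)))"
    by (auto intro: csub_closure csub_span sc)
  define E where "E = proj (closure (span (range e)))"
  have Eb: "E \<in> bops" and Ea: "adj E = E" and EE: "E \<odot> E = E"
    unfolding E_def by (auto simp: proj_bops[OF K] proj_adj[OF K] proj_idem[OF K])
  have EM: "E \<in> M"
  proof (rule vN_memI[OF vN Eb])
    fix T assume T: "T \<in> commutant M"
    have *: "T (e i) \<in> span (range e)" if T: "T \<in> commutant M" for T and i :: "'a bop \<times> 'a"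
    proof -
      have "fst i \<in> X \<Longrightarrow> T \<odot> fst i = fst i \<odot> T" by (rule commutantD[OF T]) (use good in \<open>auto simp: good_def\<close>)
      then have "fst i \<in> X \<Longrightarrow> T (fst i (snd i)) = fst i (T (snd i))"
        by (metis blinfun_apply_blinfun_compose)
      then have "T (e i) = e (fst i, T (snd i))"
        unfolding e_def split_beta by simp
      then show ?thesis by (simp add: span_base)
    qed
    show "E \<odot> T = T \<odot> E" unfolding E_def
      by (rule proj_span_commute[OF sc])
         (use T * commutant_bops[of M] star_alg_adj[OF vN_commutant_star_alg[OF vN]] in auto)
  qed
  have eK: "e i \<in> closure (span (range e))" for i by (rule subsetD[OF closure_subset]) (simp add: span_base)
  have Ew: "E \<odot> w = w" if "w \<in> X" for w
    by (rule blinfun_eqI) (use proj_id[OF K eK[of "(w, _)"]] that in \<open>simp add: E_def e_def\<close>)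
  have wE: "adj w \<odot> E = adj w" if "w \<in> X" for w
    using arg_cong[OF Ew[OF that], of adj] by (simp add: adj_comp Eb wb[OF that] Ea)
  have "E = \<I>"
  proof (rule ccontr)
    assume "E \<noteq> \<I>"
    then have "\<I> - E \<noteq> 0" by simp
    then obtain m where m: "m \<in> M" "(\<I> - E) \<odot> m \<odot> r \<noteq> 0"
      using factor_link[OF M star_alg_diff[OF sM star_alg_one[OF sM] EM] _ r(1,2)] by blast
    have "(\<I> - E) \<odot> m \<odot> r \<in> M"
      by (intro star_alg_mult[OF sM] star_alg_diff[OF sM] star_alg_one[OF sM] EM m r)
    then obtain w where w: "w \<in> M" "w \<noteq> 0" "w \<odot> (adj w \<odot> w) = w"
      "\<And>s. s \<in> bops \<Longrightarrow> adj s = s \<Longrightarrow> ((\<I> - E) \<odot> m \<odot> r) \<odot> s = (\<I> - E) \<odot> m \<odot> r \<Longrightarrow> w \<odot> s = w"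
      "\<And>q. q \<odot> ((\<I> - E) \<odot> m \<odot> r) = 0 \<Longrightarrow> q \<odot> w = 0"
      using partial_isometry_in_vN[OF vN _ m(2)] by blast
    have "w \<odot> r = w" by (rule w(4)) (use r bM in \<open>auto simp: comp_assoc\<close>)
    then have gw: "good w" using w by (simp add: good_def)
    have Ew0: "E \<odot> w = 0" by (rule w(5)) (simp add: comp_diff_left comp_diff_right EE flip: comp_assoc)
    have o: "adj w' \<odot> w = 0" if "w' \<in> X" for w' using wE[OF that] Ew0 by (metis comp_assoc comp_zero_right)
    have o': "adj w \<odot> w' = 0" if "w' \<in> X" for w'
      using arg_cong[OF o[OF that], of adj] wb[OF that] bM[OF w(1)] by (simp add: adj_comp)
    have "insert w X \<in> \<A>" using X gw o o' by (auto simp: \<A>_def)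
    then have "insert w X = X" by (rule maxX) blast
    then have "w \<in> X" by blast
    then have "E \<odot> w = w" by (rule Ew)
    then show False using Ew0 w(2) by simp
  qed
  show thesis
  proof
    show "X \<subseteq> M" using good by (auto simp: good_def)
    show "w \<odot> (adj w \<odot> w) = w \<and> w \<noteq> 0 \<and> w \<odot> r = w" if "w \<in> X" for w using good[OF that] by (simp add: good_def)
    show "adj w \<odot> w' = 0" if "w \<in> X" "w' \<in> X" "w \<noteq> w'" for w w' using X that by (auto simp: \<A>_def)
    fix x assume h: "\<And>w \<xi>. w \<in> X \<Longrightarrow> cinner (w \<xi>) x = 0"
    then have "perp_to e x" by (simp add: perp_to_def e_def split_beta)
    then have "E x = 0" unfolding E_def by (intro proj_zero[OF K] cinner_zero_closure_span)
    then show "x = 0" by (simp add: \<open>E = \<I>\<close>)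
  qed
qed

text \<open>The unit splits into countably many pieces, each equivalent to a part of
  \<open>r\<close>, while \<open>p\<close> contains a sequence of orthogonal copies of
  \<open>r\<close>. Placing one piece in each copy embeds the unit below \<open>p\<close>, and the
  Cantor-Bernstein argument finishes.\<close>

theorem type_III_projection_equivalent_one:
  fixes M :: "'a::chilbert_space bop set"
  assumes M: "type_III_factor M" and \<phi>: "faithful_normal_state M \<phi>"
    and p: "proj_in M p" "p \<noteq> 0"
  obtains V where "V \<in> M" "adj V \<odot> V = \<I>" "V \<odot> adj V = p"
proof -
  have fM: "factor M" and vN: "von_neumann_algebra M" using M by (auto simp: type_III_factor_def factor_def)
  note sM = vN_star_alg[OF vN]
  note bM = star_alg_bops[OF sM]
  have "\<not> finite_proj M p" using M p(2) by (auto simp: type_III_factor_def)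
  then obtain r F where r: "r \<in> M" "adj r = r" "r \<noteq> 0" "r \<odot> r = r" and F: "\<And>n::nat. F n \<in> M" "\<And>n. p \<odot> F n = F n"
    "\<And>n m. adj (F n) \<odot> F m = (if n = m then r else 0)"
    using infinite_projection_shift[OF sM p(1)] by blast
  obtain X where X: "X \<subseteq> M" "\<And>w. w \<in> X \<Longrightarrow> w \<odot> (adj w \<odot> w) = w \<and> w \<noteq> 0 \<and> w \<odot> r = w"
    "\<And>w w'. w \<in> X \<Longrightarrow> w' \<in> X \<Longrightarrow> w \<noteq> w' \<Longrightarrow> adj w \<odot> w' = 0"
    "\<And>x. (\<And>w \<xi>. w \<in> X \<Longrightarrow> cinner (w \<xi>) x = 0) \<Longrightarrow> x = 0"
    using maximal_partial_isometries_dense[OF fM r(1,3,2,4)] by blast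
  have "countable X" by (rule orthogonal_partial_isometries_countable[OF sM \<phi> X(1)]) (use X in auto)
  then have inj: "to_nat_on X w = to_nat_on X w' \<longleftrightarrow> w = w'" if "w \<in> X" "w' \<in> X" for w w'
    using that to_nat_on_inj by metis
  let ?n = "to_nat_on X"
  have wb: "w \<in> bops" if "w \<in> X" for w using X(1) bM that by blast
  have Fb: "F n \<in> bops" for n using F(1) bM by blast
  have rw: "r \<odot> adj w = adj w" if "w \<in> X" for w
  proof -
    have "adj (w \<odot> r) = adj w" using X(2)[OF that] by simp
    then show ?thesis by (simp add: adj_comp wb[OF that] bM[OF r(1)] r(2))
  qed
  define e where "e = (\<lambda>(w, \<xi>). if w \<in> X then w \<xi> else 0)"
  \<comment> \<open>The vector \<open>w \<xi>\<close> is pulled back to the initial space of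
    \<open>w\<close> and then sent into the copy of \<open>r\<close> that carries the number of
    \<open>w\<close>; countability of \<open>X\<close> provides the numbering.\<close>
  define f where "f = (\<lambda>(w, \<xi>). if w \<in> X then (F (?n w) \<odot> (adj w \<odot> w)) \<xi> else 0)"
  have iso: "cinner (f i) (f j) = cinner (e i) (e j)" for i j
  proof -
    obtain w \<xi> w' \<xi>' where ij: "i = (w, \<xi>)" "j = (w', \<xi>')" by (metis surj_pair)
    show ?thesis
    proof (cases "w \<in> X \<and> w' \<in> X")
      case True
      then have w: "w \<in> X" "w' \<in> X" by auto
      have "cinner (f i) (f j) = cinner ((adj w \<odot> w) \<xi>) ((adj (F (?n w)) \<odot> F (?n w') \<odot> (adj w' \<odot> w')) \<xi>')"
        using w by (simp add: ij f_def cinner_adj'[OF Fb])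
      also have "adj (F (?n w)) \<odot> F (?n w') \<odot> (adj w' \<odot> w') = (if w = w' then adj w' \<odot> w' else 0)"
        using w by (simp add: F(3) inj) (simp add: rw flip: comp_assoc)
      also have "cinner ((adj w \<odot> w) \<xi>) ((if w = w' then adj w' \<odot> w' else 0) \<xi>')
          = cinner (w \<xi>) ((if w = w' then w' \<odot> (adj w' \<odot> w') else 0) \<xi>')"
        by (simp add: cinner_adj[OF wb[OF w(1)]])
      also have "\<dots> = cinner (w \<xi>) (if w = w' then w' \<xi>' else 0)"
        using X(2)[OF w(2)] by simp
      also have "\<dots> = cinner (e i) (e j)"
      proof (cases "w = w'")
        case False
        have "cinner (w \<xi>) (w' \<xi>') = cinner \<xi> ((adj w \<odot> w') \<xi>')"
          by (simp add: cinner_adj'[OF wb[OF w(1)]])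
        then show ?thesis using False w X(3)[OF w False] by (simp add: ij e_def)
      qed (use w in \<open>simp add: ij e_def\<close>)
      finally show ?thesis .
    qed (auto simp: ij e_def f_def)
  qed
  have sc: "\<exists>j. e j = c *\<^sub>C e i \<and> f j = c *\<^sub>C f i" for c i
    by (rule exI[of _ "(fst i, c *\<^sub>C snd i)"]) (simp add: e_def f_def bops_app wb Fb split_beta)
  then have sce: "\<exists>j. e j = c *\<^sub>C e i" for c i by blast
  obtain W where W: "W \<in> bops" "\<And>i. W (e i) = f i" "\<And>i. (adj W) (f i) = e i"
    by (rule isometric_extension[of f e, OF iso sc]) (rule that)
  have e0: "x = 0" if "perp_to e x" for x
  proof (rule X(4))
    fix w \<xi> assume "w \<in> X"
    then show "cinner (w \<xi>) x = 0"
      using that[unfolded perp_to_def, rule_format, of "(w, \<xi>)"] by (simp add: e_def)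
  qed
  have eqI: "A = B" if "\<And>i. A (e i) = B (e i)" for A B :: "'a bop"
    by (rule blinfun_eq_onI[OF sce that], drule e0, simp)
  have WM: "W \<in> M"
  proof (rule vN_memI[OF vN W(1)])
    fix T assume T: "T \<in> commutant M"
    show "W \<odot> T = T \<odot> W"
    proof (rule eqI)
      fix i :: "'a bop \<times> 'a"
      obtain w \<xi> where i: "i = (w, \<xi>)" by (cases i)
      have "w \<in> X \<Longrightarrow> T \<odot> w = w \<odot> T" using commutantD[OF T] X(1) by blast
      then have 1: "T (e i) = e (w, T \<xi>)"
        by (auto simp: i e_def) (metis blinfun_apply_blinfun_compose)
      have "w \<in> X \<Longrightarrow> T \<odot> (F (?n w) \<odot> (adj w \<odot> w)) = (F (?n w) \<odot> (adj w \<odot> w)) \<odot> T"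
        by (rule commutantD[OF T]) (use X(1) in \<open>auto intro!: star_alg_mult[OF sM] star_alg_adj[OF sM] F(1)\<close>)
      then have 2: "T (f i) = f (w, T \<xi>)"
        unfolding i f_def by (auto simp del: blinfun_apply_blinfun_compose) (metis blinfun_apply_blinfun_compose)
      show "(W \<odot> T) (e i) = (T \<odot> W) (e i)" by (simp add: 1 2 W(2))
    qed
  qed
  have "adj W \<odot> W = \<I>" by (rule eqI) (simp add: W)
  moreover have "p \<odot> W = W"
  proof (rule eqI)
    fix i :: "'a bop \<times> 'a"
    obtain w \<xi> where i: "i = (w, \<xi>)" by (cases i)
    have "p (F n x) = F n x" for n x
      using F(2)[of n] by (metis blinfun_apply_blinfun_compose)
    then show "(p \<odot> W) (e i) = W (e i)" by (simp add: W(2) f_def i)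
  qed
  ultimately show thesis using schroeder_bernstein_projection[OF vN p(1) WM] that by blast
qed

section \<open>Decomposition into irreducibles\<close>

lemma EndD:
  assumes "\<rho> \<in> End M"
  shows End_mem: "x \<in> M \<Longrightarrow> \<rho> x \<in> M"
    and End_add: "x \<in> M \<Longrightarrow> y \<in> M \<Longrightarrow> \<rho> (x + y) = \<rho> x + \<rho> y"
    and End_mult: "x \<in> M \<Longrightarrow> y \<in> M \<Longrightarrow> \<rho> (x \<odot> y) = \<rho> x \<odot> \<rho> y"
    and End_scale: "x \<in> M \<Longrightarrow> \<rho> (scale_op c x) = scale_op c (\<rho> x)"
    and End_adj: "x \<in> M \<Longrightarrow> \<rho> (adj x) = adj (\<rho> x)"
    and End_one: "\<rho> \<I> = \<I>"
    and End_cont: "continuous_map (subtopology sigma_weak M) sigma_weak \<rho>"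
  using normal_homsD[of \<rho> M M] normal_homs_cont'[of \<rho> M M] assms by (auto simp: End_def)

lemma intertwinersD:
  "T \<in> intertwiners M \<rho> \<sigma> \<Longrightarrow> T \<in> M"
  "T \<in> intertwiners M \<rho> \<sigma> \<Longrightarrow> x \<in> M \<Longrightarrow> T \<odot> \<rho> x = \<sigma> x \<odot> T"
  by (auto simp: intertwiners_def)

lemma intertwinersI: "T \<in> M \<Longrightarrow> (\<And>x. x \<in> M \<Longrightarrow> T \<odot> \<rho> x = \<sigma> x \<odot> T) \<Longrightarrow> T \<in> intertwiners M \<rho> \<sigma>"
  by (auto simp: intertwiners_def)

lemma intertwiners_adj:
  assumes M: "star_alg M" and "\<rho> \<in> End M" "\<sigma> \<in> End M" "T \<in> intertwiners M \<rho> \<sigma>"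
  shows "adj T \<in> intertwiners M \<sigma> \<rho>"
proof (rule intertwinersI)
  note T = intertwinersD[OF assms(4)]
  show "adj T \<in> M" using T star_alg_adj[OF M] by blast
  fix x assume x: "x \<in> M"
  have "adj (T \<odot> \<rho> (adj x)) = adj (\<sigma> (adj x) \<odot> T)" using T(2)[OF star_alg_adj[OF M x]] by simp
  then show "adj T \<odot> \<sigma> x = \<rho> x \<odot> adj T"
    using x T(1) star_alg_bops[OF M] End_mem[OF assms(2)] End_mem[OF assms(3)] star_alg_adj[OF M]
    by (simp add: adj_comp End_adj[OF assms(2)] End_adj[OF assms(3)])
qed

lemma intertwiners_comp:
  assumes "star_alg M" "S \<in> intertwiners M \<sigma> \<tau>" "T \<in> intertwiners M \<rho> \<sigma>"
  shows "S \<odot> T \<in> intertwiners M \<rho> \<tau>"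
proof (rule intertwinersI)
  show "S \<odot> T \<in> M" using assms intertwinersD(1) star_alg_mult by metis
  fix x assume x: "x \<in> M"
  show "(S \<odot> T) \<odot> \<rho> x = \<tau> x \<odot> (S \<odot> T)"
    using intertwinersD(2)[OF assms(2) x] intertwinersD(2)[OF assms(3) x] by (metis comp_assoc)
qed

text \<open>The self-intertwiners are the relative commutant of the image of \<open>\<pi>\<close>,
  that is, the commutant of the union of \<open>commutant M\<close> with that image.\<close>

lemma von_neumann_algebra_intertwiners:
  assumes vN: "von_neumann_algebra M" and \<pi>: "\<pi> \<in> End M"
  shows "von_neumann_algebra (intertwiners M \<pi> \<pi>)"
proof -
  note sM = vN_star_alg[OF vN]
  have e: "intertwiners M \<pi> \<pi> = commutant (commutant M \<union> \<pi> ` M)"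
  proof (intro equalityI subsetI)
    fix T assume T: "T \<in> intertwiners M \<pi> \<pi>"
    show "T \<in> commutant (commutant M \<union> \<pi> ` M)"
      by (rule commutantI) (use intertwinersD[OF T] star_alg_bops[OF sM] commutantD in fastforce)+
  next
    fix T assume T: "T \<in> commutant (commutant M \<union> \<pi> ` M)"
    then have Tb: "T \<in> bops" using commutant_bops by blast
    show "T \<in> intertwiners M \<pi> \<pi>"
    proof (rule intertwinersI)
      show "T \<in> M" by (rule vN_memI[OF vN Tb]) (rule commutantD[OF T], simp)
    qed (rule commutantD[OF T], simp)
  qed
  show ?thesis unfolding e
  proof (rule von_neumann_algebra_commutant)
    show "commutant M \<union> \<pi> ` M \<subseteq> bops" using commutant_bops End_mem[OF \<pi>] star_alg_bops[OF sM] by auto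
    fix x assume "x \<in> commutant M \<union> \<pi> ` M"
    then show "adj x \<in> commutant M \<union> \<pi> ` M"
      using star_alg_adj[OF vN_commutant_star_alg[OF vN]] star_alg_adj[OF sM] End_adj[OF \<pi>]
      by (auto simp: image_iff) (metis)
  qed
qed

text \<open>With \<open>H\<close> the absolute value of \<open>A\<close>, the product of
  \<open>H - A\<close> and \<open>H + A\<close> is zero. The range projection of
  \<open>H + A\<close> lies in \<open>Q\<close>, so it is trivial: either \<open>A = - H\<close> or
  \<open>A = H\<close>.\<close>

lemma no_projections_imp_order_dichotomy:
  fixes Q :: "'a::chilbert_space bop set"
  assumes vN: "von_neumann_algebra Q" and triv: "\<And>e. proj_in Q e \<Longrightarrow> e = 0 \<or> e = \<I>"
    and A: "A \<in> Q" "adj A = A"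
  shows "(\<forall>x. Re (cinner x (blinfun_apply A x)) \<le> 0) \<or> (\<forall>x. Re (cinner x (blinfun_apply A x)) \<ge> 0)"
proof -
  note sQ = vN_star_alg[OF vN]
  have Ab: "A \<in> bops" using A star_alg_bops[OF sQ] by blast
  obtain H where H: "pos_op H" "H \<odot> H = adj A \<odot> A" "\<And>T. T \<in> bops \<Longrightarrow> T \<odot> (adj A \<odot> A) = (adj A \<odot> A) \<odot> T \<Longrightarrow> T \<odot> H = H \<odot> T"
    using op_sqrt[OF pos_op_adj_comp[OF Ab]] by blast
  have Hb: "H \<in> bops" and Ha: "adj H = H" using H(1) by (auto simp: pos_op_bops pos_op_selfadjoint)
  have HQ: "H \<in> Q"
  proof (rule vN_memI[OF vN Hb])
    fix T assume T: "T \<in> commutant Q"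
    have "T \<odot> H = H \<odot> T"
      by (rule H(3)) (use T commutant_bops commutantD[OF T star_alg_mult[OF sQ star_alg_adj[OF sQ A(1)] A(1)]] in auto)
    then show "H \<odot> T = T \<odot> H" by simp
  qed
  have AH: "A \<odot> H = H \<odot> A" by (rule H(3)) (use Ab A(2) in \<open>auto simp: comp_assoc\<close>)
  define Bp where "Bp = H + A"
  have BQ: "Bp \<in> Q" unfolding Bp_def by (rule star_alg_add[OF sQ HQ A(1)])
  have Bb: "Bp \<in> bops" using BQ star_alg_bops[OF sQ] by blast
  have CB: "(H - A) \<odot> Bp = 0" using H(2) A(2) AH by (simp add: Bp_def comp_diff_left comp_add_right)
  let ?e = "blinfun_apply Bp"
  have sc: "\<exists>j. ?e j = c *\<^sub>C ?e i" for c i by (rule exI[of _ "c *\<^sub>C i"]) (simp add: bops_app Bb)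
  have K: "csub (closure (span (range ?e)))" "closed (closure (span (range ?e)))"
    by (auto intro: csub_closure csub_span sc)
  define E where "E = proj (closure (span (range ?e)))"
  have Eb: "E \<in> bops" unfolding E_def by (rule proj_bops[OF K])
  have EQ: "E \<in> Q"
  proof (rule vN_memI[OF vN Eb])
    fix T assume T: "T \<in> commutant Q"
    have *: "blinfun_apply T (?e i) \<in> span (range ?e)" if T: "T \<in> commutant Q" for T i
    proof -
      have "T \<odot> Bp = Bp \<odot> T" by (rule commutantD[OF T BQ])
      then have "blinfun_apply T (?e i) = ?e (blinfun_apply T i)" by (metis blinfun_apply_blinfun_compose)
      then show ?thesis by (simp add: span_base)
    qed
    show "E \<odot> T = T \<odot> E" unfolding E_def
      by (rule proj_span_commute[OF sc])
         (use T * commutant_bops[of Q] star_alg_adj[OF vN_commutant_star_alg[OF vN]] in auto)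
  qed
  have "proj_in Q E" by (simp add: proj_in_def EQ) (simp add: E_def proj_adj[OF K] proj_idem[OF K])
  then consider "E = 0" | "E = \<I>" using triv by blast
  then show ?thesis
  proof cases
    case 1
    have "?e x = 0" for x
    proof -
      have "?e x \<in> closure (span (range ?e))" by (rule subsetD[OF closure_subset]) (simp add: span_base)
      then have "blinfun_apply E (?e x) = ?e x" unfolding E_def by (rule proj_id[OF K])
      then show ?thesis by (simp add: 1)
    qed
    then have "blinfun_apply A x = - blinfun_apply H x" for x
      by (simp add: Bp_def blinfun.add_left eq_neg_iff_add_eq_0 add.commute)
    then show ?thesis using pos_op_Re[OF H(1)] by simp
  next
    case 2
    have "H - A = 0"
    proof (rule blinfun_eqI)
      fix x
      have "x \<in> closure (span (range ?e))" using proj_mem[OF K, of x] 2 by (simp add: E_def)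
      moreover have "blinfun_apply (H - A) (?e i) = blinfun_apply 0 (?e i)" for i
        using arg_cong[OF CB, of "\<lambda>T. blinfun_apply T i"] by simp
      ultimately show "blinfun_apply (H - A) x = blinfun_apply 0 x" by (rule blinfun_eq_closure_span[rotated])
    qed
    then have "A = H" by simp
    then show ?thesis using pos_op_Re[OF H(1)] by simp
  qed
qed

text \<open>By the dichotomy every real \<open>c\<close> is an upper or a lower bound of the
  quadratic form of \<open>T\<close> relative to the squared norm. The infimum of the upper bounds
  is then both, so the form is a multiple of the squared norm.\<close>

lemma no_projections_imp_selfadjoint_scalar:
  fixes Q :: "'a::chilbert_space bop set"
  assumes vN: "von_neumann_algebra Q" and triv: "\<And>e. proj_in Q e \<Longrightarrow> e = 0 \<or> e = \<I>"
    and T: "T \<in> Q" "adj T = T"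
  obtains c where "T = scale_op c \<I>"
proof (cases "\<exists>v::'a. v \<noteq> 0")
  case False
  then have "T = scale_op 0 \<I>" by (intro blinfun_eqI) simp
  then show ?thesis by (rule that)
next
  case True
  then obtain v :: 'a where v: "v \<noteq> 0" by blast
  note sQ = vN_star_alg[OF vN]
  have Tb: "T \<in> bops" using T star_alg_bops[OF sQ] by blast
  define q where "q x = Re (cinner x (T x))" for x
  have dich: "(\<forall>x. q x \<le> c * (norm x)\<^sup>2) \<or> (\<forall>x. q x \<ge> c * (norm x)\<^sup>2)" for c :: real
  proof -
    have "T - c *\<^sub>R \<I> \<in> Q" "adj (T - c *\<^sub>R \<I>) = T - c *\<^sub>R \<I>"
      using T Tb by (auto simp: adj_diff adj_scaleR intro!: star_alg_diff[OF sQ] star_alg_scaleR[OF sQ] star_alg_one[OF sQ])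
    from no_projections_imp_order_dichotomy[OF vN triv this] show ?thesis
      by (simp add: q_def blinfun.diff_left blinfun.scaleR_left cinner_diff_right cinner_scaleR_right Re_cinner_self)
  qed
  define S where "S = {c. \<forall>x. q x \<le> c * (norm x)\<^sup>2}"
  have "q x \<le> norm T * (norm x)\<^sup>2" for x
  proof -
    have "q x \<le> cmod (cinner x (T x))" unfolding q_def by (rule complex_Re_le_cmod)
    also have "\<dots> \<le> norm x * norm (T x)" by (rule cinner_cauchy_schwarz)
    also have "\<dots> \<le> norm x * (norm T * norm x)" by (intro mult_left_mono norm_blinfun) simp
    finally show ?thesis by (simp add: power2_eq_square mult_ac)
  qed
  then have S0: "norm T \<in> S" by (simp add: S_def)
  have nv: "(norm v)\<^sup>2 > 0" using v by simp
  have lb: "q v / (norm v)\<^sup>2 \<le> c" if "c \<in> S" for c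
    using that nv by (simp add: S_def pos_divide_le_eq)
  define c0 where "c0 = Inf S"
  have bdd: "bdd_below S" using lb by (rule bdd_belowI)
  have up: "q x \<le> c0 * (norm x)\<^sup>2" for x
  proof (rule field_le_epsilon)
    fix e :: real assume e: "e > 0"
    have p: "(norm x)\<^sup>2 + 1 > 0" by (simp add: add_nonneg_pos)
    \<comment> \<open>The slack is divided by \<open>(norm x)\<^sup>2 + 1\<close> so that it
      contributes at most \<open>e\<close> for every \<open>x\<close>, the zero vector
      included.\<close>
    have "c0 < c0 + e / ((norm x)\<^sup>2 + 1)" using e p by simp
    then obtain c where c: "c \<in> S" "c < c0 + e / ((norm x)\<^sup>2 + 1)"
      using cInf_lessD[of S] S0 unfolding c0_def by blast
    have "q x \<le> c * (norm x)\<^sup>2" using c(1) by (simp add: S_def)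
    also have "\<dots> \<le> (c0 + e / ((norm x)\<^sup>2 + 1)) * (norm x)\<^sup>2" using c(2) by (intro mult_right_mono) auto
    also have "\<dots> = c0 * (norm x)\<^sup>2 + e * ((norm x)\<^sup>2 / ((norm x)\<^sup>2 + 1))" by (simp add: algebra_simps)
    also have "\<dots> \<le> c0 * (norm x)\<^sup>2 + e * 1" using e p by (intro add_left_mono mult_left_mono) (auto simp: pos_divide_le_eq)
    finally show "q x \<le> c0 * (norm x)\<^sup>2 + e" by simp
  qed
  have lo: "c0 * (norm x)\<^sup>2 \<le> q x" for x
  proof (rule field_le_epsilon)
    fix e :: real assume e: "e > 0"
    have p: "(norm x)\<^sup>2 + 1 > 0" by (simp add: add_nonneg_pos)
    define c where "c = c0 - e / ((norm x)\<^sup>2 + 1)"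
    have "c < c0" using e p by (simp add: c_def)
    then have "c \<notin> S" using cInf_lower[OF _ bdd, of c] unfolding c0_def by linarith
    then have "c * (norm x)\<^sup>2 \<le> q x" using dich[of c] by (auto simp: S_def)
    moreover have "c0 * (norm x)\<^sup>2 = c * (norm x)\<^sup>2 + e * ((norm x)\<^sup>2 / ((norm x)\<^sup>2 + 1))" by (simp add: c_def algebra_simps)
    moreover have "e * ((norm x)\<^sup>2 / ((norm x)\<^sup>2 + 1)) \<le> e * 1" using e p by (intro mult_left_mono) (auto simp: pos_divide_le_eq)
    ultimately show "c0 * (norm x)\<^sup>2 \<le> q x + e" by linarith
  qed
  have "T - scale_op (of_real c0) \<I> = 0"
  proof (rule bops_zero_if_quadratic_zero)
    fix x
    have "cinner x (T x) = of_real (q x)"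
      by (simp add: complex_eq_iff q_def selfadjoint_quadratic_real[OF Tb T(2)])
    moreover have "q x = c0 * (norm x)\<^sup>2" using up lo by (simp add: order_antisym)
    ultimately show "cinner x ((T - scale_op (of_real c0) \<I>) x) = 0"
      by (simp add: blinfun.diff_left cinner_diff_right cinner_scaleC_right cinner_self)
  qed (simp add: Tb)
  then show ?thesis using that[of "of_real c0"] by simp
qed

lemma no_projections_imp_scalars:
  fixes Q :: "'a::chilbert_space bop set"
  assumes vN: "von_neumann_algebra Q" and triv: "\<And>e. proj_in Q e \<Longrightarrow> e = 0 \<or> e = \<I>"
  shows "Q = range (\<lambda>c. scale_op c \<I>)"
proof (intro equalityI subsetI)
  note sQ = vN_star_alg[OF vN]
  fix T assume T: "T \<in> Q"
  have Tb: "T \<in> bops" using T star_alg_bops[OF sQ] by blast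
  note cl = star_alg_closed[OF sQ]
  obtain a where a: "T + adj T = scale_op a \<I>"
    by (rule no_projections_imp_selfadjoint_scalar[OF vN triv, of "T + adj T"]) (use T Tb cl in \<open>auto simp: adj_add add.commute\<close>)
  obtain b where b: "scale_op \<i> (T - adj T) = scale_op b \<I>"
    by (rule no_projections_imp_selfadjoint_scalar[OF vN triv, of "scale_op \<i> (T - adj T)"])
       (use T Tb cl in \<open>auto simp: adj_diff adj_scale_op scale_op_diff scale_op_add_left intro!: blinfun_eqI simp: blinfun.bilinear_simps\<close>)
  have "T - adj T = scale_op (- \<i>) (scale_op \<i> (T - adj T))" by simp
  then have "T - adj T = scale_op (- \<i> * b) \<I>" unfolding b by simp
  then have "(T + adj T) + (T - adj T) = scale_op (a - \<i> * b) \<I>" unfolding a by (simp add: scale_op_add_left[symmetric])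
  then have "scale_op (1/2) ((T + adj T) + (T - adj T)) = scale_op ((1/2) * (a - \<i> * b)) \<I>" by simp
  moreover have "scale_op (1/2) ((T + adj T) + (T - adj T)) = T"
    by (rule blinfun_eqI) (simp add: blinfun.bilinear_simps scaleC_add_left[symmetric] scaleC_add_right)
  ultimately show "T \<in> range (\<lambda>c. scale_op c \<I>)" by (metis rangeI)
next
  fix T :: "'a bop" assume "T \<in> range (\<lambda>c. scale_op c \<I>)"
  then show "T \<in> Q" using star_alg_scale[OF vN_star_alg[OF vN] star_alg_one[OF vN_star_alg[OF vN]]] by auto
qed

section \<open>Subobjects cut out by isometries, and a bound on their number\<close>

definition sub_endo :: "'a::chilbert_space bop set \<Rightarrow> 'a endo \<Rightarrow> 'a bop \<Rightarrow> 'a endo" where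
  "sub_endo M \<pi> V = (\<lambda>x\<in>M. adj V \<odot> \<pi> x \<odot> V)"

text \<open>Multiplicativity rests on \<open>V \<odot> adj V\<close> commuting with the image of
  \<open>\<pi>\<close>, so that the projection arising between two factors is absorbed by
  \<open>V\<close>.\<close>

lemma sub_endo:
  assumes sM: "star_alg M" and \<pi>: "\<pi> \<in> End M" and V: "V \<in> M" "adj V \<odot> V = \<I>"
    and VV: "V \<odot> adj V \<in> intertwiners M \<pi> \<pi>"
  shows sub_endo_End: "sub_endo M \<pi> V \<in> End M"
    and sub_endo_intertwiner: "V \<in> intertwiners M (sub_endo M \<pi> V) \<pi>"
proof -
  note bM = star_alg_bops[OF sM]
  note cl = star_alg_closed[OF sM]
  have Vb: "V \<in> bops" using V bM by blast
  have c: "V \<odot> (adj V \<odot> \<pi> x) = \<pi> x \<odot> (V \<odot> adj V)" if "x \<in> M" for x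
    using intertwinersD(2)[OF VV that] by (simp add: comp_assoc)
  have c': "V \<odot> (adj V \<odot> (\<pi> x \<odot> T)) = \<pi> x \<odot> (V \<odot> (adj V \<odot> T))" if "x \<in> M" for x T
    using arg_cong[OF c[OF that], of "\<lambda>S. S \<odot> T"] by (simp add: comp_assoc)
  show I: "V \<in> intertwiners M (sub_endo M \<pi> V) \<pi>"
    by (rule intertwinersI) (simp_all add: V sub_endo_def comp_assoc c')
  have cont: "continuous_map (subtopology sigma_weak M) sigma_weak (\<lambda>x. adj V \<odot> \<pi> x \<odot> V)"
    using continuous_map_compose[OF continuous_map_compose[OF End_cont[OF \<pi>] continuous_map_left_mult[of "adj V"]]
        continuous_map_right_mult[of V]] Vb by (simp add: comp_def)
  show "sub_endo M \<pi> V \<in> End M" unfolding End_def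
  proof (rule normal_homsI)
    show "continuous_map (subtopology sigma_weak M) sigma_weak (sub_endo M \<pi> V)"
      by (rule continuous_map_eq[OF cont]) (simp add: sub_endo_def)
    show "sub_endo M \<pi> V (x \<odot> y) = sub_endo M \<pi> V x \<odot> sub_endo M \<pi> V y" if "x \<in> M" "y \<in> M" for x y
      using that V(2) by (simp add: sub_endo_def cl End_mult[OF \<pi>] comp_assoc c')
  qed (use V in \<open>auto simp: sub_endo_def cl End_mem[OF \<pi>] End_add[OF \<pi>] End_scale[OF \<pi>] End_adj[OF \<pi>] End_one[OF \<pi>]
      comp_add_left comp_add_right comp_scale_op_left comp_scale_op_right bM Vb adj_comp comp_assoc\<close>)
qed

text \<open>The conjugate equations for a single object, with the common normalisation
  \<open>d\<close> as a free parameter instead of the dimension defined through the index.\<close>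

definition conjugate_pair :: "'a::chilbert_space bop set \<Rightarrow> 'a endo \<Rightarrow> 'a endo \<Rightarrow> 'a bop \<Rightarrow> 'a bop \<Rightarrow> real \<Rightarrow> bool" where
  "conjugate_pair M \<pi> \<pi>' R R' d \<longleftrightarrow> \<pi> \<in> End M \<and> \<pi>' \<in> End M \<and> R \<in> M \<and> R' \<in> M \<and>
     (\<forall>x\<in>M. R \<odot> x = \<pi>' (\<pi> x) \<odot> R) \<and> (\<forall>x\<in>M. R' \<odot> x = \<pi> (\<pi>' x) \<odot> R') \<and>
     adj R \<odot> R = d *\<^sub>R \<I> \<and> adj R' \<odot> R' = d *\<^sub>R \<I> \<and> adj R \<odot> \<pi>' R' = \<I> \<and> adj R' \<odot> \<pi> R = \<I>"

text \<open>\<open>\<mu>(x) = R* \<pi>'(x) R\<close> is a scalar for \<open>x \<in> (\<pi>, \<pi>)\<close>, positive of total mass \<open>d\<close>, and the second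
  conjugate equation bounds \<open>\<mu>\<close> from below by \<open>1/d\<close> on nonzero projections.\<close>

lemma conjugate_projection_bound:
  fixes M :: "'a::chilbert_space bop set"
  assumes M: "factor M" and cp: "conjugate_pair M \<pi> \<pi>' R R' d" and nt: "\<exists>v::'a. v \<noteq> 0"
    and P: "\<And>i. i < n \<Longrightarrow> p i \<in> intertwiners M \<pi> \<pi> \<and> adj (p i) = p i \<and> p i \<odot> p i = p i \<and> p i \<noteq> 0"
    and orth: "\<And>i j. i < n \<Longrightarrow> j < n \<Longrightarrow> i \<noteq> j \<Longrightarrow> p i \<odot> p j = 0"
  shows "real n \<le> d * d"
proof -
  have vN: "von_neumann_algebra M" using M by (simp add: factor_def)
  note sM = vN_star_alg[OF vN]
  note bM = star_alg_bops[OF sM]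
  note cl = star_alg_closed[OF sM]
  obtain v :: 'a where v0: "v \<noteq> 0" using nt by blast
  have \<pi>: "\<pi> \<in> End M" "\<pi>' \<in> End M" and R: "R \<in> M" "R' \<in> M"
    "\<And>x. x \<in> M \<Longrightarrow> R \<odot> x = \<pi>' (\<pi> x) \<odot> R" "\<And>x. x \<in> M \<Longrightarrow> R' \<odot> x = \<pi> (\<pi>' x) \<odot> R'"
    "adj R \<odot> R = d *\<^sub>R \<I>" "adj R' \<odot> R' = d *\<^sub>R \<I>" "adj R' \<odot> \<pi> R = \<I>"
    using cp by (auto simp: conjugate_pair_def)
  note m = End_mem[OF \<pi>(1)] End_mem[OF \<pi>(2)]
  note bb = bM[OF R(1)] bM[OF R(2)]
  have d0: "d \<ge> 0"
    using norm_sq_scalar[OF bb(1) R(5), of v] v0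
    by (metis mult_less_0_iff not_less zero_le_power2 zero_less_norm_iff zero_less_power2 norm_eq_zero)
  define \<Phi> where "\<Phi> x = adj R \<odot> \<pi>' x \<odot> R" for x
  have scal: "\<exists>c. \<Phi> x = scale_op c \<I>" if x: "x \<in> intertwiners M \<pi> \<pi>" for x
  proof -
    note xM = intertwinersD(1)[OF x]
    have "\<Phi> x \<in> M" unfolding \<Phi>_def using R xM by (auto intro!: cl m)
    moreover have "\<Phi> x \<in> commutant M"
    proof (rule commutantI)
      show "\<Phi> x \<in> bops" using \<open>\<Phi> x \<in> M\<close> bM by blast
      fix y assume y: "y \<in> M"
      have Ra: "adj R \<odot> \<pi>' (\<pi> y) = y \<odot> adj R"
        using arg_cong[OF R(3)[OF star_alg_adj[OF sM y]], of adj] y bb m bM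
        by (simp add: adj_comp End_adj[OF \<pi>(1)] End_adj[OF \<pi>(2)] cl)
      have "\<Phi> x \<odot> y = adj R \<odot> (\<pi>' x \<odot> \<pi>' (\<pi> y)) \<odot> R" unfolding \<Phi>_def using R(3)[OF y] by (simp add: comp_assoc)
      also have "\<pi>' x \<odot> \<pi>' (\<pi> y) = \<pi>' (\<pi> y) \<odot> \<pi>' x"
        using intertwinersD(2)[OF x y] xM y m by (metis End_mult[OF \<pi>(2)])
      also have "adj R \<odot> (\<pi>' (\<pi> y) \<odot> \<pi>' x) \<odot> R = (adj R \<odot> \<pi>' (\<pi> y)) \<odot> \<pi>' x \<odot> R" by (simp add: comp_assoc)
      also have "\<dots> = y \<odot> \<Phi> x" unfolding Ra \<Phi>_def by (simp add: comp_assoc)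
      finally show "\<Phi> x \<odot> y = y \<odot> \<Phi> x" .
    qed
    ultimately show ?thesis using M by (auto simp: factor_def)
  qed
  define \<mu> where "\<mu> x = Re (cinner v (\<Phi> x v)) / (norm v)\<^sup>2" for x
  have nv: "(norm v)\<^sup>2 > 0" using v0 by simp
  have proj: "\<Phi> q = adj (\<pi>' q \<odot> R) \<odot> (\<pi>' q \<odot> R) \<and> \<mu> q \<ge> 0 \<and> \<Phi> q = (\<mu> q) *\<^sub>R \<I>"
    if q: "q \<in> intertwiners M \<pi> \<pi>" "adj q = q" "q \<odot> q = q" for q
  proof -
    note qM = intertwinersD(1)[OF q(1)]
    have mb: "\<pi>' q \<in> bops" using m qM bM by blast
    have 1: "\<Phi> q = adj (\<pi>' q \<odot> R) \<odot> (\<pi>' q \<odot> R)"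
    proof -
      have i: "\<pi>' q \<odot> \<pi>' q = \<pi>' q" "adj (\<pi>' q) = \<pi>' q"
        using End_mult[OF \<pi>(2) qM qM] End_adj[OF \<pi>(2) qM] q by simp_all
      have "adj (\<pi>' q \<odot> R) \<odot> (\<pi>' q \<odot> R) = adj R \<odot> ((\<pi>' q \<odot> \<pi>' q) \<odot> R)"
        unfolding adj_comp[OF mb bb(1)] i(2) by (simp only: comp_assoc)
      then show ?thesis unfolding i(1) by (simp add: \<Phi>_def comp_assoc)
    qed
    have cq: "cinner v (\<Phi> q v) = of_real ((norm ((\<pi>' q \<odot> R) v))\<^sup>2)"
      unfolding 1 by (rule norm_sq_adj_comp) (simp add: mb bb)
    then have 2: "\<mu> q \<ge> 0" unfolding \<mu>_def by simp
    obtain c where c: "\<Phi> q = scale_op c \<I>" using scal[OF q(1)] by blast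
    have "c * of_real ((norm v)\<^sup>2) = of_real ((norm ((\<pi>' q \<odot> R) v))\<^sup>2)"
      using cq unfolding c by (simp add: cinner_scaleC_right cinner_self)
    then have "c = of_real (\<mu> q)" unfolding \<mu>_def cq using nv by (simp add: field_simps)
    then have "\<Phi> q = (\<mu> q) *\<^sub>R \<I>" by (simp add: c scaleR_scale_op)
    with 1 2 show ?thesis by blast
  qed
  have \<mu>add: "\<mu> (x + y) = \<mu> x + \<mu> y" if "x \<in> M" "y \<in> M" for x y
    by (simp add: \<mu>_def \<Phi>_def End_add[OF \<pi>(2) that] comp_add_left comp_add_right blinfun.add_left cinner_add_right add_divide_distrib)
  have nR': "norm (adj R' y) \<le> sqrt d * norm y" for y
  proof -
    have "norm R' \<le> sqrt d"
    proof (rule norm_blinfun_bound)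
      fix x
      have "(norm (R' x))\<^sup>2 = (sqrt d * norm x)\<^sup>2" using d0 norm_sq_scalar[OF bb(2) R(6)] by (simp add: power_mult_distrib)
      then show "norm (R' x) \<le> sqrt d * norm x" using d0 by simp
    qed (simp add: d0)
    then have "norm (adj R') \<le> sqrt d" by (simp add: norm_adj bb)
    then show ?thesis using norm_blinfun[of "adj R'" y] mult_right_mono[of "norm (adj R')" "sqrt d" "norm y"] by simp
  qed
  \<comment> \<open>Bending expresses \<open>q\<close> as
    \<open>adj R' \<odot> \<pi> (\<pi>' q \<odot> R)\<close>. On a vector fixed by \<open>q\<close>
    the outer factor has norm at most \<open>sqrt d\<close>, and the inner one scales norms by the
    square root of \<open>\<mu> q\<close>.\<close>
  have low: "1 \<le> d * \<mu> q" if q: "q \<in> intertwiners M \<pi> \<pi>" "adj q = q" "q \<odot> q = q" "q \<noteq> 0" for q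
  proof -
    note qM = intertwinersD(1)[OF q(1)]
    have mb: "\<pi>' q \<in> M" using m qM by blast
    have R'a: "adj R' \<odot> \<pi> (\<pi>' q) = q \<odot> adj R'"
      using arg_cong[OF R(4)[OF star_alg_adj[OF sM qM]], of adj] qM bb m bM
      by (simp add: adj_comp End_adj[OF \<pi>(1)] End_adj[OF \<pi>(2)] cl)
    have eq: "q = adj R' \<odot> \<pi> (\<pi>' q \<odot> R)"
      using R'a R(7) by (simp add: End_mult[OF \<pi>(1) mb R(1)] flip: comp_assoc) (simp add: comp_assoc)
    obtain \<xi> where \<xi>: "q \<xi> \<noteq> 0" using q(4) blinfun_eqI[of q 0] by auto
    define \<eta> where "\<eta> = q \<xi>"
    have q\<eta>: "q \<eta> = \<eta>" unfolding \<eta>_def using q(3) by (metis blinfun_apply_blinfun_compose)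
    have mR: "\<pi>' q \<odot> R \<in> M" using mb R(1) by (rule star_alg_mult[OF sM])
    have "norm \<eta> = norm (adj R' (\<pi> (\<pi>' q \<odot> R) \<eta>))"
      using q\<eta> eq by (metis blinfun_apply_blinfun_compose)
    also have "\<dots> \<le> sqrt d * norm (\<pi> (\<pi>' q \<odot> R) \<eta>)" by (rule nR')
    finally have "(norm \<eta>)\<^sup>2 \<le> (sqrt d * norm (\<pi> (\<pi>' q \<odot> R) \<eta>))\<^sup>2" by (intro power_mono) auto
    then have 1: "(norm \<eta>)\<^sup>2 \<le> d * (norm (\<pi> (\<pi>' q \<odot> R) \<eta>))\<^sup>2" using d0 by (simp add: power_mult_distrib)
    have "adj (\<pi> (\<pi>' q \<odot> R)) \<odot> \<pi> (\<pi>' q \<odot> R) = \<pi> (\<Phi> q)"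
      using proj[OF q(1-3)] mR by (simp add: End_mult[OF \<pi>(1)] End_adj[OF \<pi>(1)] cl)
    also have "\<dots> = (\<mu> q) *\<^sub>R \<I>" unfolding proj[OF q(1-3), THEN conjunct2, THEN conjunct2] by (simp add: scaleR_scale_op End_scale[OF \<pi>(1)] cl End_one[OF \<pi>(1)])
    finally have "(norm (\<pi> (\<pi>' q \<odot> R) \<eta>))\<^sup>2 = \<mu> q * (norm \<eta>)\<^sup>2"
      by (rule norm_sq_scalar[OF bM[OF m(1)[OF mR]]])
    then have "1 * (norm \<eta>)\<^sup>2 \<le> (d * \<mu> q) * (norm \<eta>)\<^sup>2" using 1 by (simp add: mult.assoc)
    then show ?thesis using \<xi> unfolding \<eta>_def[symmetric] by (simp only: mult_le_cancel_right) simp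
  qed
  have \<mu>1: "\<mu> \<I> = d" using nv by (simp add: \<mu>_def \<Phi>_def End_one[OF \<pi>(2)] R(5) blinfun.scaleR_left cinner_scaleR_right cinner_self)
  have sI: "star_alg (intertwiners M \<pi> \<pi>)" by (rule vN_star_alg[OF von_neumann_algebra_intertwiners[OF vN \<pi>(1)]])
  \<comment> \<open>Partial sums of the family are again projections, on which \<open>\<mu>\<close>
    is additive. The complement of the full sum is a projection too, of nonnegative mass, which
    bounds the total by \<open>d\<close>.\<close>
  have "(\<Sum>i<k. \<mu> (p i)) = \<mu> (\<Sum>i<k. p i) \<and> (\<Sum>i<k. p i) \<in> intertwiners M \<pi> \<pi> \<and>
      adj (\<Sum>i<k. p i) = (\<Sum>i<k. p i) \<and> (\<Sum>i<k. p i) \<odot> (\<Sum>i<k. p i) = (\<Sum>i<k. p i)" if "k \<le> n" for k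
    using that
  proof (induction k)
    case 0
    have "\<mu> 0 = 0" using \<mu>add[OF star_alg_zero[OF sM] star_alg_zero[OF sM]] by simp
    then show ?case using star_alg_zero[OF sI] by simp
  next
    case (Suc k)
    note pk = P[of k]
    have s: "(\<Sum>i<k. p i) \<in> M" "p k \<in> M" using Suc pk intertwinersD(1) by auto
    have o: "(\<Sum>i<k. p i) \<odot> p k = 0" "p k \<odot> (\<Sum>i<k. p i) = 0"
      using Suc.prems orth by (auto simp: comp_sum_left comp_sum_right intro!: sum.neutral)
    show ?case using Suc pk s o
      by (simp add: \<mu>add star_alg_add[OF sI] adj_add bM comp_add_left comp_add_right)
  qed
  from this[of n] have S: "(\<Sum>i<n. \<mu> (p i)) = \<mu> (\<Sum>i<n. p i)" "(\<Sum>i<n. p i) \<in> intertwiners M \<pi> \<pi>"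
     "adj (\<Sum>i<n. p i) = (\<Sum>i<n. p i)" "(\<Sum>i<n. p i) \<odot> (\<Sum>i<n. p i) = (\<Sum>i<n. p i)" by auto
  let ?s = "\<Sum>i<n. p i"
  have sM': "?s \<in> M" using S(2) intertwinersD(1) by blast
  have "\<mu> (\<I> - ?s) \<ge> 0"
    using proj[of "\<I> - ?s"] star_alg_diff[OF sI star_alg_one[OF sI] S(2)] S bM[OF sM']
    by (simp add: adj_diff comp_diff_left comp_diff_right)
  moreover have "\<mu> ((\<I> - ?s) + ?s) = \<mu> (\<I> - ?s) + \<mu> ?s" by (rule \<mu>add) (auto intro: cl sM')
  ultimately have le: "(\<Sum>i<n. \<mu> (p i)) \<le> d" using \<mu>1 S(1) by simp
  have "real n = (\<Sum>i<n. 1)" by simp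
  also have "\<dots> \<le> (\<Sum>i<n. d * \<mu> (p i))" by (rule sum_mono) (use low P in auto)
  also have "\<dots> = d * (\<Sum>i<n. \<mu> (p i))" by (simp add: sum_distrib_left)
  also have "\<dots> \<le> d * d" by (intro mult_left_mono le d0)
  finally show ?thesis .
qed

text \<open>Orthogonal families of nonzero projections in \<open>(\<pi>, \<pi>)\<close> have bounded
  length, so one of maximal length exists. Maximality forces its sum to be \<open>\<I>\<close> and
  each member to be minimal, since a remainder or a proper subprojection would lengthen it;
  minimality leaves the summand only scalar self-intertwiners.\<close>

theorem finite_decomposition:
  fixes M :: "'a::chilbert_space bop set"
  assumes M: "type_III_factor M" and \<phi>: "faithful_normal_state M \<phi>"
    and cp: "conjugate_pair M \<pi> \<pi>' R R' d"
  obtains n V where "\<And>i::nat. i < n \<Longrightarrow> V i \<in> M \<and> adj (V i) \<odot> V i = \<I> \<and> V i \<odot> adj (V i) \<in> intertwiners M \<pi> \<pi> \<and>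
      irreducible_endo M (sub_endo M \<pi> (V i))" "(\<Sum>i<n. V i \<odot> adj (V i)) = \<I>"
proof -
  have fM: "factor M" and vN: "von_neumann_algebra M" using M by (auto simp: type_III_factor_def factor_def)
  note sM = vN_star_alg[OF vN]
  note bM = star_alg_bops[OF sM]
  have \<pi>: "\<pi> \<in> End M" using cp by (auto simp: conjugate_pair_def)
  have nt: "\<exists>v::'a. v \<noteq> 0"
  proof (rule ccontr)
    assume "\<not> ?thesis"
    then have "(\<I> :: 'a bop) = scale_op 0 \<I>" by (intro blinfun_eqI) simp
    moreover have "\<phi> (scale_op 0 \<I>) = 0 * \<phi> \<I>" using \<phi> star_alg_one[OF sM] unfolding faithful_normal_state_def by blast
    ultimately show False using \<phi> by (simp add: faithful_normal_state_def)
  qed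
  let ?P = "intertwiners M \<pi> \<pi>"
  have vP: "von_neumann_algebra ?P" by (rule von_neumann_algebra_intertwiners[OF vN \<pi>])
  note sP = vN_star_alg[OF vP]
  note bP = star_alg_bops[OF sP]
  define fam where "fam n p \<longleftrightarrow> (\<forall>i<n. p i \<in> ?P \<and> adj (p i) = p i \<and> p i \<odot> p i = p i \<and> p i \<noteq> 0) \<and>
      (\<forall>i<n. \<forall>j<n. i \<noteq> j \<longrightarrow> p i \<odot> p j = 0)" for n and p :: "nat \<Rightarrow> 'a bop"
  have bound: "n \<le> nat \<lceil>d * d\<rceil>" if "fam n p" for n p
  proof -
    have "real n \<le> d * d"
      by (rule conjugate_projection_bound[OF fM cp nt, of n p]) (use that in \<open>auto simp: fam_def\<close>)
    then show ?thesis by linarith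
  qed
  have "\<exists>p. fam 0 p" by (simp add: fam_def)
  then obtain n where n: "\<exists>p. fam n p" "\<And>m. \<exists>p. fam m p \<Longrightarrow> m \<le> n"
    using GreatestI_nat[of "\<lambda>n. \<exists>p. fam n p" 0 "nat \<lceil>d * d\<rceil>"] Greatest_le_nat[of "\<lambda>n. \<exists>p. fam n p" _ "nat \<lceil>d * d\<rceil>"] bound
    by blast
  then obtain p where p: "fam n p" by blast
  have pi: "p i \<in> ?P" "adj (p i) = p i" "p i \<odot> p i = p i" "p i \<noteq> 0" if "i < n" for i using p that by (auto simp: fam_def)
  have po: "p i \<odot> p j = 0" if "i < n" "j < n" "i \<noteq> j" for i j using p that by (auto simp: fam_def)
  have total: "(\<Sum>i<n. p i) = \<I>"
  proof (rule ccontr)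
    assume ne: "(\<Sum>i<n. p i) \<noteq> \<I>"
    let ?s = "\<Sum>i<n. p i"
    have sPm: "?s \<in> ?P" by (rule star_alg_sum[OF sP]) (use pi in auto)
    have sa: "adj ?s = ?s" using adj_sum[of "{..<n}" p] pi bP by (simp cong: sum.cong_simp)
    have ps: "p i \<odot> ?s = p i" if "i < n" for i
    proof -
      have "p i \<odot> ?s = (\<Sum>j<n. if j = i then p i else 0)"
        unfolding comp_sum_right by (rule sum.cong) (use that po pi in auto)
      then show ?thesis using that by simp
    qed
    then have ss: "?s \<odot> ?s = ?s" unfolding comp_sum_left by simp
    have sp: "?s \<odot> p i = p i" if "i < n" for i
      using arg_cong[OF ps[OF that], of adj] pi[OF that] sa bP[OF sPm] bP by (simp add: adj_comp)
    define p' where "p' i = (if i = n then \<I> - ?s else p i)" for i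
    have "fam (Suc n) p'"
      unfolding fam_def p'_def less_Suc_eq
      using pi po ne ps sp ss sa bP[OF sPm] star_alg_diff[OF sP star_alg_one[OF sP] sPm]
      by (auto simp: adj_diff comp_diff_left comp_diff_right)
    then show False using n(2)[of "Suc n"] by auto
  qed
  have minimal: "q = 0 \<or> q = p i" if i: "i < n" and q: "q \<in> ?P" "adj q = q" "q \<odot> q = q" "q \<odot> p i = q" for i q
  proof (rule ccontr)
    assume ne: "\<not> ?thesis"
    have "adj (q \<odot> p i) = adj q" using q(4) by simp
    then have pq: "p i \<odot> q = q" unfolding adj_comp[OF bP[OF q(1)] bP[OF pi(1)[OF i]]] q(2) pi(2)[OF i] .
    have qj: "q \<odot> p j = 0" "p j \<odot> q = 0" if "j < n" "j \<noteq> i" for j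
    proof -
      have "q \<odot> p j = q \<odot> (p i \<odot> p j)" using q(4) by (simp flip: comp_assoc)
      then show "q \<odot> p j = 0" using po[OF i that(1)] that(2) by simp
      have "p j \<odot> q = (p j \<odot> p i) \<odot> q" using pq by (simp add: comp_assoc)
      then show "p j \<odot> q = 0" using po[OF that(1) i] that(2) by simp
    qed
    \<comment> \<open>Splits \<open>p i\<close>: the part \<open>q\<close> keeps the index
      \<open>i\<close>, and the other part receives the new index \<open>n\<close>.\<close>
    define p' where "p' j = (if j = n then p i - q else if j = i then q else p j)" for j
    have "fam (Suc n) p'"
      unfolding fam_def p'_def less_Suc_eq
      using i pi po ne q pq qj bP[OF q(1)] bP[OF pi(1)[OF i]] star_alg_diff[OF sP pi(1)[OF i] q(1)]
      by (auto simp: adj_diff comp_diff_left comp_diff_right)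
    then show False using n(2)[of "Suc n"] by auto
  qed
  have "\<exists>V. V \<in> M \<and> adj V \<odot> V = \<I> \<and> V \<odot> adj V = p i" if "i < n" for i
  proof (rule type_III_projection_equivalent_one[OF M \<phi>])
    show "proj_in M (p i)" "p i \<noteq> 0" using pi[OF that] intertwinersD(1) by (auto simp: proj_in_def)
  qed blast
  then obtain V where V: "\<And>i. i < n \<Longrightarrow> V i \<in> M \<and> adj (V i) \<odot> V i = \<I> \<and> V i \<odot> adj (V i) = p i" by metis
  have irr: "irreducible_endo M (sub_endo M \<pi> (V i))" if i: "i < n" for i
  proof -
    let ?V = "V i" and ?\<sigma> = "sub_endo M \<pi> (V i)"
    have Vi: "?V \<in> M" "adj ?V \<odot> ?V = \<I>" "?V \<odot> adj ?V = p i" using V[OF i] by auto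
    have VVP: "?V \<odot> adj ?V \<in> ?P" using Vi(3) pi[OF i] by simp
    note \<sigma> = sub_endo_End[OF sM \<pi> Vi(1,2) VVP] and VI = sub_endo_intertwiner[OF sM \<pi> Vi(1,2) VVP]
    have Vb: "?V \<in> bops" using Vi bM by blast
    have "intertwiners M ?\<sigma> ?\<sigma> = range (\<lambda>c. scale_op c \<I>)"
    proof (rule no_projections_imp_scalars[OF von_neumann_algebra_intertwiners[OF vN \<sigma>]])
      fix e assume e: "proj_in (intertwiners M ?\<sigma> ?\<sigma>) e"
      then have eI: "e \<in> intertwiners M ?\<sigma> ?\<sigma>" "adj e = e" "e \<odot> e = e" by (auto simp: proj_in_def)
      have eb: "e \<in> bops" using intertwinersD(1)[OF eI(1)] bM by blast
      \<comment> \<open>Conjugation by \<open>V i\<close> carries projections of the summand to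
        subprojections of \<open>p i\<close>, where minimality applies.\<close>
      have qI: "?V \<odot> e \<odot> adj ?V \<in> ?P"
        by (rule intertwiners_comp[OF sM intertwiners_comp[OF sM VI eI(1)] intertwiners_adj[OF sM \<sigma> \<pi> VI]])
      have VVe: "adj ?V \<odot> (?V \<odot> T) = T" for T using Vi(2) by (simp flip: comp_assoc)
      have "?V \<odot> e \<odot> adj ?V = 0 \<or> ?V \<odot> e \<odot> adj ?V = p i"
      proof (rule minimal[OF i qI])
        show "adj (?V \<odot> e \<odot> adj ?V) = ?V \<odot> e \<odot> adj ?V" by (simp add: adj_comp Vb eb eI(2) comp_assoc)
        have ee: "e \<odot> (e \<odot> T) = e \<odot> T" for T using eI(3) by (simp flip: comp_assoc)
        show "(?V \<odot> e \<odot> adj ?V) \<odot> (?V \<odot> e \<odot> adj ?V) = ?V \<odot> e \<odot> adj ?V" by (simp add: comp_assoc VVe ee)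
        show "(?V \<odot> e \<odot> adj ?V) \<odot> p i = ?V \<odot> e \<odot> adj ?V" unfolding Vi(3)[symmetric] by (simp add: comp_assoc VVe)
      qed
      moreover have "e = adj ?V \<odot> (?V \<odot> e \<odot> adj ?V) \<odot> ?V" using Vi(2) by (simp add: comp_assoc VVe)
      moreover have "adj ?V \<odot> p i \<odot> ?V = \<I>" unfolding Vi(3)[symmetric] by (simp add: comp_assoc VVe Vi(2))
      ultimately show "e = 0 \<or> e = \<I>" by auto
    qed
    then show ?thesis by (simp add: irreducible_endo_def)
  qed
  show thesis
  proof (rule that[of n V])
    have "(\<Sum>i<n. V i \<odot> adj (V i)) = (\<Sum>i<n. p i)" by (rule sum.cong) (use V in auto)
    then show "(\<Sum>i<n. V i \<odot> adj (V i)) = \<I>" using total by simp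
  qed (use V irr pi in auto)
qed

section \<open>Tensor products and opposite algebras\<close>

lemma hilbert_tensorD:
  assumes "hilbert_tensor t"
  shows ht_add_left: "t (x + x') y = t x y + t x' y" and ht_add_right: "t x (y + y') = t x y + t x y'"
    and ht_scale_left: "t (c *\<^sub>C x) y = c *\<^sub>C t x y" and ht_scale_right: "t x (c *\<^sub>C y) = c *\<^sub>C t x y"
    and ht_cinner: "cinner (t x y) (t x' y') = cinner x x' * cinner y y'"
    and ht_dense: "closure (span (range (\<lambda>(x, y). t x y))) = UNIV"
proof -
  have "{t x y |x y. True} = range (\<lambda>(x, y). t x y)" by auto
  then show "t (x + x') y = t x y + t x' y" "t x (y + y') = t x y + t x y'"
    "t (c *\<^sub>C x) y = c *\<^sub>C t x y" "t x (c *\<^sub>C y) = c *\<^sub>C t x y"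
    "cinner (t x y) (t x' y') = cinner x x' * cinner y y'"
    "closure (span (range (\<lambda>(x, y). t x y))) = UNIV"
    using assms by (auto simp: hilbert_tensor_def)
qed

lemma hilbert_tensor_swap: "hilbert_tensor t \<Longrightarrow> hilbert_tensor (\<lambda>y x. t x y)"
proof -
  assume t: "hilbert_tensor t"
  have "{t x y |y x. True} = {t x y |x y. True}" by blast
  then show ?thesis using t unfolding hilbert_tensor_def by (auto simp: mult.commute)
qed

lemma ht_eqI:
  fixes A B :: "'c::chilbert_space \<Rightarrow>\<^sub>L 'd::real_normed_vector"
  assumes "hilbert_tensor t" "\<And>\<xi> \<eta>. A (t \<xi> \<eta>) = B (t \<xi> \<eta>)"
  shows "A = B"
  by (rule blinfun_eq_dense[OF ht_dense[OF assms(1)]]) (use assms(2) in auto)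

text \<open>Boundedness on sums of elementary tensors cannot be seen termwise. With \<open>s\<close>
  a root of \<open>K\<^sup>2 - adj x \<odot> x\<close>, the squared norms of the images under
  \<open>x \<otimes> 1\<close> and \<open>s \<otimes> 1\<close> add up to \<open>K\<^sup>2\<close>
  times the original one.\<close>

lemma op_tensor_left_exists:
  assumes t: "hilbert_tensor t" and x: "x \<in> bops"
  obtains T where "T \<in> bops" "\<And>\<xi> \<eta>. T (t \<xi> \<eta>) = t (x \<xi>) \<eta>"
proof -
  define K where "K = norm x"
  define D where "D = (K * K) *\<^sub>R \<I> - adj x \<odot> x"
  have Db: "D \<in> bops" by (simp add: D_def x)
  have "pos_op D"
  proof (rule pos_opI[OF Db])
    show "adj D = D" by (simp add: D_def adj_diff adj_scaleR adj_comp x)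
    fix \<xi>
    have "Re (cinner \<xi> (D \<xi>)) = K * K * (norm \<xi>)\<^sup>2 - (norm (x \<xi>))\<^sup>2"
      using norm_sq_adj_comp[OF x, of \<xi>] by (simp add: D_def blinfun.diff_left blinfun.scaleR_left cinner_diff_right
          cinner_scaleR_right Re_cinner_self del: of_real_power)
    moreover have "(norm (x \<xi>))\<^sup>2 \<le> (K * norm \<xi>)\<^sup>2" unfolding K_def by (intro power_mono norm_blinfun) simp
    ultimately show "0 \<le> Re (cinner \<xi> (D \<xi>))" by (simp add: power_mult_distrib power2_eq_square mult_ac)
  qed
  then obtain s where s: "pos_op s" "s \<odot> s = D" using op_sqrt by blast
  note sb = pos_op_bops[OF s(1)] and sa = pos_op_selfadjoint[OF s(1)]
  have key: "cinner (x \<xi>) (x \<xi>') + cinner (s \<xi>) (s \<xi>') = of_real (K * K) * cinner \<xi> \<xi>'" for \<xi> \<xi>'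
  proof -
    have "cinner (s \<xi>) (s \<xi>') = cinner \<xi> ((s \<odot> s) \<xi>')"
      using cinner_adj[OF sb, of \<xi>] sa by simp
    also have "\<dots> = of_real (K * K) * cinner \<xi> \<xi>' - cinner (x \<xi>) (x \<xi>')"
      unfolding s(2) by (simp add: D_def blinfun.diff_left blinfun.scaleR_left cinner_diff_right cinner_scaleR_right cinner_adj'[OF x])
    finally show ?thesis by simp
  qed
  let ?e = "\<lambda>(\<xi>, \<eta>). t \<xi> \<eta>" and ?f = "\<lambda>(\<xi>, \<eta>). t (x \<xi>) \<eta>" and ?g = "\<lambda>(\<xi>, \<eta>). t (s \<xi>) \<eta>"
  obtain T :: "'c bop" where T: "\<And>i. T (?e i) = ?f i" "\<And>c x. T (c *\<^sub>C x) = c *\<^sub>C T x"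
  proof (rule bounded_cextension[of ?f K ?e])
    fix F :: "('a \<times> 'b) set" and c
    let ?E = "\<Sum>i\<in>F. c i *\<^sub>R ?e i" and ?Fs = "\<Sum>i\<in>F. c i *\<^sub>R ?f i" and ?G = "\<Sum>i\<in>F. c i *\<^sub>R ?g i"
    have "cinner ?Fs ?Fs + cinner ?G ?G = of_real (K * K) * cinner ?E ?E"
    proof -
      have i: "cinner (?f i) (?f j) + cinner (?g i) (?g j) = of_real (K * K) * cinner (?e i) (?e j)" for i j
        by (simp only: split_beta ht_cinner[OF t] mult.assoc[symmetric] key[symmetric] distrib_right)
      have "cinner ?Fs ?Fs + cinner ?G ?G = (\<Sum>i\<in>F. \<Sum>j\<in>F. of_real (c i) * (of_real (c j) * (cinner (?f j) (?f i) + cinner (?g j) (?g i))))"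
        by (simp add: cinner_sum_left cinner_sum_right cinner_scaleR_left cinner_scaleR_right sum.distrib distrib_left
            sum_distrib_left split_beta)
      also have "\<dots> = of_real (K * K) * cinner ?E ?E"
        unfolding i by (simp add: cinner_sum_left cinner_sum_right cinner_scaleR_left cinner_scaleR_right sum_distrib_left mult_ac split_beta)
      finally show ?thesis .
    qed
    then have "complex_of_real ((norm ?Fs)\<^sup>2 + (norm ?G)\<^sup>2) = of_real ((K * K) * (norm ?E)\<^sup>2)" by (simp only: cinner_self of_real_add of_real_mult)
    then have "(norm ?Fs)\<^sup>2 + (norm ?G)\<^sup>2 = (K * K) * (norm ?E)\<^sup>2" by (simp only: of_real_eq_iff)
    then have "(norm ?Fs)\<^sup>2 \<le> (K * norm ?E)\<^sup>2" by (simp add: power_mult_distrib power2_eq_square[of K]) (smt (verit) zero_le_power2)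
    then show "norm ?Fs \<le> K * norm ?E" by (rule power2_le_imp_le) (simp add: K_def)
  next
    fix c and i :: "'a \<times> 'b"
    show "\<exists>j. ?e j = c *\<^sub>C ?e i \<and> ?f j = c *\<^sub>C ?f i"
      by (rule exI[of _ "(c *\<^sub>C fst i, snd i)"]) (simp add: split_beta ht_scale_left[OF t] bops_app[OF x])
  qed (auto simp: K_def)
  show thesis
  proof (rule that[of T])
    show "T \<in> bops" using T(2) by (simp add: bops_def)
    show "T (t \<xi> \<eta>) = t (x \<xi>) \<eta>" for \<xi> \<eta> using T(1)[of "(\<xi>, \<eta>)"] by simp
  qed
qed

lemma op_tensor_unique:
  assumes "hilbert_tensor t" "T \<in> bops" "\<And>\<xi> \<eta>. blinfun_apply T (t \<xi> \<eta>) = t (blinfun_apply x \<xi>) (blinfun_apply y \<eta>)"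
  shows "op_tensor t x y = T"
  unfolding op_tensor_def
proof (rule the_equality)
  fix S assume "S \<in> bops \<and> (\<forall>\<xi> \<eta>. S (t \<xi> \<eta>) = t (x \<xi>) (y \<eta>))"
  then show "S = T" by (intro ht_eqI[OF assms(1)]) (simp add: assms(3))
qed (use assms in auto)

lemma op_tensor:
  assumes t: "hilbert_tensor t" and x: "x \<in> bops" and y: "y \<in> bops"
  shows op_tensor_bops: "op_tensor t x y \<in> bops"
    and op_tensor_apply: "op_tensor t x y (t \<xi> \<eta>) = t (x \<xi>) (y \<eta>)"
proof -
  obtain S where S: "S \<in> bops" "\<And>\<xi> \<eta>. S (t \<xi> \<eta>) = t (x \<xi>) \<eta>"
    using op_tensor_left_exists[OF t x] by blast
  obtain T where T: "T \<in> bops" "\<And>\<eta> \<xi>. T (t \<xi> \<eta>) = t \<xi> (y \<eta>)"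
    using op_tensor_left_exists[OF hilbert_tensor_swap[OF t] y] by blast
  have "op_tensor t x y = S \<odot> T" by (rule op_tensor_unique[OF t]) (auto simp: S T)
  then show "op_tensor t x y \<in> bops" "op_tensor t x y (t \<xi> \<eta>) = t (x \<xi>) (y \<eta>)"
    by (auto simp: S T)
qed

lemma op_tensor_swap:
  assumes "hilbert_tensor t" "x \<in> bops" "y \<in> bops"
  shows "op_tensor (\<lambda>\<eta> \<xi>. t \<xi> \<eta>) y x = op_tensor t x y"
  by (rule op_tensor_unique[OF hilbert_tensor_swap]) (auto simp: assms op_tensor_bops op_tensor_apply)

lemma op_tensor_algebra:
  assumes t: "hilbert_tensor t"
  shows op_tensor_mult: "x \<in> bops \<Longrightarrow> y \<in> bops \<Longrightarrow> x' \<in> bops \<Longrightarrow> y' \<in> bops \<Longrightarrow>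
      op_tensor t x y \<odot> op_tensor t x' y' = op_tensor t (x \<odot> x') (y \<odot> y')"
    and op_tensor_one: "op_tensor t \<I> \<I> = \<I>"
    and op_tensor_adj: "x \<in> bops \<Longrightarrow> y \<in> bops \<Longrightarrow> adj (op_tensor t x y) = op_tensor t (adj x) (adj y)"
    and op_tensor_diff_left: "x \<in> bops \<Longrightarrow> x' \<in> bops \<Longrightarrow> y \<in> bops \<Longrightarrow> op_tensor t (x - x') y = op_tensor t x y - op_tensor t x' y"
proof -
  have m: "t (\<xi> - \<xi>') \<eta> = t \<xi> \<eta> - t \<xi>' \<eta>" for \<xi> \<xi>' \<eta>
    using ht_add_left[OF t, of "\<xi> - \<xi>'" \<xi>' \<eta>] by simp
  note o = op_tensor_bops[OF t] op_tensor_apply[OF t]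
  show "op_tensor t x y \<odot> op_tensor t x' y' = op_tensor t (x \<odot> x') (y \<odot> y')" if "x \<in> bops" "y \<in> bops" "x' \<in> bops" "y' \<in> bops"
    by (rule op_tensor_unique[OF t, symmetric]) (auto simp: that o)
  show "op_tensor t \<I> \<I> = \<I>" by (rule op_tensor_unique[OF t]) auto
  show "op_tensor t (x - x') y = op_tensor t x y - op_tensor t x' y" if "x \<in> bops" "x' \<in> bops" "y \<in> bops"
    by (rule op_tensor_unique[OF t]) (auto simp: that o blinfun.diff_left m)
  show "adj (op_tensor t x y) = op_tensor t (adj x) (adj y)" if b: "x \<in> bops" "y \<in> bops"
  proof (rule ht_eqI[OF t])
    fix \<xi> \<eta>
    let ?u = "adj (op_tensor t x y) (t \<xi> \<eta>)" and ?v = "op_tensor t (adj x) (adj y) (t \<xi> \<eta>)"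
    have "perp_to (\<lambda>(\<xi>, \<eta>). t \<xi> \<eta>) (?u - ?v)"
      unfolding perp_to_def
    proof
      fix i :: "'a \<times> 'b"
      obtain \<xi>' \<eta>' where i: "i = (\<xi>', \<eta>')" by (cases i)
      show "cinner (case i of (\<xi>, \<eta>) \<Rightarrow> t \<xi> \<eta>) (?u - ?v) = 0"
        by (simp add: i cinner_diff_right cinner_adj' o b ht_cinner[OF t])
    qed
    then have "cinner (?u - ?v) (?u - ?v) = 0" by (rule cinner_zero_closure_span) (simp add: ht_dense[OF t])
    then show "?u = ?v" by (simp add: cinner_self)
  qed
qed

text \<open>\<open>S\<close> is the slice of \<open>a\<close> in the first leg, that is, its
  compression by the maps \<open>\<eta> \<mapsto> t \<xi> \<eta>\<close> and
  \<open>\<eta> \<mapsto> t \<xi>' \<eta>\<close>. Membership and commutation questions for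
  \<open>a\<close> are answered on such slices.\<close>

lemma slice_exists:
  fixes t :: "'a::chilbert_space \<Rightarrow> 'b::chilbert_space \<Rightarrow> 'c::chilbert_space"
  assumes t: "hilbert_tensor t" and a: "a \<in> bops"
  obtains S where "S \<in> bops" "\<And>\<eta> \<eta>'. cinner (t \<xi> \<eta>) (blinfun_apply a (t \<xi>' \<eta>')) = cinner \<eta> (blinfun_apply S \<eta>')"
proof -
  have bl: "bounded_linear (t \<zeta>)" for \<zeta>
  proof (rule bounded_linear_intro[of _ "norm \<zeta>"])
    fix \<eta>
    have "complex_of_real ((norm (t \<zeta> \<eta>))\<^sup>2) = of_real ((norm \<zeta> * norm \<eta>)\<^sup>2)"
      unfolding cinner_self[symmetric] ht_cinner[OF t] power_mult_distrib of_real_mult by (simp add: cinner_self)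
    then have "(norm (t \<zeta> \<eta>))\<^sup>2 = (norm \<zeta> * norm \<eta>)\<^sup>2" by (simp only: of_real_eq_iff)
    then show "norm (t \<zeta> \<eta>) \<le> norm \<eta> * norm \<zeta>" by (simp add: mult.commute)
  qed (simp_all add: ht_add_right[OF t] scaleR_scaleC ht_scale_right[OF t])
  define V where "V \<zeta> = Blinfun (t \<zeta>)" for \<zeta>
  have V: "blinfun_apply (V \<zeta>) \<eta> = t \<zeta> \<eta>" for \<zeta> \<eta> by (simp add: V_def bounded_linear_Blinfun_apply bl)
  have Vl: "blinfun_apply (V \<zeta>) (c *\<^sub>C \<eta>) = c *\<^sub>C blinfun_apply (V \<zeta>) \<eta>" for c \<zeta> \<eta> by (simp add: V ht_scale_right[OF t])
  obtain W where W: "\<And>x y. cinner (blinfun_apply W x) y = cinner x (blinfun_apply (V \<xi>) y)" "\<And>c x. blinfun_apply W (c *\<^sub>C x) = c *\<^sub>C blinfun_apply W x"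
    using adjoint_exists[of "V \<xi>", OF Vl] by blast
  have W': "cinner y (blinfun_apply W x) = cinner (t \<xi> y) x" for x y
    using W(1)[of x y] V by (metis cinner_commute)
  show thesis
  proof (rule that[of "W o\<^sub>L a o\<^sub>L V \<xi>'"])
    show "W o\<^sub>L a o\<^sub>L V \<xi>' \<in> bops" by (rule bopsI) (simp add: W Vl bops_app[OF a])
  qed (simp add: W' V)
qed

lemma slice_intertwines:
  assumes t: "hilbert_tensor t" and S: "S \<in> bops" "\<And>\<eta> \<eta>'. cinner (t \<xi> \<eta>) (blinfun_apply a (t \<xi>' \<eta>')) = cinner \<eta> (blinfun_apply S \<eta>')"
    and y: "y \<in> bops" "y' \<in> bops" and eq: "a \<odot> op_tensor t \<I> y = op_tensor t \<I> y' \<odot> a"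
  shows "S \<odot> y = y' \<odot> S"
proof (rule blinfun_eqI, rule cinner_ext)
  fix \<eta>' \<eta>
  have "cinner \<eta> (S (y \<eta>')) = cinner (t \<xi> \<eta>) ((a \<odot> op_tensor t \<I> y) (t \<xi>' \<eta>'))"
    by (simp add: S(2)[symmetric] op_tensor_apply[OF t] y)
  also have "\<dots> = cinner (adj (op_tensor t \<I> y') (t \<xi> \<eta>)) (a (t \<xi>' \<eta>'))"
    unfolding eq by (simp add: cinner_adj op_tensor_bops[OF t] y)
  also have "\<dots> = cinner \<eta> (y' (S \<eta>'))"
    by (simp add: op_tensor_adj[OF t] op_tensor_apply[OF t] y S(2) cinner_adj)
  finally show "cinner \<eta> ((S \<odot> y) \<eta>') = cinner \<eta> ((y' \<odot> S) \<eta>')" by simp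
qed

lemma slices_determine:
  fixes a b :: "'c::chilbert_space bop"
  assumes t: "hilbert_tensor t" and "\<And>\<xi> \<eta> \<xi>' \<eta>'. cinner (t \<xi> \<eta>) (a (t \<xi>' \<eta>')) = cinner (t \<xi> \<eta>) (b (t \<xi>' \<eta>'))"
  shows "a = b"
proof (rule ht_eqI[OF t])
  fix \<xi>' \<eta>'
  let ?d = "a (t \<xi>' \<eta>') - b (t \<xi>' \<eta>')"
  have "perp_to (\<lambda>(\<xi>, \<eta>). t \<xi> \<eta>) ?d" by (auto simp: perp_to_def cinner_diff_right assms(2))
  then have "cinner ?d ?d = 0" by (rule cinner_zero_closure_span) (simp add: ht_dense[OF t])
  then show "a (t \<xi>' \<eta>') = b (t \<xi>' \<eta>')" by (simp add: cinner_self)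
qed

section \<open>The opposite algebra on the conjugate space\<close>

lemma bounded_linear_Conj: "bounded_linear (Conj :: 'a::chilbert_space \<Rightarrow> _)"
  by (rule bounded_linear_intro[of _ 1]) (auto simp: plus_conj_space_def scaleR_conj_space_def norm_conj_space_def)

lemma bounded_linear_unConj: "bounded_linear (unConj :: 'a::chilbert_space conj_space \<Rightarrow> _)"
  by (rule bounded_linear_intro[of _ 1]) (auto simp: plus_conj_space_def scaleR_conj_space_def norm_conj_space_def)

lemma jmap_apply: assumes "x \<in> bops" shows "(jmap x) \<xi> = Conj (x (unConj \<xi>))"
proof -
  have "bounded_linear (\<lambda>\<xi>. Conj (x (unConj \<xi>)))"
    by (rule bounded_linear_compose[OF bounded_linear_Conj bounded_linear_compose[OF blinfun.bounded_linear_right bounded_linear_unConj]])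
  then show ?thesis using assms by (simp add: jmap_def opp_def bounded_linear_Blinfun_apply)
qed

lemma jmap_bops [simp]: "x \<in> bops \<Longrightarrow> jmap x \<in> bops"
  by (rule bopsI) (simp add: jmap_apply scaleC_conj_space_def bops_app)

lemma jmap_mult: "x \<in> bops \<Longrightarrow> y \<in> bops \<Longrightarrow> jmap (x \<odot> y) = jmap x \<odot> jmap y"
  by (rule blinfun_eqI) (simp add: jmap_apply)

lemma jmap_scale: "x \<in> bops \<Longrightarrow> jmap (scale_op c x) = scale_op (cnj c) (jmap x)"
  by (rule blinfun_eqI) (simp add: jmap_apply scaleC_conj_space_def)

lemma jmap_adj: "x \<in> bops \<Longrightarrow> adj (jmap x) = jmap (adj x)"
  by (rule adj_unique) (auto simp: jmap_apply cinner_conj_space_def cinner_adj')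

lemma jmap_one [simp]: "jmap \<I> = \<I>"
  by (rule blinfun_eqI) (simp add: jmap_apply)

lemma jmap_inj: "x \<in> bops \<Longrightarrow> y \<in> bops \<Longrightarrow> jmap x = jmap y \<Longrightarrow> x = y"
proof (rule blinfun_eqI)
  fix v assume "x \<in> bops" "y \<in> bops" "jmap x = jmap y"
  then have "jmap x (Conj v) = jmap y (Conj v)" by simp
  then show "x v = y v" using \<open>x \<in> bops\<close> \<open>y \<in> bops\<close> by (simp add: jmap_apply)
qed

lemma jmap_zero [simp]: "jmap 0 = 0"
  by (rule blinfun_eqI) (simp add: jmap_apply zero_conj_space_def)

lemma jmap_surj: fixes T :: "'a::chilbert_space conj_space bop" assumes "T \<in> bops" obtains x where "x \<in> bops" "T = jmap x"
proof -
  have bl: "bounded_linear (\<lambda>\<xi>. unConj (T (Conj \<xi>)))"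
    by (rule bounded_linear_compose[OF bounded_linear_unConj bounded_linear_compose[OF blinfun.bounded_linear_right bounded_linear_Conj]])
  let ?x = "Blinfun (\<lambda>\<xi>. unConj (T (Conj \<xi>)))"
  have a: "?x \<xi> = unConj (T (Conj \<xi>))" for \<xi> by (simp add: bounded_linear_Blinfun_apply bl)
  have xb: "?x \<in> bops"
  proof (rule bopsI)
    fix c and \<xi> :: 'a
    have "Conj (c *\<^sub>C \<xi>) = cnj c *\<^sub>C Conj \<xi>" by (simp add: scaleC_conj_space_def)
    then show "?x (c *\<^sub>C \<xi>) = c *\<^sub>C ?x \<xi>"
      by (simp add: a bops_app[OF assms] del: conj_space.sel) (simp add: scaleC_conj_space_def)
  qed
  moreover have "T = jmap ?x" by (rule blinfun_eqI) (simp add: jmap_apply[OF xb] a)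
  ultimately show thesis by (rule that)
qed

lemma Mop_jmap: assumes "star_alg M" shows "Mop M = jmap ` M"
proof -
  have "opp x = jmap (adj x)" if "x \<in> M" for x using star_alg_bops[OF assms that] by (simp add: jmap_def)
  then show ?thesis unfolding Mop_def using star_alg_adj[OF assms] star_alg_bops[OF assms]
    by (auto simp: image_iff) (metis adj_adj jmap_def)
qed

text \<open>\<open>jmap\<close> is a conjugate-linear *-isomorphism between the full operator
  algebras, hence it carries commutants to commutants.\<close>

lemma commutant_jmap: assumes "M \<subseteq> bops" shows "commutant (jmap ` M) = jmap ` commutant M"
proof (intro equalityI subsetI)
  fix T assume T: "T \<in> commutant (jmap ` M)"
  then obtain x where x: "x \<in> bops" "T = jmap x" using jmap_surj commutant_bops by blast
  have "x \<in> commutant M"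
  proof (rule commutantI[OF x(1)])
    fix m assume m: "m \<in> M"
    then have "jmap (x \<odot> m) = jmap (m \<odot> x)" using commutantD[OF T, of "jmap m"] assms x by (auto simp: jmap_mult)
    then show "x \<odot> m = m \<odot> x" using jmap_inj m assms x by (meson bops_comp subsetD)
  qed
  then show "T \<in> jmap ` commutant M" using x by blast
next
  fix T assume "T \<in> jmap ` commutant M"
  then obtain x where x: "x \<in> commutant M" "T = jmap x" by blast
  then have xb: "x \<in> bops" using commutant_bops by blast
  show "T \<in> commutant (jmap ` M)"
  proof (rule commutantI)
    fix s assume "s \<in> jmap ` M"
    then obtain m where "m \<in> M" "s = jmap m" by blast
    then show "T \<odot> s = s \<odot> T" using commutantD[OF x(1)] assms xb x by (metis jmap_mult subsetD)
  qed (simp add: x xb)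
qed

lemma von_neumann_algebra_Mop:
  assumes "von_neumann_algebra M" shows "von_neumann_algebra (Mop M)"
proof -
  note sM = vN_star_alg[OF assms]
  have e: "Mop M = jmap ` M" by (rule Mop_jmap[OF sM])
  have b: "M \<subseteq> bops" by (rule vN_bops[OF assms])
  show ?thesis unfolding von_neumann_algebra_def e
  proof (intro conjI ballI)
    show "jmap ` M \<subseteq> bops" using b by auto
    show "adj x \<in> jmap ` M" if "x \<in> jmap ` M" for x using that b star_alg_adj[OF sM] by (auto simp: jmap_adj subset_iff)
    show "commutant (commutant (jmap ` M)) = jmap ` M"
      by (simp add: commutant_jmap b commutant_bops vN_double[OF assms])
  qed
qed

section \<open>Slices of elements of the tensor product algebra\<close>

context
  fixes t :: "'a::chilbert_space \<Rightarrow> 'b::chilbert_space \<Rightarrow> 'c::chilbert_space"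
    and M :: "'a bop set" and N :: "'b bop set"
  assumes t: "hilbert_tensor t" and M: "von_neumann_algebra M" and N: "von_neumann_algebra N"
begin

lemma op_tensor_gens: "{op_tensor t x y |x y. x \<in> M \<and> y \<in> N} \<subseteq> bops"
  using vN_bops[OF M] vN_bops[OF N] op_tensor_bops[OF t] by blast

lemma von_neumann_algebra_tensor: "von_neumann_algebra (vN_tensor t M N)"
  unfolding vN_tensor_def by (rule vN_vN_generated[OF op_tensor_gens])

lemma op_tensor_mem: "x \<in> M \<Longrightarrow> y \<in> N \<Longrightarrow> op_tensor t x y \<in> vN_tensor t M N"
  unfolding vN_tensor_def using vN_generated_subset[OF op_tensor_gens] by blast

lemma tensor_commute:
  assumes x': "x' \<in> commutant M" and y': "y' \<in> commutant N" and a: "a \<in> vN_tensor t M N"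
  shows "op_tensor t x' y' \<odot> a = a \<odot> op_tensor t x' y'"
proof -
  have b: "x' \<in> bops" "y' \<in> bops" using x' y' commutant_bops by auto
  have c: "op_tensor t x' y' \<odot> op_tensor t x y = op_tensor t x y \<odot> op_tensor t x' y'" if "x \<in> M" "y \<in> N" for x y
  proof -
    have "x \<in> bops" "y \<in> bops" using that vN_bops[OF M] vN_bops[OF N] by auto
    then show ?thesis using b commutantD[OF x' that(1)] commutantD[OF y' that(2)] by (simp add: op_tensor_mult[OF t])
  qed
  show ?thesis
  proof (rule vN_generated_commute[OF _ op_tensor_gens _ _ a[unfolded vN_tensor_def]])
    show "op_tensor t x' y' \<in> bops" by (rule op_tensor_bops[OF t b])
    fix s assume "s \<in> {op_tensor t x y |x y. x \<in> M \<and> y \<in> N}"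
    then obtain x y where s: "x \<in> M" "y \<in> N" "s = op_tensor t x y" by blast
    show "op_tensor t x' y' \<odot> s = s \<odot> op_tensor t x' y'" using c s by simp
    have "adj s = op_tensor t (adj x) (adj y)"
      unfolding s(3) by (rule op_tensor_adj[OF t]) (use s vN_bops[OF M] vN_bops[OF N] in auto)
    then show "op_tensor t x' y' \<odot> adj s = adj s \<odot> op_tensor t x' y'"
      using c s star_alg_adj[OF vN_star_alg[OF M]] star_alg_adj[OF vN_star_alg[OF N]] by simp
  qed
qed

text \<open>Elements of the tensor product commute with \<open>\<I> \<otimes> T\<close> for
  \<open>T\<close> in the commutant of \<open>N\<close>, and their slices therefore commute with
  \<open>T\<close>.\<close>

lemma slice_mem:
  assumes a: "a \<in> vN_tensor t M N"
    and S: "S \<in> bops" "\<And>\<eta> \<eta>'. cinner (t \<xi> \<eta>) (a (t \<xi>' \<eta>')) = cinner \<eta> (S \<eta>')"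
  shows "S \<in> N"
proof (rule vN_memI[OF N S(1)])
  fix T assume T: "T \<in> commutant N"
  then have "T \<in> bops" using commutant_bops by blast
  moreover have "\<I> \<in> commutant M" by (rule commutantI) auto
  ultimately show "S \<odot> T = T \<odot> S"
    using slice_intertwines[OF t S, of T T] tensor_commute[OF _ T a] by simp
qed

text \<open>Every slice of \<open>a\<close> lies in \<open>N\<close> and in its commutant, so it is
  a scalar; hence the matrix coefficients of \<open>a\<close> factor, and \<open>a\<close> is
  \<open>m1 \<otimes> 1\<close>. Here \<open>m1\<close> is a slice in the other leg at a fixed
  vector \<open>v\<close>, divided by its squared norm; it lies in \<open>M\<close> since
  \<open>a\<close> commutes with \<open>commutant M\<close> acting in the first leg.\<close>

lemma tensor_right_commutant:
  assumes N': "N \<inter> commutant N = range (\<lambda>c. scale_op c \<I>)" and nt: "\<exists>v::'b. v \<noteq> 0"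
    and a: "a \<in> vN_tensor t M N" and c: "\<And>y. y \<in> N \<Longrightarrow> a \<odot> op_tensor t \<I> y = op_tensor t \<I> y \<odot> a"
  shows "\<exists>m\<in>M. a = op_tensor t m \<I>"
proof -
  have ab: "a \<in> bops" using a vN_bops[OF von_neumann_algebra_tensor] by blast
  have sc: "\<exists>c. \<forall>\<eta> \<eta>'. cinner (t \<xi> \<eta>) (a (t \<xi>' \<eta>')) = c * cinner \<eta> \<eta>'" for \<xi> \<xi>'
  proof -
    obtain S where S: "S \<in> bops" "\<And>\<eta> \<eta>'. cinner (t \<xi> \<eta>) (a (t \<xi>' \<eta>')) = cinner \<eta> (S \<eta>')"
      by (rule slice_exists[OF t ab, of \<xi> \<xi>']) (rule that)
    have "S \<in> N" by (rule slice_mem[OF a S])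
    moreover have "S \<in> commutant N"
      by (rule commutantI[OF S(1)], rule slice_intertwines[OF t S]) (use vN_bops[OF N] c in auto)
    ultimately obtain c where "S = scale_op c \<I>" using N' by blast
    then show ?thesis using S(2) by (auto simp: cinner_scaleC_right)
  qed
  obtain v :: 'b where v: "v \<noteq> 0" using nt by blast
  obtain m where m: "m \<in> bops" "\<And>\<xi> \<xi>'. cinner (t \<xi> v) (a (t \<xi>' v)) = cinner \<xi> (m \<xi>')"
    by (rule slice_exists[OF hilbert_tensor_swap[OF t] ab, of v v]) (rule that)
  have main: "cinner (t \<xi> \<eta>) (a (t \<xi>' \<eta>')) * of_real ((norm v)\<^sup>2) = cinner \<xi> (m \<xi>') * cinner \<eta> \<eta>'" for \<xi> \<xi>' \<eta> \<eta>'
  proof -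
    obtain c where "\<And>\<eta> \<eta>'. cinner (t \<xi> \<eta>) (a (t \<xi>' \<eta>')) = c * cinner \<eta> \<eta>'" using sc by blast
    then show ?thesis by (simp add: m(2)[symmetric] cinner_self)
  qed
  define m1 where "m1 = (1 / (norm v)\<^sup>2) *\<^sub>R m"
  have m1b: "m1 \<in> bops" by (simp add: m1_def m)
  have "a = op_tensor t m1 \<I>"
  proof (rule slices_determine[OF t])
    fix \<xi> \<eta> \<xi>' \<eta>'
    show "cinner (t \<xi> \<eta>) (a (t \<xi>' \<eta>')) = cinner (t \<xi> \<eta>) (op_tensor t m1 \<I> (t \<xi>' \<eta>'))"
      using main[of \<xi> \<eta> \<xi>' \<eta>'] v
      by (simp add: op_tensor_apply[OF t] m1b ht_cinner[OF t]) (simp add: m1_def blinfun.scaleR_left cinner_scaleR_right field_simps)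
  qed
  moreover have "m1 \<in> M"
  proof (rule vN_memI[OF M m1b])
    fix T assume T: "T \<in> commutant M"
    then have Tb: "T \<in> bops" using commutant_bops by blast
    have "\<I> \<in> commutant N" by (rule commutantI) auto
    from tensor_commute[OF T this a] have "a \<odot> op_tensor (\<lambda>\<eta> \<xi>. t \<xi> \<eta>) \<I> T = op_tensor (\<lambda>\<eta> \<xi>. t \<xi> \<eta>) \<I> T \<odot> a"
      using Tb by (simp add: op_tensor_swap[OF t])
    from slice_intertwines[OF hilbert_tensor_swap[OF t] m Tb Tb this] have "m \<odot> T = T \<odot> m" .
    then show "m1 \<odot> T = T \<odot> m1" by (simp add: m1_def comp_scaleR_left comp_scaleR_right)
  qed
  ultimately show ?thesis by blast
qed

end

section \<open>The Longo-Rehren algebra\<close>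

locale longo_rehren_setup =
  fixes M :: "'h::chilbert_space bop set"
    and C Irr :: "'h endo set"
    and bar :: "'h endo \<Rightarrow> 'h endo"
    and R R' :: "'h endo \<Rightarrow> 'h bop"
    and L :: "('h, 'k::chilbert_space, 'l::chilbert_space) lr_data"
  assumes type_III: "type_III_factor M" and state: "\<exists>\<phi>. faithful_normal_state M \<phi>"
    and conj_sol: "conjugate_solutions M bar R R'"
    and rigid: "rigid_category M bar C"
    and irr: "irr_system M C Irr"
    and lr: "longo_rehren M C Irr bar R L"
begin

abbreviation "\<A> \<equiv> lrA L M"
abbreviation "\<B> \<equiv> lr_alg L"
abbreviation "emb \<equiv> lr_emb L"
abbreviation "lam \<equiv> lr_lam L"
abbreviation "ten \<equiv> lr_tensor L"
abbreviation "\<E>A \<equiv> lr_exp L"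

text \<open>The second argument enters through \<open>j\<close>, so both arguments range over
  \<open>M\<close>. The map is multiplicative and *-preserving in the pair, but conjugate linear in
  \<open>y\<close>.\<close>

definition tens :: "'h bop \<Rightarrow> 'h bop \<Rightarrow> 'l bop" where
  "tens x y = elem L x (jmap y)"

lemma factor_M: "factor M" using type_III by (simp add: type_III_factor_def)
lemma vN_M: "von_neumann_algebra M" using factor_M by (simp add: factor_def)
lemmas sM = vN_star_alg[OF vN_M]
lemmas bM = star_alg_bops[OF sM]
lemmas clM = star_alg_closed[OF sM]

text \<open>On the zero space the unit is zero, against the state having value one there.\<close>

lemma nontrivial_M: "\<exists>v::'h. v \<noteq> 0"
proof (rule ccontr)
  assume "\<not> ?thesis"
  then have z: "(\<I> :: 'h bop) = scale_op 0 \<I>" by (intro blinfun_eqI) simp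
  obtain \<phi> where \<phi>: "faithful_normal_state M \<phi>" using state by blast
  then have "\<phi> (scale_op 0 \<I>) = 0 * \<phi> \<I>" using star_alg_one[OF sM] unfolding faithful_normal_state_def by blast
  then show False using z \<phi> by (simp add: faithful_normal_state_def)
qed

lemma Mop_eq: "Mop M = jmap ` M" by (rule Mop_jmap[OF sM])
lemma vN_Mop: "von_neumann_algebra (Mop M)" by (rule von_neumann_algebra_Mop[OF vN_M])
lemma jmap_Mop: "y \<in> M \<Longrightarrow> jmap y \<in> Mop M" by (simp add: Mop_eq)
lemma ten: "hilbert_tensor ten" using lr by (simp add: longo_rehren_def)
lemma vN_A: "von_neumann_algebra \<A>" unfolding lrA_def by (rule von_neumann_algebra_tensor[OF ten vN_M vN_Mop])
lemmas sA = vN_star_alg[OF vN_A]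
lemmas bA = star_alg_bops[OF sA]

lemma emb: "emb \<in> normal_homs \<A> \<B>" and emb_inj: "inj_on emb \<A>"
  and B_gen: "\<B> = vN_generated (emb ` \<A> \<union> lam ` C)" and lam_bops: "lam ` C \<subseteq> bops"
  using lr by (auto simp: longo_rehren_def)

lemma B_gens: "emb ` \<A> \<union> lam ` C \<subseteq> bops"
proof -
  have "emb a \<in> bops" if "a \<in> \<A>" for a
  proof -
    have "emb a \<in> vN_generated (emb ` \<A> \<union> lam ` C)" using normal_homs_mem[OF emb that] B_gen by simp
    then show ?thesis unfolding vN_generated_def using commutant_bops by blast
  qed
  then show ?thesis using lam_bops by auto
qed

lemma vN_B: "von_neumann_algebra \<B>" unfolding B_gen by (rule vN_vN_generated[OF B_gens])
lemmas sB = vN_star_alg[OF vN_B]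
lemmas bB = star_alg_bops[OF sB]
lemmas clB = star_alg_closed[OF sB]
lemma emb_B: "a \<in> \<A> \<Longrightarrow> emb a \<in> \<B>" by (rule normal_homs_mem[OF emb])
lemma lam_B: "\<pi> \<in> C \<Longrightarrow> lam \<pi> \<in> \<B>" using vN_generated_subset[OF B_gens] B_gen by auto

lemma op_tensor_A: "x \<in> M \<Longrightarrow> y \<in> M \<Longrightarrow> op_tensor ten x (jmap y) \<in> \<A>"
  unfolding lrA_def by (rule op_tensor_mem[OF ten vN_M vN_Mop _ jmap_Mop])

lemma tens_emb: "tens x y = emb (op_tensor ten x (jmap y))"
  by (simp add: tens_def elem_def)

lemma tens_B: "x \<in> M \<Longrightarrow> y \<in> M \<Longrightarrow> tens x y \<in> \<B>"
  by (simp add: tens_emb emb_B op_tensor_A)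

lemma tens_bops: "x \<in> M \<Longrightarrow> y \<in> M \<Longrightarrow> tens x y \<in> bops"
  by (rule bB[OF tens_B])

lemma tens_mult: "x \<in> M \<Longrightarrow> y \<in> M \<Longrightarrow> x' \<in> M \<Longrightarrow> y' \<in> M \<Longrightarrow> tens x y \<odot> tens x' y' = tens (x \<odot> x') (y \<odot> y')"
  by (simp add: tens_emb normal_homs_mult[OF emb, symmetric] op_tensor_A op_tensor_mult[OF ten] bM jmap_mult)

lemma tens_adj: "x \<in> M \<Longrightarrow> y \<in> M \<Longrightarrow> adj (tens x y) = tens (adj x) (adj y)"
  by (simp add: tens_emb normal_homs_adj[OF emb, symmetric] op_tensor_A op_tensor_adj[OF ten] bM jmap_adj)

lemma tens_one: "tens \<I> \<I> = \<I>"
  by (simp add: tens_emb op_tensor_one[OF ten] normal_homs_one[OF emb])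

lemma tens_diff: "x \<in> M \<Longrightarrow> x' \<in> M \<Longrightarrow> y \<in> M \<Longrightarrow> tens (x - x') y = tens x y - tens x' y"
  by (simp add: tens_emb normal_homs_diff[OF emb sA, symmetric] op_tensor_A op_tensor_diff_left[OF ten] bM)

lemma tens_inj: assumes x: "x \<in> M" and z: "tens x \<I> = 0" shows "x = 0"
proof -
  have "emb (op_tensor ten x \<I>) = emb 0" using z by (simp add: tens_emb normal_homs_zero[OF emb sA])
  then have o: "op_tensor ten x \<I> = 0"
    using emb_inj op_tensor_A[OF x star_alg_one[OF sM]] star_alg_zero[OF sA] by (auto dest: inj_onD)
  obtain v :: 'h where v: "v \<noteq> 0" using nontrivial_M by blast
  have "x \<odot> \<I> = 0"
  proof (rule blinfun_eqI)
    fix \<xi>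
    have "ten (blinfun_apply x \<xi>) (Conj v) = blinfun_apply (op_tensor ten x \<I>) (ten \<xi> (Conj v))"
      by (simp add: op_tensor_apply[OF ten] bM x)
    then have "ten (blinfun_apply x \<xi>) (Conj v) = 0" by (simp add: o)
    then have "cinner (blinfun_apply x \<xi>) (blinfun_apply x \<xi>) * cinner (Conj v) (Conj v) = 0"
      unfolding ht_cinner[OF ten, symmetric] by simp
    moreover have "cinner (Conj v) (Conj v) \<noteq> 0" using v by (simp add: cinner_conj_space_def cinner_self)
    ultimately show "blinfun_apply (x \<odot> \<I>) \<xi> = blinfun_apply 0 \<xi>" by (simp add: cinner_self)
  qed
  then show ?thesis by simp
qed

section \<open>Relations of the category, the generators and the conditional expectation\<close>

lemma C_End0: "\<pi> \<in> C \<Longrightarrow> \<pi> \<in> End0 M" using rigid by (auto simp: rigid_category_def)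
lemma C_End: "\<pi> \<in> C \<Longrightarrow> \<pi> \<in> End M" using C_End0 by (auto simp: End0_def)
lemma C_bar: "\<pi> \<in> C \<Longrightarrow> bar \<pi> \<in> C" using rigid by (auto simp: rigid_category_def)
lemma C_comp: "\<pi> \<in> C \<Longrightarrow> \<rho> \<in> C \<Longrightarrow> compose M \<pi> \<rho> \<in> C" using rigid by (auto simp: rigid_category_def)
lemma C_id: "idend M \<in> C" using rigid by (auto simp: rigid_category_def)
lemma C_mem: "\<pi> \<in> C \<Longrightarrow> x \<in> M \<Longrightarrow> \<pi> x \<in> M" using C_End End_mem by blast

lemma idend_apply [simp]: "x \<in> M \<Longrightarrow> idend M x = x" by (simp add: idend_def)
lemma compose_apply [simp]: "x \<in> M \<Longrightarrow> compose M \<pi> \<rho> x = \<pi> (\<rho> x)" by (simp add: compose_def)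

lemma conj_pair:
  assumes "\<pi> \<in> C" shows "conjugate_pair M \<pi> (bar \<pi>) (R \<pi>) (R' \<pi>) (sdim M \<pi>)"
  using conj_sol C_End0[OF assms] C_End[OF assms] C_End[OF C_bar[OF assms]]
  unfolding conjugate_solutions_def conjugate_pair_def intertwiners_def by auto

lemma conj_pairD:
  assumes "\<pi> \<in> C"
  shows R_M: "R \<pi> \<in> M" and R'_M: "R' \<pi> \<in> M"
    and R_int: "x \<in> M \<Longrightarrow> R \<pi> \<odot> x = bar \<pi> (\<pi> x) \<odot> R \<pi>" and R'_int: "x \<in> M \<Longrightarrow> R' \<pi> \<odot> x = \<pi> (bar \<pi> x) \<odot> R' \<pi>"
    and R_norm: "adj (R \<pi>) \<odot> R \<pi> = sdim M \<pi> *\<^sub>R \<I>"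
    and R_eq: "adj (R \<pi>) \<odot> bar \<pi> (R' \<pi>) = \<I>" and R'_eq: "adj (R' \<pi>) \<odot> \<pi> (R \<pi>) = \<I>"
  using conj_pair[OF assms] by (auto simp: conjugate_pair_def)

lemma R_intertwiner: "\<pi> \<in> C \<Longrightarrow> R \<pi> \<in> intertwiners M (idend M) (compose M (bar \<pi>) \<pi>)"
  and R'_intertwiner: "\<pi> \<in> C \<Longrightarrow> R' \<pi> \<in> intertwiners M (idend M) (compose M \<pi> (bar \<pi>))"
  by (rule intertwinersI; simp add: R_M R'_M R_int R'_int)+

lemma lam_emb:
  assumes "\<pi> \<in> C"
  obtains \<Theta> where "\<And>a. a \<in> \<A> \<Longrightarrow> \<Theta> a \<in> \<A>" "\<And>a. a \<in> \<A> \<Longrightarrow> lam \<pi> \<odot> emb a = emb (\<Theta> a) \<odot> lam \<pi>"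
    "\<And>x y. x \<in> M \<Longrightarrow> y \<in> M \<Longrightarrow> \<Theta> (op_tensor ten x (jmap y)) = op_tensor ten (\<pi> x) (jmap (\<pi> y))"
proof -
  have "\<forall>\<pi>\<in>C. \<exists>\<Theta>. is_tensor_endo ten M (Mop M) \<pi> (op_endo M \<pi>) \<Theta> \<and>
      (\<forall>a\<in>\<A>. lam \<pi> \<odot> emb a = emb (\<Theta> a) \<odot> lam \<pi>)"
    using lr unfolding longo_rehren_def by (elim conjE)
  then obtain \<Theta> where \<Theta>: "is_tensor_endo ten M (Mop M) \<pi> (op_endo M \<pi>) \<Theta>"
      "\<And>a. a \<in> \<A> \<Longrightarrow> lam \<pi> \<odot> emb a = emb (\<Theta> a) \<odot> lam \<pi>"
    using assms by blast
  have "op_endo M \<pi> (jmap y) = jmap (\<pi> y)" if "y \<in> M" for y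
  proof -
    have "inj_on jmap M" by (rule inj_onI) (use jmap_inj bM in blast)
    then have "inv_into M jmap (jmap y) = y" using that by simp
    then show ?thesis using jmap_Mop[OF that] by (simp add: op_endo_def)
  qed
  then show thesis
    using \<Theta> jmap_Mop by (intro that[of \<Theta>]) (auto simp: is_tensor_endo_def lrA_def[symmetric] End_mem)
qed

lemma lam_tens: "\<pi> \<in> C \<Longrightarrow> x \<in> M \<Longrightarrow> y \<in> M \<Longrightarrow> lam \<pi> \<odot> tens x y = tens (\<pi> x) (\<pi> y) \<odot> lam \<pi>"
  using lam_emb[of \<pi>] op_tensor_A[of x y] unfolding tens_emb by metis

lemma lam_mult: "\<pi> \<in> C \<Longrightarrow> \<rho> \<in> C \<Longrightarrow> lam \<pi> \<odot> lam \<rho> = lam (compose M \<pi> \<rho>)"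
  using lr by (simp add: longo_rehren_def)

lemma lam_adj: "\<pi> \<in> C \<Longrightarrow> adj (lam \<pi>) = tens (adj (R \<pi>)) (adj (R \<pi>)) \<odot> lam (bar \<pi>)"
  using lr R_M tens_adj[of "R \<pi>" "R \<pi>"] by (simp add: longo_rehren_def tens_def)

lemma lam_rel: "\<pi> \<in> C \<Longrightarrow> \<rho> \<in> C \<Longrightarrow> T \<in> intertwiners M \<pi> \<rho> \<Longrightarrow> tens T \<I> \<odot> lam \<pi> = tens \<I> (adj T) \<odot> lam \<rho>"
  using lr by (simp add: longo_rehren_def tens_def)

lemma condE: "fn_cond_exp \<B> (emb ` \<A>) \<E>A"
  using lr unfolding longo_rehren_def by blast

lemma condE_mem: "x \<in> \<B> \<Longrightarrow> \<E>A x \<in> emb ` \<A>"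
  and condE_id: "a \<in> \<A> \<Longrightarrow> \<E>A (emb a) = emb a"
  and condE_add: "x \<in> \<B> \<Longrightarrow> y \<in> \<B> \<Longrightarrow> \<E>A (x + y) = \<E>A x + \<E>A y"
  and condE_bimod: "x \<in> \<B> \<Longrightarrow> a \<in> \<A> \<Longrightarrow> b \<in> \<A> \<Longrightarrow> \<E>A (emb a \<odot> x \<odot> emb b) = emb a \<odot> \<E>A x \<odot> emb b"
  and condE_faithful: "x \<in> \<B> \<Longrightarrow> \<E>A (adj x \<odot> x) = 0 \<Longrightarrow> x = 0"
  and condE_cont: "continuous_map (subtopology sigma_weak \<B>) sigma_weak \<E>A"
  using condE by (auto simp: fn_cond_exp_def cond_exp_def continuous_map_in_subtopology)

lemma condE_left: "x \<in> \<B> \<Longrightarrow> a \<in> \<A> \<Longrightarrow> \<E>A (emb a \<odot> x) = emb a \<odot> \<E>A x"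
  and condE_right: "x \<in> \<B> \<Longrightarrow> a \<in> \<A> \<Longrightarrow> \<E>A (x \<odot> emb a) = \<E>A x \<odot> emb a"
  using condE_bimod[of x a \<I>] condE_bimod[of x \<I> a] star_alg_one[OF sA] by (simp_all add: normal_homs_one[OF emb])

lemma condE_diff: "x \<in> \<B> \<Longrightarrow> y \<in> \<B> \<Longrightarrow> \<E>A (x - y) = \<E>A x - \<E>A y"
  using condE_add[of "x - y" y] star_alg_diff[OF sB] by simp

text \<open>Up to a factor, \<open>x \<mapsto> adj (R \<pi>) \<odot> bar \<pi> x \<odot> R
  \<pi>\<close> is the left inverse of \<open>\<pi>\<close>; the \<open>adj (R \<pi>)\<close> in the
  second leg is absorbed by the relation for the intertwiner \<open>R \<pi>\<close>. The factor
  \<open>lam (idend M)\<close> stays until \<open>lam_id\<close> shows that it is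
  \<open>\<I>\<close>.\<close>

lemma lam_sq:
  assumes "\<pi> \<in> C" "x \<in> M"
  shows "adj (lam \<pi>) \<odot> (tens x \<I> \<odot> lam \<pi>) = tens (adj (R \<pi>) \<odot> bar \<pi> x \<odot> R \<pi>) \<I> \<odot> lam (idend M)"
proof -
  note m = R_M[OF assms(1)] C_mem[OF C_bar[OF assms(1)] assms(2)] End_one[OF C_End[OF C_bar[OF assms(1)]]]
  have r: "tens (R \<pi>) \<I> \<odot> lam (idend M) = tens \<I> (adj (R \<pi>)) \<odot> lam (compose M (bar \<pi>) \<pi>)"
    by (rule lam_rel[OF C_id C_comp[OF C_bar[OF assms(1)] assms(1)] R_intertwiner[OF assms(1)]])
  have "adj (lam \<pi>) \<odot> (tens x \<I> \<odot> lam \<pi>) = tens (adj (R \<pi>)) (adj (R \<pi>)) \<odot> (lam (bar \<pi>) \<odot> tens x \<I>) \<odot> lam \<pi>"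
    by (simp add: lam_adj assms comp_assoc)
  also have "\<dots> = tens (adj (R \<pi>)) (adj (R \<pi>)) \<odot> tens (bar \<pi> x) \<I> \<odot> (lam (bar \<pi>) \<odot> lam \<pi>)"
    using lam_tens[OF C_bar[OF assms(1)] assms(2) star_alg_one[OF sM]] by (simp add: m comp_assoc)
  also have "\<dots> = tens (adj (R \<pi>) \<odot> bar \<pi> x) \<I> \<odot> (tens \<I> (adj (R \<pi>)) \<odot> lam (compose M (bar \<pi>) \<pi>))"
    by (simp add: tens_mult lam_mult C_bar assms m clM flip: comp_assoc)
  also have "\<dots> = tens (adj (R \<pi>) \<odot> bar \<pi> x \<odot> R \<pi>) \<I> \<odot> lam (idend M)"
    unfolding r[symmetric] by (simp add: tens_mult m clM flip: comp_assoc)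
  finally show ?thesis .
qed

text \<open>The element is idempotent by the product rule, and \<open>lam_sq\<close> makes its
  absolute square a nonzero multiple of it, so it is self-adjoint. Faithfulness of the expectation,
  applied to the complementary projection, shows that it is \<open>\<I>\<close>.\<close>

lemma lam_id: "lam (idend M) = \<I>"
proof -
  let ?l = "lam (idend M)" and ?d = "sdim M (idend M)"
  have lB: "?l \<in> \<B>" by (rule lam_B[OF C_id])
  have ll: "?l \<odot> ?l = ?l"
  proof -
    have "compose M (idend M) (idend M) = idend M" by (auto simp: compose_def idend_def fun_eq_iff)
    then show ?thesis using lam_mult[OF C_id C_id] by simp
  qed
  have e: "adj ?l \<odot> ?l = tens (?d *\<^sub>R \<I>) \<I> \<odot> ?l"
    using lam_sq[OF C_id star_alg_one[OF sM]] by (simp add: tens_one End_one[OF C_End[OF C_bar[OF C_id]]] R_norm[OF C_id])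
  have td: "tens (?d *\<^sub>R \<I>) \<I> = ?d *\<^sub>R \<I>"
  proof -
    have "op_tensor ten (?d *\<^sub>R \<I>) \<I> = ?d *\<^sub>R \<I>"
      by (rule op_tensor_unique[OF ten]) (auto simp: blinfun.scaleR_left scaleR_scaleC ht_scale_left[OF ten])
    then show ?thesis by (simp add: tens_emb normal_homs_scaleR[OF emb sA star_alg_one[OF sA]] normal_homs_one[OF emb])
  qed
  have d: "adj ?l \<odot> ?l = ?d *\<^sub>R ?l" unfolding e td by (simp add: comp_scaleR_left)
  have d0: "?d \<noteq> 0"
  proof
    assume "?d = 0"
    then have "adj (R (idend M)) \<odot> R (idend M) = 0" using R_norm[OF C_id] by simp
    then have "R (idend M) = 0" by (rule adj_comp_zero[rotated]) (simp add: bM R_M C_id)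
    then have "(\<I> :: 'h bop) = 0"
      using R'_eq[OF C_id] normal_homs_zero[OF C_End[OF C_id, unfolded End_def] sM] by simp
    then show False using nontrivial_M by (metis blinfun.zero_left id_blinfun.rep_eq)
  qed
  have lb: "?l \<in> bops" by (rule bB[OF lB])
  have "adj (adj ?l \<odot> ?l) = adj ?l \<odot> ?l" by (simp add: adj_comp lb)
  then have "?d *\<^sub>R adj ?l = ?d *\<^sub>R ?l" unfolding d adj_scaleR[OF lb] .
  then have la: "adj ?l = ?l" using d0 by simp
  have "adj (\<I> - ?l) \<odot> (\<I> - ?l) = \<I> - ?l" by (simp add: adj_diff lb la comp_diff_left comp_diff_right ll)
  moreover have "\<E>A (\<I> - ?l) = 0"
  proof -
    have 1: "\<I> = emb \<I>" by (simp add: normal_homs_one[OF emb])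
    have "\<E>A (emb \<I> \<odot> lam (idend M)) = emb \<I>"
    proof -
      have "\<forall>\<pi>\<in>Irr. \<forall>a\<in>\<A>. \<E>A (emb a \<odot> lam \<pi>) = (if \<pi> = idend M then emb a else 0)"
        using lr by (simp add: longo_rehren_def)
      moreover have "idend M \<in> Irr" using irr by (simp add: irr_system_def)
      ultimately show ?thesis using star_alg_one[OF sA] by simp
    qed
    then have "\<E>A ?l = \<I>" by (simp add: normal_homs_one[OF emb])
    moreover have "\<E>A \<I> = \<I>" using condE_id[OF star_alg_one[OF sA]] by (simp add: normal_homs_one[OF emb])
    ultimately show ?thesis using condE_diff[OF star_alg_one[OF sB] lB] by simp
  qed
  ultimately have "\<E>A (adj (\<I> - ?l) \<odot> (\<I> - ?l)) = 0" by simp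
  then have "\<I> - ?l = 0" by (rule condE_faithful[rotated]) (intro star_alg_diff[OF sB] star_alg_one[OF sB] lB)
  then show ?thesis by simp
qed

lemma lam_bar_lam:
  assumes "\<pi> \<in> C"
  shows "tens \<I> (adj (R \<pi>)) \<odot> lam (compose M (bar \<pi>) \<pi>) = tens (R \<pi>) \<I>"
    and "tens (adj (R \<pi>)) \<I> \<odot> lam (compose M (bar \<pi>) \<pi>) = tens \<I> (R \<pi>)"
proof -
  note c = C_comp[OF C_bar[OF assms] assms]
  show "tens \<I> (adj (R \<pi>)) \<odot> lam (compose M (bar \<pi>) \<pi>) = tens (R \<pi>) \<I>"
    using lam_rel[OF C_id c R_intertwiner[OF assms]] by (simp add: lam_id)
  have "adj (R \<pi>) \<in> intertwiners M (compose M (bar \<pi>) \<pi>) (idend M)"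
    by (rule intertwiners_adj[OF sM C_End[OF C_id] C_End[OF c] R_intertwiner[OF assms]])
  from lam_rel[OF c C_id this] show "tens (adj (R \<pi>)) \<I> \<odot> lam (compose M (bar \<pi>) \<pi>) = tens \<I> (R \<pi>)"
    by (simp add: lam_id bM R_M assms)
qed

text \<open>Forming the absolute square reduces the claim to the first leg:
  \<open>bar \<pi> T \<odot> R \<pi>\<close> vanishes. Bending back with the second conjugate
  equation writes \<open>T\<close> as
  \<open>adj (R' \<pi>) \<odot> \<pi> (bar \<pi> T \<odot> R \<pi>)\<close>.\<close>

lemma lam_separating:
  assumes \<pi>: "\<pi> \<in> C" and T: "T \<in> M" and z: "tens T \<I> \<odot> lam \<pi> = 0"
  shows "T = 0"
proof -
  note b = C_bar[OF \<pi>]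
  note e = C_End[OF b]
  have TT: "adj T \<odot> T \<in> M" using T by (auto intro: clM)
  have "tens (adj T \<odot> T) \<I> = tens (adj T) \<I> \<odot> tens T \<I>" using T by (simp add: tens_mult clM)
  then have "tens (adj T \<odot> T) \<I> \<odot> lam \<pi> = 0" using z by (simp add: comp_assoc)
  then have "tens (adj (R \<pi>) \<odot> bar \<pi> (adj T \<odot> T) \<odot> R \<pi>) \<I> = 0"
    using lam_sq[OF \<pi> TT] by (simp add: lam_id)
  then have "adj (R \<pi>) \<odot> bar \<pi> (adj T \<odot> T) \<odot> R \<pi> = 0"
    by (rule tens_inj[rotated]) (intro clM R_M \<pi> C_mem[OF b] T)
  moreover have "bar \<pi> (adj T \<odot> T) = adj (bar \<pi> T) \<odot> bar \<pi> T"
    using T by (simp add: End_mult[OF e] End_adj[OF e] clM)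
  ultimately have "adj (bar \<pi> T \<odot> R \<pi>) \<odot> (bar \<pi> T \<odot> R \<pi>) = 0"
    using bM[OF C_mem[OF b T]] bM[OF R_M[OF \<pi>]] by (simp add: adj_comp comp_assoc)
  then have 0: "bar \<pi> T \<odot> R \<pi> = 0"
    by (rule adj_comp_zero[rotated]) (simp_all add: bM[OF C_mem[OF b T]] bM[OF R_M[OF \<pi>]])
  have "adj (R' \<pi>) \<odot> \<pi> (bar \<pi> T) = T \<odot> adj (R' \<pi>)"
  proof -
    have "adj (R' \<pi> \<odot> adj T) = adj (\<pi> (bar \<pi> (adj T)) \<odot> R' \<pi>)" using R'_int[OF \<pi>, of "adj T"] T by (simp add: clM)
    then show ?thesis using T bM R'_M[OF \<pi>] C_mem[OF \<pi>] C_mem[OF b]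
      by (simp add: adj_comp End_adj[OF e] End_adj[OF C_End[OF \<pi>]] clM)
  qed
  then have "T = adj (R' \<pi>) \<odot> \<pi> (bar \<pi> T) \<odot> \<pi> (R \<pi>)" using R'_eq[OF \<pi>] by (simp add: comp_assoc)
  also have "\<dots> = adj (R' \<pi>) \<odot> \<pi> (bar \<pi> T \<odot> R \<pi>)"
    using C_mem[OF b T] R_M[OF \<pi>] by (simp add: End_mult[OF C_End[OF \<pi>]] comp_assoc)
  also have "\<dots> = 0" unfolding 0 using normal_homs_zero[OF C_End[OF \<pi>, unfolded End_def] sM] by simp
  finally show ?thesis .
qed

lemma lam_separating_eq:
  assumes "\<pi> \<in> C" "S \<in> M" "T \<in> M" "tens S \<I> \<odot> lam \<pi> = tens T \<I> \<odot> lam \<pi>"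
  shows "S = T"
  using lam_separating[of \<pi> "S - T"] assms star_alg_diff[OF sM] by (simp add: tens_diff clM comp_diff_left)

section \<open>The dense *-algebra of finite sums\<close>

inductive_set polys :: "'l bop set" where
  base: "a \<in> \<A> \<Longrightarrow> \<pi> \<in> C \<Longrightarrow> emb a \<odot> lam \<pi> \<in> polys"
| add: "x \<in> polys \<Longrightarrow> y \<in> polys \<Longrightarrow> x + y \<in> polys"

lemma polys_B: "x \<in> polys \<Longrightarrow> x \<in> \<B>"
  by (induction rule: polys.induct) (auto intro: clB emb_B lam_B)

lemma emb_polys: "a \<in> \<A> \<Longrightarrow> emb a \<in> polys"
  using polys.base[OF _ C_id, of a] by (simp add: lam_id)

lemma lam_polys: "\<pi> \<in> C \<Longrightarrow> lam \<pi> \<in> polys"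
  using polys.base[OF star_alg_one[OF sA], of \<pi>] by (simp add: normal_homs_one[OF emb])

lemma emb_lam_mult:
  assumes "a \<in> \<A>" "\<pi> \<in> C" "b \<in> \<A>" "\<rho> \<in> C"
  obtains c where "c \<in> \<A>" "(emb a \<odot> lam \<pi>) \<odot> (emb b \<odot> lam \<rho>) = emb c \<odot> lam (compose M \<pi> \<rho>)"
proof -
  obtain \<Theta> where \<Theta>: "\<And>a. a \<in> \<A> \<Longrightarrow> \<Theta> a \<in> \<A>" "\<And>a. a \<in> \<A> \<Longrightarrow> lam \<pi> \<odot> emb a = emb (\<Theta> a) \<odot> lam \<pi>"
    using lam_emb[OF assms(2)] by metis
  have "(emb a \<odot> lam \<pi>) \<odot> (emb b \<odot> lam \<rho>) = emb a \<odot> (lam \<pi> \<odot> emb b) \<odot> lam \<rho>" by (simp add: comp_assoc)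
  also have "\<dots> = emb (a \<odot> \<Theta> b) \<odot> lam (compose M \<pi> \<rho>)"
    using \<Theta> assms by (simp add: normal_homs_mult[OF emb] lam_mult[symmetric] comp_assoc)
  finally show thesis using that star_alg_mult[OF sA assms(1) \<Theta>(1)[OF assms(3)]] by blast
qed

lemma star_alg_polys: "star_alg polys"
  unfolding star_alg_def
proof (intro conjI ballI allI)
  show "polys \<subseteq> bops" using polys_B bB by blast
  show "\<I> \<in> polys" using emb_polys[OF star_alg_one[OF sA]] by (simp add: normal_homs_one[OF emb])
  have 1: "(emb a \<odot> lam \<pi>) \<odot> y \<in> polys" if a: "a \<in> \<A>" "\<pi> \<in> C" and "y \<in> polys" for a \<pi> y
    using \<open>y \<in> polys\<close>
  proof induction
    case (base b \<rho>)
    then show ?case using emb_lam_mult[OF a base] polys.base C_comp[OF a(2) base(2)] by metis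
  qed (simp add: comp_add_right polys.add)
  show "x \<odot> y \<in> polys" if "x \<in> polys" "y \<in> polys" for x y
    using that(1) by induction (auto simp: comp_add_left polys.add 1 that(2))
  then have m: "x \<odot> y \<in> polys" if "x \<in> polys" "y \<in> polys" for x y using that by blast
  show "adj x \<in> polys" if "x \<in> polys" for x
    using that
  proof induction
    case (base a \<pi>)
    have "adj (emb a \<odot> lam \<pi>) = (tens (adj (R \<pi>)) (adj (R \<pi>)) \<odot> lam (bar \<pi>)) \<odot> emb (adj a)"
      using base bB[OF emb_B] bB[OF lam_B] by (simp add: adj_comp lam_adj normal_homs_adj[OF emb])
    moreover have "tens (adj (R \<pi>)) (adj (R \<pi>)) \<in> polys"
      unfolding tens_emb by (intro emb_polys op_tensor_A clM R_M base)
    ultimately show ?case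
      using m lam_polys[OF C_bar[OF base(2)]] emb_polys[OF star_alg_adj[OF sA base(1)]] by simp
  next
    case (add x y)
    then show ?case using polys_B bB by (simp add: adj_add polys.add)
  qed
  show "scale_op c x \<in> polys" if "x \<in> polys" for c x
    using that
  proof induction
    case (base a \<pi>)
    have "scale_op c (emb a \<odot> lam \<pi>) = emb (scale_op c a) \<odot> lam \<pi>"
      using base by (simp add: comp_scale_op_left normal_homs_scale[OF emb])
    then show ?case using polys.base star_alg_scale[OF sA] base by simp
  qed (simp add: scale_op_add polys.add)
qed (rule polys.add)

lemma polys_dense: "y \<in> \<B> \<Longrightarrow> y \<in> sigma_weak closure_of polys"
proof (rule bicommutant_density[OF star_alg_polys])
  assume y: "y \<in> \<B>"
  have "vN_generated (emb ` \<A> \<union> lam ` C) \<subseteq> commutant (commutant polys)"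
  proof (rule vN_generated_minimal)
    show "von_neumann_algebra (commutant (commutant polys))"
    proof -
      have "star_alg (commutant polys)"
        by (rule star_alg_commutant) (use star_alg_bops[OF star_alg_polys] star_alg_adj[OF star_alg_polys] in auto)
      then show ?thesis by (intro von_neumann_algebra_commutant) (auto simp: star_alg_def)
    qed
    have "emb ` \<A> \<union> lam ` C \<subseteq> polys" using emb_polys lam_polys by auto
    also have "\<dots> \<subseteq> commutant (commutant polys)"
      by (rule subset_double_commutant) (use star_alg_bops[OF star_alg_polys] in blast)
    finally show "emb ` \<A> \<union> lam ` C \<subseteq> commutant (commutant polys)" .
  qed
  then show "y \<in> commutant (commutant polys)" using y B_gen by blast
qed

section \<open>Fourier coefficients and the relative commutant of the opposite factor\<close>

lemma lam_adj_tens: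
  assumes "\<pi> \<in> C" "y \<in> M"
  shows "adj (lam \<pi>) \<odot> tens \<I> (\<pi> y) = tens \<I> y \<odot> adj (lam \<pi>)"
proof -
  note e = C_End[OF assms(1)]
  have "adj (lam \<pi> \<odot> tens \<I> (adj y)) = adj (tens \<I> (adj (\<pi> y)) \<odot> lam \<pi>)"
    using lam_tens[OF assms(1) star_alg_one[OF sM] star_alg_adj[OF sM assms(2)]]
    by (simp add: End_one[OF e] End_adj[OF e] assms)
  then show ?thesis using assms bB[OF lam_B] bM[OF C_mem[OF assms]] bM[OF assms(2)]
    by (simp add: adj_comp tens_bops tens_adj clM C_mem)
qed

lemma condE_lam_adj_zero:
  assumes z: "z \<in> \<B>" "\<E>A z = 0" and comm: "\<And>y. y \<in> M \<Longrightarrow> z \<odot> tens \<I> y = tens \<I> y \<odot> z" and \<pi>: "\<pi> \<in> C"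
  shows "\<E>A (z \<odot> adj (lam \<pi>)) = 0"
proof -
  have lB: "adj (lam \<pi>) \<in> \<B>" "z \<odot> adj (lam \<pi>) \<in> \<B>" using z lam_B[OF \<pi>] by (auto intro: clB)
  obtain a where a: "a \<in> \<A>" "\<E>A (z \<odot> adj (lam \<pi>)) = emb a" using condE_mem[OF lB(2)] by auto
  have ab: "a \<in> bops" by (rule bA[OF a(1)])
  have inj: "x = y" if "x \<in> \<A>" "y \<in> \<A>" "emb x = emb y" for x y using emb_inj that by (auto dest: inj_onD)
  let ?o = "\<lambda>y. op_tensor ten \<I> (jmap y)"
  have oA: "?o y \<in> \<A>" if "y \<in> M" for y using op_tensor_A that star_alg_one[OF sM] by blast
  \<comment> \<open>The bimodule property of the expectation transfers the commutation of
    \<open>z\<close> to its coefficient, twisted by \<open>\<pi>\<close>.\<close>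
  have c1: "a \<odot> ?o (\<pi> y) = ?o y \<odot> a" if y: "y \<in> M" for y
  proof (rule inj)
    note \<pi>y = C_mem[OF \<pi> y]
    have "emb (a \<odot> ?o (\<pi> y)) = \<E>A (z \<odot> adj (lam \<pi>)) \<odot> tens \<I> (\<pi> y)"
      using a oA[OF \<pi>y] by (simp add: normal_homs_mult[OF emb] tens_emb)
    also have "\<dots> = \<E>A (z \<odot> (adj (lam \<pi>) \<odot> tens \<I> (\<pi> y)))"
      using condE_right[OF lB(2) oA[OF \<pi>y]] by (simp add: tens_emb comp_assoc)
    also have "z \<odot> (adj (lam \<pi>) \<odot> tens \<I> (\<pi> y)) = tens \<I> y \<odot> (z \<odot> adj (lam \<pi>))"
      unfolding lam_adj_tens[OF \<pi> y] using comm[OF y] by (simp flip: comp_assoc)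
    also have "\<E>A (tens \<I> y \<odot> (z \<odot> adj (lam \<pi>))) = tens \<I> y \<odot> emb a"
      using condE_left[OF lB(2) oA[OF y]] a by (simp add: tens_emb)
    finally show "emb (a \<odot> ?o (\<pi> y)) = emb (?o y \<odot> a)" using a oA[OF y] by (simp add: normal_homs_mult[OF emb] tens_emb)
  qed (use a oA[OF y] oA[OF C_mem[OF \<pi> y]] star_alg_mult[OF sA] in auto)
  \<comment> \<open>For \<open>v\<close> in \<open>(id, \<pi>)\<close> the intertwiner relation
    collapses \<open>adj (lam \<pi>) \<odot> tens \<I> v\<close> to
    \<open>tens (adj v) \<I>\<close>, which can be pulled out of the expectation; what remains is
    the expectation of \<open>z\<close>, which is zero.\<close>
  have c2: "a \<odot> ?o v = 0" if v: "v \<in> intertwiners M (idend M) \<pi>" for v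
  proof (rule inj)
    note vM = intertwinersD(1)[OF v]
    have "adj (tens v \<I>) = adj (tens \<I> (adj v) \<odot> lam \<pi>)" using lam_rel[OF C_id \<pi> v] by (simp add: lam_id)
    then have t: "adj (lam \<pi>) \<odot> tens \<I> v = tens (adj v) \<I>"
      using vM bB[OF lam_B[OF \<pi>]] by (simp add: adj_comp tens_adj tens_bops clM bM)
    have "emb (a \<odot> ?o v) = \<E>A (z \<odot> adj (lam \<pi>)) \<odot> tens \<I> v"
      using a oA[OF vM] by (simp add: normal_homs_mult[OF emb] tens_emb)
    also have "\<dots> = \<E>A (z \<odot> (adj (lam \<pi>) \<odot> tens \<I> v))"
      using condE_right[OF lB(2) oA[OF vM]] by (simp add: tens_emb comp_assoc)
    also have "\<dots> = \<E>A z \<odot> tens (adj v) \<I>"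
      unfolding t using condE_right[OF z(1) op_tensor_A[OF star_alg_adj[OF sM vM] star_alg_one[OF sM]]] by (simp add: tens_emb)
    finally show "emb (a \<odot> ?o v) = emb 0" using z(2) by (simp add: normal_homs_zero[OF emb sA])
  qed (use a oA[OF intertwinersD(1)[OF v]] star_alg_mult[OF sA] star_alg_zero[OF sA] in auto)
  have o0: "op_tensor ten \<I> 0 = 0"
  proof (rule op_tensor_unique[OF ten])
    show "blinfun_apply 0 (ten \<xi> \<eta>) = ten (blinfun_apply \<I> \<xi>) (blinfun_apply 0 \<eta>)" for \<xi> \<eta>
      using ht_add_right[OF ten, of \<xi> 0 0] by simp
  qed simp
  have "a = 0"
  proof (rule slices_determine[OF ten])
    fix \<xi> \<eta> \<xi>' \<eta>'
    obtain S where S: "S \<in> bops" "\<And>\<eta> \<eta>'. cinner (ten \<xi> \<eta>) (blinfun_apply a (ten \<xi>' \<eta>')) = cinner \<eta> (blinfun_apply S \<eta>')"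
      by (rule slice_exists[OF ten ab, of \<xi> \<xi>']) (rule that)
    have "S \<in> Mop M" by (rule slice_mem[OF ten vN_M vN_Mop a(1)[unfolded lrA_def] S])
    then obtain s where s: "s \<in> M" "S = jmap s" by (auto simp: Mop_eq)
    have "s \<in> intertwiners M \<pi> (idend M)"
    proof (rule intertwinersI[OF s(1)])
      fix y assume y: "y \<in> M"
      note \<pi>y = C_mem[OF \<pi> y]
      have "S \<odot> jmap (\<pi> y) = jmap y \<odot> S"
        by (rule slice_intertwines[OF ten S]) (use c1[OF y] y \<pi>y bM in auto)
      then have "jmap (s \<odot> \<pi> y) = jmap (y \<odot> s)" using s y \<pi>y bM by (simp add: jmap_mult)
      then show "s \<odot> \<pi> y = idend M y \<odot> s" using jmap_inj[of "s \<odot> \<pi> y" "y \<odot> s"] s y \<pi>y bM by simp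
    qed
    then have v: "adj s \<in> intertwiners M (idend M) \<pi>"
      by (rule intertwiners_adj[OF sM C_End[OF \<pi>] C_End[OF C_id]])
    \<comment> \<open>The slice is tested against its own adjoint, which is an admissible
      \<open>v\<close>; this yields \<open>s \<odot> adj s = 0\<close>.\<close>
    have "S \<odot> jmap (adj s) = 0 \<odot> S"
      by (rule slice_intertwines[OF ten S]) (use c2[OF v] s bM o0 in auto)
    then have "jmap (s \<odot> adj s) = jmap 0" using s bM by (simp add: jmap_mult)
    then have "s \<odot> adj s = 0" using jmap_inj[of "s \<odot> adj s" 0] s bM by simp
    then have "adj (adj s) \<odot> adj s = 0" using s bM by simp
    then have "adj s = 0" by (rule adj_comp_zero[rotated]) (use s bM in auto)
    then have "s = 0" using adj_adj[OF bM[OF s(1)]] by simp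
    then show "cinner (ten \<xi> \<eta>) (blinfun_apply a (ten \<xi>' \<eta>')) = cinner (ten \<xi> \<eta>) (blinfun_apply 0 (ten \<xi>' \<eta>'))"
      using S(2) s(2) by simp
  qed
  then show ?thesis using a(2) by (simp add: normal_homs_zero[OF emb sA])
qed

text \<open>After subtracting \<open>E(z)\<close>, all Fourier coefficients \<open>E(z \<lambda>\<^sub>\<pi>*)\<close> vanish: their slices are
  intertwiners \<open>\<pi> \<rightarrow> id\<close> annihilated by all intertwiners \<open>id \<rightarrow> \<pi>\<close>.\<close>

theorem commutant_of_opposite:
  assumes z: "z \<in> \<B>" and comm: "\<And>y. y \<in> M \<Longrightarrow> z \<odot> tens \<I> y = tens \<I> y \<odot> z"
  shows "\<exists>m\<in>M. z = tens m \<I>"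
proof -
  obtain a where a: "a \<in> \<A>" "\<E>A z = emb a" using condE_mem[OF z] by auto
  let ?o = "\<lambda>y. op_tensor ten \<I> (jmap y)"
  have oA: "?o y \<in> \<A>" if "y \<in> M" for y using op_tensor_A that star_alg_one[OF sM] by blast
  have ea: "emb (a \<odot> ?o y) = emb (?o y \<odot> a)" if y: "y \<in> M" for y
  proof -
    have "emb (a \<odot> ?o y) = \<E>A (z \<odot> tens \<I> y)"
      using a oA[OF y] condE_right[OF z oA[OF y]] by (simp add: normal_homs_mult[OF emb] tens_emb)
    also have "\<dots> = emb (?o y \<odot> a)"
      unfolding comm[OF y] using a oA[OF y] condE_left[OF z oA[OF y]] by (simp add: normal_homs_mult[OF emb] tens_emb)
    finally show ?thesis .
  qed
  have ca: "a \<odot> ?o y = ?o y \<odot> a" if y: "y \<in> M" for y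
    using ea[OF y] emb_inj a(1) oA[OF y] star_alg_mult[OF sA] by (auto dest: inj_onD)
  define z' where "z' = z - emb a"
  have z'B: "z' \<in> \<B>" unfolding z'_def by (intro clB z emb_B a)
  have z'E: "\<E>A z' = 0" unfolding z'_def using condE_diff[OF z emb_B[OF a(1)]] a by (simp add: condE_id)
  have z'c: "z' \<odot> tens \<I> y = tens \<I> y \<odot> z'" if y: "y \<in> M" for y
    using comm[OF y] ea[OF y] a(1) oA[OF y]
    by (simp add: z'_def comp_diff_left comp_diff_right tens_emb normal_homs_mult[OF emb])
  have adjP: "\<E>A (z' \<odot> adj x) = 0" if "x \<in> polys" for x
    using that
  proof induction
    case (base b \<pi>)
    have "z' \<odot> adj (emb b \<odot> lam \<pi>) = (z' \<odot> adj (lam \<pi>)) \<odot> emb (adj b)"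
      using base bB[OF emb_B] bB[OF lam_B] by (simp add: adj_comp normal_homs_adj[OF emb] comp_assoc)
    then show ?case
      using condE_right[OF _ star_alg_adj[OF sA base(1)], of "z' \<odot> adj (lam \<pi>)"] condE_lam_adj_zero[OF z'B z'E z'c base(2)]
        z'B lam_B[OF base(2)] by (simp add: clB)
  next
    case (add x y)
    have "z' \<odot> adj (x + y) = z' \<odot> adj x + z' \<odot> adj y"
      using add polys_B bB by (simp add: adj_add comp_add_right)
    then show ?case using condE_add[of "z' \<odot> adj x" "z' \<odot> adj y"] add z'B polys_B by (simp add: clB)
  qed
  have P: "\<E>A (z' \<odot> x) = 0" if "x \<in> polys" for x
    using adjP[OF star_alg_adj[OF star_alg_polys that]] polys_B[OF that] bB by simp
  have cm: "continuous_map (subtopology sigma_weak \<B>) sigma_weak (\<lambda>x. \<E>A (z' \<odot> x))"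
  proof -
    have "continuous_map (subtopology sigma_weak \<B>) (subtopology sigma_weak \<B>) (\<lambda>x. z' \<odot> x)"
      unfolding continuous_map_in_subtopology
      using continuous_map_from_subtopology[OF continuous_map_left_mult[OF bB[OF z'B]]] z'B clB by auto
    from continuous_map_compose[OF this condE_cont] show ?thesis by (simp add: comp_def)
  qed
  \<comment> \<open>By density the vanishing of \<open>\<E>A (z' \<odot> x)\<close> extends from
    finite sums to \<open>x = adj z'\<close>, where faithfulness applies.\<close>
  have "\<E>A (z' \<odot> adj z') = 0"
  proof -
    have "closedin (subtopology sigma_weak \<B>) {x \<in> topspace (subtopology sigma_weak \<B>). \<E>A (z' \<odot> x) \<in> {0}}"
      by (rule closedin_continuous_map_preimage[OF cm])
         (simp add: closedin_Hausdorff_singleton Hausdorff_sigma_weak)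
    then have "closedin sigma_weak {x \<in> \<B>. \<E>A (z' \<odot> x) = 0}"
      using closedin_trans_full[OF _ vN_closedin[OF vN_B]] by simp
    then have "sigma_weak closure_of polys \<subseteq> {x \<in> \<B>. \<E>A (z' \<odot> x) = 0}"
      by (rule closure_of_minimal[rotated]) (use P polys_B in auto)
    then show ?thesis using polys_dense[OF star_alg_adj[OF sB z'B]] by blast
  qed
  then have "\<E>A (adj (adj z') \<odot> adj z') = 0" by (simp add: bB[OF z'B])
  then have "adj z' = 0" by (rule condE_faithful[rotated]) (rule star_alg_adj[OF sB z'B])
  then have "z' = 0" using adj_adj[OF bB[OF z'B]] by simp
  then have za: "z = emb a" by (simp add: z'_def)
  have "\<exists>m\<in>M. a = op_tensor ten m \<I>"
  proof (rule tensor_right_commutant[OF ten vN_M vN_Mop])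
    show "a \<in> vN_tensor ten M (Mop M)" using a(1) by (simp add: lrA_def)
    show "a \<odot> op_tensor ten \<I> y = op_tensor ten \<I> y \<odot> a" if "y \<in> Mop M" for y using that ca by (auto simp: Mop_eq)
    obtain v :: 'h where "v \<noteq> 0" using nontrivial_M by blast
    then show "\<exists>v::'h conj_space. v \<noteq> 0" by (intro exI[of _ "Conj v"]) (simp add: zero_conj_space_def)
    show "Mop M \<inter> commutant (Mop M) = range (\<lambda>c. scale_op c \<I>)"
    proof -
      have "Mop M \<inter> commutant (Mop M) = jmap ` (M \<inter> commutant M)"
        unfolding Mop_eq commutant_jmap[OF vN_bops[OF vN_M]]
        by (rule inj_on_image_Int[symmetric, of _ bops]) (use jmap_inj bM commutant_bops[of M] in \<open>auto intro: inj_onI\<close>)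
      also have "\<dots> = range (\<lambda>c. jmap (scale_op c \<I>))" using factor_M by (auto simp: factor_def)
      also have "\<dots> = range (\<lambda>c. scale_op c \<I>)"
        by (auto simp: jmap_scale image_iff) (metis complex_cnj_cnj)
      finally show ?thesis .
    qed
  qed
  then show ?thesis using za by (auto simp: tens_emb)
qed

end

section \<open>The half braiding of an endomorphism extending
  \<open>\<sigma> \<otimes> id\<close>\<close>

context longo_rehren_setup
begin

lemma intertwiner_R'_adj: "\<pi> \<in> C \<Longrightarrow> adj (R' \<pi>) \<in> intertwiners M (compose M \<pi> (bar \<pi>)) (idend M)"
  by (rule intertwiners_adj[OF sM C_End[OF C_id] C_End[OF C_comp[OF _ C_bar]] R'_intertwiner])

lemma intertwiner_R_adj: "\<pi> \<in> C \<Longrightarrow> adj (R \<pi>) \<in> intertwiners M (compose M (bar \<pi>) \<pi>) (idend M)"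
  by (rule intertwiners_adj[OF sM C_End[OF C_id] C_End[OF C_comp[OF C_bar]] R_intertwiner])

context
  fixes \<eta> :: "'l endo" and \<sigma> :: "'h endo"
  assumes \<eta>: "\<eta> \<in> End \<B>" and \<sigma>: "\<sigma> \<in> End M"
    and \<eta>_tens: "\<And>x y. x \<in> M \<Longrightarrow> y \<in> M \<Longrightarrow> \<eta> (tens x y) = tens (\<sigma> x) y"
begin

lemma eta_lam_tens:
  assumes "\<pi> \<in> C" "x \<in> M" "y \<in> M"
  shows "\<eta> (lam \<pi>) \<odot> tens (\<sigma> x) y = tens (\<sigma> (\<pi> x)) (\<pi> y) \<odot> \<eta> (lam \<pi>)"
proof -
  have "\<eta> (lam \<pi> \<odot> tens x y) = \<eta> (tens (\<pi> x) (\<pi> y) \<odot> lam \<pi>)" by (simp add: lam_tens assms)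
  then show ?thesis using assms
    by (simp add: End_mult[OF \<eta>] lam_B tens_B C_mem \<eta>_tens)
qed

text \<open>Frobenius reciprocity: bending the \<open>\<pi>\<close>-strand of \<open>\<eta>(\<lambda>\<^sub>\<pi>)\<close> gives an element commuting with
  \<open>1 \<otimes> M\<^sup>o\<^sup>p\<close>.\<close>

lemma eta_lam_exists:
  assumes \<pi>: "\<pi> \<in> C"
  shows "\<exists>T\<in>M. \<eta> (lam \<pi>) = tens T \<I> \<odot> lam \<pi>"
proof -
  note b = C_bar[OF \<pi>] and e = C_End[OF \<pi>] and e' = C_End[OF C_bar[OF \<pi>]]
  note m = R_M[OF \<pi>] R'_M[OF \<pi>] C_mem[OF \<pi>] C_mem[OF b]
  let ?X = "\<eta> (lam \<pi>)" and ?r = "adj (R \<pi>)" and ?r' = "adj (R' \<pi>)"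
  have XB: "?X \<in> \<B>" by (rule End_mem[OF \<eta> lam_B[OF \<pi>]])
  have Xt: "?X \<odot> tens \<I> y = tens \<I> (\<pi> y) \<odot> ?X" if "y \<in> M" for y
    using eta_lam_tens[OF \<pi> star_alg_one[OF sM] that] by (simp add: End_one[OF \<sigma>] End_one[OF e])
  define Z where "Z = tens \<I> ?r' \<odot> (?X \<odot> (tens ?r \<I> \<odot> lam (bar \<pi>)))"
  have ZB: "Z \<in> \<B>" unfolding Z_def by (intro clB tens_B XB lam_B b clM m)
  have "Z \<odot> tens \<I> y = tens \<I> y \<odot> Z" if y: "y \<in> M" for y
  proof -
    have "Z \<odot> tens \<I> y = tens \<I> ?r' \<odot> (?X \<odot> (tens ?r \<I> \<odot> (lam (bar \<pi>) \<odot> tens \<I> y)))"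
      by (simp add: Z_def comp_assoc)
    also have "lam (bar \<pi>) \<odot> tens \<I> y = tens \<I> (bar \<pi> y) \<odot> lam (bar \<pi>)"
      using lam_tens[OF b star_alg_one[OF sM] y] by (simp add: End_one[OF e'])
    also have "tens ?r \<I> \<odot> (tens \<I> (bar \<pi> y) \<odot> lam (bar \<pi>)) = tens \<I> (bar \<pi> y) \<odot> (tens ?r \<I> \<odot> lam (bar \<pi>))"
      using y m by (simp add: tens_mult clM flip: comp_assoc)
    also have "?X \<odot> (tens \<I> (bar \<pi> y) \<odot> (tens ?r \<I> \<odot> lam (bar \<pi>))) = (?X \<odot> tens \<I> (bar \<pi> y)) \<odot> (tens ?r \<I> \<odot> lam (bar \<pi>))"
      by (simp add: comp_assoc)
    also have "?X \<odot> tens \<I> (bar \<pi> y) = tens \<I> (\<pi> (bar \<pi> y)) \<odot> ?X" by (rule Xt[OF m(4)[OF y]])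
    also have "tens \<I> ?r' \<odot> ((tens \<I> (\<pi> (bar \<pi> y)) \<odot> ?X) \<odot> (tens ?r \<I> \<odot> lam (bar \<pi>)))
        = tens \<I> (?r' \<odot> \<pi> (bar \<pi> y)) \<odot> (?X \<odot> (tens ?r \<I> \<odot> lam (bar \<pi>)))"
      using y m by (simp add: tens_mult clM flip: comp_assoc)
    also have "?r' \<odot> \<pi> (bar \<pi> y) = y \<odot> ?r'"
      using intertwinersD(2)[OF intertwiner_R'_adj[OF \<pi>] y] y by simp
    also have "tens \<I> (y \<odot> ?r') = tens \<I> y \<odot> tens \<I> ?r'" using y m by (simp add: tens_mult clM)
    finally show ?thesis by (simp add: Z_def comp_assoc)
  qed
  then obtain T where T: "T \<in> M" "Z = tens T \<I>" using commutant_of_opposite[OF ZB] by blast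
  \<comment> \<open>Multiplying by \<open>lam \<pi>\<close> straightens the bent strand:
    \<open>R \<pi>\<close> appears in the second leg, passes through
    \<open>\<eta> (lam \<pi>)\<close> at the price of a \<open>\<pi>\<close>, and cancels against
    \<open>adj (R' \<pi>)\<close>.\<close>
  have "tens T \<I> \<odot> lam \<pi> = tens \<I> ?r' \<odot> (?X \<odot> (tens ?r \<I> \<odot> (lam (bar \<pi>) \<odot> lam \<pi>)))"
    by (simp add: T(2)[symmetric] Z_def comp_assoc)
  also have "tens ?r \<I> \<odot> (lam (bar \<pi>) \<odot> lam \<pi>) = tens \<I> (R \<pi>)"
    by (simp add: lam_mult[OF b \<pi>] lam_bar_lam(2)[OF \<pi>])
  also have "?X \<odot> tens \<I> (R \<pi>) = tens \<I> (\<pi> (R \<pi>)) \<odot> ?X" by (rule Xt[OF m(1)])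
  also have "tens \<I> ?r' \<odot> (tens \<I> (\<pi> (R \<pi>)) \<odot> ?X) = ?X"
    using m R'_eq[OF \<pi>] by (simp add: tens_mult clM tens_one flip: comp_assoc)
  finally show ?thesis using T(1) by metis
qed

text \<open>Each relation among the \<open>lam \<pi>\<close> is pushed through \<open>\<eta>\<close>
  and then read off on \<open>T\<close> by \<open>lam_separating_eq\<close>. Unitarity takes more:
  it combines the relation for \<open>adj (lam \<pi>)\<close> with the conjugate equations.\<close>

theorem eta_extension_exists:
  obtains \<E> where "half_braiding M C \<sigma> \<E>" "\<And>\<pi>. \<pi> \<in> C \<Longrightarrow> \<eta> (lam \<pi>) = elem L (adj (\<E> \<pi>)) \<I> \<odot> lam \<pi>"
proof -
  have "\<forall>\<pi>\<in>C. \<exists>T. T \<in> M \<and> \<eta> (lam \<pi>) = tens T \<I> \<odot> lam \<pi>" using eta_lam_exists by blast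
  then obtain T where T: "\<And>\<pi>. \<pi> \<in> C \<Longrightarrow> T \<pi> \<in> M" "\<And>\<pi>. \<pi> \<in> C \<Longrightarrow> \<eta> (lam \<pi>) = tens (T \<pi>) \<I> \<odot> lam \<pi>"
    by metis
  note \<sigma>m = End_mem[OF \<sigma>]
  have nat: "T \<pi> \<odot> \<pi> (\<sigma> x) = \<sigma> (\<pi> x) \<odot> T \<pi>" if "\<pi> \<in> C" "x \<in> M" for \<pi> x
  proof (rule lam_separating_eq[OF that(1)])
    note m = T(1)[OF that(1)] C_mem[OF that] C_mem[OF that(1) \<sigma>m[OF that(2)]] \<sigma>m[OF C_mem[OF that]] \<sigma>m[OF that(2)]
    have "tens (T \<pi> \<odot> \<pi> (\<sigma> x)) \<I> \<odot> lam \<pi> = tens (T \<pi>) \<I> \<odot> (tens (\<pi> (\<sigma> x)) \<I> \<odot> lam \<pi>)"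
      using m by (simp add: tens_mult clM flip: comp_assoc)
    also have "tens (\<pi> (\<sigma> x)) \<I> \<odot> lam \<pi> = lam \<pi> \<odot> tens (\<sigma> x) \<I>"
      using lam_tens[OF that(1) m(5) star_alg_one[OF sM]] by (simp add: End_one[OF C_End[OF that(1)]])
    also have "tens (T \<pi>) \<I> \<odot> (lam \<pi> \<odot> tens (\<sigma> x) \<I>) = tens (\<sigma> (\<pi> x)) \<I> \<odot> \<eta> (lam \<pi>)"
      using eta_lam_tens[OF that star_alg_one[OF sM]] that by (simp add: T(2) comp_assoc End_one[OF C_End])
    also have "\<dots> = tens (\<sigma> (\<pi> x) \<odot> T \<pi>) \<I> \<odot> lam \<pi>"
      using m that by (simp add: T(2) tens_mult clM flip: comp_assoc)
    finally show "tens (T \<pi> \<odot> \<pi> (\<sigma> x)) \<I> \<odot> lam \<pi> = tens (\<sigma> (\<pi> x) \<odot> T \<pi>) \<I> \<odot> lam \<pi>" .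
    show "T \<pi> \<odot> \<pi> (\<sigma> x) \<in> M" "\<sigma> (\<pi> x) \<odot> T \<pi> \<in> M" using m by (auto intro: clM)
  qed
  have mult: "T (compose M \<pi> \<rho>) = T \<pi> \<odot> \<pi> (T \<rho>)" if "\<pi> \<in> C" "\<rho> \<in> C" for \<pi> \<rho>
  proof (rule lam_separating_eq[OF C_comp[OF that]])
    note m = T(1)[OF that(1)] T(1)[OF that(2)] C_mem[OF that(1) T(1)[OF that(2)]]
    have "tens (T (compose M \<pi> \<rho>)) \<I> \<odot> lam (compose M \<pi> \<rho>) = \<eta> (lam \<pi> \<odot> lam \<rho>)"
      using T(2)[OF C_comp[OF that]] lam_mult[OF that] by simp
    also have "\<dots> = tens (T \<pi>) \<I> \<odot> (lam \<pi> \<odot> tens (T \<rho>) \<I>) \<odot> lam \<rho>"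
      using that by (simp add: End_mult[OF \<eta>] lam_B T(2) comp_assoc)
    also have "lam \<pi> \<odot> tens (T \<rho>) \<I> = tens (\<pi> (T \<rho>)) \<I> \<odot> lam \<pi>"
      using lam_tens[OF that(1) m(2) star_alg_one[OF sM]] by (simp add: End_one[OF C_End[OF that(1)]])
    also have "tens (T \<pi>) \<I> \<odot> (tens (\<pi> (T \<rho>)) \<I> \<odot> lam \<pi>) \<odot> lam \<rho> = tens (T \<pi> \<odot> \<pi> (T \<rho>)) \<I> \<odot> (lam \<pi> \<odot> lam \<rho>)"
      using m by (simp add: tens_mult clM flip: comp_assoc)
    finally show "tens (T (compose M \<pi> \<rho>)) \<I> \<odot> lam (compose M \<pi> \<rho>) = tens (T \<pi> \<odot> \<pi> (T \<rho>)) \<I> \<odot> lam (compose M \<pi> \<rho>)"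
      by (simp add: lam_mult[OF that])
    show "T (compose M \<pi> \<rho>) \<in> M" "T \<pi> \<odot> \<pi> (T \<rho>) \<in> M" using m C_comp[OF that] T(1) by (auto intro: clM)
  qed
  have intw: "\<sigma> S \<odot> T \<pi> = T \<rho> \<odot> S" if "\<pi> \<in> C" "\<rho> \<in> C" "S \<in> intertwiners M \<pi> \<rho>" for \<pi> \<rho> S
  proof (rule lam_separating_eq[OF that(1)])
    note SM = intertwinersD(1)[OF that(3)]
    note m = T(1)[OF that(1)] T(1)[OF that(2)] SM \<sigma>m[OF SM]
    have "tens (\<sigma> S \<odot> T \<pi>) \<I> \<odot> lam \<pi> = \<eta> (tens S \<I>) \<odot> \<eta> (lam \<pi>)"
      using m that by (simp add: T(2) \<eta>_tens tens_mult clM flip: comp_assoc)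
    also have "\<dots> = \<eta> (tens S \<I> \<odot> lam \<pi>)" using m that by (simp add: End_mult[OF \<eta>] tens_B lam_B clM)
    also have "\<dots> = \<eta> (tens \<I> (adj S) \<odot> lam \<rho>)" by (simp add: lam_rel[OF that])
    also have "\<dots> = tens \<I> (adj S) \<odot> (tens (T \<rho>) \<I> \<odot> lam \<rho>)"
      using m that by (simp add: End_mult[OF \<eta>] tens_B lam_B clM \<eta>_tens T(2) End_one[OF \<sigma>])
    also have "\<dots> = tens (T \<rho>) \<I> \<odot> (tens \<I> (adj S) \<odot> lam \<rho>)"
      using m by (simp add: tens_mult clM flip: comp_assoc)
    also have "\<dots> = tens (T \<rho>) \<I> \<odot> (tens S \<I> \<odot> lam \<pi>)" by (simp add: lam_rel[OF that])
    also have "\<dots> = tens (T \<rho> \<odot> S) \<I> \<odot> lam \<pi>" using m by (simp add: tens_mult clM flip: comp_assoc)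
    finally show "tens (\<sigma> S \<odot> T \<pi>) \<I> \<odot> lam \<pi> = tens (T \<rho> \<odot> S) \<I> \<odot> lam \<pi>" .
    show "\<sigma> S \<odot> T \<pi> \<in> M" "T \<rho> \<odot> S \<in> M" using m by (auto intro: clM)
  qed
  have Tid: "T (idend M) = \<I>"
  proof (rule lam_separating_eq[OF C_id T(1)[OF C_id] star_alg_one[OF sM]])
    show "tens (T (idend M)) \<I> \<odot> lam (idend M) = tens \<I> \<I> \<odot> lam (idend M)"
      using T(2)[OF C_id] by (simp add: lam_id End_one[OF \<eta>] tens_one)
  qed
  \<comment> \<open>The image of \<open>adj (lam \<pi>)\<close> is computed once through the adjoint
    relation and once as an adjoint. The common \<open>adj (R \<pi>)\<close> in the second leg is
    then removed by multiplying with \<open>tens \<I> (R' \<pi>)\<close>.\<close>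
  have bend: "\<sigma> (adj (R \<pi>)) \<odot> T (bar \<pi>) = adj (R \<pi>) \<odot> bar \<pi> (adj (T \<pi>))" if \<pi>: "\<pi> \<in> C" for \<pi>
  proof -
    note b = C_bar[OF \<pi>]
    note m = R_M[OF \<pi>] R'_M[OF \<pi>] T(1)[OF \<pi>] T(1)[OF b]
    have rM: "adj (R \<pi>) \<in> M" using m by (auto intro: clM)
    define D where "D = \<sigma> (adj (R \<pi>)) \<odot> T (bar \<pi>) - adj (R \<pi>) \<odot> bar \<pi> (adj (T \<pi>))"
    have dM: "\<sigma> (adj (R \<pi>)) \<odot> T (bar \<pi>) \<in> M" "adj (R \<pi>) \<odot> bar \<pi> (adj (T \<pi>)) \<in> M"
      using m \<sigma>m[OF rM] C_mem[OF b] by (auto intro!: clM)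
    have "tens (\<sigma> (adj (R \<pi>)) \<odot> T (bar \<pi>)) (adj (R \<pi>)) \<odot> lam (bar \<pi>)
        = tens (\<sigma> (adj (R \<pi>))) (adj (R \<pi>)) \<odot> (tens (T (bar \<pi>)) \<I> \<odot> lam (bar \<pi>))"
      using m rM \<sigma>m[OF rM] by (simp add: tens_mult clM flip: comp_assoc)
    also have "\<dots> = \<eta> (tens (adj (R \<pi>)) (adj (R \<pi>)) \<odot> lam (bar \<pi>))"
      using rM b by (simp add: End_mult[OF \<eta>] tens_B lam_B \<eta>_tens T(2))
    also have "\<dots> = adj (\<eta> (lam \<pi>))" by (simp add: lam_adj[OF \<pi>, symmetric] End_adj[OF \<eta>] lam_B \<pi>)
    also have "\<dots> = adj (lam \<pi>) \<odot> tens (adj (T \<pi>)) \<I>"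
      unfolding T(2)[OF \<pi>] using m bB[OF lam_B[OF \<pi>]] by (simp add: adj_comp tens_bops tens_adj clM)
    also have "\<dots> = tens (adj (R \<pi>)) (adj (R \<pi>)) \<odot> (lam (bar \<pi>) \<odot> tens (adj (T \<pi>)) \<I>)"
      by (simp add: lam_adj[OF \<pi>] comp_assoc)
    also have "lam (bar \<pi>) \<odot> tens (adj (T \<pi>)) \<I> = tens (bar \<pi> (adj (T \<pi>))) \<I> \<odot> lam (bar \<pi>)"
      using lam_tens[OF b _ star_alg_one[OF sM]] m by (simp add: End_one[OF C_End[OF b]] clM)
    also have "tens (adj (R \<pi>)) (adj (R \<pi>)) \<odot> (tens (bar \<pi> (adj (T \<pi>))) \<I> \<odot> lam (bar \<pi>))
        = tens (adj (R \<pi>) \<odot> bar \<pi> (adj (T \<pi>))) (adj (R \<pi>)) \<odot> lam (bar \<pi>)"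
      using m rM C_mem[OF b] by (simp add: tens_mult clM flip: comp_assoc)
    finally have eq: "tens D (adj (R \<pi>)) \<odot> lam (bar \<pi>) = 0"
      unfolding D_def tens_diff[OF dM rM] by (simp add: comp_diff_left)
    have DM: "D \<in> M" unfolding D_def by (rule star_alg_diff[OF sM dM])
    have "0 = (tens D (adj (R \<pi>)) \<odot> lam (bar \<pi>)) \<odot> tens \<I> (R' \<pi>)" by (simp add: eq)
    also have "\<dots> = tens D (adj (R \<pi>)) \<odot> (tens \<I> (bar \<pi> (R' \<pi>)) \<odot> lam (bar \<pi>))"
      using lam_tens[OF b star_alg_one[OF sM] m(2)] by (simp add: comp_assoc End_one[OF C_End[OF b]])
    also have "\<dots> = tens D \<I> \<odot> lam (bar \<pi>)"
      using DM rM m C_mem[OF b] R_eq[OF \<pi>] by (simp add: tens_mult clM flip: comp_assoc)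
    finally have "D = 0" using lam_separating[OF b DM] by simp
    then show ?thesis by (simp add: D_def)
  qed
  have unit: "unitary_in M (adj (T \<pi>))" if \<pi>: "\<pi> \<in> C" for \<pi>
  proof -
    note b = C_bar[OF \<pi>] and e = C_End[OF \<pi>]
    note m = R_M[OF \<pi>] R'_M[OF \<pi>] T(1)[OF \<pi>] T(1)[OF b]
    have rM: "adj (R \<pi>) \<in> M" and TaM: "adj (T \<pi>) \<in> M" using m by (auto intro: clM)
    have \<pi>r: "\<pi> (adj (R \<pi>)) \<odot> R' \<pi> = \<I>"
    proof -
      have "adj (adj (R' \<pi>) \<odot> \<pi> (R \<pi>)) = adj \<I>" using R'_eq[OF \<pi>] by simp
      then show ?thesis using bM m C_mem[OF \<pi>] by (simp add: adj_comp End_adj[OF e])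
    qed
    \<comment> \<open>Applying \<open>\<pi>\<close> to \<open>bend\<close> and closing with
      \<open>R' \<pi>\<close> expresses the adjoint through \<open>T (bar \<pi>)\<close>, so that
      both products with \<open>T \<pi>\<close> reduce to multiplicativity and naturality of
      \<open>T\<close>.\<close>
    have Ta: "adj (T \<pi>) = \<pi> (\<sigma> (adj (R \<pi>))) \<odot> (\<pi> (T (bar \<pi>)) \<odot> R' \<pi>)"
    proof -
      have "\<pi> (\<sigma> (adj (R \<pi>))) \<odot> (\<pi> (T (bar \<pi>)) \<odot> R' \<pi>) = \<pi> (\<sigma> (adj (R \<pi>)) \<odot> T (bar \<pi>)) \<odot> R' \<pi>"
        using \<sigma>m[OF rM] m by (simp add: End_mult[OF e] comp_assoc)
      also have "\<dots> = \<pi> (adj (R \<pi>)) \<odot> (\<pi> (bar \<pi> (adj (T \<pi>))) \<odot> R' \<pi>)"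
        unfolding bend[OF \<pi>] using rM C_mem[OF b TaM] by (simp add: End_mult[OF e] comp_assoc)
      also have "\<pi> (bar \<pi> (adj (T \<pi>))) \<odot> R' \<pi> = R' \<pi> \<odot> adj (T \<pi>)" using R'_int[OF \<pi> TaM] by simp
      also have "\<pi> (adj (R \<pi>)) \<odot> (R' \<pi> \<odot> adj (T \<pi>)) = adj (T \<pi>)" using \<pi>r by (simp flip: comp_assoc)
      finally show ?thesis by simp
    qed
    have 1: "T \<pi> \<odot> adj (T \<pi>) = \<I>"
    proof -
      have "T \<pi> \<odot> adj (T \<pi>) = (T \<pi> \<odot> \<pi> (\<sigma> (adj (R \<pi>)))) \<odot> (\<pi> (T (bar \<pi>)) \<odot> R' \<pi>)"
        by (subst Ta) (simp add: comp_assoc)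
      also have "\<dots> = \<sigma> (\<pi> (adj (R \<pi>))) \<odot> ((T \<pi> \<odot> \<pi> (T (bar \<pi>))) \<odot> R' \<pi>)"
        unfolding nat[OF \<pi> rM] by (simp add: comp_assoc)
      also have "(T \<pi> \<odot> \<pi> (T (bar \<pi>))) \<odot> R' \<pi> = \<sigma> (R' \<pi>)"
        using intw[OF C_id C_comp[OF \<pi> b] R'_intertwiner[OF \<pi>]] by (simp add: Tid mult[OF \<pi> b])
      also have "\<sigma> (\<pi> (adj (R \<pi>))) \<odot> \<sigma> (R' \<pi>) = \<I>"
        using End_mult[OF \<sigma> C_mem[OF \<pi> rM] m(2)] by (simp add: \<pi>r End_one[OF \<sigma>])
      finally show ?thesis .
    qed
    have 2: "adj (T \<pi>) \<odot> T \<pi> = \<I>"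
    proof -
      have "adj (T \<pi>) \<odot> T \<pi> = \<pi> (\<sigma> (adj (R \<pi>))) \<odot> (\<pi> (T (bar \<pi>)) \<odot> (R' \<pi> \<odot> T \<pi>))"
        by (subst Ta) (simp add: comp_assoc)
      also have "R' \<pi> \<odot> T \<pi> = \<pi> (bar \<pi> (T \<pi>)) \<odot> R' \<pi>" by (rule R'_int[OF \<pi> m(3)])
      also have "\<pi> (\<sigma> (adj (R \<pi>))) \<odot> (\<pi> (T (bar \<pi>)) \<odot> (\<pi> (bar \<pi> (T \<pi>)) \<odot> R' \<pi>))
          = \<pi> (\<sigma> (adj (R \<pi>)) \<odot> (T (bar \<pi>) \<odot> bar \<pi> (T \<pi>))) \<odot> R' \<pi>"
        using \<sigma>m[OF rM] m C_mem[OF b m(3)] by (simp add: End_mult[OF e] clM comp_assoc)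
      also have "T (bar \<pi>) \<odot> bar \<pi> (T \<pi>) = T (compose M (bar \<pi>) \<pi>)" by (simp add: mult[OF b \<pi>])
      also have "\<sigma> (adj (R \<pi>)) \<odot> T (compose M (bar \<pi>) \<pi>) = adj (R \<pi>)"
        using intw[OF C_comp[OF b \<pi>] C_id intertwiner_R_adj[OF \<pi>]] by (simp add: Tid)
      also have "\<pi> (adj (R \<pi>)) \<odot> R' \<pi> = \<I>" by (rule \<pi>r)
      finally show ?thesis .
    qed
    show ?thesis using 1 2 TaM bM[OF m(3)] by (simp add: unitary_in_def)
  qed
  note Tb = bM[OF T(1)]
  have TT: "T \<pi> \<odot> adj (T \<pi>) = \<I>" "adj (T \<pi>) \<odot> T \<pi> = \<I>" if "\<pi> \<in> C" for \<pi>
    using unit[OF that] Tb[OF that] by (auto simp: unitary_in_def)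
  show thesis
  \<comment> \<open>The adjoint is taken because an \<open>\<eta>\<close>-extension multiplies
    \<open>lam \<pi>\<close> by the adjoint of the half braiding.\<close>
  proof (rule that[of "\<lambda>\<pi>. adj (T \<pi>)"])
    show "\<eta> (lam \<pi>) = elem L (adj (adj (T \<pi>))) \<I> \<odot> lam \<pi>" if "\<pi> \<in> C" for \<pi>
      using T(2)[OF that] Tb[OF that] by (simp add: tens_def)
    show "half_braiding M C \<sigma> (\<lambda>\<pi>. adj (T \<pi>))"
      unfolding half_braiding_def
    proof (intro conjI ballI)
      fix \<pi> assume \<pi>: "\<pi> \<in> C"
      note e = C_End[OF \<pi>]
      show "unitary_in M (adj (T \<pi>))" by (rule unit[OF \<pi>])
      have "T \<pi> \<in> intertwiners M (compose M \<pi> \<sigma>) (compose M \<sigma> \<pi>)"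
        by (rule intertwinersI) (use T(1)[OF \<pi>] nat[OF \<pi>] in auto)
      then show "adj (T \<pi>) \<in> intertwiners M (compose M \<sigma> \<pi>) (compose M \<pi> \<sigma>)"
        by (rule intertwiners_adj[OF sM End_compose[OF e \<sigma> sM] End_compose[OF \<sigma> e sM]])
      fix \<rho> assume \<rho>: "\<rho> \<in> C"
      show "adj (T (compose M \<pi> \<rho>)) = \<pi> (adj (T \<rho>)) \<odot> adj (T \<pi>)"
        using \<pi> \<rho> T(1) bM C_mem by (simp add: mult adj_comp End_adj[OF e])
      fix S assume S: "S \<in> intertwiners M \<pi> \<rho>"
      have "adj (T \<rho>) \<odot> \<sigma> S = adj (T \<rho>) \<odot> (\<sigma> S \<odot> T \<pi>) \<odot> adj (T \<pi>)" by (simp add: comp_assoc TT \<pi>)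
      also have "\<dots> = (adj (T \<rho>) \<odot> T \<rho>) \<odot> S \<odot> adj (T \<pi>)" unfolding intw[OF \<pi> \<rho> S] by (simp add: comp_assoc)
      finally show "adj (T \<rho>) \<odot> \<sigma> S = S \<odot> adj (T \<pi>)" by (simp add: TT \<rho>)
    qed
  qed
qed

end

end

section \<open>The graded components\<close>

text \<open>Meant for maps whose continuity is known only on a sigma-weakly closed set, such as the
  adjoint or a normal endomorphism.\<close>

lemma sigma_weak_closure_map:
  assumes f: "continuous_map (subtopology sigma_weak B) sigma_weak f" and B: "closedin sigma_weak B"
    and S: "S \<subseteq> B" "\<And>x. x \<in> S \<Longrightarrow> f x \<in> sigma_weak closure_of T" and x: "x \<in> sigma_weak closure_of S"
  shows "f x \<in> sigma_weak closure_of T"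
proof -
  have "sigma_weak closure_of S \<subseteq> B" by (rule closure_of_minimal[OF S(1) B])
  then have "x \<in> subtopology sigma_weak B closure_of S"
    using x S(1) by (auto simp: closure_of_subtopology Int_absorb1)
  then have "f x \<in> sigma_weak closure_of (f ` S)" using continuous_map_image_closure_subset[OF f] by blast
  also have "\<dots> \<subseteq> sigma_weak closure_of (sigma_weak closure_of T)" by (rule closure_of_mono) (use S(2) in blast)
  finally show ?thesis by simp
qed

section \<open>Unitary equivalence of endomorphisms\<close>

lemma uequiv_refl: "star_alg M \<Longrightarrow> uequiv M \<rho> \<rho>"
  unfolding uequiv_def unitary_in_def by (intro exI[of _ \<I>]) (auto simp: star_alg_one)

lemma unitary_in_adj: "star_alg M \<Longrightarrow> unitary_in M w \<Longrightarrow> unitary_in M (adj w)"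
  by (auto simp: unitary_in_def star_alg_adj star_alg_bops)

lemma unitary_in_mult: "star_alg M \<Longrightarrow> unitary_in M v \<Longrightarrow> unitary_in M w \<Longrightarrow> unitary_in M (v \<odot> w)"
proof -
  assume a: "star_alg M" "unitary_in M v" "unitary_in M w"
  then have vw: "v \<in> bops" "w \<in> bops" "v \<in> M" "w \<in> M" "adj v \<odot> v = \<I>" "adj w \<odot> w = \<I>" "v \<odot> adj v = \<I>" "w \<odot> adj w = \<I>"
    by (auto simp: unitary_in_def star_alg_bops)
  have "adj w \<odot> (adj v \<odot> (v \<odot> w)) = \<I>" using vw by (simp flip: comp_assoc add: comp_assoc[of "adj w" "adj v" v])
  moreover have "v \<odot> (w \<odot> (adj w \<odot> adj v)) = \<I>" using vw by (simp flip: comp_assoc add: comp_assoc[of v w "adj w"])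
  ultimately show ?thesis using vw a(1) by (simp add: unitary_in_def adj_comp comp_assoc star_alg_mult)
qed

lemma uequivI: "unitary_in M w \<Longrightarrow> (\<And>x. x \<in> M \<Longrightarrow> \<rho> x = w \<odot> \<sigma> x \<odot> adj w) \<Longrightarrow> uequiv M \<rho> \<sigma>"
  by (auto simp: uequiv_def)

lemma conj_unitary_cancel:
  assumes "adj w \<odot> w = \<I>" "y = w \<odot> x \<odot> adj w" shows "adj w \<odot> y \<odot> w = x"
proof -
  have "adj w \<odot> y \<odot> w = (adj w \<odot> w) \<odot> x \<odot> (adj w \<odot> w)" by (simp add: assms(2) comp_assoc)
  then show ?thesis using assms(1) by simp
qed

lemma uequiv_sym: assumes M: "star_alg M" and u: "uequiv M \<rho> \<sigma>" shows "uequiv M \<sigma> \<rho>"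
proof -
  obtain w where w: "unitary_in M w" "\<And>x. x \<in> M \<Longrightarrow> \<rho> x = w \<odot> \<sigma> x \<odot> adj w" using u by (auto simp: uequiv_def)
  then have "w \<in> bops" "adj w \<odot> w = \<I>" using star_alg_bops[OF M] by (auto simp: unitary_in_def)
  then show ?thesis
    using conj_unitary_cancel[OF _ w(2)] by (intro uequivI[OF unitary_in_adj[OF M w(1)]]) simp
qed

lemma uequiv_intertwiner:
  assumes M: "star_alg M" and w: "unitary_in M w" "\<And>x. x \<in> M \<Longrightarrow> \<rho> x = w \<odot> \<sigma> x \<odot> adj w"
  shows "adj w \<in> intertwiners M \<rho> \<sigma>"
proof (rule intertwinersI)
  show "adj w \<in> M" using w(1) star_alg_adj[OF M] by (simp add: unitary_in_def)
  fix x assume x: "x \<in> M"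
  have "adj w \<odot> \<rho> x = (adj w \<odot> w) \<odot> (\<sigma> x \<odot> adj w)" by (simp add: w(2)[OF x] comp_assoc)
  then show "adj w \<odot> \<rho> x = \<sigma> x \<odot> adj w" using w(1) by (simp add: unitary_in_def)
qed

section \<open>Homogeneous elements and their closures\<close>

locale graded_longo_rehren = longo_rehren_setup M C Irr bar R R' L
  for M :: "'h::chilbert_space bop set" and C Irr and bar :: "'h endo \<Rightarrow> 'h endo" and R R'
    and L :: "('h, 'k::chilbert_space, 'l::chilbert_space) lr_data" +
  fixes Cg :: "'g::group_add \<Rightarrow> 'h endo set"
  assumes graded: "graded M bar C Cg"
begin

definition presum :: "'g \<Rightarrow> 'l bop set" where
  "presum g = {\<Sum>\<pi>\<in>F. emb (a \<pi>) \<odot> lam \<pi> | F a. finite F \<and> F \<subseteq> Irr \<inter> Cg g \<and> (\<forall>\<pi>\<in>F. a \<pi> \<in> \<A>)}"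

abbreviation Bg :: "'g \<Rightarrow> 'l bop set" where "Bg g \<equiv> lr_component M Irr L (Cg g)"

lemma Bg_eq: "Bg g = sigma_weak closure_of presum g"
  by (simp add: lr_component_def presum_def)

lemma Cg_C: "\<pi> \<in> Cg g \<Longrightarrow> \<pi> \<in> C" using graded by (auto simp: graded_def)
lemma Cg_closed: "closed_subcategory M (Cg g)" using graded by (simp add: graded_def)
lemma Cg_comp: "\<pi> \<in> Cg g \<Longrightarrow> \<rho> \<in> Cg h \<Longrightarrow> compose M \<pi> \<rho> \<in> Cg (g + h)" using graded by (simp add: graded_def)
lemma Cg_uequiv: "\<pi> \<in> Cg g \<Longrightarrow> \<sigma> \<in> End M \<Longrightarrow> uequiv M \<sigma> \<pi> \<Longrightarrow> \<sigma> \<in> Cg g"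
  using Cg_closed[of g] unfolding closed_subcategory_def by blast
lemma Cg_bar: assumes "\<pi> \<in> Cg g" shows "bar \<pi> \<in> Cg (- g)"
proof -
  have "{\<sigma> \<in> End M. \<exists>\<rho>\<in>Cg g. uequiv M \<sigma> (bar \<rho>)} = Cg (- g)" using graded by (simp add: graded_def)
  then show ?thesis using assms C_End[OF C_bar[OF Cg_C[OF assms]]] uequiv_refl[OF sM] by blast
qed

text \<open>The identity is irreducible, so it has a single degree; composing it with itself shows
  that this degree is idempotent in the group.\<close>

lemma Cg_id: "idend M \<in> Cg 0"
proof -
  have i: "irreducible_endo M (idend M)" and ii: "idend M \<in> C"
    using irr C_id by (auto simp: irr_system_def)
  then obtain g where g: "idend M \<in> Cg g" and un: "\<And>h. idend M \<in> Cg h \<Longrightarrow> h = g"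
    using graded unfolding graded_def by metis
  have "compose M (idend M) (idend M) = idend M" by (auto simp: compose_def idend_def fun_eq_iff)
  then have "idend M \<in> Cg (g + g)" using Cg_comp[OF g g] by simp
  then have "g + g = g" by (rule un)
  then have "g = 0" by (metis add_0_right add_left_cancel)
  then show ?thesis using g by simp
qed

lemma presum_base: "a \<in> \<A> \<Longrightarrow> \<pi> \<in> Irr \<Longrightarrow> \<pi> \<in> Cg g \<Longrightarrow> emb a \<odot> lam \<pi> \<in> presum g"
  unfolding presum_def by (intro CollectI exI[of _ "{\<pi>}"] exI[of _ "\<lambda>_. a"]) auto

lemma presum_zero: "0 \<in> presum g"
  unfolding presum_def by (intro CollectI exI[of _ "{}"] exI) auto

lemma presum_add: assumes "x \<in> presum g" "y \<in> presum g" shows "x + y \<in> presum g"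
proof -
  obtain F a where F: "finite F" "F \<subseteq> Irr \<inter> Cg g" "\<forall>\<pi>\<in>F. a \<pi> \<in> \<A>" and x: "x = (\<Sum>\<pi>\<in>F. emb (a \<pi>) \<odot> lam \<pi>)"
    using assms(1) unfolding presum_def by blast
  obtain G b where G: "finite G" "G \<subseteq> Irr \<inter> Cg g" "\<forall>\<pi>\<in>G. b \<pi> \<in> \<A>" and y: "y = (\<Sum>\<pi>\<in>G. emb (b \<pi>) \<odot> lam \<pi>)"
    using assms(2) unfolding presum_def by blast
  define a' where "a' \<pi> = (if \<pi> \<in> F then a \<pi> else 0)" for \<pi>
  define b' where "b' \<pi> = (if \<pi> \<in> G then b \<pi> else 0)" for \<pi>
  have m: "a' \<pi> \<in> \<A>" "b' \<pi> \<in> \<A>" for \<pi> using F G star_alg_zero[OF sA] by (auto simp: a'_def b'_def)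
  have z: "emb 0 = 0" by (rule normal_homs_zero[OF emb sA])
  have "x = (\<Sum>\<pi>\<in>F \<union> G. emb (a' \<pi>) \<odot> lam \<pi>)" "y = (\<Sum>\<pi>\<in>F \<union> G. emb (b' \<pi>) \<odot> lam \<pi>)"
    unfolding x y using F(1) G(1) by (auto intro!: sum.mono_neutral_cong_left simp: a'_def b'_def z)
  then have "x + y = (\<Sum>\<pi>\<in>F \<union> G. emb (a' \<pi> + b' \<pi>) \<odot> lam \<pi>)"
    using m by (simp add: normal_homs_add[OF emb] comp_add_left sum.distrib)
  then show ?thesis
    unfolding presum_def using F G m star_alg_add[OF sA]
    by (intro CollectI exI[of _ "F \<union> G"] exI[of _ "\<lambda>\<pi>. a' \<pi> + b' \<pi>"]) auto
qed

lemma presum_sum: "(\<And>i. i \<in> F \<Longrightarrow> f i \<in> presum g) \<Longrightarrow> (\<Sum>i\<in>F. f i) \<in> presum g"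
  by (induction F rule: infinite_finite_induct) (auto simp: presum_zero presum_add)

lemma presum_induct:
  assumes x: "x \<in> presum g" and "P 0" "\<And>x y. P x \<Longrightarrow> P y \<Longrightarrow> P (x + y)"
    and "\<And>a \<pi>. a \<in> \<A> \<Longrightarrow> \<pi> \<in> Cg g \<Longrightarrow> P (emb a \<odot> lam \<pi>)"
  shows "P x"
proof -
  obtain F a where F: "finite F" "F \<subseteq> Irr \<inter> Cg g" "\<forall>\<pi>\<in>F. a \<pi> \<in> \<A>" and x: "x = (\<Sum>\<pi>\<in>F. emb (a \<pi>) \<odot> lam \<pi>)"
    using assms(1) unfolding presum_def by blast
  from F show ?thesis unfolding x by (induction F) (auto intro!: assms(2-4))
qed

lemma presum_emb_mult: assumes "a \<in> \<A>" "x \<in> presum g" shows "emb a \<odot> x \<in> presum g"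
proof -
  obtain F b where F: "finite F" "F \<subseteq> Irr \<inter> Cg g" "\<forall>\<pi>\<in>F. b \<pi> \<in> \<A>" and x: "x = (\<Sum>\<pi>\<in>F. emb (b \<pi>) \<odot> lam \<pi>)"
    using assms(2) unfolding presum_def by blast
  have "emb a \<odot> (emb (b \<pi>) \<odot> lam \<pi>) = emb (a \<odot> b \<pi>) \<odot> lam \<pi>" if "\<pi> \<in> F" for \<pi>
    using that F assms(1) by (simp add: normal_homs_mult[OF emb] comp_assoc)
  then show ?thesis unfolding x comp_sum_right
    using F assms(1) by (intro presum_sum) (auto intro!: presum_base star_alg_mult[OF sA])
qed

lemma tens_add: "x \<in> M \<Longrightarrow> x' \<in> M \<Longrightarrow> y \<in> M \<Longrightarrow> tens (x + x') y = tens x y + tens x' y"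
  using tens_diff[of "x + x'" x' y] star_alg_add[OF sM] by simp

lemma tens_zero: "y \<in> M \<Longrightarrow> tens 0 y = 0"
  using tens_diff[of 0 0 y] star_alg_zero[OF sM] by simp

lemma tens_sum: "y \<in> M \<Longrightarrow> (\<And>i. i \<in> F \<Longrightarrow> f i \<in> M) \<Longrightarrow> tens (\<Sum>i\<in>F. f i) y = (\<Sum>i\<in>F. tens (f i) y)"
  by (induction F rule: infinite_finite_induct) (auto simp: tens_zero tens_add star_alg_sum[OF sM])

text \<open>Splits \<open>W \<odot> adj W\<close> and moves one factor to the second leg. For an
  isometry \<open>W\<close> this compares \<open>lam \<pi>\<close> with a summand, for a unitary it
  compares equivalent objects.\<close>

lemma lam_subobject:
  assumes "\<pi> \<in> C" "\<kappa> \<in> C" and W: "adj W \<in> intertwiners M \<pi> \<kappa>" "W \<in> M"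
  shows "tens (W \<odot> adj W) \<I> \<odot> lam \<pi> = tens W W \<odot> lam \<kappa>"
proof -
  have WM: "adj W \<in> M" using intertwinersD(1)[OF W(1)] .
  have "tens (W \<odot> adj W) \<I> \<odot> lam \<pi> = tens W \<I> \<odot> (tens (adj W) \<I> \<odot> lam \<pi>)"
    using W(2) WM by (simp add: tens_mult clM flip: comp_assoc)
  also have "\<dots> = tens W \<I> \<odot> (tens \<I> W \<odot> lam \<kappa>)" using lam_rel[OF assms(1-3)] bM[OF W(2)] by simp
  also have "\<dots> = tens W W \<odot> lam \<kappa>" using W(2) by (simp add: tens_mult clM flip: comp_assoc)
  finally show ?thesis .
qed

lemma lam_presum: assumes \<pi>: "\<pi> \<in> Cg g" shows "lam \<pi> \<in> presum g"
proof -
  obtain \<phi> where \<phi>: "faithful_normal_state M \<phi>" using state by blast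
  note \<pi>C = Cg_C[OF \<pi>] and \<pi>E = C_End[OF Cg_C[OF \<pi>]]
  obtain n :: nat and V where
    V: "\<And>i. i < n \<Longrightarrow> V i \<in> M \<and> adj (V i) \<odot> V i = \<I> \<and> V i \<odot> adj (V i) \<in> intertwiners M \<pi> \<pi> \<and>
        irreducible_endo M (sub_endo M \<pi> (V i))"
    and sum: "(\<Sum>i<n. V i \<odot> adj (V i)) = \<I>"
    by (rule finite_decomposition[OF type_III \<phi> conj_pair[OF \<pi>C]]) blast
  have "tens (V i \<odot> adj (V i)) \<I> \<odot> lam \<pi> \<in> presum g" if i: "i < n" for i
  proof -
    let ?V = "V i" and ?p = "sub_endo M \<pi> (V i)"
    have V': "?V \<in> M" "adj ?V \<odot> ?V = \<I>" "?V \<odot> adj ?V \<in> intertwiners M \<pi> \<pi>" "irreducible_endo M ?p" using V[OF i] by auto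
    note pE = sub_endo_End[OF sM \<pi>E V'(1-3)] and pI = sub_endo_intertwiner[OF sM \<pi>E V'(1-3)]
    \<comment> \<open>Each graded component is closed under subobjects and under equivalence, so
      neither the summand nor its representative in \<open>Irr\<close> changes degree.\<close>
    have pg: "?p \<in> Cg g" using Cg_closed[of g] \<pi> pE pI V'(2) unfolding closed_subcategory_def by blast
    then obtain \<kappa> where \<kappa>: "\<kappa> \<in> Irr" "uequiv M ?p \<kappa>"
      using irr V'(4) Cg_C[OF pg] unfolding irr_system_def by blast
    have \<kappa>C: "\<kappa> \<in> C" using \<kappa>(1) irr by (auto simp: irr_system_def)
    have \<kappa>g: "\<kappa> \<in> Cg g" by (rule Cg_uequiv[OF pg C_End[OF \<kappa>C] uequiv_sym[OF sM \<kappa>(2)]])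
    obtain w where w: "unitary_in M w" "\<And>x. x \<in> M \<Longrightarrow> ?p x = w \<odot> \<kappa> x \<odot> adj w" using \<kappa>(2) by (auto simp: uequiv_def)
    have wM: "w \<in> M" and ww: "w \<odot> adj w = \<I>" using w(1) by (auto simp: unitary_in_def)
    have "tens (w \<odot> adj w) \<I> \<odot> lam ?p = tens w w \<odot> lam \<kappa>"
      by (rule lam_subobject[OF Cg_C[OF pg] \<kappa>C uequiv_intertwiner[OF sM w] wM])
    then have lp: "lam ?p = tens w w \<odot> lam \<kappa>" by (simp add: ww tens_one)
    have "tens (?V \<odot> adj ?V) \<I> \<odot> lam \<pi> = tens ?V ?V \<odot> lam ?p"
      by (rule lam_subobject[OF \<pi>C Cg_C[OF pg] intertwiners_adj[OF sM pE \<pi>E pI] V'(1)])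
    also have "\<dots> \<in> presum g"
      unfolding lp unfolding tens_emb
      by (intro presum_emb_mult presum_base op_tensor_A V' wM \<kappa> \<kappa>g)
    finally show ?thesis .
  qed
  then have "(\<Sum>i<n. tens (V i \<odot> adj (V i)) \<I> \<odot> lam \<pi>) \<in> presum g" by (intro presum_sum) auto
  also have "(\<Sum>i<n. tens (V i \<odot> adj (V i)) \<I> \<odot> lam \<pi>) = lam \<pi>"
    unfolding comp_sum_left[symmetric] using V
    by (subst tens_sum[symmetric]) (auto simp: sum tens_one intro!: clM)
  finally show ?thesis .
qed

lemma presum_baseC: "a \<in> \<A> \<Longrightarrow> \<pi> \<in> Cg g \<Longrightarrow> emb a \<odot> lam \<pi> \<in> presum g"
  by (intro presum_emb_mult lam_presum)

lemma presum_B: "x \<in> presum g \<Longrightarrow> x \<in> \<B>"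
  by (erule presum_induct) (auto intro!: clB star_alg_zero[OF sB] emb_B lam_B Cg_C)

text \<open>A product of irreducible labels is in general reducible; \<open>presum_baseC\<close>
  absorbs its decomposition.\<close>

lemma presum_mult: assumes x: "x \<in> presum g" and y: "y \<in> presum h" shows "x \<odot> y \<in> presum (g + h)"
  using x
proof (rule presum_induct)
  fix a \<pi> assume a: "a \<in> \<A>" "\<pi> \<in> Cg g"
  show "(emb a \<odot> lam \<pi>) \<odot> y \<in> presum (g + h)" using y
  proof (rule presum_induct)
    fix b \<rho> assume b: "b \<in> \<A>" "\<rho> \<in> Cg h"
    obtain c where c: "c \<in> \<A>" "(emb a \<odot> lam \<pi>) \<odot> (emb b \<odot> lam \<rho>) = emb c \<odot> lam (compose M \<pi> \<rho>)"
      using emb_lam_mult[OF a(1) Cg_C[OF a(2)] b(1) Cg_C[OF b(2)]] by metis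
    then show "(emb a \<odot> lam \<pi>) \<odot> (emb b \<odot> lam \<rho>) \<in> presum (g + h)"
      using presum_baseC[OF c(1) Cg_comp[OF a(2) b(2)]] by simp
  qed (simp_all add: presum_zero presum_add comp_add_right)
qed (simp_all add: presum_zero presum_add comp_add_left)

lemma presum_adj: assumes "x \<in> presum g" shows "adj x \<in> presum (- g)"
proof -
  have "adj x \<in> presum (- g) \<and> x \<in> bops" using assms
  proof (rule presum_induct)
    fix a \<pi> assume a: "a \<in> \<A>" "\<pi> \<in> Cg g"
    note b = Cg_bar[OF a(2)] and \<pi>C = Cg_C[OF a(2)]
    have aa: "adj a \<in> \<A>" by (rule star_alg_adj[OF sA a(1)])
    obtain \<Theta> where \<Theta>: "\<And>a. a \<in> \<A> \<Longrightarrow> \<Theta> a \<in> \<A>" "\<And>a. a \<in> \<A> \<Longrightarrow> lam (bar \<pi>) \<odot> emb a = emb (\<Theta> a) \<odot> lam (bar \<pi>)"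
      using lam_emb[OF Cg_C[OF b]] by metis
    have "adj (emb a \<odot> lam \<pi>) = adj (lam \<pi>) \<odot> adj (emb a)"
      by (rule adj_comp) (auto intro!: bB emb_B lam_B a \<pi>C)
    also have "\<dots> = tens (adj (R \<pi>)) (adj (R \<pi>)) \<odot> (lam (bar \<pi>) \<odot> emb (adj a))"
      using a by (simp add: lam_adj[OF \<pi>C] normal_homs_adj[OF emb] comp_assoc)
    also have "\<dots> \<in> presum (- g)"
      unfolding \<Theta>(2)[OF aa] unfolding tens_emb
      by (intro presum_emb_mult lam_presum b op_tensor_A \<Theta>(1) aa clM R_M \<pi>C)
    finally show "adj (emb a \<odot> lam \<pi>) \<in> presum (- g) \<and> emb a \<odot> lam \<pi> \<in> bops"
      using a \<pi>C by (auto intro!: bB clB emb_B lam_B)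
  qed (auto simp: presum_zero adj_add bops_add intro!: presum_add)
  then show ?thesis by simp
qed

lemma Bg_B: "x \<in> Bg g \<Longrightarrow> x \<in> \<B>"
  using closure_of_minimal[OF _ vN_closedin[OF vN_B], of "presum g"] presum_B unfolding Bg_eq by blast

lemma presum_Bg: "x \<in> presum g \<Longrightarrow> x \<in> Bg g"
  unfolding Bg_eq using closure_of_subset[of "presum g" sigma_weak] by auto

lemma Bg_map:
  assumes f: "continuous_map (subtopology sigma_weak \<B>) sigma_weak f" and "x \<in> Bg g"
    and "\<And>x. x \<in> presum g \<Longrightarrow> f x \<in> Bg h"
  shows "f x \<in> Bg h"
  unfolding Bg_eq by (rule sigma_weak_closure_map[OF f vN_closedin[OF vN_B]]) (use assms presum_B in \<open>auto simp: Bg_eq\<close>)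

text \<open>Only separate continuity of multiplication is at hand, so the closure is taken in one
  factor at a time: first in \<open>y\<close> with a finite sum on the left, then in
  \<open>x\<close>.\<close>

lemma Bg_mult: assumes x: "x \<in> Bg g" and y: "y \<in> Bg h" shows "x \<odot> y \<in> Bg (g + h)"
proof -
  have "a \<odot> y \<in> Bg (g + h)" if "a \<in> presum g" for a
    by (rule Bg_map[of "\<lambda>y. a \<odot> y", OF continuous_map_from_subtopology[OF continuous_map_left_mult[OF bB[OF presum_B[OF that]]]] y])
      (rule presum_Bg[OF presum_mult[OF that]])
  then show ?thesis
    by (rule Bg_map[of "\<lambda>x. x \<odot> y", OF continuous_map_from_subtopology[OF continuous_map_right_mult] x])
qed

lemma Bg_add: assumes x: "x \<in> Bg g" and y: "y \<in> Bg g" shows "x + y \<in> Bg g"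
proof -
  have "a + y \<in> Bg g" if "a \<in> presum g" for a
    by (rule Bg_map[of "\<lambda>y. a + y", OF continuous_map_from_subtopology[OF continuous_map_translation] y])
      (rule presum_Bg[OF presum_add[OF that]])
  then have "y + a \<in> Bg g" if "a \<in> presum g" for a using that by (metis add.commute)
  then have "y + x \<in> Bg g"
    by (rule Bg_map[of "\<lambda>x. y + x", OF continuous_map_from_subtopology[OF continuous_map_translation] x])
  then show ?thesis by (metis add.commute)
qed

lemma Bg_adj: assumes "x \<in> Bg g" shows "adj x \<in> Bg (- g)"
proof (rule Bg_map[OF _ assms])
  show "continuous_map (subtopology sigma_weak \<B>) sigma_weak adj"
    by (rule continuous_map_from_subtopology_mono[OF continuous_map_adj]) (use bB in auto)
qed (rule presum_Bg[OF presum_adj])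

lemma emb_B0: "a \<in> \<A> \<Longrightarrow> emb a \<in> Bg 0"
  using presum_baseC[OF _ Cg_id, of a] by (intro presum_Bg) (simp add: lam_id)

lemma lam_Bg: "\<pi> \<in> Cg g \<Longrightarrow> lam \<pi> \<in> Bg g"
  by (rule presum_Bg[OF lam_presum])

lemma sB0: "star_alg (Bg 0)"
proof -
  have one: "\<I> \<in> Bg 0" using emb_B0[OF star_alg_one[OF sA]] by (simp add: normal_homs_one[OF emb])
  have "scale_op c x \<in> Bg 0" if "x \<in> Bg 0" for c x
  proof -
    have "emb (scale_op c \<I>) \<odot> x \<in> Bg (0 + 0)"
      by (intro Bg_mult that emb_B0 star_alg_scale[OF sA] star_alg_one[OF sA])
    then show ?thesis
      by (simp add: normal_homs_scale[OF emb] normal_homs_one[OF emb] star_alg_one[OF sA] comp_scale_op_left)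
  qed
  then show ?thesis
    unfolding star_alg_def using one Bg_add[of _ 0] Bg_mult[of _ 0 _ 0] Bg_adj[of _ 0] bB[OF Bg_B] by auto
qed

text \<open>Such an \<open>\<eta>\<close> changes the coefficient of each \<open>lam \<pi>\<close>
  but not the label, so finite sums keep their degree; normality extends this to the
  closure.\<close>

lemma eta_Bg:
  assumes \<eta>: "\<eta> \<in> End \<B>" and \<Theta>: "\<And>a. a \<in> \<A> \<Longrightarrow> \<Theta> a \<in> \<A> \<and> \<eta> (emb a) = emb (\<Theta> a)"
    and T: "\<And>\<pi>. \<pi> \<in> C \<Longrightarrow> T \<pi> \<in> M \<and> \<eta> (lam \<pi>) = tens (T \<pi>) \<I> \<odot> lam \<pi>" and x: "x \<in> Bg g"
  shows "\<eta> x \<in> Bg g"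
proof (rule Bg_map[OF normal_homs_cont'[OF \<eta>[unfolded End_def]] x])
  fix x assume "x \<in> presum g"
  then have "\<eta> x \<in> Bg g \<and> x \<in> \<B>"
  proof (rule presum_induct)
    fix a \<pi> assume a: "a \<in> \<A>" "\<pi> \<in> Cg g"
    note \<pi>C = Cg_C[OF a(2)]
    have "\<eta> (emb a \<odot> lam \<pi>) = emb (\<Theta> a) \<odot> (emb (op_tensor ten (T \<pi>) (jmap \<I>)) \<odot> lam \<pi>)"
      using a \<pi>C \<Theta> T by (simp add: End_mult[OF \<eta>] emb_B lam_B tens_emb)
    also have "\<dots> \<in> Bg g"
      by (intro presum_Bg presum_emb_mult lam_presum a op_tensor_A star_alg_one[OF sM]) (use \<Theta> T a \<pi>C in auto)
    finally show "\<eta> (emb a \<odot> lam \<pi>) \<in> Bg g \<and> emb a \<odot> lam \<pi> \<in> \<B>" using a \<pi>C by (auto intro!: clB emb_B lam_B)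
  next
    show "\<eta> 0 \<in> Bg g \<and> 0 \<in> \<B>"
      using normal_homs_zero[OF \<eta>[unfolded End_def] sB] presum_Bg[OF presum_zero] star_alg_zero[OF sB] by simp
  qed (auto simp: End_add[OF \<eta>] intro!: Bg_add clB)
  then show "\<eta> x \<in> Bg g" by simp
qed

end

section \<open>Crossed products\<close>

lemma ell2_sumD:
  assumes "ell2_sum \<delta>"
  shows "\<delta> g (x + y) = \<delta> g x + \<delta> g y" "\<delta> g (c *\<^sub>C x) = c *\<^sub>C \<delta> g x"
    "cinner (\<delta> g x) (\<delta> h y) = (if g = h then cinner x y else 0)"
    "closure (span (range (\<lambda>(g, x). \<delta> g x))) = UNIV"
proof -
  have "range (\<lambda>(g, x). \<delta> g x) = {\<delta> g x | g x. True}" by auto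
  then show "closure (span (range (\<lambda>(g, x). \<delta> g x))) = UNIV" using assms by (simp add: ell2_sum_def)
qed (use assms in \<open>simp_all add: ell2_sum_def\<close>)

lemma ell2_sum_norm:
  assumes \<delta>: "ell2_sum \<delta>" and "finite H" "inj_on p H"
  shows "(norm (\<Sum>h\<in>H. \<delta> (p h) (v h)))\<^sup>2 = (\<Sum>h\<in>H. (norm (v h))\<^sup>2)"
proof -
  have "cinner (\<Sum>h\<in>H. \<delta> (p h) (v h)) (\<Sum>h\<in>H. \<delta> (p h) (v h)) = (\<Sum>h\<in>H. \<Sum>k\<in>H. if h = k then cinner (v h) (v k) else 0)"
    unfolding cinner_sum_left cinner_sum_right ell2_sumD[OF \<delta>]
    using assms(3) by (intro sum.cong refl) (auto dest: inj_onD)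
  also have "\<dots> = (\<Sum>h\<in>H. cinner (v h) (v h))" using assms(2) by simp
  finally show ?thesis unfolding Re_cinner_self[symmetric] by simp
qed

text \<open>Both \<open>cp_pi\<close> (with \<open>p = id\<close>) and \<open>cp_unitary\<close> (with \<open>T = 1\<close>) are of this block-permutation form.\<close>

lemma ell2_block_operator:
  assumes \<delta>: "ell2_sum \<delta>" and p: "inj p" and T: "\<And>h. T h \<in> bops" "\<And>h. norm (T h) \<le> K"
  obtains S where "S \<in> bops" "\<And>h \<xi>. blinfun_apply S (\<delta> h \<xi>) = \<delta> (p h) (blinfun_apply (T h) \<xi>)"
proof -
  note d = ell2_sumD[OF \<delta>]
  have K: "K \<ge> 0" using T(2)[of undefined] norm_ge_zero[of "T undefined"] by linarith
  have ds: "\<delta> g (r *\<^sub>R x) = r *\<^sub>R \<delta> g x" for g r x by (simp add: scaleR_scaleC d)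
  have d0: "\<delta> g 0 = 0" for g using ds[of g 0 0] by simp
  have dsum: "\<delta> g (sum f F) = (\<Sum>i\<in>F. \<delta> g (f i))" for g F and f :: "'a \<times> 'b \<Rightarrow> _"
    by (induction F rule: infinite_finite_induct) (auto simp: d d0)
  let ?e = "\<lambda>(h, \<xi>). \<delta> h \<xi>" and ?f = "\<lambda>(h, \<xi>). \<delta> (p h) (blinfun_apply (T h) \<xi>)"
  have bound: "norm (\<Sum>i\<in>F. c i *\<^sub>R ?f i) \<le> K * norm (\<Sum>i\<in>F. c i *\<^sub>R ?e i)" if F: "finite F" for F c
  proof (rule power2_le_imp_le)
    define H where "H = fst ` F"
    define v where "v h = (\<Sum>i\<in>{i \<in> F. fst i = h}. c i *\<^sub>R snd i)" for h
    have H: "finite H" "fst ` F \<subseteq> H" using F by (auto simp: H_def)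
    have "(\<Sum>i\<in>F. c i *\<^sub>R ?e i) = (\<Sum>h\<in>H. \<Sum>i\<in>{i \<in> F. fst i = h}. c i *\<^sub>R ?e i)"
      by (rule sum.group[OF F H, symmetric])
    also have "\<dots> = (\<Sum>h\<in>H. \<delta> (id h) (v h))"
      unfolding v_def dsum by (intro sum.cong refl) (auto simp: ds)
    finally have e: "(norm (\<Sum>i\<in>F. c i *\<^sub>R ?e i))\<^sup>2 = (\<Sum>h\<in>H. (norm (v h))\<^sup>2)"
      using ell2_sum_norm[OF \<delta> H(1), of id v] by simp
    have "(\<Sum>i\<in>F. c i *\<^sub>R ?f i) = (\<Sum>h\<in>H. \<Sum>i\<in>{i \<in> F. fst i = h}. c i *\<^sub>R ?f i)"
      by (rule sum.group[OF F H, symmetric])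
    also have "\<dots> = (\<Sum>h\<in>H. \<delta> (p h) (blinfun_apply (T h) (v h)))"
      unfolding v_def blinfun.sum_right dsum by (intro sum.cong refl) (auto simp: ds blinfun.scaleR_right)
    finally have f: "(norm (\<Sum>i\<in>F. c i *\<^sub>R ?f i))\<^sup>2 = (\<Sum>h\<in>H. (norm (blinfun_apply (T h) (v h)))\<^sup>2)"
      using ell2_sum_norm[OF \<delta> H(1), of p] p by (simp add: inj_on_subset)
    have "norm (blinfun_apply (T h) (v h)) \<le> K * norm (v h)" for h
      using norm_blinfun[of "T h" "v h"] mult_right_mono[OF T(2)[of h] norm_ge_zero[of "v h"]] by linarith
    then have "(\<Sum>h\<in>H. (norm (blinfun_apply (T h) (v h)))\<^sup>2) \<le> (\<Sum>h\<in>H. (K * norm (v h))\<^sup>2)"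
      by (intro sum_mono power_mono) auto
    then show "(norm (\<Sum>i\<in>F. c i *\<^sub>R ?f i))\<^sup>2 \<le> (K * norm (\<Sum>i\<in>F. c i *\<^sub>R ?e i))\<^sup>2"
      unfolding power_mult_distrib e f by (simp add: sum_distrib_left)
  qed (simp add: K)
  have sc: "\<exists>j. ?e j = c *\<^sub>C ?e i \<and> ?f j = c *\<^sub>C ?f i" for c i
    by (cases i, rule exI[of _ "(fst i, c *\<^sub>C snd i)"]) (auto simp: d T bops_app)
  obtain S where S: "\<And>i. blinfun_apply S (?e i) = ?f i" "\<And>c x. blinfun_apply S (c *\<^sub>C x) = c *\<^sub>C blinfun_apply S x"
    using bounded_cextension[of ?f K ?e, OF bound sc K] by metis
  show thesis
  proof (rule that[OF bopsI[OF S(2)]])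
    show "blinfun_apply S (\<delta> h \<xi>) = \<delta> (p h) (blinfun_apply (T h) \<xi>)" for h \<xi> using S(1)[of "(h, \<xi>)"] by simp
  qed
qed

lemma ell2_sum_eqI:
  assumes "ell2_sum \<delta>" "\<And>h \<xi>. blinfun_apply S (\<delta> h \<xi>) = blinfun_apply T (\<delta> h \<xi>)" shows "S = T"
  by (rule blinfun_eq_dense[OF ell2_sumD(4)[OF assms(1)]]) (auto simp: assms(2))

text \<open>\<open>cp_pi\<close> is a definite description over operators; the uniform bound over
  the group is what produces an operator satisfying it.\<close>

lemma cp_pi_bops:
  assumes \<delta>: "ell2_sum \<delta>" and "\<And>h. \<beta> h b \<in> bops" "\<And>h. norm (\<beta> h b) \<le> K"
  shows "cp_pi \<delta> \<beta> b \<in> bops"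
proof -
  obtain S where S: "S \<in> bops" "\<And>h \<xi>. S (\<delta> h \<xi>) = \<delta> (id h) (\<beta> (- h) b \<xi>)"
    using ell2_block_operator[OF \<delta> inj_on_id, of "\<lambda>h. \<beta> (- h) b" K] assms(2,3) by metis
  have "cp_pi \<delta> \<beta> b = S"
    unfolding cp_pi_def by (rule the_equality) (use S in \<open>auto intro!: ell2_sum_eqI[OF \<delta>]\<close>)
  then show ?thesis using S(1) by simp
qed

lemma cp_unitary_bops:
  assumes \<delta>: "ell2_sum (\<delta> :: 'g::group_add \<Rightarrow> 'l::chilbert_space \<Rightarrow> 'm::chilbert_space)" shows "cp_unitary \<delta> g \<in> bops"
proof -
  have "inj ((+) g)" by (rule injI) simp
  from ell2_block_operator[OF \<delta> this, of "\<lambda>_. \<I>" 1]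
  obtain S where S: "S \<in> bops" "\<And>h \<xi>. S (\<delta> h \<xi>) = \<delta> (g + h) \<xi>"
    by (metis bops_id blinfun_apply_id_blinfun norm_blinfun_id_le)
  have "cp_unitary \<delta> g = S"
    unfolding cp_unitary_def by (rule the_equality) (use S in \<open>auto intro!: ell2_sum_eqI[OF \<delta>]\<close>)
  then show ?thesis using S(1) by simp
qed

lemma norm_isometry_le:
  assumes "w \<in> bops" "adj w \<odot> w = \<I>" shows "norm w \<le> 1" "norm (adj w) \<le> 1"
proof -
  show "norm w \<le> 1"
  proof (rule norm_blinfun_bound)
    fix x
    have "(norm (w x))\<^sup>2 = (norm x)\<^sup>2" using norm_sq_scalar[of w 1 x] assms by simp
    then show "norm (w x) \<le> 1 * norm x" by (simp add: power2_eq_iff_nonneg)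
  qed simp
  then show "norm (adj w) \<le> 1" by (simp add: norm_adj[OF assms(1)])
qed

lemma crossed_product_vN:
  assumes \<delta>: "ell2_sum \<delta>" and N: "N \<subseteq> bops" and u: "\<And>g. unitary_in B (u g)" "B \<subseteq> bops"
  shows "von_neumann_algebra (crossed_product \<delta> N (Ad_action u N))"
    and "b \<in> N \<Longrightarrow> cp_pi \<delta> (Ad_action u N) b \<in> crossed_product \<delta> N (Ad_action u N)"
    and "cp_unitary \<delta> g \<in> crossed_product \<delta> N (Ad_action u N)"
proof -
  have "cp_pi \<delta> (Ad_action u N) b \<in> bops" if b: "b \<in> N" for b
  proof (rule cp_pi_bops[OF \<delta>])
    fix h
    have uh: "u h \<in> bops" "adj (u h) \<odot> u h = \<I>" using u by (auto simp: unitary_in_def)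
    show "Ad_action u N h b \<in> bops" using uh b N by (auto simp: Ad_action_def)
    have "norm (u h \<odot> b) \<le> norm (u h) * norm b" "norm (u h) * norm b \<le> norm b"
      using norm_isometry_le[OF uh] by (auto intro: norm_blinfun_compose mult_left_le_one_le)
    moreover have "norm (u h \<odot> b \<odot> adj (u h)) \<le> norm (u h \<odot> b) * norm (adj (u h))" "norm (u h \<odot> b) * norm (adj (u h)) \<le> norm (u h \<odot> b)"
      using norm_isometry_le[OF uh] by (auto intro: norm_blinfun_compose mult_right_le_one_le)
    ultimately show "norm (Ad_action u N h b) \<le> norm b" using b by (simp add: Ad_action_def)
  qed
  then have S: "cp_pi \<delta> (Ad_action u N) ` N \<union> range (cp_unitary \<delta>) \<subseteq> bops" using cp_unitary_bops[OF \<delta>] by auto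
  show "von_neumann_algebra (crossed_product \<delta> N (Ad_action u N))"
    "b \<in> N \<Longrightarrow> cp_pi \<delta> (Ad_action u N) b \<in> crossed_product \<delta> N (Ad_action u N)"
    "cp_unitary \<delta> g \<in> crossed_product \<delta> N (Ad_action u N)"
    unfolding crossed_product_def using vN_vN_generated[OF S] vN_generated_subset[OF S] by auto
qed

section \<open>Countable direct sums\<close>

text \<open>Tonelli for unconditional sums: nonnegativity turns the iterated sums into absolute
  summability of the double family.\<close>

lemma has_sum_nonneg_iterated:
  fixes f :: "'i \<Rightarrow> 'j \<Rightarrow> real"
  assumes "\<And>i j. f i j \<ge> 0" "\<And>i. i \<in> A \<Longrightarrow> (f i has_sum g i) B" "(g has_sum S) A"
  shows "((\<lambda>(i, j). f i j) has_sum S) (A \<times> B)"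
proof (rule has_sum_SigmaI[OF _ assms(3)])
  have g: "(\<Sum>\<^sub>\<infinity>j\<in>B. norm (f i j)) = g i" if "i \<in> A" for i
    using infsumI[OF assms(2)[OF that]] assms(1) by simp
  have "(\<lambda>i. norm (g i)) summable_on A"
    using has_sum_imp_summable[OF assms(3)] has_sum_nonneg[OF assms(2)] assms(1)
    by (subst summable_on_cong[of _ _ g]) auto
  then have "(\<lambda>p. norm (case_prod f p)) summable_on (A \<times> B)"
    using has_sum_imp_summable[OF assms(2)] assms(1) g
    by (intro Infinite_Sum.abs_summable_on_Sigma_iff[THEN iffD2]) (auto cong: summable_on_cong)
  then show "(\<lambda>(i, j). f i j) summable_on (A \<times> B)" by (rule abs_summable_summable)
qed (use assms in auto)

lemma has_sum_nonneg_swap: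
  fixes f :: "'i \<Rightarrow> 'j \<Rightarrow> real"
  assumes "\<And>i j. f i j \<ge> 0" "\<And>i. i \<in> A \<Longrightarrow> (f i has_sum g i) B" "(g has_sum S) A"
    and "\<And>j. j \<in> B \<Longrightarrow> ((\<lambda>i. f i j) has_sum h j) A"
  shows "(h has_sum S) B"
proof (rule has_sum_SigmaD)
  have "bij_betw prod.swap (B \<times> A) (A \<times> B)" by (intro bij_betwI[of _ _ _ prod.swap]) auto
  from has_sum_reindex_bij_betw[OF this, of "\<lambda>(i, j). f i j" S] has_sum_nonneg_iterated[OF assms(1-3)]
  show "((\<lambda>(j, i). f i j) has_sum S) (B \<times> A)" by (simp add: case_prod_unfold)
qed (use assms(4) in auto)

lemma orthogonal_isometries_norm:
  fixes V :: "'i \<Rightarrow> 'a::chilbert_space bop"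
  assumes F: "finite F" and V: "\<And>i. i \<in> F \<Longrightarrow> V i \<in> bops"
    and orth: "\<And>i k. i \<in> F \<Longrightarrow> k \<in> F \<Longrightarrow> adj (V i) \<odot> V k = (if i = k then \<I> else 0)"
  shows "(norm (x - (\<Sum>i\<in>F. (V i \<odot> adj (V i)) x)))\<^sup>2 =
    (norm x)\<^sup>2 - (\<Sum>i\<in>F. (norm (adj (V i) x))\<^sup>2)"
proof -
  let ?y = "\<lambda>i. (adj (V i)) x" and ?s = "\<Sum>i\<in>F. (V i \<odot> adj (V i)) x"
  define N where "N = (\<Sum>i\<in>F. cinner (?y i) (?y i))"
  have xs: "cinner x ?s = N"
    unfolding cinner_sum_right N_def by (intro sum.cong refl) (simp add: cinner_adj V)
  have sx: "cinner ?s x = N"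
    unfolding cinner_sum_left N_def by (intro sum.cong refl) (simp add: cinner_adj' V)
  have "cinner ((V i \<odot> adj (V i)) x) ((V k \<odot> adj (V k)) x) =
      (if i = k then cinner (?y i) (?y i) else 0)" if "i \<in> F" "k \<in> F" for i k
  proof -
    have "cinner (V i (?y i)) (V k (?y k)) =
        cinner (?y i) ((adj (V i) \<odot> V k) (?y k))" using that V by (simp add: cinner_adj')
    then show ?thesis using orth[OF that] by simp
  qed
  then have "cinner ?s ?s = (\<Sum>i\<in>F. \<Sum>k\<in>F. if i = k then cinner (?y i) (?y i) else 0)"
    unfolding cinner_sum_left cinner_sum_right by (intro sum.cong refl) auto
  then have ss: "cinner ?s ?s = N" unfolding N_def using F by simp
  have "cinner (x - ?s) (x - ?s) = cinner x x - N" unfolding cinner_diff_left cinner_diff_right xs sx ss by simp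
  then show ?thesis unfolding Re_cinner_self[symmetric] by (simp add: N_def)
qed

text \<open>Pythagoras turns completeness of the ranges into Parseval's identity. Sums of
  nonnegative reals can be regrouped freely, and this is how completeness is checked for amplified
  and composed families.\<close>

lemma orthogonal_isometries_complete:
  fixes V :: "'i \<Rightarrow> 'a::chilbert_space bop"
  assumes V: "\<And>i. i \<in> I \<Longrightarrow> V i \<in> bops"
    and orth: "\<And>i k. i \<in> I \<Longrightarrow> k \<in> I \<Longrightarrow> adj (V i) \<odot> V k = (if i = k then \<I> else 0)"
  shows "((\<lambda>i. (V i \<odot> adj (V i)) x) has_sum x) I \<longleftrightarrow>
    ((\<lambda>i. (norm (adj (V i) x))\<^sup>2) has_sum (norm x)\<^sup>2) I"
proof -
  let ?s = "\<lambda>F. \<Sum>i\<in>F. (V i \<odot> adj (V i)) x" and ?n = "\<lambda>F. \<Sum>i\<in>F. (norm (adj (V i) x))\<^sup>2"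
  have eq: "eventually (\<lambda>F. (norm (x - ?s F))\<^sup>2 = (norm x)\<^sup>2 - ?n F) (finite_subsets_at_top I)"
    by (rule eventually_finite_subsets_at_top_weakI, rule orthogonal_isometries_norm)
      (use V orth in \<open>meson subsetD\<close>)+
  have "(?s \<longlongrightarrow> x) (finite_subsets_at_top I) \<longleftrightarrow> ((\<lambda>F. (norm (x - ?s F))\<^sup>2) \<longlongrightarrow> 0) (finite_subsets_at_top I)"
  proof
    assume "(?s \<longlongrightarrow> x) (finite_subsets_at_top I)"
    then have "((\<lambda>F. (norm (x - ?s F))\<^sup>2) \<longlongrightarrow> (norm (x - x))\<^sup>2) (finite_subsets_at_top I)" by (intro tendsto_intros)
    then show "((\<lambda>F. (norm (x - ?s F))\<^sup>2) \<longlongrightarrow> 0) (finite_subsets_at_top I)" by simp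
  next
    assume "((\<lambda>F. (norm (x - ?s F))\<^sup>2) \<longlongrightarrow> 0) (finite_subsets_at_top I)"
    then have "((\<lambda>F. sqrt ((norm (x - ?s F))\<^sup>2)) \<longlongrightarrow> sqrt 0) (finite_subsets_at_top I)" by (rule tendsto_real_sqrt)
    then have "((\<lambda>F. x - ?s F) \<longlongrightarrow> 0) (finite_subsets_at_top I)" by (simp add: tendsto_norm_zero_iff)
    then have "((\<lambda>F. x - (x - ?s F)) \<longlongrightarrow> x - 0) (finite_subsets_at_top I)" by (intro tendsto_intros)
    then show "(?s \<longlongrightarrow> x) (finite_subsets_at_top I)" by simp
  qed
  also have "\<dots> \<longleftrightarrow> ((\<lambda>F. (norm x)\<^sup>2 - ?n F) \<longlongrightarrow> 0) (finite_subsets_at_top I)"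
    by (rule tendsto_cong[OF eq])
  also have "\<dots> \<longleftrightarrow> (?n \<longlongrightarrow> (norm x)\<^sup>2) (finite_subsets_at_top I)"
  proof
    assume "((\<lambda>F. (norm x)\<^sup>2 - ?n F) \<longlongrightarrow> 0) (finite_subsets_at_top I)"
    then have "((\<lambda>F. (norm x)\<^sup>2 - ((norm x)\<^sup>2 - ?n F)) \<longlongrightarrow> (norm x)\<^sup>2 - 0) (finite_subsets_at_top I)" by (intro tendsto_intros)
    then show "(?n \<longlongrightarrow> (norm x)\<^sup>2) (finite_subsets_at_top I)" by simp
  next
    assume "(?n \<longlongrightarrow> (norm x)\<^sup>2) (finite_subsets_at_top I)"
    then have "((\<lambda>F. (norm x)\<^sup>2 - ?n F) \<longlongrightarrow> (norm x)\<^sup>2 - (norm x)\<^sup>2) (finite_subsets_at_top I)" by (intro tendsto_intros)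
    then show "((\<lambda>F. (norm x)\<^sup>2 - ?n F) \<longlongrightarrow> 0) (finite_subsets_at_top I)" by simp
  qed
  finally show ?thesis unfolding has_sum_def .
qed

lemma amp_sum: "amp (\<Sum>i\<in>F. f i) = (\<Sum>i\<in>F. amp (f i))"
  by (induction F rule: infinite_finite_induct) (auto simp: amp_add)

text \<open>Strong convergence on the given space must be lifted to the amplified one. Parseval
  holds in every coordinate, and exchanging the sums over coordinates and over isometries gives it
  for \<open>amp (V i)\<close>.\<close>

lemma orthogonal_isometries_sigma_weak:
  fixes V :: "'i \<Rightarrow> 'a::chilbert_space bop"
  assumes V: "\<And>i. i \<in> I \<Longrightarrow> V i \<in> bops"
    and orth: "\<And>i k. i \<in> I \<Longrightarrow> k \<in> I \<Longrightarrow> adj (V i) \<odot> V k = (if i = k then \<I> else 0)"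
    and sum: "\<And>x. ((\<lambda>i. (V i \<odot> adj (V i)) x) has_sum x) I"
  shows "limitin sigma_weak (\<lambda>F. \<Sum>i\<in>F. V i \<odot> adj (V i)) \<I> (finite_subsets_at_top I)"
proof -
  have "((\<lambda>F. (amp (\<Sum>i\<in>F. V i \<odot> adj (V i))) \<eta>) \<longlongrightarrow> \<eta>) (finite_subsets_at_top I)" for \<eta>
  proof -
    have sums: "((\<lambda>n. (norm (coord \<zeta> n))\<^sup>2) has_sum (norm \<zeta>)\<^sup>2) UNIV" for \<zeta> :: "'a l2seq"
      unfolding norm_l2seq_sq by (intro sums_nonneg_imp_has_sum summable_sums summable_coord) auto
    have "((\<lambda>i. (norm (adj (amp (V i)) \<eta>))\<^sup>2) has_sum (norm \<eta>)\<^sup>2) I"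
    proof (rule has_sum_nonneg_swap[where A = UNIV])
      show "((\<lambda>n. (norm (coord \<eta> n))\<^sup>2) has_sum (norm \<eta>)\<^sup>2) UNIV" by (rule sums)
      fix n :: nat
      show "((\<lambda>i. (norm (adj (V i) (coord \<eta> n)))\<^sup>2) has_sum (norm (coord \<eta> n))\<^sup>2) I"
        using orthogonal_isometries_complete[OF V orth] sum by blast
    next
      fix i assume "i \<in> I"
      then have "coord (adj (amp (V i)) \<eta>) n = adj (V i) (coord \<eta> n)" for n
        using V by (simp flip: amp_adj)
      then show "((\<lambda>n. (norm (adj (V i) (coord \<eta> n)))\<^sup>2) has_sum (norm (adj (amp (V i)) \<eta>))\<^sup>2) UNIV"
        using sums[of "(adj (amp (V i))) \<eta>"] by simp
    qed simp
    then have "((\<lambda>i. (amp (V i) \<odot> adj (amp (V i))) \<eta>) has_sum \<eta>) I"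
      using V orth by (subst orthogonal_isometries_complete) (auto simp: amp_adj[symmetric] amp_comp[symmetric])
    then have "((\<lambda>F. \<Sum>i\<in>F. (amp (V i) \<odot> adj (amp (V i))) \<eta>) \<longlongrightarrow> \<eta>) (finite_subsets_at_top I)"
      unfolding has_sum_def .
    moreover have "eventually (\<lambda>F. (\<Sum>i\<in>F. (amp (V i) \<odot> adj (amp (V i))) \<eta>) =
        (amp (\<Sum>i\<in>F. V i \<odot> adj (V i))) \<eta>) (finite_subsets_at_top I)"
      using V by (intro eventually_finite_subsets_at_top_weakI)
        (auto simp: amp_sum blinfun.sum_left amp_adj amp_comp subset_iff intro!: sum.cong)
    ultimately show ?thesis by (rule Lim_transform_eventually)
  qed
  note lim = this
  show ?thesis
    unfolding limitin_def
  proof (intro conjI allI impI)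
    fix U :: "'a bop set" assume "openin sigma_weak U \<and> \<I> \<in> U"
    then obtain \<eta> e where e: "e > 0" "\<And>y :: 'a bop. norm (amp (y - \<I>) \<eta>) < e \<Longrightarrow> y \<in> U"
      using sigma_weak_nbhd by metis
    have "eventually (\<lambda>F. dist (amp (\<Sum>i\<in>F. V i \<odot> adj (V i)) \<eta>) \<eta> < e) (finite_subsets_at_top I)"
      by (rule tendstoD[OF lim e(1)])
    then show "eventually (\<lambda>F. (\<Sum>i\<in>F. V i \<odot> adj (V i)) \<in> U) (finite_subsets_at_top I)"
      by (rule eventually_mono) (intro e(2), simp add: dist_norm amp_diff blinfun.diff_left)
  qed simp
qed

text \<open>A normal map preserves the limit of the partial sums of
  \<open>V i \<odot> adj (V i)\<close>; testing at the vector \<open>y\<close> gives Parseval's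
  identity for the images.\<close>

lemma normal_homs_isometries_complete:
  fixes V :: "'i \<Rightarrow> 'a::chilbert_space bop"
  assumes M: "star_alg M" and \<rho>: "\<rho> \<in> normal_homs M N" and V: "\<And>i. i \<in> I \<Longrightarrow> V i \<in> M"
    and orth: "\<And>i k. i \<in> I \<Longrightarrow> k \<in> I \<Longrightarrow> adj (V i) \<odot> V k = (if i = k then \<I> else 0)"
    and sum: "\<And>x. ((\<lambda>i. (V i \<odot> adj (V i)) x) has_sum x) I"
    and N: "N \<subseteq> bops"
  shows "((\<lambda>i. (norm (adj (\<rho> (V i)) y))\<^sup>2) has_sum (norm y)\<^sup>2) I"
proof -
  note b = star_alg_bops[OF M]
  let ?Q = "\<lambda>F. \<Sum>i\<in>F. V i \<odot> adj (V i)"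
  have QM: "?Q F \<in> M" if "F \<subseteq> I" for F
    using that V by (intro star_alg_sum[OF M] star_alg_mult[OF M] star_alg_adj[OF M]) auto
  have "limitin (subtopology sigma_weak M) ?Q \<I> (finite_subsets_at_top I)"
    unfolding limitin_subtopology
    using orthogonal_isometries_sigma_weak[of I V, OF b[OF V] orth sum] QM star_alg_one[OF M]
    by (auto intro!: eventually_finite_subsets_at_top_weakI)
  then have "limitin sigma_weak (\<rho> \<circ> ?Q) (\<rho> \<I>) (finite_subsets_at_top I)"
    by (rule continuous_map_limit[OF normal_homs_cont'[OF \<rho>]])
  from continuous_map_limit[OF continuous_map_vector_functional[of "(l2emb 0) y" "(l2emb 0) y"] this]
  have "((\<lambda>F. cinner y (\<rho> (?Q F) y)) \<longlongrightarrow> cinner y y) (finite_subsets_at_top I)"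
    by (simp add: normal_homs_one[OF \<rho>] cinner_l2emb o_def)
  then have "((\<lambda>F. Re (cinner y (\<rho> (?Q F) y))) \<longlongrightarrow> (norm y)\<^sup>2) (finite_subsets_at_top I)"
    unfolding Re_cinner_self[symmetric] by (rule tendsto_Re)
  moreover have "eventually (\<lambda>F. Re (cinner y (\<rho> (?Q F) y)) =
      (\<Sum>i\<in>F. (norm (adj (\<rho> (V i)) y))\<^sup>2)) (finite_subsets_at_top I)"
  proof (rule eventually_finite_subsets_at_top_weakI)
    fix F assume F: "finite F" "F \<subseteq> I"
    have VM: "V i \<in> M" "adj (V i) \<in> M" if "i \<in> F" for i using that F V star_alg_adj[OF M] by auto
    have "\<rho> (?Q F) = (\<Sum>i\<in>F. \<rho> (V i) \<odot> adj (\<rho> (V i)))"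
      using VM by (subst normal_homs_sum[OF \<rho> M])
        (auto intro!: star_alg_mult[OF M] sum.cong simp: normal_homs_mult[OF \<rho>] normal_homs_adj[OF \<rho>])
    moreover have "cinner y (\<rho> (V i) z) = cinner (adj (\<rho> (V i)) y) z" if "i \<in> F" for i z
      using VM[OF that] normal_homs_mem[OF \<rho>] N by (subst cinner_adj) auto
    ultimately show "Re (cinner y (\<rho> (?Q F) y)) = (\<Sum>i\<in>F. (norm (adj (\<rho> (V i)) y))\<^sup>2)"
      by (simp add: blinfun.sum_left cinner_sum_right Re_cinner_self)
  qed
  ultimately show ?thesis unfolding has_sum_def by (rule Lim_transform_eventually)
qed

lemma countable_sums_End: "\<sigma> \<in> countable_sums M C \<Longrightarrow> \<sigma> \<in> End M"
  by (auto simp: countable_sums_def direct_sum_endo_def)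

lemma countable_sumsE:
  fixes M :: "'a::chilbert_space bop set"
  assumes "\<sigma> \<in> countable_sums M C"
  obtains I :: "nat set" and \<rho> V where "\<And>i. i \<in> I \<Longrightarrow> \<rho> i \<in> C" "\<And>i. i \<in> I \<Longrightarrow> V i \<in> intertwiners M (\<rho> i) \<sigma>"
    "\<And>i k. i \<in> I \<Longrightarrow> k \<in> I \<Longrightarrow> adj (V i) \<odot> V k = (if i = k then \<I> else 0)"
    "\<And>x. ((\<lambda>i. (V i \<odot> adj (V i)) x) has_sum x) I"
proof -
  obtain I \<rho> where 1: "\<forall>i\<in>I. \<rho> i \<in> C" "direct_sum_endo M I \<rho> \<sigma>" using assms by (auto simp: countable_sums_def)
  from 1(2) have "\<exists>V. (\<forall>i\<in>I. V i \<in> intertwiners M (\<rho> i) \<sigma>) \<and>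
          (\<forall>i\<in>I. \<forall>k\<in>I. adj (V i) \<odot> V k = (if i = k then \<I> else 0)) \<and>
          (\<forall>x. ((\<lambda>i. (V i \<odot> adj (V i)) x) has_sum x) I)"
    unfolding direct_sum_endo_def by (rule conjunct2)
  then show thesis
  proof (elim exE conjE)
    fix V :: "nat \<Rightarrow> 'a bop" assume V: "\<forall>i\<in>I. V i \<in> intertwiners M (\<rho> i) \<sigma>"
      "\<forall>i\<in>I. \<forall>k\<in>I. adj (V i) \<odot> V k = (if i = k then \<I> else 0)"
      "\<forall>x. ((\<lambda>i. (V i \<odot> adj (V i)) x) has_sum x) I"
    show thesis
      by (rule that[of I \<rho> V]) (rule bspec[OF 1(1)] bspec[OF V(1)] bspec[OF bspec[OF V(2)]] spec[OF V(3)]; assumption)+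
  qed
qed

lemma idend_countable_sums:
  assumes M: "star_alg M" and "idend M \<in> C" shows "idend M \<in> countable_sums M C"
proof -
  have "direct_sum_endo M {0} (\<lambda>_. idend M) (idend M)"
    unfolding direct_sum_endo_def using idend_End[OF M] star_alg_one[OF M]
    by (intro conjI exI[of _ "\<lambda>_. \<I>"])
      (auto simp: intertwiners_def idend_def intro!: has_sum_finiteI)
  then show ?thesis unfolding countable_sums_def using assms(2)
    by (intro CollectI exI[of _ "{0}"] exI[of _ "\<lambda>_. idend M"]) auto
qed

text \<open>The summands of the composition are \<open>compose M (\<rho> i) (\<rho>' j)\<close> with
  isometries \<open>V i \<odot> \<rho> i (V' j)\<close>. Their completeness uses normality of each
  \<open>\<rho> i\<close>, which keeps the family of the \<open>V' j\<close> complete.\<close>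

lemma countable_sums_compose:
  assumes M: "star_alg M" and CE: "C \<subseteq> End M" and C: "\<And>\<rho> \<sigma>. \<rho> \<in> C \<Longrightarrow> \<sigma> \<in> C \<Longrightarrow> compose M \<rho> \<sigma> \<in> C"
    and s: "\<sigma> \<in> countable_sums M C" and s': "\<sigma>' \<in> countable_sums M C"
  shows "compose M \<sigma> \<sigma>' \<in> countable_sums M C"
proof -
  note cl = star_alg_mult[OF M] star_alg_adj[OF M] and b = star_alg_bops[OF M]
  obtain I :: "nat set" and \<rho> V where \<rho>: "\<And>i. i \<in> I \<Longrightarrow> \<rho> i \<in> C" and V: "\<And>i. i \<in> I \<Longrightarrow> V i \<in> intertwiners M (\<rho> i) \<sigma>"
    and orth: "\<And>i k. i \<in> I \<Longrightarrow> k \<in> I \<Longrightarrow> adj (V i) \<odot> V k = (if i = k then \<I> else 0)"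
    and sum: "\<And>x. ((\<lambda>i. (V i \<odot> adj (V i)) x) has_sum x) I"
    by (rule countable_sumsE[OF s], rule that)
  obtain I' :: "nat set" and \<rho>' V' where \<rho>': "\<And>i. i \<in> I' \<Longrightarrow> \<rho>' i \<in> C" and V': "\<And>i. i \<in> I' \<Longrightarrow> V' i \<in> intertwiners M (\<rho>' i) \<sigma>'"
    and orth': "\<And>i k. i \<in> I' \<Longrightarrow> k \<in> I' \<Longrightarrow> adj (V' i) \<odot> V' k = (if i = k then \<I> else 0)"
    and sum': "\<And>x. ((\<lambda>i. (V' i \<odot> adj (V' i)) x) has_sum x) I'"
    by (rule countable_sumsE[OF s'], rule that)
  note \<sigma>E = countable_sums_End[OF s] and \<sigma>E' = countable_sums_End[OF s']
  note VM = intertwinersD(1)[OF V] and VM' = intertwinersD(1)[OF V']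
  have \<rho>E: "\<rho> i \<in> End M" if "i \<in> I" for i using \<rho>[OF that] CE by blast
  have \<rho>E': "\<rho>' i \<in> End M" if "i \<in> I'" for i using \<rho>'[OF that] CE by blast
  define W where "W = (\<lambda>(i, j). V i \<odot> \<rho> i (V' j))"
  have WM: "W p \<in> M" if "p \<in> I \<times> I'" for p
    using that by (auto simp: W_def intro!: cl VM VM' End_mem[OF \<rho>E])
  have W: "W (i, j) \<in> intertwiners M (compose M (\<rho> i) (\<rho>' j)) (compose M \<sigma> \<sigma>')" if "i \<in> I" "j \<in> I'" for i j
  proof (rule intertwinersI)
    show "W (i, j) \<in> M" using WM that by simp
    fix x assume x: "x \<in> M"
    note m = VM'[OF that(2)] End_mem[OF \<rho>E'[OF that(2)] x] End_mem[OF \<sigma>E' x]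
    have "W (i, j) \<odot> \<rho> i (\<rho>' j x) = V i \<odot> \<rho> i (V' j \<odot> \<rho>' j x)"
      using m that by (simp add: W_def End_mult[OF \<rho>E] comp_assoc)
    also have "V' j \<odot> \<rho>' j x = \<sigma>' x \<odot> V' j" by (rule intertwinersD(2)[OF V'[OF that(2)] x])
    also have "V i \<odot> \<rho> i (\<sigma>' x \<odot> V' j) = (V i \<odot> \<rho> i (\<sigma>' x)) \<odot> \<rho> i (V' j)"
      using m that by (simp add: End_mult[OF \<rho>E] comp_assoc)
    also have "V i \<odot> \<rho> i (\<sigma>' x) = \<sigma> (\<sigma>' x) \<odot> V i" by (rule intertwinersD(2)[OF V[OF that(1)] m(3)])
    finally show "W (i, j) \<odot> compose M (\<rho> i) (\<rho>' j) x = compose M \<sigma> \<sigma>' x \<odot> W (i, j)"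
      using x by (simp add: W_def compose_def comp_assoc)
  qed
  have adjW: "adj (W (i, j)) = adj (\<rho> i (V' j)) \<odot> adj (V i)" if "i \<in> I" "j \<in> I'" for i j
    using that VM VM' End_mem[OF \<rho>E] b by (simp add: W_def adj_comp)
  have Worth: "adj (W p) \<odot> W q = (if p = q then \<I> else 0)" if "p \<in> I \<times> I'" "q \<in> I \<times> I'" for p q
  proof -
    obtain i j k l where pq': "p = (i, j)" "q = (k, l)" by (cases p, cases q)
    then have pq: "p = (i, j)" "q = (k, l)" "i \<in> I" "j \<in> I'" "k \<in> I" "l \<in> I'" using that by auto
    have "adj (W p) \<odot> W q = adj (\<rho> i (V' j)) \<odot> (adj (V i) \<odot> V k) \<odot> \<rho> k (V' l)"
      using adjW[OF pq(3,4)] pq by (simp add: W_def comp_assoc)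
    also have "\<dots> = (if i = k then adj (\<rho> i (V' j)) \<odot> \<rho> i (V' l) else 0)" using orth pq by auto
    also have "adj (\<rho> i (V' j)) \<odot> \<rho> i (V' l) = \<rho> i (adj (V' j) \<odot> V' l)"
      using pq VM' by (simp add: End_mult[OF \<rho>E] End_adj[OF \<rho>E] cl)
    also have "\<dots> = (if j = l then \<I> else 0)"
      using orth'[OF pq(4,6)] normal_homs_zero[OF \<rho>E[unfolded End_def] M] pq by (simp add: End_one[OF \<rho>E])
    finally show ?thesis by (simp add: pq)
  qed
  have Wsum: "((\<lambda>p. (W p \<odot> adj (W p)) x) has_sum x) (I \<times> I')" for x
  proof -
    have "((\<lambda>(i, j). (norm (adj (\<rho> i (V' j)) (adj (V i) x)))\<^sup>2) has_sum (norm x)\<^sup>2) (I \<times> I')"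
    proof (rule has_sum_nonneg_iterated)
      show "((\<lambda>i. (norm (adj (V i) x))\<^sup>2) has_sum (norm x)\<^sup>2) I"
        using orthogonal_isometries_complete[OF b[OF VM] orth] sum by blast
      show "((\<lambda>j. (norm (adj (\<rho> i (V' j)) (adj (V i) x)))\<^sup>2) has_sum
          (norm (adj (V i) x))\<^sup>2) I'" if "i \<in> I" for i
        by (rule normal_homs_isometries_complete[OF M \<rho>E[OF that, unfolded End_def] VM' orth' sum']) (use b in auto)
    qed simp
    then have "((\<lambda>p. (norm (adj (W p) x))\<^sup>2) has_sum (norm x)\<^sup>2) (I \<times> I')"
      by (rule has_sum_cong[THEN iffD1, rotated]) (auto simp: adjW)
    then show ?thesis by (subst orthogonal_isometries_complete[OF b[OF WM] Worth]) auto
  qed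
  \<comment> \<open>Direct sums are indexed by sets of natural numbers, so the pairs are
    encoded.\<close>
  define J where "J = prod_encode ` (I \<times> I')"
  have bij: "bij_betw prod_decode J (I \<times> I')" unfolding J_def by (intro bij_betwI[of _ _ _ prod_encode]) auto
  have J: "prod_decode n \<in> I \<times> I'" if "n \<in> J" for n using that by (auto simp: J_def)
  have inj: "prod_decode m = prod_decode n \<longleftrightarrow> m = n" for m n by (metis prod_decode_inverse)
  have "direct_sum_endo M J (\<lambda>n. compose M (\<rho> (fst (prod_decode n))) (\<rho>' (snd (prod_decode n)))) (compose M \<sigma> \<sigma>')"
    unfolding direct_sum_endo_def
  proof (intro conjI exI[of _ "\<lambda>n. W (prod_decode n)"] ballI allI)
    show "compose M \<sigma> \<sigma>' \<in> End M" by (rule End_compose[OF \<sigma>E \<sigma>E' M])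
    fix n assume n: "n \<in> J"
    show "W (prod_decode n) \<in> intertwiners M (compose M (\<rho> (fst (prod_decode n))) (\<rho>' (snd (prod_decode n)))) (compose M \<sigma> \<sigma>')"
      using W[of "fst (prod_decode n)" "snd (prod_decode n)"] J[OF n] by (auto simp: mem_Times_iff)
    fix m assume "m \<in> J"
    then show "adj (W (prod_decode n)) \<odot> W (prod_decode m) = (if n = m then \<I> else 0)"
      using Worth[OF J[OF n] J] by (simp add: inj)
  next
    show "((\<lambda>n. (W (prod_decode n) \<odot> adj (W (prod_decode n))) x) has_sum x) J" for x
      using has_sum_reindex_bij_betw[OF bij, of "\<lambda>p. (W p \<odot> adj (W p)) x"] Wsum by simp
  qed
  moreover have "compose M (\<rho> (fst (prod_decode n))) (\<rho>' (snd (prod_decode n))) \<in> C" if "n \<in> J" for n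
    using J[OF that] by (intro C \<rho> \<rho>') (auto simp: mem_Times_iff)
  ultimately show ?thesis unfolding countable_sums_def by (intro CollectI exI conjI ballI)
qed

section \<open>Transport along an isomorphism\<close>

lemma compose_in: "x \<in> M \<Longrightarrow> compose M \<rho> \<sigma> x = \<rho> (\<sigma> x)"
  by (simp add: compose_def)

lemma unitary_in_hom: "\<rho> \<in> normal_homs M N \<Longrightarrow> star_alg M \<Longrightarrow> unitary_in M w \<Longrightarrow> unitary_in N (\<rho> w)"
  unfolding unitary_in_def
  using normal_homs_mem normal_homs_one star_alg_adj
  by (metis normal_homs_adj normal_homs_mult)

lemma Ad_unitary_End:
  assumes M: "star_alg M" and w: "unitary_in M w" and \<eta>: "\<eta> \<in> End M"
  shows "(\<lambda>x\<in>M. w \<odot> \<eta> x \<odot> adj w) \<in> End M"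
  unfolding End_def
proof (rule normal_homsI)
  note b = star_alg_bops[OF M] and m = End_mem[OF \<eta>]
  have wM: "w \<in> M" "adj w \<in> M" and ww: "adj w \<odot> w = \<I>" "w \<odot> adj w = \<I>"
    using w star_alg_adj[OF M] by (auto simp: unitary_in_def)
  fix x y assume x: "x \<in> M"
  show "(\<lambda>x\<in>M. w \<odot> \<eta> x \<odot> adj w) x \<in> M" using x wM m by (simp add: star_alg_mult[OF M])
  show "(\<lambda>x\<in>M. w \<odot> \<eta> x \<odot> adj w) (scale_op c x) = scale_op c ((\<lambda>x\<in>M. w \<odot> \<eta> x \<odot> adj w) x)" for c
    using x b[OF wM(1)] star_alg_scale[OF M]
    by (simp add: End_scale[OF \<eta>] comp_scale_op_left comp_scale_op_right)
  show "(\<lambda>x\<in>M. w \<odot> \<eta> x \<odot> adj w) (adj x) = adj ((\<lambda>x\<in>M. w \<odot> \<eta> x \<odot> adj w) x)"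
    using x b wM m star_alg_adj[OF M] by (simp add: End_adj[OF \<eta>] adj_comp comp_assoc)
  assume y: "y \<in> M"
  show "(\<lambda>x\<in>M. w \<odot> \<eta> x \<odot> adj w) (x + y) = (\<lambda>x\<in>M. w \<odot> \<eta> x \<odot> adj w) x + (\<lambda>x\<in>M. w \<odot> \<eta> x \<odot> adj w) y"
    using x y star_alg_add[OF M] by (simp add: End_add[OF \<eta>] comp_add_left comp_add_right)
  have "w \<odot> \<eta> (x \<odot> y) \<odot> adj w = w \<odot> \<eta> x \<odot> (adj w \<odot> w) \<odot> \<eta> y \<odot> adj w"
    using x y ww by (simp add: End_mult[OF \<eta>] comp_assoc)
  then show "(\<lambda>x\<in>M. w \<odot> \<eta> x \<odot> adj w) (x \<odot> y) = (\<lambda>x\<in>M. w \<odot> \<eta> x \<odot> adj w) x \<odot> (\<lambda>x\<in>M. w \<odot> \<eta> x \<odot> adj w) y"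
    using x y star_alg_mult[OF M] by (simp add: comp_assoc)
next
  have wb: "w \<in> bops" and ww: "w \<odot> adj w = \<I>" using w star_alg_bops[OF M] by (auto simp: unitary_in_def)
  show "(\<lambda>x\<in>M. w \<odot> \<eta> x \<odot> adj w) \<I> = \<I>" using star_alg_one[OF M] ww by (simp add: End_one[OF \<eta>])
  have "continuous_map (subtopology sigma_weak M) sigma_weak ((\<lambda>T. T \<odot> adj w) \<circ> ((\<lambda>T. w \<odot> T) \<circ> \<eta>))"
    by (intro continuous_map_compose[OF _ continuous_map_right_mult] continuous_map_compose[OF _ continuous_map_left_mult[OF wb]] End_cont[OF \<eta>])
  then show "continuous_map (subtopology sigma_weak M) sigma_weak (\<lambda>x\<in>M. w \<odot> \<eta> x \<odot> adj w)"
    by (rule continuous_map_eq) simp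
qed simp

locale normal_iso =
  fixes A :: "'a::chilbert_space bop set" and B :: "'b::chilbert_space bop set" and \<Phi> :: "'a bop \<Rightarrow> 'b bop"
  assumes A: "von_neumann_algebra A" and B: "von_neumann_algebra B"
    and hom: "\<Phi> \<in> normal_homs A B" and bij: "bij_betw \<Phi> A B"
begin

lemmas sA = vN_star_alg[OF A]
lemmas sB = vN_star_alg[OF B]
abbreviation "\<Psi> \<equiv> inv_into A \<Phi>"
abbreviation "F \<equiv> transport A B \<Phi>"

lemma \<Psi>_mem: "y \<in> B \<Longrightarrow> \<Psi> y \<in> A" and \<Phi>_\<Psi>: "y \<in> B \<Longrightarrow> \<Phi> (\<Psi> y) = y" and \<Psi>_\<Phi>: "x \<in> A \<Longrightarrow> \<Psi> (\<Phi> x) = x"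
  and \<Phi>_mem: "x \<in> A \<Longrightarrow> \<Phi> x \<in> B"
  using bij normal_homs_mem[OF hom] by (auto simp: bij_betw_def inv_into_into f_inv_into_f)

lemma \<Psi>_hom: "(\<lambda>y\<in>B. \<Psi> y) \<in> normal_homs B A"
  by (rule normal_iso_inverse[OF A B hom bij])

lemma transport_apply: "x \<in> A \<Longrightarrow> F \<mu> (\<Phi> x) = \<Phi> (\<mu> x)"
  by (simp add: transport_def \<Psi>_\<Phi> \<Phi>_mem)

lemma transport_End: assumes "\<mu> \<in> End A" shows "F \<mu> \<in> End B"
proof -
  have "(\<lambda>y\<in>B. \<Phi> ((\<lambda>y\<in>B. \<mu> ((\<lambda>y\<in>B. \<Psi> y) y)) y)) \<in> normal_homs B B"
    using assms by (intro normal_homs_compose[OF _ hom sB] normal_homs_compose[OF \<Psi>_hom _ sB]) (simp add: End_def)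
  moreover have "(\<lambda>y\<in>B. \<Phi> ((\<lambda>y\<in>B. \<mu> ((\<lambda>y\<in>B. \<Psi> y) y)) y)) = F \<mu>" by (auto simp: transport_def)
  ultimately show ?thesis by (simp add: End_def)
qed

lemma transport_surj: assumes "\<nu> \<in> End B" obtains \<mu> where "\<mu> \<in> End A" "F \<mu> = \<nu>" "\<And>x. x \<in> A \<Longrightarrow> \<mu> x = \<Psi> (\<nu> (\<Phi> x))"
proof -
  define \<mu> where "\<mu> = (\<lambda>x\<in>A. (\<lambda>y\<in>B. \<Psi> y) ((\<lambda>x\<in>A. \<nu> (\<Phi> x)) x))"
  have E: "\<mu> \<in> End A"
    unfolding \<mu>_def End_def by (intro normal_homs_compose[OF _ \<Psi>_hom sA] normal_homs_compose[OF hom _ sA]) (use assms in \<open>simp add: End_def\<close>)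
  have \<mu>: "\<mu> x = \<Psi> (\<nu> (\<Phi> x))" if "x \<in> A" for x using that End_mem[OF assms \<Phi>_mem] by (simp add: \<mu>_def)
  have "F \<mu> = \<nu>"
    by (rule End_eqI[OF transport_End[OF E] assms]) (simp add: transport_def \<mu> \<Psi>_mem \<Phi>_\<Psi> End_mem[OF assms])
  then show thesis using that E \<mu> by blast
qed

lemma \<Phi>_inj: "x \<in> A \<Longrightarrow> y \<in> A \<Longrightarrow> \<Phi> x = \<Phi> y \<longleftrightarrow> x = y"
  by (metis \<Psi>_\<Phi>)

lemma transport_inj: assumes "\<mu> \<in> End A" "\<nu> \<in> End A" "F \<mu> = F \<nu>" shows "\<mu> = \<nu>"
proof (rule End_eqI[OF assms(1,2)])
  fix x assume "x \<in> A"
  then have "\<Phi> (\<mu> x) = \<Phi> (\<nu> x)" using assms(3) by (simp flip: transport_apply)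
  then show "\<mu> x = \<nu> x" using \<open>x \<in> A\<close> assms by (simp add: \<Phi>_inj End_mem)
qed

lemma transport_idend: "F (idend A) = idend B"
  by (auto simp: transport_def idend_def \<Psi>_mem \<Phi>_\<Psi>)

lemma transport_compose: "\<rho> \<in> End A \<Longrightarrow> \<sigma> \<in> End A \<Longrightarrow> F (compose A \<rho> \<sigma>) = compose B (F \<rho>) (F \<sigma>)"
  by (auto simp: transport_def compose_def \<Psi>_mem \<Phi>_\<Psi> \<Psi>_\<Phi> End_mem \<Phi>_mem intro!: restrict_ext)

lemma transport_intertwiners:
  assumes "\<rho> \<in> End A" "\<sigma> \<in> End A"
  shows "bij_betw \<Phi> (intertwiners A \<rho> \<sigma>) (intertwiners B (F \<rho>) (F \<sigma>))"
proof -
  have iff: "\<Phi> T \<in> intertwiners B (F \<rho>) (F \<sigma>) \<longleftrightarrow> T \<in> intertwiners A \<rho> \<sigma>" if T: "T \<in> A" for T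
  proof -
    have "T \<odot> \<rho> x = \<sigma> x \<odot> T \<longleftrightarrow> \<Phi> T \<odot> F \<rho> (\<Phi> x) = F \<sigma> (\<Phi> x) \<odot> \<Phi> T" if "x \<in> A" for x
      using that T assms
      by (simp add: transport_apply normal_homs_mult[OF hom, symmetric] End_mem \<Phi>_inj star_alg_mult[OF sA])
    moreover have "B = \<Phi> ` A" using bij by (simp add: bij_betw_def)
    ultimately show ?thesis using T by (auto simp: intertwiners_def)
  qed
  have "\<Phi> ` intertwiners A \<rho> \<sigma> = intertwiners B (F \<rho>) (F \<sigma>)"
  proof (intro equalityI subsetI)
    fix y assume y: "y \<in> intertwiners B (F \<rho>) (F \<sigma>)"
    then have yB: "y \<in> B" by (rule intertwinersD)
    then show "y \<in> \<Phi> ` intertwiners A \<rho> \<sigma>" using iff[OF \<Psi>_mem[OF yB]] y \<Phi>_\<Psi>[OF yB] by (metis imageI)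
  qed (use iff intertwinersD(1) in blast)
  moreover have "inj_on \<Phi> (intertwiners A \<rho> \<sigma>)" by (rule inj_onI) (metis \<Phi>_inj intertwinersD(1))
  ultimately show ?thesis by (simp add: bij_betw_def)
qed

lemma transport_uequiv: assumes "\<rho> \<in> End A" "\<sigma> \<in> End A" "uequiv A \<rho> \<sigma>" shows "uequiv B (F \<rho>) (F \<sigma>)"
proof -
  obtain w where w: "unitary_in A w" "\<And>x. x \<in> A \<Longrightarrow> \<rho> x = w \<odot> \<sigma> x \<odot> adj w" using assms(3) by (auto simp: uequiv_def)
  have wA: "w \<in> A" "adj w \<in> A" using w(1) star_alg_adj[OF sA] by (auto simp: unitary_in_def)
  show ?thesis
  proof (rule uequivI[OF unitary_in_hom[OF hom sA w(1)]])
    fix y assume "y \<in> B"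
    then have x: "\<Psi> y \<in> A" by (rule \<Psi>_mem)
    have "F \<rho> y = \<Phi> (w \<odot> \<sigma> (\<Psi> y) \<odot> adj w)" using \<open>y \<in> B\<close> w(2)[OF x] by (simp add: transport_def)
    also have "\<dots> = \<Phi> w \<odot> F \<sigma> y \<odot> adj (\<Phi> w)"
      using wA x \<open>y \<in> B\<close> End_mem[OF assms(2)]
      by (simp add: transport_def normal_homs_mult[OF hom] normal_homs_adj[OF hom] star_alg_mult[OF sA])
    finally show "F \<rho> y = \<Phi> w \<odot> F \<sigma> y \<odot> adj (\<Phi> w)" .
  qed
qed

lemma transport_uequiv_back: assumes "\<rho> \<in> End A" "\<sigma> \<in> End A" "uequiv B (F \<rho>) (F \<sigma>)" shows "uequiv A \<rho> \<sigma>"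
proof -
  obtain w where w: "unitary_in B w" "\<And>y. y \<in> B \<Longrightarrow> F \<rho> y = w \<odot> F \<sigma> y \<odot> adj w" using assms(3) by (auto simp: uequiv_def)
  have wB: "w \<in> B" and w': "unitary_in A (\<Psi> w)"
    using w(1) unitary_in_hom[OF \<Psi>_hom sB w(1)] by (auto simp: unitary_in_def)
  have wA: "\<Psi> w \<in> A" "adj (\<Psi> w) \<in> A" using \<Psi>_mem[OF wB] star_alg_adj[OF sA] by auto
  show ?thesis
  proof (rule uequivI[OF w'])
    fix x assume x: "x \<in> A"
    have "\<Phi> (\<rho> x) = w \<odot> \<Phi> (\<sigma> x) \<odot> adj w" using w(2)[OF \<Phi>_mem[OF x]] x by (simp add: transport_apply)
    also have "\<dots> = \<Phi> (\<Psi> w \<odot> \<sigma> x \<odot> adj (\<Psi> w))"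
      using wA x End_mem[OF assms(2)]
      by (simp add: normal_homs_mult[OF hom] normal_homs_adj[OF hom] star_alg_mult[OF sA] \<Phi>_\<Psi>[OF wB])
    finally show "\<rho> x = \<Psi> w \<odot> \<sigma> x \<odot> adj (\<Psi> w)"
      using x wA End_mem[OF assms(1)] End_mem[OF assms(2)] by (subst (asm) \<Phi>_inj) (auto intro: star_alg_mult[OF sA])
  qed
qed

text \<open>Only the target has to be known as a tensor category: transport is injective on
  endomorphisms and respects composition, so \<open>Z\<close> inherits its closure properties from
  the image.\<close>

lemma tensor_category_iso_transport:
  assumes Z: "Z \<subseteq> End A" and Z': "tensor_category B Z'" and FZ: "F ` Z = Z'"
  shows "tensor_category_iso A Z B Z' F \<Phi>"
proof -
  have E: "\<rho> \<in> End A" if "\<rho> \<in> Z" for \<rho> using that Z by blast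
  have ZI: "\<rho> \<in> Z" if "\<rho> \<in> End A" "F \<rho> \<in> Z'" for \<rho> using that transport_inj[OF that(1) E] FZ by (metis imageE)
  have t: "tensor_category A Z"
    unfolding tensor_category_def
  proof (intro conjI ballI)
    show "idend A \<in> Z" by (rule ZI[OF idend_End[OF sA]]) (use Z' in \<open>simp add: transport_idend tensor_category_def\<close>)
    fix \<rho> \<sigma> assume "\<rho> \<in> Z" "\<sigma> \<in> Z"
    then show "compose A \<rho> \<sigma> \<in> Z"
      using Z' FZ unfolding tensor_category_def
      by (intro ZI[OF End_compose[OF E E sA]]) (auto simp: transport_compose E)
  qed (use Z in auto)
  have int: "T \<in> A" if "T \<in> intertwiners A \<rho> \<sigma>" for T \<rho> \<sigma> using that by (rule intertwinersD)
  have "bij_betw F Z Z'"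
    using FZ transport_inj E by (auto simp: bij_betw_def inj_on_def)
  then show ?thesis
    unfolding tensor_category_iso_def
    using t Z' transport_idend transport_compose[OF E E] transport_intertwiners[OF E E]
      normal_homs_add[OF hom int int] normal_homs_scale[OF hom int] normal_homs_adj[OF hom int] normal_homs_one[OF hom]
      normal_homs_mult[OF hom int int] normal_homs_mult[OF hom int End_mem[OF E int]] transport_apply[OF int]
    by (intro conjI ballI allI) simp_all
qed

end

section \<open>The Drinfeld center and the equivariantization\<close>

lemma uequiv_trans:
  assumes M: "star_alg M" and "uequiv M \<rho> \<sigma>" "uequiv M \<sigma> \<tau>" shows "uequiv M \<rho> \<tau>"
proof -
  obtain v w where v: "unitary_in M v" "\<And>x. x \<in> M \<Longrightarrow> \<rho> x = v \<odot> \<sigma> x \<odot> adj v"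
    and w: "unitary_in M w" "\<And>x. x \<in> M \<Longrightarrow> \<sigma> x = w \<odot> \<tau> x \<odot> adj w" using assms(2,3) unfolding uequiv_def by metis
  have "v \<in> bops" "w \<in> bops" using v w star_alg_bops[OF M] by (auto simp: unitary_in_def)
  then show ?thesis
    by (intro uequivI[OF unitary_in_mult[OF M v(1) w(1)]]) (simp add: v(2) w(2) adj_comp comp_assoc)
qed

lemma uequiv_compose:
  assumes M: "star_alg M" and E: "\<rho>' \<in> End M" "\<sigma> \<in> End M" "\<sigma>' \<in> End M"
    and u: "uequiv M \<rho> \<sigma>" "uequiv M \<rho>' \<sigma>'"
  shows "uequiv M (compose M \<rho> \<rho>') (compose M \<sigma> \<sigma>')"
proof -
  obtain v w where v: "unitary_in M v" "\<And>x. x \<in> M \<Longrightarrow> \<rho> x = v \<odot> \<sigma> x \<odot> adj v"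
    and w: "unitary_in M w" "\<And>x. x \<in> M \<Longrightarrow> \<rho>' x = w \<odot> \<sigma>' x \<odot> adj w" using u unfolding uequiv_def by metis
  have wM: "w \<in> M" "adj w \<in> M" and vb: "v \<in> bops" using v w star_alg_bops[OF M] star_alg_adj[OF M] by (auto simp: unitary_in_def)
  have \<sigma>w: "unitary_in M (\<sigma> w)" using unitary_in_hom[OF E(2)[unfolded End_def] M w(1)] .
  then have \<sigma>wb: "\<sigma> w \<in> bops" using star_alg_bops[OF M] by (auto simp: unitary_in_def)
  show ?thesis
  proof (rule uequivI[OF unitary_in_mult[OF M v(1) \<sigma>w]])
    fix x assume x: "x \<in> M"
    have "\<rho> (\<rho>' x) = v \<odot> \<sigma> (w \<odot> \<sigma>' x \<odot> adj w) \<odot> adj v" using v(2)[OF End_mem[OF E(1) x]] w(2)[OF x] by simp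
    also have "\<sigma> (w \<odot> \<sigma>' x \<odot> adj w) = \<sigma> w \<odot> \<sigma> (\<sigma>' x) \<odot> adj (\<sigma> w)"
      using wM End_mem[OF E(3) x] by (simp add: End_mult[OF E(2)] End_adj[OF E(2)] star_alg_mult[OF M])
    finally show "compose M \<rho> \<rho>' x = (v \<odot> \<sigma> w) \<odot> compose M \<sigma> \<sigma>' x \<odot> adj (v \<odot> \<sigma> w)"
      using x vb \<sigma>wb by (simp add: compose_in adj_comp comp_assoc)
  qed
qed

section \<open>The Drinfeld center as a tensor category\<close>

context longo_rehren_setup
begin

abbreviation "tensor_endo \<sigma> \<Theta> \<equiv> is_tensor_endo ten M (Mop M) \<sigma> (idend (Mop M)) \<Theta>"

lemma tensor_endo_id: "tensor_endo (idend M) (idend \<A>)"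
  unfolding is_tensor_endo_def lrA_def[symmetric]
  using idend_End[OF sA] op_tensor_A by (auto simp: idend_def Mop_eq)

lemma tensor_endo_compose:
  assumes "\<sigma> \<in> End M" "\<sigma>' \<in> End M" "tensor_endo \<sigma> \<Theta>" "tensor_endo \<sigma>' \<Theta>'"
  shows "tensor_endo (compose M \<sigma> \<sigma>') (compose \<A> \<Theta> \<Theta>')"
  using assms(3,4) End_compose[OF _ _ sA] op_tensor_A End_mem[OF assms(2)]
  unfolding is_tensor_endo_def lrA_def[symmetric] by (auto simp: idend_def Mop_eq compose_in)

lemma tensor_endo_mem: "tensor_endo \<sigma> \<Theta> \<Longrightarrow> a \<in> \<A> \<Longrightarrow> \<Theta> a \<in> \<A>"
  unfolding is_tensor_endo_def lrA_def[symmetric] by (auto simp: End_mem)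

text \<open>For \<open>\<sigma>\<close> a countable direct sum, membership becomes a condition on
  \<open>\<A>\<close> alone, which is why closure under composition takes no computation with half
  braidings.\<close>

lemma drinfeldI:
  assumes "\<mu> \<in> End \<B>" "\<sigma> \<in> countable_sums M C" "\<eta> \<in> End \<B>" and \<Theta>: "tensor_endo \<sigma> \<Theta>"
    and \<eta>\<Theta>: "\<And>a. a \<in> \<A> \<Longrightarrow> \<eta> (emb a) = emb (\<Theta> a)" and "uequiv \<B> \<mu> \<eta>"
  shows "\<mu> \<in> drinfeld_center M C L"
proof -
  have "\<eta> (tens x y) = tens (\<sigma> x) y" if "x \<in> M" "y \<in> M" for x y
    using \<eta>\<Theta>[OF op_tensor_A[OF that]] \<Theta> that jmap_Mop[OF that(2)]
    by (simp add: tens_emb is_tensor_endo_def idend_def)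
  then obtain \<E> where "half_braiding M C \<sigma> \<E>" "\<And>\<pi>. \<pi> \<in> C \<Longrightarrow> \<eta> (lam \<pi>) = elem L (adj (\<E> \<pi>)) \<I> \<odot> lam \<pi>"
    using eta_extension_exists[OF assms(3) countable_sums_End[OF assms(2)]] by metis
  then show ?thesis
    unfolding relative_center_def is_eta_extension_def using assms by blast
qed

lemma drinfeldE:
  assumes "\<mu> \<in> drinfeld_center M C L"
  obtains \<sigma> \<E> \<eta> \<Theta> where "\<mu> \<in> End \<B>" "\<sigma> \<in> countable_sums M C" "half_braiding M C \<sigma> \<E>" "\<eta> \<in> End \<B>"
    "tensor_endo \<sigma> \<Theta>" "\<And>a. a \<in> \<A> \<Longrightarrow> \<eta> (emb a) = emb (\<Theta> a)"
    "\<And>\<pi>. \<pi> \<in> C \<Longrightarrow> \<eta> (lam \<pi>) = elem L (adj (\<E> \<pi>)) \<I> \<odot> lam \<pi>" "uequiv \<B> \<mu> \<eta>"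
  using assms unfolding relative_center_def is_eta_extension_def by blast

lemma tensor_category_drinfeld: "tensor_category \<B> (drinfeld_center M C L)"
  unfolding tensor_category_def
proof (intro conjI ballI subsetI)
  show "\<mu> \<in> End \<B>" if "\<mu> \<in> drinfeld_center M C L" for \<mu> using that by (simp add: relative_center_def)
  show "idend \<B> \<in> drinfeld_center M C L"
    by (rule drinfeldI[OF idend_End[OF sB] idend_countable_sums[OF sM C_id] idend_End[OF sB] tensor_endo_id _ uequiv_refl[OF sB]])
      (simp add: idend_def emb_B)
  fix \<mu> \<mu>' assume \<mu>: "\<mu> \<in> drinfeld_center M C L" and \<mu>': "\<mu>' \<in> drinfeld_center M C L"
  obtain \<sigma> \<eta> \<Theta> where 1: "\<mu> \<in> End \<B>" "\<sigma> \<in> countable_sums M C" "\<eta> \<in> End \<B>" "tensor_endo \<sigma> \<Theta>"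
      "\<And>a. a \<in> \<A> \<Longrightarrow> \<eta> (emb a) = emb (\<Theta> a)" "uequiv \<B> \<mu> \<eta>" by (rule drinfeldE[OF \<mu>]) metis
  obtain \<sigma>' \<eta>' \<Theta>' where 2: "\<mu>' \<in> End \<B>" "\<sigma>' \<in> countable_sums M C" "\<eta>' \<in> End \<B>" "tensor_endo \<sigma>' \<Theta>'"
      "\<And>a. a \<in> \<A> \<Longrightarrow> \<eta>' (emb a) = emb (\<Theta>' a)" "uequiv \<B> \<mu>' \<eta>'" by (rule drinfeldE[OF \<mu>']) metis
  show "compose \<B> \<mu> \<mu>' \<in> drinfeld_center M C L"
  proof (rule drinfeldI)
    show "compose \<B> \<mu> \<mu>' \<in> End \<B>" "compose \<B> \<eta> \<eta>' \<in> End \<B>" using 1 2 by (auto intro: End_compose sB)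
    show "compose M \<sigma> \<sigma>' \<in> countable_sums M C"
      using 1 2 C_End C_comp by (intro countable_sums_compose[OF sM]) auto
    show "tensor_endo (compose M \<sigma> \<sigma>') (compose \<A> \<Theta> \<Theta>')"
      using 1 2 by (intro tensor_endo_compose countable_sums_End)
    show "compose \<B> \<eta> \<eta>' (emb a) = emb (compose \<A> \<Theta> \<Theta>' a)" if "a \<in> \<A>" for a
      using that tensor_endo_mem[OF 2(4) that] by (simp add: compose_in emb_B 1 2)
    show "uequiv \<B> (compose \<B> \<mu> \<mu>') (compose \<B> \<eta> \<eta>')" using 1 2 by (intro uequiv_compose[OF sB])
  qed
qed

end

section \<open>Equivariantization and center under the identification\<close>

locale crossed_longo_rehren = graded_longo_rehren M C Irr bar R R' L Cg
  for M :: "'h::chilbert_space bop set" and C Irr and bar :: "'h endo \<Rightarrow> 'h endo" and R R'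
    and L :: "('h, 'k::chilbert_space, 'l::chilbert_space) lr_data" and Cg :: "'g::group_add \<Rightarrow> 'h endo set" +
  fixes u :: "'g \<Rightarrow> 'l bop" and \<delta> :: "'g \<Rightarrow> 'l \<Rightarrow> 'm::chilbert_space" and \<Phi> :: "'m bop \<Rightarrow> 'l bop"
  assumes u: "unitary_in (lr_alg L) (u g)" "u g \<in> lr_component M Irr L (Cg g)" and u_mult: "u g \<odot> u h = u (g + h)"
    and ell2: "ell2_sum \<delta>"
    and identification: "crossed_identification \<delta> (lr_component M Irr L (Cg 0)) (Ad_action u (lr_component M Irr L (Cg 0))) (lr_alg L) u \<Phi>"
begin

abbreviation "B0 \<equiv> Bg 0"
abbreviation "\<beta> \<equiv> Ad_action u B0"
abbreviation "N \<equiv> crossed_product \<delta> B0 \<beta>"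

lemma B0_B: "B0 \<subseteq> \<B>" using Bg_B by blast

lemma N: "von_neumann_algebra N" "b \<in> B0 \<Longrightarrow> cp_pi \<delta> \<beta> b \<in> N" "cp_unitary \<delta> g \<in> N"
proof -
  have b: "B0 \<subseteq> bops" "\<B> \<subseteq> bops" using B0_B bB by auto
  note cp = crossed_product_vN[where u = u, OF ell2 b(1) u(1) b(2)]
  show "von_neumann_algebra N" "b \<in> B0 \<Longrightarrow> cp_pi \<delta> \<beta> b \<in> N" "cp_unitary \<delta> g \<in> N" by (rule cp, assumption?)+
qed

sublocale normal_iso N \<B> \<Phi>
  using N(1) vN_B identification by unfold_locales (auto simp: crossed_identification_def)

lemma \<Phi>_pi: "b \<in> B0 \<Longrightarrow> \<Phi> (cp_pi \<delta> \<beta> b) = b" and \<Phi>_unitary: "\<Phi> (cp_unitary \<delta> g) = u g"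
  using identification by (auto simp: crossed_identification_def)

lemma uB: "u g \<in> \<B>" and ub: "u g \<in> bops" and u_unitary: "adj (u g) \<odot> u g = \<I>" "u g \<odot> adj (u g) = \<I>"
  using u(1)[of g] bB by (auto simp: unitary_in_def)

lemma u_zero: "u 0 = \<I>"
proof -
  have "adj (u 0) \<odot> (u 0 \<odot> u 0) = adj (u 0) \<odot> u 0" by (simp add: u_mult)
  then show ?thesis by (simp add: u_unitary flip: comp_assoc)
qed

lemma u_adj: "adj (u g) = u (- g)"
proof -
  have "adj (u g) \<odot> (u g \<odot> u (- g)) = adj (u g)" by (simp add: u_mult u_zero)
  then show ?thesis by (simp add: u_unitary flip: comp_assoc)
qed

lemma u_cancel: "u g \<odot> u (- g) = \<I>" "u (- g) \<odot> u g = \<I>" by (simp_all add: u_mult u_zero)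

lemma action_apply: "b \<in> B0 \<Longrightarrow> \<beta> g b = u g \<odot> b \<odot> u (- g)"
  by (simp add: Ad_action_def u_adj)

lemma action_B0: assumes "b \<in> B0" shows "u g \<odot> b \<odot> u (- g) \<in> B0"
proof -
  have "u g \<odot> b \<odot> u (- g) \<in> Bg (g + 0 + - g)" by (intro Bg_mult u assms)
  then show ?thesis by simp
qed

lemma equivariantization_drinfeld:
  assumes "\<rho> \<in> equivariantization \<delta> B0 \<beta> (relative_center M C L (Cg 0) B0)"
  shows "F \<rho> \<in> drinfeld_center M C L"
proof -
  obtain \<theta> c \<nu> where \<rho>: "\<rho> \<in> End N" and \<theta>: "\<theta> \<in> relative_center M C L (Cg 0) B0"
    and \<nu>: "is_hat_eta \<delta> B0 \<beta> \<theta> c \<nu>" and \<rho>\<nu>: "uequiv N \<rho> \<nu>"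
    using assms unfolding equivariantization_def by blast
  obtain \<sigma> \<eta>0 \<Theta> where \<sigma>: "\<sigma> \<in> countable_sums M C" and \<theta>E: "\<theta> \<in> End B0" and \<Theta>: "tensor_endo \<sigma> \<Theta>"
    and \<eta>0: "\<And>a. a \<in> \<A> \<Longrightarrow> \<eta>0 (emb a) = emb (\<Theta> a)" and "uequiv B0 \<theta> \<eta>0"
    using \<theta> unfolding relative_center_def is_eta_extension_def by blast
  then obtain w where w: "unitary_in B0 w" "\<And>b. b \<in> B0 \<Longrightarrow> \<theta> b = w \<odot> \<eta>0 b \<odot> adj w" by (auto simp: uequiv_def)
  have wB: "unitary_in \<B> w" using w(1) Bg_B by (auto simp: unitary_in_def)
  have \<nu>E: "\<nu> \<in> End N" and \<nu>\<theta>: "\<And>b. b \<in> B0 \<Longrightarrow> \<nu> (cp_pi \<delta> \<beta> b) = cp_pi \<delta> \<beta> (\<theta> b)"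
    using \<nu> by (auto simp: is_hat_eta_def)
  note FE = transport_End[OF \<nu>E]
  have F\<theta>: "F \<nu> b = \<theta> b" if "b \<in> B0" for b
    using transport_apply[OF N(2)[OF that], of \<nu>] that by (simp add: \<Phi>_pi \<nu>\<theta> End_mem[OF \<theta>E])
  have wa: "adj (adj w) = w" and ww: "adj w \<odot> w = \<I>" "w \<odot> adj w = \<I>" using wB bB by (auto simp: unitary_in_def)
  \<comment> \<open>The endomorphism \<open>\<eta>0\<close> is given on \<open>B0\<close> only, so
    the unitary is undone on the transported extension \<open>F \<nu>\<close> instead; this makes
    sense because \<open>w\<close> also lies in \<open>\<B>\<close>.\<close>
  define \<eta> where "\<eta> = (\<lambda>y\<in>\<B>. adj w \<odot> F \<nu> y \<odot> adj (adj w))"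
  have \<eta>E: "\<eta> \<in> End \<B>" unfolding \<eta>_def by (rule Ad_unitary_End[OF vN_star_alg[OF vN_B] unitary_in_adj[OF vN_star_alg[OF vN_B] wB] FE])
  have "uequiv \<B> (F \<nu>) \<eta>"
  proof (rule uequivI[OF wB])
    fix y assume "y \<in> \<B>"
    then have "w \<odot> \<eta> y \<odot> adj w = (w \<odot> adj w) \<odot> F \<nu> y \<odot> (w \<odot> adj w)" by (simp add: \<eta>_def wa comp_assoc)
    then show "F \<nu> y = w \<odot> \<eta> y \<odot> adj w" by (simp add: ww)
  qed
  then have "uequiv \<B> (F \<rho>) \<eta>"
    using transport_uequiv[OF \<rho> \<nu>E \<rho>\<nu>] uequiv_trans[OF vN_star_alg[OF vN_B]] by blast
  moreover have "\<eta> (emb a) = emb (\<Theta> a)" if a: "a \<in> \<A>" for a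
    using conj_unitary_cancel[OF ww(1) w(2)[OF emb_B0[OF a]]] \<eta>0[OF a] a
    by (simp add: \<eta>_def wa emb_B F\<theta>[OF emb_B0])
  ultimately show ?thesis by (intro drinfeldI[OF transport_End[OF \<rho>] \<sigma> \<eta>E \<Theta>])
qed

lemma drinfeld_equivariantization:
  assumes "\<mu> \<in> drinfeld_center M C L"
  obtains \<rho> where "\<rho> \<in> equivariantization \<delta> B0 \<beta> (relative_center M C L (Cg 0) B0)" "F \<rho> = \<mu>"
proof -
  obtain \<sigma> \<E> \<eta> \<Theta> where \<mu>: "\<mu> \<in> End \<B>" and \<sigma>: "\<sigma> \<in> countable_sums M C" and \<E>: "half_braiding M C \<sigma> \<E>"
    and \<eta>: "\<eta> \<in> End \<B>" and \<Theta>: "tensor_endo \<sigma> \<Theta>" "\<And>a. a \<in> \<A> \<Longrightarrow> \<eta> (emb a) = emb (\<Theta> a)"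
    and lam: "\<And>\<pi>. \<pi> \<in> C \<Longrightarrow> \<eta> (lam \<pi>) = elem L (adj (\<E> \<pi>)) \<I> \<odot> lam \<pi>" and \<mu>\<eta>: "uequiv \<B> \<mu> \<eta>"
    using drinfeldE[OF assms] by metis
  obtain \<rho> where \<rho>: "\<rho> \<in> End N" "F \<rho> = \<mu>" using transport_surj[OF \<mu>] by metis
  obtain \<nu> where \<nu>: "\<nu> \<in> End N" "F \<nu> = \<eta>" "\<And>x. x \<in> N \<Longrightarrow> \<nu> x = \<Psi> (\<eta> (\<Phi> x))" using transport_surj[OF \<eta>] by metis
  have EM: "adj (\<E> \<pi>) \<in> M" if "\<pi> \<in> C" for \<pi>
    using \<E> that star_alg_adj[OF sM] by (auto simp: half_braiding_def unitary_in_def)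
  have \<eta>Bg: "\<eta> x \<in> Bg g" if "x \<in> Bg g" for x g
    by (rule eta_Bg[OF \<eta> _ _ that, of \<Theta> "\<lambda>\<pi>. adj (\<E> \<pi>)"])
      (use \<Theta> tensor_endo_mem lam EM in \<open>simp_all add: tens_def\<close>)
  define \<theta> where "\<theta> = restrict \<eta> B0"
  have \<theta>E: "\<theta> \<in> End B0"
    unfolding \<theta>_def End_def
  proof (rule normal_homsI)
    have "continuous_map (subtopology sigma_weak B0) sigma_weak \<eta>"
      by (rule continuous_map_from_subtopology_mono[OF End_cont[OF \<eta>] B0_B])
    then show "continuous_map (subtopology sigma_weak B0) sigma_weak (restrict \<eta> B0)"
      by (rule continuous_map_eq) simp
  qed (use \<eta>Bg in \<open>auto simp: Bg_B End_add[OF \<eta>] End_mult[OF \<eta>] End_scale[OF \<eta>] End_adj[OF \<eta>] End_one[OF \<eta>] star_algD[OF sB0]\<close>)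
  \<comment> \<open>Forced by the requirement that \<open>adj (c g) \<odot> u g\<close> be
    \<open>\<eta> (u g)\<close>.\<close>
  define c where "c g = u g \<odot> \<eta> (u (- g))" for g
  have \<eta>u: "\<eta> (u g) \<odot> \<eta> (u (- g)) = \<I>" "\<eta> (u (- g)) \<odot> \<eta> (u g) = \<I>" for g
    using End_mult[OF \<eta> uB uB, symmetric] by (simp_all add: u_cancel End_one[OF \<eta>])
  have c_adj: "adj (c g) = \<eta> (u g) \<odot> u (- g)" for g
    using ub bB[OF End_mem[OF \<eta> uB]] by (simp add: c_def adj_comp u_adj flip: End_adj[OF \<eta> uB])
  \<comment> \<open>The degrees of the two factors are \<open>g\<close> and \<open>- g\<close>,
    because \<open>\<eta>\<close> preserves degrees.\<close>
  have cB0: "c g \<in> B0" for g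
    using Bg_mult[OF u(2)[of g] \<eta>Bg[OF u(2)[of "- g"]]] by (simp add: c_def)
  have c_unitary: "adj (c g) \<odot> c g = \<I>" "c g \<odot> adj (c g) = \<I>" for g
  proof -
    have "adj (c g) \<odot> c g = \<eta> (u g) \<odot> (u (- g) \<odot> u g) \<odot> \<eta> (u (- g))" unfolding c_adj by (simp add: c_def comp_assoc)
    then show "adj (c g) \<odot> c g = \<I>" by (simp add: u_cancel \<eta>u)
    have "c g \<odot> adj (c g) = u g \<odot> (\<eta> (u (- g)) \<odot> \<eta> (u g)) \<odot> u (- g)" unfolding c_adj by (simp add: c_def comp_assoc)
    then show "c g \<odot> adj (c g) = \<I>" by (simp add: u_cancel \<eta>u)
  qed
  have \<theta>Z: "\<theta> \<in> relative_center M C L (Cg 0) B0"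
  proof -
    have "half_braiding M (Cg 0) \<sigma> \<E>" using \<E> Cg_C unfolding half_braiding_def by blast
    moreover have "is_eta_extension M L (Cg 0) B0 \<sigma> \<E> \<theta>"
      unfolding is_eta_extension_def using \<theta>E \<Theta> lam by (auto simp: \<theta>_def emb_B0 lam_Bg Cg_C)
    ultimately show ?thesis unfolding relative_center_def using \<theta>E \<sigma> uequiv_refl[OF sB0] by blast
  qed
  have equi: "equivariant B0 \<beta> \<theta> c"
    unfolding equivariant_def
  proof (intro conjI allI ballI)
    show "unitary_in B0 (c g)" for g using cB0 c_unitary by (simp add: unitary_in_def)
    fix g b assume b: "b \<in> B0"
    have "\<beta> g (\<theta> (\<beta> (- g) b)) = u g \<odot> \<eta> (u (- g) \<odot> b \<odot> u g) \<odot> u (- g)"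
      using action_B0[OF b, of "- g"] by (simp add: action_apply b \<theta>_def \<eta>Bg)
    also have "\<eta> (u (- g) \<odot> b \<odot> u g) = \<eta> (u (- g)) \<odot> \<eta> b \<odot> \<eta> (u g)"
      using b by (simp add: End_mult[OF \<eta>] uB Bg_B clB)
    finally show "\<beta> g (\<theta> (\<beta> (- g) b)) = c g \<odot> \<theta> b \<odot> adj (c g)"
      unfolding c_adj using b by (simp add: c_def \<theta>_def comp_assoc)
  next
    fix g h
    \<comment> \<open>The inner \<open>u (- g) \<odot> u g\<close> cancels, and the two
      \<open>\<eta>\<close>-factors combine in reversed order, as the inverse of
      \<open>g + h\<close> demands.\<close>
    have "\<beta> g (c h) \<odot> c g = u g \<odot> u h \<odot> \<eta> (u (- h)) \<odot> (u (- g) \<odot> u g) \<odot> \<eta> (u (- g))"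
      unfolding action_apply[OF cB0] by (simp add: c_def comp_assoc)
    also have "\<dots> = u (g + h) \<odot> \<eta> (u (- h) \<odot> u (- g))"
      by (simp add: u_cancel End_mult[OF \<eta>] uB comp_assoc flip: u_mult)
    finally show "\<beta> g (c h) \<odot> c g = c (g + h)" by (simp add: c_def u_mult minus_add)
  qed
  have hat: "is_hat_eta \<delta> B0 \<beta> \<theta> c \<nu>"
    unfolding is_hat_eta_def
  proof (intro conjI ballI allI)
    show "\<nu> \<in> End N" by (rule \<nu>(1))
    fix b assume b: "b \<in> B0"
    have "\<nu> (cp_pi \<delta> \<beta> b) = \<Psi> (\<Phi> (cp_pi \<delta> \<beta> (\<eta> b)))" using b N(2) by (simp add: \<nu>(3) \<Phi>_pi \<eta>Bg)
    then show "\<nu> (cp_pi \<delta> \<beta> b) = cp_pi \<delta> \<beta> (\<theta> b)" using b N(2) by (simp add: \<Psi>_\<Phi> \<eta>Bg \<theta>_def)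
  next
    fix g
    have cg: "adj (c g) \<in> B0" using cB0 star_alg_adj[OF sB0] by blast
    have m: "cp_pi \<delta> \<beta> (adj (c g)) \<odot> cp_unitary \<delta> g \<in> N" by (intro star_alg_mult[OF vN_star_alg[OF N(1)]] N(2,3) cg)
    \<comment> \<open>The prescribed value on \<open>cp_unitary \<delta> g\<close> is verified after
      applying the injective map \<open>\<Phi>\<close>, which turns it into
      \<open>\<eta> (u g)\<close>.\<close>
    have "\<Phi> (cp_pi \<delta> \<beta> (adj (c g)) \<odot> cp_unitary \<delta> g) = adj (c g) \<odot> u g"
      using cg N by (simp add: normal_homs_mult[OF hom] \<Phi>_pi \<Phi>_unitary)
    also have "\<dots> = \<eta> (u g)" unfolding c_adj by (simp add: comp_assoc u_cancel)
    finally have "\<Psi> (\<eta> (u g)) = cp_pi \<delta> \<beta> (adj (c g)) \<odot> cp_unitary \<delta> g" using \<Psi>_\<Phi>[OF m] by simp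
    then show "\<nu> (cp_unitary \<delta> g) = cp_pi \<delta> \<beta> (adj (c g)) \<odot> cp_unitary \<delta> g" using N(3) by (simp add: \<nu>(3) \<Phi>_unitary)
  qed
  have "uequiv N \<rho> \<nu>" by (rule transport_uequiv_back[OF \<rho>(1) \<nu>(1)]) (simp add: \<rho> \<nu> \<mu>\<eta>)
  then have "\<rho> \<in> equivariantization \<delta> B0 \<beta> (relative_center M C L (Cg 0) B0)"
    unfolding equivariantization_def using \<rho>(1) \<theta>Z equi hat by blast
  then show thesis using that \<rho>(2) by blast
qed

lemma transport_equivariantization:
  "F ` equivariantization \<delta> B0 \<beta> (relative_center M C L (Cg 0) B0) = drinfeld_center M C L"
proof (intro equalityI subsetI)
  show "\<mu> \<in> F ` equivariantization \<delta> B0 \<beta> (relative_center M C L (Cg 0) B0)" if "\<mu> \<in> drinfeld_center M C L" for \<mu>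
    using drinfeld_equivariantization[OF that] by (metis imageI)
qed (use equivariantization_drinfeld in blast)

end

theorem theorem4p6:
  fixes M :: "'h::chilbert_space bop set"
    and C Irr :: "'h endo set"
    and Cg :: "'g::group_add \<Rightarrow> 'h endo set"
    and bar :: "'h endo \<Rightarrow> 'h endo"
    and R R' :: "'h endo \<Rightarrow> 'h bop"
    and L :: "('h, 'k::chilbert_space, 'l::chilbert_space) lr_data"
    and u :: "'g \<Rightarrow> 'l bop"
    and \<delta> :: "'g \<Rightarrow> 'l \<Rightarrow> 'm::chilbert_space"
    and \<beta> :: "'g \<Rightarrow> 'l endo"
    and B B\<^sub>0 :: "'l bop set"
    and \<Phi> :: "'m bop \<Rightarrow> 'l bop"
  assumes "type_III_factor M" and "\<exists>\<phi>. faithful_normal_state M \<phi>"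
    and "conjugate_solutions M bar R R'"
    and "rigid_category M bar C"
    and "irr_system M C Irr" and "countable Irr"
    and "graded M bar C Cg"
    and "longo_rehren M C Irr bar R L"
    and "B = lr_alg L" and "B\<^sub>0 = lr_component M Irr L (Cg 0)"
    and "\<And>g. unitary_in B (u g) \<and> u g \<in> lr_component M Irr L (Cg g)"
    and "\<And>g h. u g \<odot> u h = u (g + h)"
    and "\<beta> = Ad_action u B\<^sub>0"
    and "ell2_sum \<delta>"
    and "crossed_identification \<delta> B\<^sub>0 \<beta> B u \<Phi>"
  shows "transport (crossed_product \<delta> B\<^sub>0 \<beta>) B \<Phi> `
           equivariantization \<delta> B\<^sub>0 \<beta> (relative_center M C L (Cg 0) B\<^sub>0) = drinfeld_center M C L \<and>
         tensor_category_iso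
           (crossed_product \<delta> B\<^sub>0 \<beta>)
           (equivariantization \<delta> B\<^sub>0 \<beta> (relative_center M C L (Cg 0) B\<^sub>0))
           B (drinfeld_center M C L)
           (transport (crossed_product \<delta> B\<^sub>0 \<beta>) B \<Phi>) \<Phi>"
proof -
  interpret crossed_longo_rehren M C Irr bar R R' L Cg u \<delta> \<Phi>
    by unfold_locales (use assms in auto)
  have "equivariantization \<delta> B0 \<beta> (relative_center M C L (Cg 0) B0) \<subseteq> End (crossed_product \<delta> B0 \<beta>)"
    by (auto simp: equivariantization_def)
  then show ?thesis
    unfolding assms(9,10,13)
    using transport_equivariantization tensor_category_iso_transport[OF _ tensor_category_drinfeld transport_equivariantization]
    by blast
qed

end
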